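(* Let $0<p_2<p_1<\infty$, $-1<\alpha_1,\alpha_2,\xi<\infty$ and $\mu\in\mathcal{M}_+$. Suppose that $$n+1+\xi>n\max\left(1,\frac1{p_i}\right)+\frac{1+\alpha_i}{p_i},\qquad i=1,2.$$ Let $$\lambda=1+\frac1{p_1}-\frac1{p_2},\qquad \gamma=\frac1\lambda\left(\xi+\frac{\alpha_1}{p_1}-\frac{\alpha_2}{p_2}\right),$$ where the exponent $(n+1+\gamma)\lambda$ below is understood as $(n+1)\lambda+\xi+\frac{\alpha_1}{p_1}-\frac{\alpha_2}{p_2}$ (so that it is meaningful also when $\lambda=0$). Then the following statements are equivalent: (1) $T_\mu^\xi$ is bounded from $A^{p_1}_{\alpha_1}(T_B)$ to $A^{p_2}_{\alpha_2}(T_B)$. (2) For any $r>0$ and any $r$-lattice $\{a_k\}$ in $T_B$, $$\left\{\frac{\mu(D(a_k,r))}{\rho(a_k)^{(n+1+\gamma)\lambda}}\right\}_{k}\in l^{1/(1-\lambda)}.$$ (3) $T_\mu^\xi$ is compact from $A^{p_1}_{\alpha_1}(T_B)$ to $A^{p_2}_{\alpha_2}(T_B)$.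
   Context: Let $n\ge 1$. Write $z=(z',z_n)\in\mathbb{C}^n$ with $z'=(z_1,\dots,z_{n-1})$, and $u^2:=u\cdot u=\sum_j u_j^2$ for a vector $u$ (no conjugation). The tubular domain is $T_B=\{z=x+iy\in\mathbb{C}^n: x\in\mathbb{R}^n,\ y\in B\}$ with $B=\{(y',y_n)\in\mathbb{R}^n: |y'|^2=y_1^2+\cdots+y_{n-1}^2<y_n\}$. For $z,w\in T_B$ put $$\rho(z,w)=\tfrac14\left((z'-\overline{w'})^2-2i(z_n-\overline{w_n})\right),\qquad \rho(z)=\rho(z,z)=y_n-|y'|^2 .$$ One has $\operatorname{Re}\rho(z,w)>0$, and non-integer powers of $\rho(z,w)$ are taken with the principal branch. Let $\mathbf{i}=(0',i)\in T_B$. The Bergman metric on $T_B$ is $\beta(z,w)=\tanh^{-1}\sqrt{1-\frac{\rho(z)\rho(w)}{|\rho(z,w)|^2}}$, and $D(z,r)=\{w\in T_B:\beta(z,w)<r\}$. An $r$-lattice is a sequence $\{a_k\}$ in $T_B$ such that $T_B=\bigcup_k D(a_k,r)$, the sets $D(a_k,r/4)$ are mutually disjoint, and for some positive integer $N$ each point of $T_B$ belongs to at most $N$ of the sets $D(a_k,2r)$. For $\alpha>-1$ let $dV_\alpha(z)=\rho(z)^\alpha dV(z)$, with $dV$ Lebesgue measure on $\mathbb{C}^n$. For $0<p<\infty$, $L^p_\alpha(T_B)$ is the space of Lebesgue measurable $f$ on $T_B$ with $\|f\|_{p,\alpha}=\left(\int_{T_B}|f|^p\,dV_\alpha\right)^{1/p}<\infty$,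 and the Bergman space $A^p_\alpha(T_B)$ is the set of holomorphic functions in $L^p_\alpha(T_B)$. $\mathcal{M}_+$ is the set of positive Borel measures $\mu$ on $T_B$ with $\int_{T_B}|\rho(z,\mathbf{i})|^{-t}\,d\mu(z)<\infty$ for some $t>0$. For $\xi>-1$, $\mu\in\mathcal{M}_+$ and $f$ holomorphic on $T_B$, the Toeplitz operator is $$T_\mu^\xi f(z)=\int_{T_B}\frac{f(w)}{\rho(z,w)^{n+1+\xi}}\,d\mu(w),\qquad z\in T_B.$$ It is bounded from $X$ to $Y$ if it is well defined from $X$ to $Y$ (the defining integral converges absolutely for every $f\in X$ and $z\in T_B$) and there is $C$ with $\|T_\mu^\xi f\|_Y\le C\|f\|_X$ for all $f\in X$. It is compact if it is bounded and maps every bounded subset of $X$ to a relatively compact subset of $Y$. For $0<s<\infty$, $l^s$ is the set of complex sequences $\{c_k\}$ with $\sum_k|c_k|^s<\infty$. *)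

theory Defs
  imports "HOL-Analysis.Analysis"
begin

text \<open>
  \<open>\<complex>\<^sup>n\<close> is \<open>complex ^ 'n\<close> with \<open>n = CARD('n) \<ge> 1\<close>. The index type is linearly ordered, and
  \<open>z\<^sub>n\<close> is the component at its greatest element; for \<open>n = 1\<close> the vector \<open>z'\<close> is empty.
  Functions on the tubular domain are total functions of which only the values on
  \<open>tube\<close> matter.
\<close>

definition last_ix :: "'n::{finite,wellorder}" where
  "last_ix = Max UNIV"

definition tube :: "(complex ^ 'n::{finite,wellorder}) set" where
  "tube = {z. (\<Sum>j\<in>UNIV - {last_ix}. (Im (z $ j))\<^sup>2) < Im (z $ last_ix)}"

definition rho :: "complex ^ 'n::{finite,wellorder} \<Rightarrow> complex ^ 'n::_ \<Rightarrow> complex" where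
  "rho z w = (1/4) * ((\<Sum>j\<in>UNIV - {last_ix}. (z $ j - cnj (w $ j))\<^sup>2)
                       - 2 * \<i> * (z $ last_ix - cnj (w $ last_ix)))"

text \<open>\<open>\<rho>(z, z)\<close> is real, see \<open>rho_same\<close>.\<close>

definition rho_diag :: "complex ^ 'n::{finite,wellorder} \<Rightarrow> real" where
  "rho_diag z = Re (rho z z)"

lemma rho_same:
  "rho z z = of_real (Im (z $ last_ix) - (\<Sum>j\<in>UNIV - {last_ix}. (Im (z $ j))\<^sup>2))"
proof -
  have sq: "(u - cnj u)\<^sup>2 = of_real (- 4 * (Im u)\<^sup>2)" for u :: complex
    by (simp add: complex_eq_iff power2_eq_square)
  have lin: "2 * \<i> * (u - cnj u) = of_real (- 4 * Im u)" for u :: complex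
    by (simp add: complex_eq_iff)
  show ?thesis
    unfolding rho_def sq lin of_real_sum[symmetric] sum_distrib_left[symmetric]
    by (simp add: complex_eq_iff)
qed

lemma rho_diag_eq:
  "rho_diag z = Im (z $ last_ix) - (\<Sum>j\<in>UNIV - {last_ix}. (Im (z $ j))\<^sup>2)"
  by (simp add: rho_diag_def rho_same)

definition base_point :: "complex ^ 'n::{finite,wellorder}" where
  "base_point = axis last_ix \<i>"

definition bergman_dist :: "complex ^ 'n::{finite,wellorder} \<Rightarrow> complex ^ 'n::_ \<Rightarrow> real" where
  "bergman_dist z w = artanh (sqrt (1 - rho_diag z * rho_diag w / (cmod (rho z w))\<^sup>2))"

definition bergman_ball ::
    "complex ^ 'n::{finite,wellorder} \<Rightarrow> real \<Rightarrow> (complex ^ 'n::_) set" where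
  "bergman_ball z r = {w \<in> tube. bergman_dist z w < r}"

text \<open>The domain is not covered by finitely many Bergman balls of a fixed radius, so every
  \<open>r\<close>-lattice is an infinite sequence.\<close>

definition is_lattice :: "real \<Rightarrow> (nat \<Rightarrow> complex ^ 'n::{finite,wellorder}) \<Rightarrow> bool" where
  "is_lattice r a \<longleftrightarrow>
     range a \<subseteq> tube \<and>
     (\<Union>k. bergman_ball (a k) r) = tube \<and>
     disjoint_family (\<lambda>k. bergman_ball (a k) (r / 4)) \<and>
     (\<exists>N::nat. N > 0 \<and>
        (\<forall>z\<in>tube. finite {k. z \<in> bergman_ball (a k) (2 * r)} \<and>
                  card {k. z \<in> bergman_ball (a k) (2 * r)} \<le> N))"

definition weighted_measure :: "real \<Rightarrow> (complex ^ 'n::{finite,wellorder}) measure" where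
  "weighted_measure \<alpha> = density (lebesgue_on tube) (\<lambda>z. ennreal (rho_diag z powr \<alpha>))"

definition Lp_space :: "real \<Rightarrow> real \<Rightarrow> (complex ^ 'n::{finite,wellorder} \<Rightarrow> complex) set" where
  "Lp_space p \<alpha> = {f. f \<in> borel_measurable (lebesgue_on tube) \<and>
                      integrable (weighted_measure \<alpha>) (\<lambda>z. cmod (f z) powr p)}"

definition Lp_norm :: "real \<Rightarrow> real \<Rightarrow> (complex ^ 'n::{finite,wellorder} \<Rightarrow> complex) \<Rightarrow> real" where
  "Lp_norm p \<alpha> f = (\<integral>z. cmod (f z) powr p \<partial>weighted_measure \<alpha>) powr (1 / p)"

text \<open>Holomorphy in several variables: real differentiability at every point with a
  complex-linear derivative.\<close>

definition holomorphic_tube :: "(complex ^ 'n::{finite,wellorder} \<Rightarrow> complex) \<Rightarrow> bool" where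
  "holomorphic_tube f \<longleftrightarrow>
     (\<forall>z\<in>tube. \<exists>f'. (f has_derivative f') (at z) \<and> (\<forall>c v. f' (c *s v) = c * f' v))"

definition bergman_space ::
    "real \<Rightarrow> real \<Rightarrow> (complex ^ 'n::{finite,wellorder} \<Rightarrow> complex) set" where
  "bergman_space p \<alpha> = {f \<in> Lp_space p \<alpha>. holomorphic_tube f}"

text \<open>
  The topology of \<open>A\<^sup>p\<^sub>\<alpha>\<close> given by the balls \<open>{g. \<parallel>g - f\<parallel> < \<epsilon>}\<close>. For \<open>p < 1\<close> these are the balls
  of the metric \<open>\<parallel>g - f\<parallel>\<^sup>p\<close>. Functions that agree on \<open>tube\<close> are at distance \<open>0\<close> and hence
  topologically indistinguishable.
\<close>

definition bergman_topology ::
    "real \<Rightarrow> real \<Rightarrow> (complex ^ 'n::{finite,wellorder} \<Rightarrow> complex) topology" where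
  "bergman_topology p \<alpha> =
     topology (\<lambda>U. U \<subseteq> bergman_space p \<alpha> \<and>
       (\<forall>f\<in>U. \<exists>\<epsilon>>0. \<forall>g\<in>bergman_space p \<alpha>. Lp_norm p \<alpha> (\<lambda>z. g z - f z) < \<epsilon> \<longrightarrow> g \<in> U))"

lemma openin_bergman_topology:
  fixes U :: "(complex ^ 'n::{finite,wellorder} \<Rightarrow> complex) set"
  shows "openin (bergman_topology p \<alpha>) U \<longleftrightarrow>
     U \<subseteq> bergman_space p \<alpha> \<and>
     (\<forall>f\<in>U. \<exists>\<epsilon>>0. \<forall>g\<in>bergman_space p \<alpha>. Lp_norm p \<alpha> (\<lambda>z. g z - f z) < \<epsilon> \<longrightarrow> g \<in> U)"
proof -
  let ?X = "bergman_space p \<alpha> :: (complex ^ 'n::_ \<Rightarrow> complex) set"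
  let ?d = "\<lambda>g f :: complex ^ 'n::_ \<Rightarrow> complex. Lp_norm p \<alpha> (\<lambda>z. g z - f z)"
  have "istopology (\<lambda>U. U \<subseteq> ?X \<and> (\<forall>f\<in>U. \<exists>\<epsilon>>0. \<forall>g\<in>?X. ?d g f < \<epsilon> \<longrightarrow> g \<in> U))"
    unfolding istopology_def
  proof (intro conjI allI impI)
    fix S T
    assume S: "S \<subseteq> ?X \<and> (\<forall>f\<in>S. \<exists>\<epsilon>>0. \<forall>g\<in>?X. ?d g f < \<epsilon> \<longrightarrow> g \<in> S)"
      and T: "T \<subseteq> ?X \<and> (\<forall>f\<in>T. \<exists>\<epsilon>>0. \<forall>g\<in>?X. ?d g f < \<epsilon> \<longrightarrow> g \<in> T)"
    show "S \<inter> T \<subseteq> ?X" using S by blast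
    show "\<forall>f\<in>S \<inter> T. \<exists>\<epsilon>>0. \<forall>g\<in>?X. ?d g f < \<epsilon> \<longrightarrow> g \<in> S \<inter> T"
    proof
      fix f assume f: "f \<in> S \<inter> T"
      obtain e where "e > 0" "\<forall>g\<in>?X. ?d g f < e \<longrightarrow> g \<in> S" using S f by blast
      moreover obtain e' where "e' > 0" "\<forall>g\<in>?X. ?d g f < e' \<longrightarrow> g \<in> T" using T f by blast
      ultimately show "\<exists>\<epsilon>>0. \<forall>g\<in>?X. ?d g f < \<epsilon> \<longrightarrow> g \<in> S \<inter> T"
        by (intro exI[of _ "min e e'"]) auto
    qed
  next
    fix K
    assume K: "\<forall>S\<in>K. S \<subseteq> ?X \<and> (\<forall>f\<in>S. \<exists>\<epsilon>>0. \<forall>g\<in>?X. ?d g f < \<epsilon> \<longrightarrow> g \<in> S)"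
    show "\<Union>K \<subseteq> ?X" using K by blast
    show "\<forall>f\<in>\<Union>K. \<exists>\<epsilon>>0. \<forall>g\<in>?X. ?d g f < \<epsilon> \<longrightarrow> g \<in> \<Union>K"
      proof
      fix f assume "f \<in> \<Union>K"
      then obtain S where "S \<in> K" "f \<in> S" by blast
      then obtain e where "e > 0" "\<forall>g\<in>?X. ?d g f < e \<longrightarrow> g \<in> S" using K by blast
      then show "\<exists>\<epsilon>>0. \<forall>g\<in>?X. ?d g f < \<epsilon> \<longrightarrow> g \<in> \<Union>K" using \<open>S \<in> K\<close> by blast
    qed
  qed
  then show ?thesis
    unfolding bergman_topology_def by (simp add: topology_inverse')
qed

text \<open>The class \<open>\<M>\<^sub>+\<close>. The integrability condition makes every member finite on Bergman balls.\<close>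

definition M_plus :: "(complex ^ 'n::{finite,wellorder}) measure set" where
  "M_plus = {\<mu>. sets \<mu> = sets (restrict_space borel tube) \<and>
      (\<exists>t>0. (\<integral>\<^sup>+z. ennreal (cmod (rho z base_point) powr (- t)) \<partial>\<mu>) < \<infinity>)}"

text \<open>Complex \<open>powr\<close> is the principal branch; \<open>Re (rho z w) > 0\<close> on \<open>tube\<close>.\<close>

definition toeplitz_integrand ::
    "real \<Rightarrow> (complex ^ 'n::{finite,wellorder} \<Rightarrow> complex) \<Rightarrow> complex ^ 'n::_ \<Rightarrow> complex ^ 'n::_ \<Rightarrow> complex"
  where
  "toeplitz_integrand \<xi> f z w = f w / rho z w powr complex_of_real (real CARD('n) + 1 + \<xi>)"

definition toeplitz ::
    "(complex ^ 'n::{finite,wellorder}) measure \<Rightarrow> real \<Rightarrow>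
     (complex ^ 'n::_ \<Rightarrow> complex) \<Rightarrow> complex ^ 'n::_ \<Rightarrow> complex" where
  "toeplitz \<mu> \<xi> f z = (\<integral>w. toeplitz_integrand \<xi> f z w \<partial>\<mu>)"

text \<open>Bochner integrability in the next definition is the absolute convergence of the defining
  integral.\<close>

definition toeplitz_bounded ::
    "(complex ^ 'n::{finite,wellorder}) measure \<Rightarrow> real \<Rightarrow> real \<Rightarrow> real \<Rightarrow> real \<Rightarrow> real \<Rightarrow> bool" where
  "toeplitz_bounded \<mu> \<xi> p\<^sub>1 \<alpha>\<^sub>1 p\<^sub>2 \<alpha>\<^sub>2 \<longleftrightarrow>
     (\<forall>f\<in>bergman_space p\<^sub>1 \<alpha>\<^sub>1.
        (\<forall>z\<in>tube. integrable \<mu> (toeplitz_integrand \<xi> f z)) \<and>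
        toeplitz \<mu> \<xi> f \<in> bergman_space p\<^sub>2 \<alpha>\<^sub>2) \<and>
     (\<exists>C. \<forall>f\<in>bergman_space p\<^sub>1 \<alpha>\<^sub>1.
        Lp_norm p\<^sub>2 \<alpha>\<^sub>2 (toeplitz \<mu> \<xi> f) \<le> C * Lp_norm p\<^sub>1 \<alpha>\<^sub>1 f)"

definition toeplitz_compact ::
    "(complex ^ 'n::{finite,wellorder}) measure \<Rightarrow> real \<Rightarrow> real \<Rightarrow> real \<Rightarrow> real \<Rightarrow> real \<Rightarrow> bool" where
  "toeplitz_compact \<mu> \<xi> p\<^sub>1 \<alpha>\<^sub>1 p\<^sub>2 \<alpha>\<^sub>2 \<longleftrightarrow>
     toeplitz_bounded \<mu> \<xi> p\<^sub>1 \<alpha>\<^sub>1 p\<^sub>2 \<alpha>\<^sub>2 \<and>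
     (\<forall>S\<subseteq>bergman_space p\<^sub>1 \<alpha>\<^sub>1. (\<exists>M. \<forall>f\<in>S. Lp_norm p\<^sub>1 \<alpha>\<^sub>1 f \<le> M) \<longrightarrow>
        compactin (bergman_topology p\<^sub>2 \<alpha>\<^sub>2)
          (bergman_topology p\<^sub>2 \<alpha>\<^sub>2 closure_of (toeplitz \<mu> \<xi> ` S)))"

definition lseq :: "real \<Rightarrow> (nat \<Rightarrow> complex) set" where
  "lseq s = {c. summable (\<lambda>k. cmod (c k) powr s)}"

end

theory Submission
  imports Defs "HOL-Complex_Analysis.Complex_Analysis"
begin

text \<open>
  Write \<open>h = rho_diag\<close>, \<open>b = n + 1 + \<xi>\<close>, \<open>d\<^sub>k = \<mu>(D(a\<^sub>k, r)) / h(a\<^sub>k)\<^bsup>(n + 1 + \<gamma>) \<lambda>\<^esup>\<close>. The affine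
  automorphisms of the domain act transitively and rescale \<open>rho\<close>, which reduces the estimates on
  balls and the Forelli--Rudin integral to the base point. They imply that \<open>\<Sum> c\<^sub>k K\<^sub>k\<close> with
  \<open>K\<^sub>k(z) = h(a\<^sub>k)\<^bsup>b - (n + 1 + \<alpha>)/p\<^esup> rho(z, a\<^sub>k)\<^bsup>-b\<^esup>\<close> has \<open>L\<^sup>p\<^sub>\<alpha>\<close> quasinorm at most a constant
  times \<open>\<parallel>c\<parallel>\<^sub>p\<close> whenever the points \<open>a\<^sub>k\<close> are separated.

  Boundedness implies summability: apply the operator to \<open>f = \<Sum>\<^bsub>k \<in> A\<^esub> c\<^sub>k K\<^sub>k\<close> and average over
  all subsets \<open>A\<close> of a finite index set. This leaves a lower bound by the diagonal terms, which
  near \<open>a\<^sub>k\<close> are integrals with positive real part, hence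
  \<open>\<Sum> c\<^sub>k\<^bsup>p2\<^esup> d\<^sub>k\<^bsup>p2\<^esup> \<le> C (\<Sum> c\<^sub>k\<^bsup>p1\<^esup>)\<^bsup>p2/p1\<^esup>\<close> for all finite sequences, and the choice of \<open>c\<close> as a power of \<open>d\<close> gives
  \<open>d \<in> l\<^bsup>1/(1 - \<lambda>)\<^esup>\<close>.

  Summability implies compactness: \<open>|T f|\<close> is dominated by a kernel sum whose coefficients are
  \<open>d\<^sub>k\<close> times the \<open>L\<^bsup>p1\<^esup>\<close> quasinorm of \<open>f\<close> over \<open>D(a\<^sub>k, R)\<close>, and Young's inequality bounds their
  \<open>p2\<close>-th powers by \<open>\<eta> \<parallel>f\<parallel>\<^bsup>p1\<^esup> + C\<^sub>\<eta> d\<^sub>k\<^bsup>1/(1 - \<lambda>)\<^esup>\<close>. For a bounded sequence that converges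
  locally uniformly, which Montel's theorem provides, the first summand is small by the choice of
  \<open>\<eta>\<close>, the tail of the second one by summability, and the finitely many remaining terms by uniform
  convergence.
\<close>

section \<open>Geometry of the tubular domain\<close>

text \<open>Exponents below 1 are allowed, so neither duality nor the triangle inequality for norms
  can carry the argument: estimates are made for integrals of \<open>p\<close>-th powers, and the
  average over subsets asks for nothing but linearity of the operator. A second obstacle is that
  \<open>\<mu>\<close> is an arbitrary measure, so the part of an integral far from
  \<open>a k\<close> is not a small error. It is discarded by its sign: for evaluation points close
  to \<open>a k\<close> the integrand of the diagonal term has positive real part on the whole
  domain. The exponent \<open>s = 1 / (1 - \<lambda>)\<close> satisfies
  \<open>1 / s = 1 / p2 - 1 / p1\<close>. It is the one for which Young's inequality with weights
  \<open>p2 / p1\<close> and \<open>1 - p2 / p1\<close> produces \<open>d powr s\<close>, and for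
  which \<open>c = d powr (s / p1)\<close> makes both sides of the inequality for finite sequences
  the same sum. The conditions on \<open>\<xi>\<close> are those of the kernel sums: the one for
  \<open>p1\<close> puts the test functions into the source space, the one for \<open>p2\<close>
  bounds the dominating sum in the target space. Necessity holds for every lattice, while
  sufficiency starts from a single one; that such a lattice exists has to be shown.\<close>

definition horizontal_norm2 :: "complex ^ 'n::{finite,wellorder} \<Rightarrow> real" where
  "horizontal_norm2 z = (\<Sum>j\<in>UNIV - {last_ix}. (cmod (z $ j))\<^sup>2)"

lemma horizontal_norm2_nonneg: "0 \<le> horizontal_norm2 z"
  by (simp add: horizontal_norm2_def sum_nonneg)

lemma tube_iff: "z \<in> tube \<longleftrightarrow> 0 < rho_diag z"
  by (simp add: tube_def rho_diag_eq)

lemma rho_commute: "rho w z = cnj (rho z w)"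
proof -
  have *: "(cnj x - y)\<^sup>2 = (y - cnj x)\<^sup>2" for x y :: complex
    by (simp add: power2_commute)
  show ?thesis
    by (simp add: rho_def * algebra_simps)
qed

lemma cmod_rho_commute: "cmod (rho w z) = cmod (rho z w)"
  by (simp add: rho_commute[of w z])

text \<open>For complex \<open>u\<close>, \<open>v\<close> the real part of
  \<open>(u - cnj v)^2\<close> is \<open>|u - v|^2 - 2 (Im u)^2 - 2 (Im v)^2\<close>, which leaves a
  sum of terms that are non-negative on the domain. Positivity of the real part, hence the use of
  the principal branch, and all lower bounds for \<open>cmod (rho z w)\<close> come from
  here.\<close>

lemma Re_rho: "Re (rho z w) = horizontal_norm2 (z - w) / 4 + rho_diag z / 2 + rho_diag w / 2"
proof -
  let ?S = "UNIV - {last_ix} :: 'a set"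
  have "4 * Re (rho z w) = (\<Sum>j\<in>?S. Re ((z $ j - cnj (w $ j))\<^sup>2)) + 2 * (Im (z $ last_ix) + Im (w $ last_ix))"
    by (simp add: rho_def)
  also have "(\<Sum>j\<in>?S. Re ((z $ j - cnj (w $ j))\<^sup>2)) =
      (\<Sum>j\<in>?S. (cmod (z $ j - w $ j))\<^sup>2 - 2 * (Im (z $ j))\<^sup>2 - 2 * (Im (w $ j))\<^sup>2)"
    by (intro sum.cong refl) (simp only: cmod_power2, simp add: power2_eq_square algebra_simps)
  also have "\<dots> = horizontal_norm2 (z - w) - 2 * (\<Sum>j\<in>?S. (Im (z $ j))\<^sup>2) - 2 * (\<Sum>j\<in>?S. (Im (w $ j))\<^sup>2)"
    by (simp add: horizontal_norm2_def sum_subtractf sum_distrib_left)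
  finally show ?thesis
    unfolding rho_diag_eq by (simp add: field_simps)
qed

lemma Re_rho_ge: "rho_diag z / 2 + rho_diag w / 2 \<le> Re (rho z w)"
  using horizontal_norm2_nonneg[of "z - w"] by (simp add: Re_rho)

lemma Re_rho_pos: "z \<in> tube \<Longrightarrow> w \<in> tube \<Longrightarrow> 0 < Re (rho z w)"
  using Re_rho_ge[of z w] by (simp add: tube_iff)

lemma rho_nonzero: "z \<in> tube \<Longrightarrow> w \<in> tube \<Longrightarrow> rho z w \<noteq> 0"
  using Re_rho_pos[of z w] by auto

lemma cmod_rho_ge: "rho_diag z / 2 + rho_diag w / 2 \<le> cmod (rho z w)"
  using Re_rho_ge[of z w] complex_Re_le_cmod[of "rho z w"] by linarith

lemma cmod_rho_pos: "z \<in> tube \<Longrightarrow> w \<in> tube \<Longrightarrow> 0 < cmod (rho z w)"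
  by (simp add: rho_nonzero)

lemma cmod_rho_same: "z \<in> tube \<Longrightarrow> cmod (rho z z) = rho_diag z"
  by (simp add: tube_iff rho_diag_eq rho_same del: of_real_diff)

text \<open>The inequality of arithmetic and geometric means, applied to the lower bound
  \<open>cmod_rho_ge\<close>. It keeps the argument of the square root in
  \<open>bergman_dist\<close> non-negative.\<close>

lemma rho_diag_mult_le:
  assumes "z \<in> tube" "w \<in> tube"
  shows "rho_diag z * rho_diag w \<le> (cmod (rho z w))\<^sup>2"
proof -
  have "(rho_diag z / 2 + rho_diag w / 2)\<^sup>2 \<le> (cmod (rho z w))\<^sup>2"
    using assms by (intro power_mono cmod_rho_ge) (auto simp: tube_iff)
  moreover have "rho_diag z * rho_diag w \<le> (rho_diag z / 2 + rho_diag w / 2)\<^sup>2"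
    using sum_squares_ge_zero[of "rho_diag z - rho_diag w" 0]
    by (simp add: power2_eq_square field_simps)
  ultimately show ?thesis by linarith
qed

lemma base_point_nth: "base_point $ j = (if j = last_ix then \<i> else 0)"
  by (simp add: base_point_def axis_def)

lemma rho_diag_base [simp]: "rho_diag base_point = 1"
  by (simp add: rho_diag_eq base_point_nth)

lemma base_point_tube [simp]: "base_point \<in> tube"
  by (simp add: tube_iff)

lemma Re_rho_base: "Re (rho z base_point) = horizontal_norm2 z / 4 + rho_diag z / 2 + 1 / 2"
proof -
  have "horizontal_norm2 (z - base_point) = horizontal_norm2 z"
    unfolding horizontal_norm2_def by (intro sum.cong) (auto simp: base_point_nth)
  then show ?thesis by (simp add: Re_rho)
qed

text \<open>Polarisation: apart from the Hermitian product of the horizontal parts,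
  \<open>rho z w\<close> is a function of \<open>z\<close> plus a function of \<open>w\<close>, and
  both are values of \<open>rho\<close> against \<open>base_point\<close>.\<close>

lemma rho_base_expand:
  "rho z w = rho z base_point + rho base_point w - 1 - (1/2) * (\<Sum>j\<in>UNIV - {last_ix}. z $ j * cnj (w $ j))"
proof -
  let ?S = "UNIV - {last_ix} :: 'a set"
  have a: "(\<Sum>j\<in>?S. (z $ j - cnj (w $ j))\<^sup>2) =
      (\<Sum>j\<in>?S. (z $ j)\<^sup>2) + (\<Sum>j\<in>?S. (cnj (w $ j))\<^sup>2) - 2 * (\<Sum>j\<in>?S. z $ j * cnj (w $ j))"
    by (simp add: power2_diff sum.distrib sum_subtractf sum_distrib_left mult.assoc)
  have b: "(\<Sum>j\<in>?S. (z $ j - cnj (base_point $ j))\<^sup>2) = (\<Sum>j\<in>?S. (z $ j)\<^sup>2)"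
          "(\<Sum>j\<in>?S. (base_point $ j - cnj (w $ j))\<^sup>2) = (\<Sum>j\<in>?S. (cnj (w $ j))\<^sup>2)"
    by (auto intro!: sum.cong simp: base_point_nth)
  show ?thesis
    unfolding rho_def a b by (simp add: base_point_nth field_simps)
qed

text \<open>Cauchy--Schwarz bounds the mixed term of \<open>rho_base_expand\<close>, and
  \<open>Re_rho_base\<close> bounds the horizontal norms. Both moduli on the right are at least 1/2,
  so their product dominates each of them as well as constants.\<close>

lemma cmod_rho_le_base:
  assumes "z \<in> tube" "w \<in> tube"
  shows "cmod (rho z w) \<le> 12 * (cmod (rho z base_point) * cmod (rho w base_point))"
proof -
  let ?S = "UNIV - {last_ix} :: 'a set"
  define A B where "A = cmod (rho z base_point)" and "B = cmod (rho w base_point)"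
  have A: "1/2 \<le> A" "horizontal_norm2 z \<le> 4 * A"
    using complex_Re_le_cmod[of "rho z base_point"] Re_rho_base[of z] assms horizontal_norm2_nonneg[of z]
    unfolding A_def tube_iff by auto
  have B: "1/2 \<le> B" "horizontal_norm2 w \<le> 4 * B"
    using complex_Re_le_cmod[of "rho w base_point"] Re_rho_base[of w] assms horizontal_norm2_nonneg[of w]
    unfolding B_def tube_iff by auto
  have "cmod (\<Sum>j\<in>?S. z $ j * cnj (w $ j)) \<le> (\<Sum>j\<in>?S. \<bar>cmod (z $ j)\<bar> * \<bar>cmod (w $ j)\<bar>)"
    by (rule order_trans[OF norm_sum]) (simp add: norm_mult)
  also have "\<dots> \<le> sqrt (horizontal_norm2 z) * sqrt (horizontal_norm2 w)"
    using L2_set_mult_ineq[of "\<lambda>j. cmod (z $ j)" "\<lambda>j. cmod (w $ j)" ?S]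
    by (simp add: L2_set_def horizontal_norm2_def)
  also have "\<dots> \<le> sqrt (4 * A) * sqrt (4 * B)"
    using A B by (intro mult_mono) (auto simp: horizontal_norm2_nonneg)
  also have "\<dots> = 4 * sqrt (A * B)"
    by (simp add: real_sqrt_mult)
  finally have s: "cmod (\<Sum>j\<in>?S. z $ j * cnj (w $ j)) \<le> 4 * sqrt (A * B)" .
  \<comment> \<open>The constant 12 is \<open>2 + 2 + 4 + 4\<close>: the summands \<open>A\<close>
    and \<open>B\<close> cost \<open>2 A B\<close> each, the summand 1 and half of the mixed term
    cost \<open>4 A B\<close> each.\<close>
  have AB: "1 / 4 \<le> A * B" "A \<le> 2 * (A * B)" "B \<le> 2 * (A * B)"
    using A(1) B(1) mult_mono[of "1/2" A "1/2" B] mult_left_mono[of "1/2" B A] mult_right_mono[of "1/2" A B]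
        by auto
  have sq: "sqrt (A * B) \<le> 2 * (A * B)"
  proof (rule real_le_lsqrt)
    show "A * B \<le> (2 * (A * B))\<^sup>2"
      using AB(1) mult_left_mono[of "1/4" "A*B" "4 * (A*B)"] by (simp add: power2_eq_square)
  qed (use AB(1) in auto)
  have "cmod (rho z w) \<le> A + B + 1 + 1/2 * cmod (\<Sum>j\<in>?S. z $ j * cnj (w $ j))"
    unfolding rho_base_expand[of z w] A_def B_def
    by (intro order_trans[OF norm_triangle_ineq4] add_mono order_trans[OF norm_triangle_ineq]) (auto simp:
        norm_mult cmod_rho_commute[of base_point w])
  then show ?thesis
    using s sq AB unfolding A_def[symmetric] B_def[symmetric] by linarith
qed

text \<open>The affine automorphism of the tube that maps \<open>base_point\<close> to \<open>a\<close>.\<close>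

definition aut :: "complex ^ 'n::{finite,wellorder} \<Rightarrow> complex ^ 'n::_ \<Rightarrow> complex ^ 'n::_" where
  "aut a z = (\<chi> j. if j = last_ix
     then of_real (rho_diag a) * z $ j
        + 2 * of_real (sqrt (rho_diag a)) * (\<Sum>i\<in>UNIV - {last_ix}. of_real (Im (a $ i)) * z $ i)
        + Complex (Re (a $ last_ix)) (\<Sum>i\<in>UNIV - {last_ix}. (Im (a $ i))\<^sup>2)
     else of_real (sqrt (rho_diag a)) * z $ j + a $ j)"

lemma aut_nth_last: "aut a z $ last_ix = of_real (rho_diag a) * z $ last_ix
        + 2 * of_real (sqrt (rho_diag a)) * (\<Sum>i\<in>UNIV - {last_ix}. of_real (Im (a $ i)) * z $ i)
        + Complex (Re (a $ last_ix)) (\<Sum>i\<in>UNIV - {last_ix}. (Im (a $ i))\<^sup>2)"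
  by (simp add: aut_def)

lemma aut_nth: "j \<noteq> last_ix \<Longrightarrow> aut a z $ j = of_real (sqrt (rho_diag a)) * z $ j + a $ j"
  by (simp add: aut_def)

lemma aut_base:
  assumes "a \<in> tube"
  shows "aut a base_point = a"
proof -
  have s: "(\<Sum>i\<in>UNIV - {last_ix}. of_real (Im (a $ i)) * base_point $ i) = 0"
    by (intro sum.neutral) (auto simp: base_point_nth)
  have "aut a base_point $ j = a $ j" for j
  proof (cases "j = last_ix")
    case True
    then show ?thesis
      using s by (simp add: aut_nth_last base_point_nth complex_eq_iff rho_diag_eq)
  qed (simp add: aut_nth base_point_nth)
  then show ?thesis by (simp add: vec_eq_iff)
qed

text \<open>The translation by \<open>a\<close> in the horizontal components produces cross terms
  and a constant in the squares; the linear term in the last component of \<open>aut\<close> cancels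
  the former and the imaginary part of its constant term the latter. Only the dilation survives.
  Every reduction to the base point rests on this identity.\<close>

lemma rho_aut:
  assumes "a \<in> tube"
  shows "rho (aut a z) (aut a w) = of_real (rho_diag a) * rho z w"
proof -
  let ?S = "UNIV - {last_ix} :: 'a set"
  define t where "t = complex_of_real (sqrt (rho_diag a))"
  have t: "t * t = of_real (rho_diag a)" "cnj t = t"
    using assms by (auto simp: t_def tube_iff simp flip: of_real_mult)
  have ca: "a $ j - cnj (a $ j) = 2 * \<i> * of_real (Im (a $ j))" for j
    by (simp add: complex_eq_iff)
  have sq: "(aut a z $ j - cnj (aut a w $ j))\<^sup>2 =
     t * t * (z $ j - cnj (w $ j))\<^sup>2 + (4 * \<i> * t) * (of_real (Im (a $ j)) * z $ j)
       - (4 * \<i> * t) * (of_real (Im (a $ j)) * cnj (w $ j)) - 4 * of_real ((Im (a $ j))\<^sup>2)" if "j \<in> ?S" for j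
  proof -
    have e: "aut a z $ j - cnj (aut a w $ j) = t * (z $ j - cnj (w $ j)) + (a $ j - cnj (a $ j))"
      using that t by (simp add: aut_nth flip: t_def) (simp add: algebra_simps)
    show ?thesis
      unfolding e ca by (simp add: power2_eq_square algebra_simps)
  qed
  define X where "X = (\<Sum>j\<in>?S. of_real (Im (a $ j)) * z $ j)"
  define Y where "Y = (\<Sum>j\<in>?S. of_real (Im (a $ j)) * cnj (w $ j))"
  define W where "W = (\<Sum>j\<in>?S. (Im (a $ j))\<^sup>2)"
  have 1: "(\<Sum>j\<in>?S. (aut a z $ j - cnj (aut a w $ j))\<^sup>2) =
     t * t * (\<Sum>j\<in>?S. (z $ j - cnj (w $ j))\<^sup>2) + (4 * \<i> * t) * X - (4 * \<i> * t) * Y - 4 * of_real W"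
    unfolding X_def Y_def W_def of_real_sum sum_distrib_left sum_subtractf[symmetric] sum.distrib[symmetric]
    by (intro sum.cong refl sq)
  have cw: "cnj (\<Sum>i\<in>?S. of_real (Im (a $ i)) * w $ i) = Y"
    by (simp add: Y_def)
  have cc: "Complex u W - cnj (Complex u W) = 2 * \<i> * of_real W" for u
    by (simp add: complex_eq_iff)
  have 2: "aut a z $ last_ix - cnj (aut a w $ last_ix) =
     t * t * (z $ last_ix - cnj (w $ last_ix)) + 2 * t * X - 2 * t * Y + 2 * \<i> * of_real W"
    unfolding aut_nth_last t_def[symmetric] X_def[symmetric] W_def[symmetric] t(1)[symmetric]
      complex_cnj_add complex_cnj_mult cw t(2) cc[of "Re (a $ last_ix)", symmetric]
    by (simp add: algebra_simps)
  show ?thesis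
    unfolding rho_def 1 2 t(1)[symmetric] by (simp add: field_simps)
qed

lemma rho_diag_aut: "a \<in> tube \<Longrightarrow> rho_diag (aut a z) = rho_diag a * rho_diag z"
  by (simp add: rho_diag_def rho_aut)

lemma aut_tube: "a \<in> tube \<Longrightarrow> aut a z \<in> tube \<longleftrightarrow> z \<in> tube"
  by (simp add: tube_iff rho_diag_aut zero_less_mult_iff)

lemma aut_surj:
  assumes "a \<in> tube"
  obtains z where "aut a z = w"
proof -
  define t where "t = complex_of_real (sqrt (rho_diag a))"
  have t: "t \<noteq> 0" "complex_of_real (rho_diag a) \<noteq> 0" using assms by (auto simp: t_def tube_iff)
  define z' where "z' = (\<lambda>j. (w $ j - a $ j) / t)"
  define z where "z = (\<chi> j. if j = last_ix then
     (w $ j - 2 * t * (\<Sum>i\<in>UNIV - {last_ix}. of_real (Im (a $ i)) * z' i)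
      - Complex (Re (a $ last_ix)) (\<Sum>i\<in>UNIV - {last_ix}. (Im (a $ i))\<^sup>2)) / of_real (rho_diag a) else z' j)"
  have s: "(\<Sum>i\<in>UNIV - {last_ix}. of_real (Im (a $ i)) * z $ i)
      = (\<Sum>i\<in>UNIV - {last_ix}. of_real (Im (a $ i)) * z' i)"
    by (intro sum.cong) (auto simp: z_def)
  have "aut a z $ j = w $ j" for j
  proof (cases "j = last_ix")
    case True
    show ?thesis
      unfolding True aut_nth_last s t_def[symmetric] using t by (simp add: z_def field_simps)
  next
    case False
    then show ?thesis
      unfolding aut_nth[OF False] t_def[symmetric] using t by (simp add: z_def z'_def)
  qed
  then show ?thesis using that[of z] by (simp add: vec_eq_iff)
qed

text \<open>This is \<open>cmod_rho_le_base\<close> moved from \<open>base_point\<close> to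
  \<open>v\<close> by \<open>aut v\<close>; with the factor \<open>rho_diag v\<close> both sides
  scale by \<open>(rho_diag v)^2\<close>. It is a quasi-triangle inequality in multiplicative form
  and takes the place of the triangle inequality for \<open>bergman_dist\<close>.\<close>

lemma cmod_rho_triangle:
  assumes "z \<in> tube" "w \<in> tube" "v \<in> tube"
  shows "cmod (rho z w) * rho_diag v \<le> 12 * (cmod (rho z v) * cmod (rho w v))"
proof -
  obtain z' w' where zw: "aut v z' = z" "aut v w' = w"
    using aut_surj[OF assms(3)] by metis
  then have t: "z' \<in> tube" "w' \<in> tube" using assms aut_tube by blast+
  have v: "rho (aut v u) v = of_real (rho_diag v) * rho u base_point" for u
    using rho_aut[OF assms(3), of u base_point] aut_base[OF assms(3)] by simp
  have pos: "0 < rho_diag v" using assms by (simp add: tube_iff)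
  have "cmod (rho z w) * rho_diag v = (rho_diag v)\<^sup>2 * cmod (rho z' w')"
    using pos by (simp add: zw[symmetric] rho_aut assms norm_mult power2_eq_square)
  also have "\<dots> \<le> (rho_diag v)\<^sup>2 * (12 * (cmod (rho z' base_point) * cmod (rho w' base_point)))"
    by (intro mult_left_mono cmod_rho_le_base t) auto
  also have "\<dots> = 12 * (cmod (rho z v) * cmod (rho w v))"
    using pos by (simp add: zw[symmetric] v norm_mult power2_eq_square)
  finally show ?thesis .
qed

section \<open>Bergman balls and the size of \<open>rho\<close> on them\<close>

text \<open>\<open>artanh\<close> is increasing and \<open>(tanh r)^2 = 1 - 1 / (cosh r)^2\<close>.
  The resulting condition is free of inverse hyperbolic functions, and openness of the balls and all
  comparisons on them are read off from it.\<close>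

lemma bergman_ball_iff:
  assumes "z \<in> tube" "w \<in> tube" "0 < r"
  shows "w \<in> bergman_ball z r \<longleftrightarrow> (cmod (rho z w))\<^sup>2 < (cosh r)\<^sup>2 * (rho_diag z * rho_diag w)"
proof -
  define q where "q = rho_diag z * rho_diag w / (cmod (rho z w))\<^sup>2"
  have c: "0 < (cmod (rho z w))\<^sup>2" using assms cmod_rho_pos by auto
  have q: "0 < q" "q \<le> 1"
    using c rho_diag_mult_le[OF assms(1,2)] assms(1,2) by (auto simp: q_def tube_iff)
  have th: "tanh r < 1" "0 < tanh r" "-1 < tanh r" using assms tanh_real_lt_1 tanh_real_gt_neg1 by auto
  have "w \<in> bergman_ball z r \<longleftrightarrow> artanh (sqrt (1 - q)) < artanh (tanh r)"
    using assms by (simp add: bergman_ball_def bergman_dist_def q_def artanh_tanh_real)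
  also have "\<dots> \<longleftrightarrow> sqrt (1 - q) < tanh r"
  proof -
    have m: "artanh x < artanh y" if "x < y" "-1 < x" "y < 1" for x y :: real
      using that unfolding artanh_def by (simp add: divide_simps mult_strict_mono algebra_simps)
    have "-1 < sqrt (1 - q)" "sqrt (1 - q) < 1" using q
      by (smt (verit) real_sqrt_ge_zero, smt (verit) real_sqrt_lt_1_iff)
    then show ?thesis
      using m[of "sqrt (1 - q)" "tanh r"] m[of "tanh r" "sqrt (1-q)"] th
          by (metis linorder_neqE_linordered_idom order_less_asym order_less_irrefl)
  qed
  also have "\<dots> \<longleftrightarrow> 1 - q < (tanh r)\<^sup>2"
    using q th by (metis real_less_lsqrt real_less_rsqrt diff_ge_0_iff_ge not_less real_le_rsqrt less_imp_le)
  also have "(tanh r)\<^sup>2 = 1 - 1 / (cosh r)\<^sup>2"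
    by (simp add: tanh_def power_divide sinh_square_eq diff_divide_distrib)
  also have "1 - q < 1 - 1 / (cosh r)\<^sup>2 \<longleftrightarrow> 1 / (cosh r)\<^sup>2 < q" by auto
  also have "\<dots> \<longleftrightarrow> (cmod (rho z w))\<^sup>2 < (cosh r)\<^sup>2 * (rho_diag z * rho_diag w)"
    using c cosh_real_pos[of r] by (simp add: q_def field_simps)
  finally show ?thesis .
qed

lemma bergman_ball_subset_tube: "bergman_ball z r \<subseteq> tube"
  by (auto simp: bergman_ball_def)

lemma bergman_dist_commute: "bergman_dist z w = bergman_dist w z"
  by (simp add: bergman_dist_def cmod_rho_commute[of z w] mult.commute)

lemma bergman_ball_commute:
  "z \<in> tube \<Longrightarrow> w \<in> bergman_ball z r \<Longrightarrow> z \<in> bergman_ball w r"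
  by (simp add: bergman_ball_def bergman_dist_commute)

lemma bergman_ball_self: "z \<in> tube \<Longrightarrow> 0 < r \<Longrightarrow> z \<in> bergman_ball z r"
  using cosh_real_ge_1[of r] cosh_square_eq[of r]
  by (simp add: bergman_ball_iff cmod_rho_same tube_iff power2_eq_square[of "rho_diag z"])

lemma bergman_ball_mono: "r \<le> s \<Longrightarrow> bergman_ball z r \<subseteq> bergman_ball z s"
  by (auto simp: bergman_ball_def)

lemma bergman_dist_aut:
  assumes "a \<in> tube"
  shows "bergman_dist (aut a z) (aut a w) = bergman_dist z w"
  using assms by (simp add: bergman_dist_def rho_aut rho_diag_aut norm_mult power_mult_distrib tube_iff
      power2_eq_square)

lemma bergman_ball_aut:
  assumes "a \<in> tube"
  shows "aut a z \<in> bergman_ball a r \<longleftrightarrow> z \<in> bergman_ball base_point r"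
  using bergman_dist_aut[OF assms, of base_point z] assms
  by (simp add: bergman_ball_def aut_base aut_tube)

text \<open>Half of \<open>rho_diag w\<close> is a lower bound for \<open>cmod (rho z w)\<close>, so
  after squaring one factor \<open>rho_diag w\<close> cancels.\<close>

lemma bergman_ball_rho_diag_le:
  assumes "z \<in> tube" "w \<in> bergman_ball z r" "0 < r"
  shows "rho_diag w \<le> 4 * (cosh r)\<^sup>2 * rho_diag z"
proof -
  have w: "w \<in> tube" using assms bergman_ball_subset_tube by auto
  have pos: "0 < rho_diag z" "0 < rho_diag w" using assms w by (auto simp: tube_iff)
  have "(rho_diag w / 2)\<^sup>2 \<le> (cmod (rho z w))\<^sup>2"
    using cmod_rho_ge[of z w] pos by (intro power_mono) auto
  also have "\<dots> < (cosh r)\<^sup>2 * (rho_diag z * rho_diag w)"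
    using assms w bergman_ball_iff by blast
  finally have "rho_diag w * rho_diag w < (4 * (cosh r)\<^sup>2 * rho_diag z) * rho_diag w"
    by (simp add: power2_eq_square)
  then show ?thesis using pos by (simp add: mult_less_cancel_right)
qed

lemma bergman_ball_rho_diag_ge:
  assumes "z \<in> tube" "w \<in> bergman_ball z r" "0 < r"
  shows "rho_diag z \<le> 4 * (cosh r)\<^sup>2 * rho_diag w"
  using bergman_ball_rho_diag_le[of w z r] bergman_ball_commute assms bergman_ball_subset_tube by blast

text \<open>The quasi-triangle inequality with middle point \<open>a\<close> contributes the factor
  12; the remaining factor \<open>cmod (rho w a)\<close> is at most
  \<open>2 (cosh r)^2 rho_diag a\<close>. Together with its converse below, this allows a kernel to
  be replaced by its value at the centre of a ball, uniformly in the other argument.\<close>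

lemma bergman_ball_cmod_rho_le:
  assumes "a \<in> tube" "w \<in> bergman_ball a r" "0 < r" "z \<in> tube"
  shows "cmod (rho z w) \<le> 24 * (cosh r)\<^sup>2 * cmod (rho z a)"
proof -
  have w: "w \<in> tube" using assms bergman_ball_subset_tube by auto
  have pos: "0 < rho_diag a" "0 < rho_diag w" using assms w by (auto simp: tube_iff)
  have "(cmod (rho w a))\<^sup>2 < (cosh r)\<^sup>2 * (rho_diag a * rho_diag w)"
    using assms w bergman_ball_iff[of a w r] by (simp add: cmod_rho_commute[of w a])
  also have "\<dots> \<le> (cosh r)\<^sup>2 * (rho_diag a * (4 * (cosh r)\<^sup>2 * rho_diag a))"
    using bergman_ball_rho_diag_le[OF assms(1-3)] pos by (intro mult_left_mono) auto
  also have "\<dots> = (2 * (cosh r)\<^sup>2 * rho_diag a)\<^sup>2"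
    by (simp add: power2_eq_square)
  finally have *: "cmod (rho w a) \<le> 2 * (cosh r)\<^sup>2 * rho_diag a"
    using pos by (meson less_imp_le power_less_imp_less_base mult_nonneg_nonneg zero_le_power2 zero_le_numeral)
  have "cmod (rho z w) * rho_diag a \<le> 12 * (cmod (rho z a) * cmod (rho w a))"
    by (rule cmod_rho_triangle) (use assms w in auto)
  also have "\<dots> \<le> 12 * (cmod (rho z a) * (2 * (cosh r)\<^sup>2 * rho_diag a))"
    using * by (intro mult_left_mono) auto
  finally have "cmod (rho z w) * rho_diag a \<le> (24 * (cosh r)\<^sup>2 * cmod (rho z a)) * rho_diag a"
    by (simp only: mult_ac)
  then show ?thesis using pos by (simp add: mult_le_cancel_right)
qed

lemma bergman_ball_cmod_rho_ge:
  assumes "a \<in> tube" "w \<in> bergman_ball a r" "0 < r" "z \<in> tube"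
  shows "cmod (rho z a) \<le> 24 * (cosh r)\<^sup>2 * cmod (rho z w)"
  using bergman_ball_cmod_rho_le[of w a r z] bergman_ball_commute assms bergman_ball_subset_tube by blast

text \<open>With a quasi-triangle inequality, two steps of length \<open>r\<close> end in a ball
  whose radius is governed by \<open>12 (cosh r)^2 \<le> cosh R\<close> instead of
  \<open>R = 2 r\<close>. Only the dependence of \<open>R\<close> on \<open>r\<close> alone matters
  later.\<close>

lemma bergman_ball_trans:
  assumes "z \<in> tube" "v \<in> bergman_ball z r" "w \<in> bergman_ball v r" "0 < r"
    and R: "0 < R" "12 * (cosh r)\<^sup>2 \<le> cosh R"
  shows "w \<in> bergman_ball z R"
proof -
  have t: "v \<in> tube" "w \<in> tube" using assms bergman_ball_subset_tube by auto
  have pos: "0 < rho_diag z" "0 < rho_diag v" "0 < rho_diag w" using t assms by (auto simp: tube_iff)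
  have 1: "(cmod (rho z v))\<^sup>2 < (cosh r)\<^sup>2 * (rho_diag z * rho_diag v)"
    using assms t by (simp add: bergman_ball_iff)
  have 2: "(cmod (rho w v))\<^sup>2 < (cosh r)\<^sup>2 * (rho_diag v * rho_diag w)"
    using assms t bergman_ball_iff[of v w r] by (simp add: cmod_rho_commute[of w v])
  have "(cmod (rho z w))\<^sup>2 * (rho_diag v)\<^sup>2 = (cmod (rho z w) * rho_diag v)\<^sup>2"
    by (simp add: power_mult_distrib)
  also have "\<dots> \<le> (12 * (cmod (rho z v) * cmod (rho w v)))\<^sup>2"
    by (intro power_mono cmod_rho_triangle) (use t assms pos in auto)
  also have "\<dots> = 144 * ((cmod (rho z v))\<^sup>2 * (cmod (rho w v))\<^sup>2)"
    by (simp add: power_mult_distrib)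
  also have "\<dots> < 144 * (((cosh r)\<^sup>2 * (rho_diag z * rho_diag v)) * ((cosh r)\<^sup>2 * (rho_diag v * rho_diag w)))"
    using 1 2 by (intro mult_strict_left_mono mult_strict_mono) (auto intro: le_less_trans[OF _ 1])
  also have "\<dots> = (12 * (cosh r)\<^sup>2)\<^sup>2 * (rho_diag z * rho_diag w) * (rho_diag v)\<^sup>2"
    by (simp add: power2_eq_square)
  finally have "(cmod (rho z w))\<^sup>2 < (12 * (cosh r)\<^sup>2)\<^sup>2 * (rho_diag z * rho_diag w)"
    using pos by (simp add: mult_less_cancel_right)
  also have "\<dots> \<le> (cosh R)\<^sup>2 * (rho_diag z * rho_diag w)"
    using R pos by (intro mult_right_mono power_mono) auto
  finally show ?thesis using assms t R by (simp add: bergman_ball_iff)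
qed

lemma cosh_unbounded: "\<exists>R::real. 0 < R \<and> M \<le> cosh R"
proof -
  have "M \<le> cosh (max 1 (2 * M))"
  proof (cases "M \<le> 1")
    case True
    then show ?thesis using cosh_real_ge_1[of "max 1 (2 * M)"] by linarith
  next
    case False
    have "2 * M \<le> exp (2 * M)" using exp_ge_add_one_self[of "2 * M"] by linarith
    then have "M \<le> exp (2 * M) / 2" by simp
    also have "\<dots> \<le> cosh (2 * M)" by (simp add: cosh_field_def)
    finally show ?thesis using False by (simp add: max_def)
  qed
  then show ?thesis by (intro exI[of _ "max 1 (2 * M)"]) auto
qed

section \<open>Continuity, measurability and uniform behaviour near the base point\<close>

lemma continuous_rho: "continuous_on UNIV (\<lambda>(z, w). rho z w)"
  unfolding rho_def split_def by (intro continuous_intros)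

lemma continuous_rho1 [continuous_intros]: "continuous_on S f \<Longrightarrow> continuous_on S (\<lambda>x. rho (f x) w)"
  and continuous_rho2 [continuous_intros]: "continuous_on S f \<Longrightarrow> continuous_on S (\<lambda>x. rho w (f x))"
  unfolding rho_def by (intro continuous_intros; assumption)+

lemma continuous_rho_diag [continuous_intros]: "continuous_on S f \<Longrightarrow> continuous_on S (\<lambda>x. rho_diag (f x))"
  unfolding rho_diag_def rho_def by (intro continuous_intros)

lemma rho_measurable [measurable]:
  "(\<lambda>z. rho z w) \<in> borel_measurable borel" "(\<lambda>z. rho w z) \<in> borel_measurable borel"
  "rho_diag \<in> borel_measurable borel"
  by (auto intro!: borel_measurable_continuous_onI continuous_intros)

lemma open_tube: "open (tube :: (complex ^ 'n::{finite,wellorder}) set)"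
proof -
  have "tube = {z :: complex ^ 'n::_. 0 < rho_diag z}" by (auto simp: tube_iff)
  moreover have "open {z :: complex ^ 'n::_. 0 < rho_diag z}"
    by (intro open_Collect_less continuous_intros)
  ultimately show ?thesis by simp
qed

lemma tube_borel [measurable]: "tube \<in> sets borel" by (rule borel_open[OF open_tube])

lemma open_bergman_ball:
  assumes "z \<in> tube" "0 < r"
  shows "open (bergman_ball z r)"
proof -
  have "bergman_ball z r = tube \<inter> {w. (cmod (rho z w))\<^sup>2 < (cosh r)\<^sup>2 * (rho_diag z * rho_diag w)}"
    using bergman_ball_iff[OF assms(1) _ assms(2)] bergman_ball_subset_tube by blast
  then show ?thesis
    using open_tube by (auto intro!: open_Int open_Collect_less continuous_intros)
qed

lemma continuous_aut: "continuous_on S (aut a)"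
  unfolding aut_def
proof (rule continuous_on_vec_lambda, goal_cases)
  case (1 j)
  show ?case by (cases "j = last_ix") (auto intro!: continuous_intros)
qed

text \<open>Uniformity in \<open>z\<close>: the difference is linear in \<open>z'\<close>, while \<open>Re (rho z base_point)\<close> controls
  \<open>1 + |z'|\<^sup>2\<close>.\<close>

lemma rho_near_base:
  assumes "0 < \<epsilon>"
  shows "\<exists>\<delta>>0. \<forall>v \<in> ball (base_point :: complex ^ 'n::{finite,wellorder}) \<delta>. \<forall>z\<in>tube.
           cmod (rho z v / rho z base_point - 1) \<le> \<epsilon>"
proof -
  let ?S = "UNIV - {last_ix} :: 'n set"
  \<comment> \<open>\<open>K\<close> is made to satisfy
    \<open>3 n + 2 |z'|^2 + 2 \<le> 4 K R\<close> for \<open>R = cmod (rho z base_point)\<close>, by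
    means of \<open>1 \<le> 2 R\<close> and \<open>|z'|^2 \<le> 4 R\<close>.\<close>
  define K where "K = 3 + 2 * real CARD('n)"
  have K: "0 < K" by (simp add: K_def add_pos_nonneg)
  have main: "cmod (rho z v - rho z base_point) \<le> \<delta> * K * cmod (rho z base_point)"
    if v: "norm (v - base_point) < \<delta>" and z: "z \<in> tube" and d: "\<delta> \<le> 1" "0 < \<delta>" for v z :: "complex ^ 'n::_"
        and \<delta>
  proof -
    have vn: "cmod (v $ j - base_point $ j) \<le> \<delta>" for j
      using Finite_Cartesian_Product.norm_nth_le[of "v - base_point" j] v by simp
    have vj: "cmod (v $ j) \<le> \<delta>" if "j \<in> ?S" for j
      using vn[of j] that by (simp add: base_point_nth)
    have eq: "rho z v - rho z base_point =
      (1/4) * ((\<Sum>j\<in>?S. cnj (v $ j) * cnj (v $ j) - 2 * z $ j * cnj (v $ j)) + 2 * \<i> * cnj (v $ last_ix - \<i>))"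
    proof -
      have "(\<Sum>j\<in>?S. (z $ j - cnj (v $ j))\<^sup>2) - (\<Sum>j\<in>?S. (z $ j - cnj (base_point $ j))\<^sup>2)
        = (\<Sum>j\<in>?S. cnj (v $ j) * cnj (v $ j) - 2 * z $ j * cnj (v $ j))"
        unfolding sum_subtractf[symmetric]
        by (intro sum.cong) (auto simp: base_point_nth power2_eq_square algebra_simps)
      then show ?thesis unfolding rho_def by (simp add: field_simps base_point_nth)
    qed
    have s: "cmod (\<Sum>j\<in>?S. cnj (v $ j) * cnj (v $ j) - 2 * z $ j * cnj (v $ j))
        \<le> (\<Sum>j\<in>?S. \<delta> * (3 + 2 * (cmod (z $ j))\<^sup>2))"
    proof (rule order_trans[OF norm_sum], rule sum_mono)
      fix j assume j: "j \<in> ?S"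
      have c: "2 * cmod (z $ j) \<le> 2 + 2 * (cmod (z $ j))\<^sup>2"
        using sum_power2_ge_zero[of "cmod (z $ j) - 1" 0]
            by (simp add: power2_eq_square algebra_simps) (smt (verit) norm_ge_zero)
      have "cmod (cnj (v $ j) * cnj (v $ j) - 2 * z $ j * cnj (v $ j))
          \<le> cmod (v $ j) * cmod (v $ j) + 2 * cmod (z $ j) * cmod (v $ j)"
        by (rule order_trans[OF norm_triangle_ineq4]) (simp add: norm_mult)
      also have "\<dots> \<le> 1 * \<delta> + 2 * cmod (z $ j) * \<delta>"
        using vj[OF j] d by (intro add_mono mult_mono) auto
      also have "\<dots> \<le> \<delta> * (3 + 2 * (cmod (z $ j))\<^sup>2)"
        using mult_left_mono[OF c, of \<delta>] d by (simp add: algebra_simps)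
      finally show "cmod (cnj (v $ j) * cnj (v $ j) - 2 * z $ j * cnj (v $ j))
          \<le> \<delta> * (3 + 2 * (cmod (z $ j))\<^sup>2)" .
    qed
    have "(\<Sum>j\<in>?S. \<delta> * (3 + 2 * (cmod (z $ j))\<^sup>2)) = \<delta> * (3 * real (card ?S) + 2 * horizontal_norm2 z)"
      by (simp add: horizontal_norm2_def sum_distrib_left[symmetric] sum.distrib algebra_simps)
    also have "\<dots> \<le> \<delta> * (3 * real CARD('n) + 2 * horizontal_norm2 z)"
      using d by (intro mult_left_mono add_right_mono) (auto intro!: card_mono)
    finally have s2: "cmod (\<Sum>j\<in>?S. cnj (v $ j) * cnj (v $ j) - 2 * z $ j * cnj (v $ j))
       \<le> \<delta> * (3 * real CARD('n) + 2 * horizontal_norm2 z)" using s by linarith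
    have l: "cmod (2 * \<i> * cnj (v $ last_ix - \<i>)) \<le> \<delta> * 2"
      using vn[of last_ix] by (simp add: norm_mult base_point_nth del: complex_cnj_diff)
    have "4 * cmod (rho z v - rho z base_point) \<le> \<delta> * (3 * real CARD('n) + 2 * horizontal_norm2 z + 2)"
      unfolding eq norm_mult using norm_triangle_ineq[of "\<Sum>j\<in>?S. cnj (v $ j) * cnj (v $ j) - 2 * z $ j
          * cnj (v $ j)" "2 * \<i> * cnj (v $ last_ix - \<i>)"] s2 l
      by (simp add: algebra_simps)
    also have "\<dots> \<le> \<delta> * (4 * K * cmod (rho z base_point))"
    proof (rule mult_left_mono)
      define R where "R = cmod (rho z base_point)"
      have R: "1 \<le> 2 * R" "horizontal_norm2 z \<le> 4 * R"
        using complex_Re_le_cmod[of "rho z base_point"] Re_rho_base[of z] z horizontal_norm2_nonneg[of z]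
        unfolding tube_iff R_def by auto
      have "real CARD('n) * 1 \<le> real CARD('n) * (2 * R)" by (intro mult_left_mono R) auto
      then have n: "real CARD('n) \<le> 2 * (real CARD('n) * R)" by (simp only: mult_ac mult_1_left mult_1_right)
      have "4 * K * R = 12 * R + 8 * (real CARD('n) * R)" by (simp add: K_def algebra_simps)
      then show "3 * real CARD('n) + 2 * horizontal_norm2 z + 2 \<le> 4 * K * cmod (rho z base_point)"
        using R n mult_nonneg_nonneg[of "real CARD('n)" R] unfolding R_def[symmetric] by linarith
    qed (use d in auto)
    finally show ?thesis by simp
  qed
  define \<delta> where "\<delta> = min 1 (\<epsilon> / K)"
  have d: "0 < \<delta>" "\<delta> \<le> 1" "\<delta> * K \<le> \<epsilon>" using assms K by (auto simp: \<delta>_def min_def field_simps)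
  show ?thesis
  proof (intro exI[of _ \<delta>] conjI ballI)
    fix v z :: "complex ^ 'n::_" assume v: "v \<in> ball base_point \<delta>" and z: "z \<in> tube"
    have nz: "0 < cmod (rho z base_point)" using cmod_rho_pos[OF z base_point_tube] .
    have "cmod (rho z v / rho z base_point - 1) = cmod (rho z v - rho z base_point) / cmod (rho z base_point)"
      using nz by (simp add: norm_divide[symmetric] diff_divide_distrib)
    also have "\<dots> \<le> (\<delta> * K * cmod (rho z base_point)) / cmod (rho z base_point)"
      using main[of v \<delta> z] v z d by (intro divide_right_mono) (auto simp: dist_norm norm_minus_commute)
    also have "\<dots> \<le> \<epsilon>" using nz d by simp
    finally show "cmod (rho z v / rho z base_point - 1) \<le> \<epsilon>" .
  qed (use d in auto)
qed

section \<open>Integration over the tubular domain\<close>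

lemma nn_integral_lborel_shift:
  fixes g :: "'a::euclidean_space \<Rightarrow> ennreal"
  assumes [measurable]: "g \<in> borel_measurable borel"
  shows "(\<integral>\<^sup>+x. g (t + x) \<partial>lborel) = (\<integral>\<^sup>+x. g x \<partial>lborel)"
proof -
  have "(\<integral>\<^sup>+x. g x \<partial>lborel) = (\<integral>\<^sup>+x. g x \<partial>distr lborel borel ((+) t))"
    by (simp only: lborel_distr_plus)
  then show ?thesis by (simp add: nn_integral_distr)
qed

lemma nn_integral_lborel_reflect:
  fixes g :: "'a::euclidean_space \<Rightarrow> ennreal"
  assumes [measurable]: "g \<in> borel_measurable borel"
  shows "(\<integral>\<^sup>+x. g (t - x) \<partial>lborel) = (\<integral>\<^sup>+x. g x \<partial>lborel)"
proof -
  have "lborel = density (distr lborel borel (\<lambda>x::'a. t + (-1) *\<^sub>R x)) (\<lambda>_. ennreal (\<bar>-1\<bar> ^ DIM('a)))"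
    by (rule lborel_affine) simp
  then have "lborel = distr lborel borel (\<lambda>x::'a. t - x)"
    by (simp add: density_1)
  then have "(\<integral>\<^sup>+x. g x \<partial>lborel) = (\<integral>\<^sup>+x. g x \<partial>distr lborel borel (\<lambda>x. t - x))"
    by metis
  then show ?thesis by (simp add: nn_integral_distr)
qed

text \<open>Fubini with the coordinate \<open>j\<close> split off: for fixed other coordinates the
  shear is a translation, because \<open>h\<close> does not depend on the coordinate
  \<open>j\<close>. No linearity of \<open>h\<close> is assumed, since the map that straightens the
  domain has quadratic shears.\<close>

lemma nn_integral_lborel_shear:
  fixes j :: "'a::euclidean_space" and h :: "'a \<Rightarrow> real" and g :: "'a \<Rightarrow> ennreal"
  assumes j: "j \<in> Basis" and [measurable]: "h \<in> borel_measurable borel" "g \<in> borel_measurable borel"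
    and inv: "\<And>x t. h (x + t *\<^sub>R j) = h x"
  shows "(\<integral>\<^sup>+x. g (x + h x *\<^sub>R j) \<partial>lborel) = (\<integral>\<^sup>+x. g x \<partial>lborel)"
proof -
  interpret product_sigma_finite "\<lambda>_::'a. lborel :: real measure" ..
  define E where "E = (\<lambda>f. \<Sum>b\<in>Basis - {j}. f b *\<^sub>R (b::'a))"
  have split: "(\<integral>\<^sup>+x. G x \<partial>lborel) =
      (\<integral>\<^sup>+x. (\<integral>\<^sup>+y. G (E x + y *\<^sub>R j) \<partial>lborel) \<partial>(\<Pi>\<^sub>M b\<in>Basis - {j}. lborel))"
    if [measurable]: "G \<in> borel_measurable borel" for G :: "'a \<Rightarrow> ennreal"
  proof -
    have ins: "(Basis :: 'a set) = insert j (Basis - {j})" using j by auto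
    have "(\<integral>\<^sup>+x. G x \<partial>lborel) = (\<integral>\<^sup>+x. G (\<Sum>b\<in>Basis. x b *\<^sub>R b) \<partial>(\<Pi>\<^sub>M b\<in>Basis. lborel))"
      by (subst lborel_eq) (simp add: nn_integral_distr)
    also have "\<dots> = (\<integral>\<^sup>+x. G (\<Sum>b\<in>Basis. x b *\<^sub>R b) \<partial>(\<Pi>\<^sub>M b\<in>insert j (Basis - {j}). lborel))"
      using ins by simp
    also have "\<dots> = (\<integral>\<^sup>+x. (\<integral>\<^sup>+y. G (\<Sum>b\<in>Basis. (x(j := y)) b *\<^sub>R b) \<partial>lborel) \<partial>(\<Pi>\<^sub>M b\<in>Basis - {j}. lborel))"
    proof (rule product_nn_integral_insert)
      have "(\<lambda>x. G (\<Sum>b\<in>Basis. x b *\<^sub>R b)) \<in> borel_measurable (\<Pi>\<^sub>M b\<in>(Basis :: 'a set). lborel)"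
        by measurable
      then show "(\<lambda>x. G (\<Sum>b\<in>Basis. x b *\<^sub>R b)) \<in> borel_measurable (\<Pi>\<^sub>M b\<in>insert j (Basis - {j}). lborel)"
        using ins by simp
    qed auto
    also have "\<dots> = (\<integral>\<^sup>+x. (\<integral>\<^sup>+y. G (E x + y *\<^sub>R j) \<partial>lborel) \<partial>(\<Pi>\<^sub>M b\<in>Basis - {j}. lborel))"
    proof -
      have "(\<Sum>b\<in>Basis. (x(j := y)) b *\<^sub>R b) = E x + y *\<^sub>R j" for x y
      proof -
        have "(\<Sum>b\<in>Basis. (x(j := y)) b *\<^sub>R b) = y *\<^sub>R j + (\<Sum>b\<in>Basis - {j}. (x(j := y)) b *\<^sub>R b)"
          using sum.remove[OF finite_Basis j, of "\<lambda>b. (x(j := y)) b *\<^sub>R b"] by simp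
        also have "(\<Sum>b\<in>Basis - {j}. (x(j := y)) b *\<^sub>R b) = E x"
          unfolding E_def by (intro sum.cong) auto
        finally show ?thesis by simp
      qed
      then show ?thesis by simp
    qed
    finally show ?thesis .
  qed
  have "(\<integral>\<^sup>+x. g (x + h x *\<^sub>R j) \<partial>lborel) =
      (\<integral>\<^sup>+x. (\<integral>\<^sup>+y. g (E x + (h (E x) + y) *\<^sub>R j) \<partial>lborel) \<partial>(\<Pi>\<^sub>M b\<in>Basis - {j}. lborel))"
    by (subst split) (simp_all add: inv algebra_simps)
  also have "\<dots> = (\<integral>\<^sup>+x. (\<integral>\<^sup>+y. g (E x + y *\<^sub>R j) \<partial>lborel) \<partial>(\<Pi>\<^sub>M b\<in>Basis - {j}. lborel))"
  proof (rule nn_integral_cong)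
    fix x
    show "(\<integral>\<^sup>+y. g (E x + (h (E x) + y) *\<^sub>R j) \<partial>lborel) = (\<integral>\<^sup>+y. g (E x + y *\<^sub>R j) \<partial>lborel)"
      by (rule nn_integral_lborel_shift[of "\<lambda>y. g (E x + y *\<^sub>R j)"]) measurable
  qed
  also have "\<dots> = (\<integral>\<^sup>+x. g x \<partial>lborel)" by (subst split) simp_all
  finally show ?thesis .
qed

text \<open>Uniqueness of Haar measure in disguise: integrate \<open>f(x) g(L y + x)\<close> in both orders, with \<open>f\<close>
  the indicator function of the unit ball.\<close>

lemma nn_integral_lborel_isometry:
  fixes L L' :: "'a::euclidean_space \<Rightarrow> 'a" and g :: "'a \<Rightarrow> ennreal"
  assumes lin: "linear L" and inv: "\<And>x. L (L' x) = x" and iso: "\<And>x. norm (L x) = norm x"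
    and [measurable]: "g \<in> borel_measurable borel"
  shows "(\<integral>\<^sup>+x. g (L x) \<partial>lborel) = (\<integral>\<^sup>+x. g x \<partial>lborel)"
proof -
  have [measurable]: "L \<in> borel_measurable borel"
    using lin by (intro borel_measurable_continuous_onI linear_continuous_on) (simp add:
        linear_conv_bounded_linear)
  define V where "V = emeasure lborel (ball (0::'a) 1)"
  define f where "f = (indicator (ball 0 1) :: 'a \<Rightarrow> ennreal)"
  have [measurable]: "f \<in> borel_measurable borel" unfolding f_def by (intro borel_measurable_indicator) simp
  have V: "V = (\<integral>\<^sup>+x. f x \<partial>lborel)" by (simp add: V_def f_def)
  have "V * (\<integral>\<^sup>+y. g (L y) \<partial>lborel) = (\<integral>\<^sup>+x. \<integral>\<^sup>+y. f x * g (L y) \<partial>lborel \<partial>lborel)"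
    by (simp add: V nn_integral_cmult nn_integral_multc)
  also have "\<dots> = (\<integral>\<^sup>+x. \<integral>\<^sup>+y. f x * g (L y + x) \<partial>lborel \<partial>lborel)"
  proof (rule nn_integral_cong)
    fix x
    have "(\<integral>\<^sup>+y. f x * g (L (L' x + y)) \<partial>lborel) = (\<integral>\<^sup>+y. f x * g (L y) \<partial>lborel)"
      by (rule nn_integral_lborel_shift) measurable
    then show "(\<integral>\<^sup>+y. f x * g (L y) \<partial>lborel) = (\<integral>\<^sup>+y. f x * g (L y + x) \<partial>lborel)"
      by (simp add: linear_add[OF lin] inv add.commute)
  qed
  also have "\<dots> = (\<integral>\<^sup>+y. \<integral>\<^sup>+x. f x * g (L y + x) \<partial>lborel \<partial>lborel)"
    by (rule lborel_pair.Fubini') measurable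
  also have "\<dots> = (\<integral>\<^sup>+y. \<integral>\<^sup>+x. f (x - L y) * g x \<partial>lborel \<partial>lborel)"
  proof (rule nn_integral_cong)
    fix y
    have "(\<integral>\<^sup>+x. f (L y + x - L y) * g (L y + x) \<partial>lborel) = (\<integral>\<^sup>+x. f (x - L y) * g x \<partial>lborel)"
      by (rule nn_integral_lborel_shift) measurable
    then show "(\<integral>\<^sup>+x. f x * g (L y + x) \<partial>lborel) = (\<integral>\<^sup>+x. f (x - L y) * g x \<partial>lborel)"
      by simp
  qed
  also have "\<dots> = (\<integral>\<^sup>+x. \<integral>\<^sup>+y. f (x - L y) * g x \<partial>lborel \<partial>lborel)"
    by (rule lborel_pair.Fubini') measurable
  also have "\<dots> = (\<integral>\<^sup>+x. V * g x \<partial>lborel)"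
  proof (rule nn_integral_cong)
    fix x
    \<comment> \<open>Here the isometry enters: the unit ball is invariant under \<open>L\<close>,
      so the inner integral is the volume of a reflected and translated unit ball. This volume is
      finite and positive and can be cancelled at the end.\<close>
    have "f (x - L y) = f (L' x - y)" for y
    proof -
      have "x - L y = L (L' x - y)" by (simp add: linear_diff[OF lin] inv)
      then show ?thesis by (simp add: f_def indicator_def iso)
    qed
    then show "(\<integral>\<^sup>+y. f (x - L y) * g x \<partial>lborel) = V * g x"
      by (simp add: nn_integral_multc nn_integral_lborel_reflect V)
  qed
  also have "\<dots> = V * (\<integral>\<^sup>+x. g x \<partial>lborel)" by (simp add: nn_integral_cmult)
  finally have "V * (\<integral>\<^sup>+y. g (L y) \<partial>lborel) = V * (\<integral>\<^sup>+x. g x \<partial>lborel)" .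
  moreover have "unit_ball_vol (real DIM('a)) \<noteq> 0"
    using unit_ball_vol_pos[of "real DIM('a)"] by (metis less_irrefl of_nat_0_le_iff)
  then have "V \<noteq> 0" "V \<noteq> top"
    using emeasure_ball[of 1 "0::'a"] by (auto simp: V_def)
  ultimately show ?thesis by (simp add: ennreal_mult_cancel_left)
qed

lemma norm_vector_smult: "norm (c *s v) = cmod c * norm (v :: complex ^ 'n)"
  by (simp add: norm_vec_def L2_set_def norm_mult power_mult_distrib sum_distrib_left[symmetric] real_sqrt_mult)

lemma linear_vector_smult: "linear ((*s) (c :: complex) :: complex ^ 'n \<Rightarrow> complex ^ 'n)"
  by (intro linearI) (auto simp: vec_eq_iff algebra_simps)

lemma nn_integral_lborel_rotate:
  fixes g :: "complex ^ 'n \<Rightarrow> ennreal"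
  assumes "cmod c = 1" and "g \<in> borel_measurable borel"
  shows "(\<integral>\<^sup>+x. g (c *s x) \<partial>lborel) = (\<integral>\<^sup>+x. g x \<partial>lborel)"
proof (rule nn_integral_lborel_isometry[where L' = "\<lambda>x. inverse c *s x"])
  show "c *s (inverse c *s x) = x" for x :: "complex ^ 'n"
    using assms(1) by (cases "c = 0") (auto simp: vector_smult_assoc)
qed (use assms in \<open>auto simp: norm_vector_smult linear_vector_smult\<close>)

text \<open>The real basis grouped by complex coordinates, so that Jacobians and product integrands
  can be computed one complex coordinate at a time.\<close>

lemma prod_Basis_vec:
  fixes F :: "complex ^ 'n \<Rightarrow> 'b::comm_monoid_mult"
  shows "(\<Prod>b\<in>Basis. F b) = (\<Prod>i\<in>UNIV. F (axis i 1) * F (axis i \<i>))"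
proof -
  have B: "(Basis :: (complex ^ 'n) set) = (\<lambda>(i, u). axis i u) ` (UNIV \<times> {1, \<i>})"
    by (auto simp: Basis_vec_def Basis_complex_def)
  have inj: "inj_on (\<lambda>(i, u). axis i u :: complex ^ 'n) (UNIV \<times> {1, \<i>})"
    by (auto simp: inj_on_def axis_eq_axis)
  have "(\<Prod>b\<in>Basis. F b) = (\<Prod>(i, u)\<in>UNIV \<times> {1, \<i>}. F (axis i u))"
    unfolding B by (subst prod.reindex[OF inj]) (auto intro!: prod.cong)
  also have "\<dots> = (\<Prod>i\<in>UNIV. \<Prod>u\<in>{1, \<i>}. F (axis i u))"
    by (rule prod.cartesian_product[symmetric])
  finally show ?thesis by simp
qed

lemma inner_axis_ii: "x \<bullet> axis i \<i> = Im (x $ i)" "x \<bullet> axis i 1 = Re (x $ i)" for x :: "complex ^ 'n"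
  by (simp_all add: inner_axis inner_complex_def)

lemma prod_last_ix:
  fixes u v :: "'b::comm_monoid_mult"
  shows "(\<Prod>i\<in>(UNIV :: 'n::{finite,wellorder} set). if i = last_ix then u else v) = u * v ^ (CARD('n) - 1)"
proof -
  have "(\<Prod>i\<in>(UNIV :: 'n set). if i = last_ix then u
      else v) = u * (\<Prod>i\<in>UNIV - {last_ix :: 'n}. if i = last_ix then u else v)"
    by (subst prod.remove[of UNIV last_ix]) auto
  also have "(\<Prod>i\<in>UNIV - {last_ix :: 'n}. if i = last_ix then u else v) = (\<Prod>i\<in>UNIV - {last_ix :: 'n}. v)"
    by (intro prod.cong) auto
  finally show ?thesis by (simp add: card_Diff_singleton)
qed

text \<open>\<open>aut a\<close> is a diagonal dilation, followed by one shear in each of the two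
  real directions of the last coordinate and a translation. Only the dilation changes volume: the
  last complex coordinate is scaled by \<open>R\<close> and contributes \<open>R^2\<close>, the
  other \<open>n - 1\<close> are scaled by \<open>sqrt R\<close> and contribute \<open>R\<close>
  each.\<close>

lemma nn_integral_aut:
  fixes a :: "complex ^ 'n::{finite,wellorder}" and g :: "complex ^ 'n::_ \<Rightarrow> ennreal"
  assumes a: "a \<in> tube" and [measurable]: "g \<in> borel_measurable borel"
  shows "(\<integral>\<^sup>+z. g z \<partial>lborel) = ennreal (rho_diag a ^ (CARD('n) + 1)) * (\<integral>\<^sup>+z. g (aut a z) \<partial>lborel)"
proof -
  let ?S = "UNIV - {last_ix} :: 'n set"
  define R t where "R = rho_diag a" and "t = sqrt R"
  have R: "0 < R" "0 < t" "t * t = R" using a by (auto simp: R_def t_def tube_iff)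
  define cst where "cst = (\<chi> j. if j = last_ix then Complex (Re (a $ last_ix)) (\<Sum>i\<in>?S. (Im (a $ i))\<^sup>2)
      else a $ j)"
  define e1 e2 :: "complex ^ 'n::_" where "e1 = axis last_ix 1" and "e2 = axis last_ix \<i>"
  define h1 where "h1 = (\<lambda>w :: complex ^ 'n::_. 2 * (\<Sum>i\<in>?S. Im (a $ i) * Re (w $ i)))"
  define h2 where "h2 = (\<lambda>w :: complex ^ 'n::_. 2 * (\<Sum>i\<in>?S. Im (a $ i) * Im (w $ i)))"
  have [measurable]: "h1 \<in> borel_measurable borel" "h2 \<in> borel_measurable borel"
    unfolding h1_def h2_def by (auto intro!: borel_measurable_continuous_onI continuous_intros)
  have inv: "h1 (w + s *\<^sub>R e1) = h1 w" "h2 (w + s *\<^sub>R e1) = h2 w" "h2 (w + s *\<^sub>R e2) = h2 w" for w s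
    unfolding h1_def h2_def by (auto simp: e1_def e2_def axis_def)
  have e: "e1 \<in> Basis" "e2 \<in> Basis" by (auto simp: e1_def e2_def Basis_complex_def)
  define c where "c = (\<lambda>b :: complex ^ 'n::_. if b $ last_ix = 0 then t else R)"
  define D where "D = (\<lambda>z :: complex ^ 'n::_. 0 + (\<Sum>b\<in>Basis. (c b * (z \<bullet> b)) *\<^sub>R b))"
  have [measurable]: "D \<in> borel_measurable borel" unfolding D_def by simp
  have D: "D z $ j = of_real (if j = last_ix then R else t) * z $ j" for z j
  proof -
    have ip: "D z \<bullet> axis j u = (of_real (if j = last_ix then R else t) * z $ j) \<bullet> u" if "u \<in> Basis" for u
    proof -
      have b: "axis j u \<in> Basis" "u \<noteq> 0" using that by auto
      have "D z \<bullet> axis j u = c (axis j u) * (z \<bullet> axis j u)"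
        unfolding D_def using b by simp
      also have "\<dots> = (if j = last_ix then R else t) * (z $ j \<bullet> u)"
      proof -
        have "c (axis j u) = (if j = last_ix then R else t)"
          using b by (simp add: c_def axis_def)
        then show ?thesis by (simp add: inner_axis)
      qed
      finally show ?thesis by (simp add: inner_complex_def algebra_simps)
    qed
    show ?thesis
      using ip[of 1] ip[of \<i>] by (simp add: Basis_complex_def inner_axis_ii complex_eq_iff inner_complex_def)
  qed
  have aut: "aut a z = (D z + h1 (D z) *\<^sub>R e1) + h2 (D z + h1 (D z) *\<^sub>R e1) *\<^sub>R e2 + cst" for z
  proof -
    have s: "complex_of_real (h1 (D z)) + \<i> * of_real (h2 (D z))
        = 2 * of_real t * (\<Sum>i\<in>?S. of_real (Im (a $ i)) * z $ i)"
      unfolding h1_def h2_def by (simp add: D complex_eq_iff sum_distrib_left algebra_simps)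
    have "aut a z $ j = ((D z + h1 (D z) *\<^sub>R e1) + h2 (D z) *\<^sub>R e2 + cst) $ j" for j
    proof (cases "j = last_ix")
      case True
      have "((D z + h1 (D z) *\<^sub>R e1) + h2 (D z) *\<^sub>R e2 + cst) $ last_ix
        = of_real R * z $ last_ix + (complex_of_real (h1 (D z)) + \<i> * of_real (h2 (D z))) + cst $ last_ix"
        by (simp add: D e1_def e2_def axis_def complex_eq_iff)
      then show ?thesis unfolding s True aut_nth_last by (simp add: cst_def R_def t_def)
    next
      case False
      then show ?thesis by (simp add: aut_nth D cst_def e1_def e2_def axis_def R_def t_def)
    qed
    then show ?thesis by (simp add: vec_eq_iff inv)
  qed
  define G2 where "G2 = (\<lambda>w. g (w + h2 w *\<^sub>R e2 + cst))"
  define G1 where "G1 = (\<lambda>w. G2 (w + h1 w *\<^sub>R e1))"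
  have [measurable]: "G2 \<in> borel_measurable borel" "G1 \<in> borel_measurable borel" unfolding G1_def G2_def
      by measurable
  have "(\<integral>\<^sup>+w. G1 w \<partial>lborel) = (\<integral>\<^sup>+w. G2 w \<partial>lborel)"
    unfolding G1_def by (rule nn_integral_lborel_shear) (auto simp: e inv)
  also have "\<dots> = (\<integral>\<^sup>+w. g (w + cst) \<partial>lborel)"
    unfolding G2_def using nn_integral_lborel_shear[of e2 h2 "\<lambda>w. g (w + cst)"] by (simp add: e inv)
  also have "\<dots> = (\<integral>\<^sup>+w. g w \<partial>lborel)"
    using nn_integral_lborel_shift[of g cst] by (simp add: add.commute)
  finally have 1: "(\<integral>\<^sup>+w. G1 w \<partial>lborel) = (\<integral>\<^sup>+w. g w \<partial>lborel)" .
  have cpos: "c b \<noteq> 0" for b using R by (auto simp: c_def)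
  have "(\<integral>\<^sup>+w. G1 w \<partial>lborel) = (\<integral>\<^sup>+w. G1 w \<partial>density (distr lborel borel D) (\<lambda>_. (\<Prod>b\<in>Basis. \<bar>c b\<bar>)))"
    unfolding D_def using lborel_affine_euclidean[of c 0] cpos by simp
  also have "\<dots> = (\<Prod>b\<in>Basis. \<bar>c b\<bar>) * (\<integral>\<^sup>+z. G1 (D z) \<partial>lborel)"
    by (simp add: nn_integral_density nn_integral_distr nn_integral_cmult)
  also have "(\<lambda>z. G1 (D z)) = (\<lambda>z. g (aut a z))"
    by (simp add: G1_def G2_def aut)
  also have "(\<Prod>b\<in>Basis. \<bar>c b\<bar>) = (\<Prod>i\<in>(UNIV :: 'n set). if i = last_ix then R * R else R)"
    unfolding prod_Basis_vec using R by (intro prod.cong) (auto simp: c_def axis_def)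
  also have "\<dots> = R ^ (CARD('n) + 1)"
  proof -
    have "0 < CARD('n)" by simp
    then obtain m where "CARD('n) = Suc m" by (metis gr0_conv_Suc)
    then show ?thesis unfolding prod_last_ix by simp
  qed
  finally show ?thesis unfolding 1 R_def .
qed

section \<open>One-dimensional integrals, weighted volume and the Forelli--Rudin integral\<close>

text \<open>On \<open>(0, 1]\<close> the second factor is at most 1 and integrability is decided by
  \<open>-1 < \<alpha>\<close>; beyond 1 the integrand is at most
  \<open>y powr (\<alpha> - s)\<close>.\<close>

lemma nn_integral_powr_tail_finite:
  fixes \<alpha> s :: real
  assumes "-1 < \<alpha>" "1 + \<alpha> < s"
  shows "(\<integral>\<^sup>+y. ennreal (indicator {0<..} y * y powr \<alpha> * (1 + y) powr (-s)) \<partial>lborel) < \<infinity>"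
proof -
  have 1: "(\<integral>\<^sup>+y. ennreal (indicator {0..1} y * y powr \<alpha>) \<partial>lborel) = ennreal (1 powr (\<alpha> + 1) / (\<alpha> + 1))"
    by (rule nn_integral_has_integral_lebesgue) (use assms has_integral_powr_from_0[of \<alpha> 1] in auto)
  have 2: "(\<integral>\<^sup>+y. ennreal (indicator {1..} y * y powr (\<alpha> - s)) \<partial>lborel)
      = ennreal (-(1 powr (\<alpha> - s + 1)) / (\<alpha> - s + 1))"
    by (rule nn_integral_has_integral_lebesgue) (use assms has_integral_powr_to_inf[of "\<alpha> - s" 1] in auto)
  have "(\<integral>\<^sup>+y. ennreal (indicator {0<..} y * y powr \<alpha> * (1 + y) powr (-s)) \<partial>lborel) \<le>
     (\<integral>\<^sup>+y. ennreal (indicator {0..1} y * y powr \<alpha>) + ennreal (indicator {1..} y * y powr (\<alpha> - s)) \<partial>lborel)"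
  proof (rule nn_integral_mono)
    fix y :: real
    have a: "y powr \<alpha> * (1 + y) powr (-s) \<le> y powr \<alpha>" if "0 < y"
    proof -
      have "(1 + y) powr (-s) \<le> 1 powr (-s)" using that assms by (intro powr_mono2') auto
      then show ?thesis by (simp add: mult_left_le)
    qed
    have b: "y powr \<alpha> * (1 + y) powr (-s) \<le> y powr (\<alpha> - s)" if "1 < y"
    proof -
      have "(1 + y) powr (-s) \<le> y powr (-s)" using that assms by (intro powr_mono2') auto
      then have "y powr \<alpha> * (1 + y) powr (-s) \<le> y powr \<alpha> * y powr (-s)" by (intro mult_left_mono) auto
      then show ?thesis by (simp add: powr_add[symmetric])
    qed
    show "ennreal (indicator {0<..} y * y powr \<alpha> * (1 + y) powr (-s)) \<le>
       ennreal (indicator {0..1} y * y powr \<alpha>) + ennreal (indicator {1..} y * y powr (\<alpha> - s))"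
    proof (cases "y \<le> 1")
      case True
      then show ?thesis using a by (intro add_increasing2) (auto simp: indicator_def ennreal_leI)
    next
      case False
      then show ?thesis using b by (auto simp: indicator_def ennreal_leI)
    qed
  qed
  also have "\<dots> < \<infinity>"
    by (subst nn_integral_add) (auto simp: 1[simplified] 2[simplified])
  finally show ?thesis .
qed

lemma nn_integral_abs_powr_finite:
  fixes s :: real
  assumes "1 < s"
  shows "(\<integral>\<^sup>+y. ennreal ((1 + \<bar>y\<bar>) powr (-s)) \<partial>lborel) < \<infinity>"
proof -
  define F where "F = (\<lambda>y::real. ennreal (indicator {0<..} y * y powr 0 * (1 + y) powr (-s)))"
  have [measurable]: "F \<in> borel_measurable borel" unfolding F_def by measurable
  have fin: "(\<integral>\<^sup>+y. F y \<partial>lborel) < \<infinity>" unfolding F_def by (rule nn_integral_powr_tail_finite) (use assms in auto)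
  have r: "(\<integral>\<^sup>+y. F (-y) \<partial>lborel) = (\<integral>\<^sup>+y. F y \<partial>lborel)"
    using nn_integral_lborel_reflect[of F 0] by simp
  have "(\<integral>\<^sup>+y. ennreal ((1 + \<bar>y\<bar>) powr (-s)) \<partial>lborel) = (\<integral>\<^sup>+y. F y + F (-y) \<partial>lborel)"
  proof (rule nn_integral_cong_AE)
    show "AE y in lborel. ennreal ((1 + \<bar>y\<bar>) powr (-s)) = F y + F (-y)"
      using AE_lborel_singleton[of "0::real"] by eventually_elim (auto simp: F_def indicator_def)
  qed
  also have "\<dots> = (\<integral>\<^sup>+y. F y \<partial>lborel) + (\<integral>\<^sup>+y. F (-y) \<partial>lborel)"
    by (rule nn_integral_add) auto
  also have "\<dots> < \<infinity>" using fin r by simp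
  finally show ?thesis .
qed

lemma nn_integral_square_powr_finite:
  fixes s :: real
  assumes "1 / 2 < s"
  shows "(\<integral>\<^sup>+y. ennreal ((1 + y\<^sup>2) powr (-s)) \<partial>lborel) < \<infinity>"
proof -
  have "(\<integral>\<^sup>+y. ennreal ((1 + y\<^sup>2) powr (-s)) \<partial>lborel) \<le> (\<integral>\<^sup>+y. ennreal (2 powr s) * ennreal ((1
      + \<bar>y\<bar>) powr (-(2 * s))) \<partial>lborel)"
  proof (rule nn_integral_mono)
    fix y :: real
    have "(1 + \<bar>y\<bar>)\<^sup>2 / 2 \<le> 1 + y\<^sup>2"
      using sum_squares_ge_zero[of "1 - \<bar>y\<bar>" 0] by (simp add: power2_eq_square algebra_simps)
    then have "(1 + y\<^sup>2) powr (-s) \<le> ((1 + \<bar>y\<bar>)\<^sup>2 / 2) powr (-s)"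
      using assms by (intro powr_mono2') auto
    also have "\<dots> = 2 powr s * (1 + \<bar>y\<bar>) powr (-(2 * s))"
    proof -
      have "(1 + \<bar>y\<bar>)\<^sup>2 = (1 + \<bar>y\<bar>) powr 2" by simp
      then have "(1 + \<bar>y\<bar>)\<^sup>2 powr s = (1 + \<bar>y\<bar>) powr (2 * s)" by (simp only: powr_powr)
      then show ?thesis by (simp add: powr_divide powr_minus_divide)
    qed
    finally show "ennreal ((1 + y\<^sup>2) powr (-s)) \<le> ennreal (2 powr s) * ennreal ((1 + \<bar>y\<bar>) powr (-(2 * s)))"
      by (simp add: ennreal_mult[symmetric] ennreal_leI)
  qed
  also have "\<dots> = ennreal (2 powr s) * (\<integral>\<^sup>+y. ennreal ((1 + \<bar>y\<bar>) powr (-(2 * s))) \<partial>lborel)"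
    by (rule nn_integral_cmult) measurable
  also have "\<dots> < \<infinity>"
    using nn_integral_abs_powr_finite[of "2 * s"] assms by (simp add: ennreal_mult_less_top)
  finally show ?thesis .
qed


text \<open>A Borel counterpart of \<open>weighted_measure\<close>: with the indicator of the domain
  moved into the density, Fubini and the changes of variables apply without completion or
  restriction. On non-negative continuous integrands both measures agree, see
  \<open>nn_integral_weighted_measure\<close>.\<close>

definition wmeas :: "real \<Rightarrow> (complex ^ 'n::{finite,wellorder}) measure" where
  "wmeas \<alpha> = density lborel (\<lambda>z. ennreal (indicator tube z * rho_diag z powr \<alpha>))"

lemma sets_wmeas [measurable_cong, simp]: "sets (wmeas \<alpha>) = sets borel"
  by (simp add: wmeas_def)

lemma AE_wmeas: "AE z in wmeas \<alpha>. z \<in> tube"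
  unfolding wmeas_def by (subst AE_density) (auto simp: indicator_def)

lemma nn_integral_wmeas_mono:
  "(\<And>z. z \<in> tube \<Longrightarrow> f z \<le> g z) \<Longrightarrow> (\<integral>\<^sup>+z. f z \<partial>wmeas \<alpha>) \<le> (\<integral>\<^sup>+z. g z \<partial>wmeas \<alpha>)"
  by (intro nn_integral_mono_AE eventually_mono[OF AE_wmeas]) auto

lemma nn_integral_wmeas_cong:
  "(\<And>z. z \<in> tube \<Longrightarrow> f z = g z) \<Longrightarrow> (\<integral>\<^sup>+z. f z \<partial>wmeas \<alpha>) = (\<integral>\<^sup>+z. g z \<partial>wmeas \<alpha>)"
  by (intro nn_integral_cong_AE eventually_mono[OF AE_wmeas]) auto

lemma nn_integral_wmeas:
  "f \<in> borel_measurable borel \<Longrightarrow>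
   (\<integral>\<^sup>+z. f z \<partial>wmeas \<alpha>) = (\<integral>\<^sup>+z. ennreal (indicator tube z * rho_diag z powr \<alpha>) * f z \<partial>lborel)"
  unfolding wmeas_def by (subst nn_integral_density) auto

lemma nn_integral_wmeas_shift_weight:
  assumes "f \<in> borel_measurable borel"
  shows "(\<integral>\<^sup>+z. ennreal (rho_diag z powr \<beta>) * f z \<partial>wmeas \<alpha>) = (\<integral>\<^sup>+z. f z \<partial>wmeas (\<alpha> + \<beta>))"
  using assms by (simp add: nn_integral_wmeas mult.assoc[symmetric] ennreal_mult[symmetric] powr_add)

text \<open>In the exponent, \<open>n + 1\<close> is the Jacobian of \<open>aut a\<close> and
  \<open>\<alpha>\<close> the rescaling of the weight by \<open>rho_diag_aut\<close>.\<close>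

lemma nn_integral_wmeas_aut:
  fixes a :: "complex ^ 'n::{finite,wellorder}" and g :: "complex ^ 'n::_ \<Rightarrow> ennreal"
  assumes a: "a \<in> tube" and [measurable]: "g \<in> borel_measurable borel"
  shows "(\<integral>\<^sup>+z. g z \<partial>wmeas \<alpha>) =
     ennreal (rho_diag a powr (real CARD('n) + 1 + \<alpha>)) * (\<integral>\<^sup>+z. g (aut a z) \<partial>wmeas \<alpha>)"
proof -
  have [measurable]: "aut a \<in> borel_measurable borel"
    by (intro borel_measurable_continuous_onI continuous_aut)
  have R: "0 < rho_diag a" using a by (simp add: tube_iff)
  have "(\<integral>\<^sup>+z. g z \<partial>wmeas \<alpha>) = (\<integral>\<^sup>+z. ennreal (indicator tube z * rho_diag z powr \<alpha>) * g z \<partial>lborel)"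
    by (simp add: nn_integral_wmeas)
  also have "\<dots> = ennreal (rho_diag a ^ (CARD('n) + 1)) *
     (\<integral>\<^sup>+z. ennreal (indicator tube (aut a z) * rho_diag (aut a z) powr \<alpha>) * g (aut a z) \<partial>lborel)"
    by (rule nn_integral_aut[OF a]) measurable
  also have "(\<lambda>z. ennreal (indicator tube (aut a z) * rho_diag (aut a z) powr \<alpha>) * g (aut a z)) =
      (\<lambda>z. ennreal (rho_diag a powr \<alpha>) * (ennreal (indicator tube z * rho_diag z powr \<alpha>) * g (aut a z)))"
    using R a by (auto simp: fun_eq_iff indicator_def aut_tube rho_diag_aut powr_mult tube_iff
        ennreal_mult mult.assoc zero_less_mult_iff)
  also have "(\<integral>\<^sup>+z. ennreal (rho_diag a powr \<alpha>) * (ennreal (indicator tube z * rho_diag z powr \<alpha>)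
      * g (aut a z)) \<partial>lborel)
     = ennreal (rho_diag a powr \<alpha>) * (\<integral>\<^sup>+z. g (aut a z) \<partial>wmeas \<alpha>)"
    by (subst nn_integral_cmult) (auto simp: nn_integral_wmeas)
  also have "ennreal (rho_diag a ^ (CARD('n) + 1)) * (ennreal (rho_diag a powr \<alpha>) * (\<integral>\<^sup>+z. g (aut a z)
      \<partial>wmeas \<alpha>))
    = ennreal (rho_diag a powr (real CARD('n) + 1 + \<alpha>)) * (\<integral>\<^sup>+z. g (aut a z) \<partial>wmeas \<alpha>)"
  proof -
    have "rho_diag a powr (real CARD('n) + 1 + \<alpha>) = rho_diag a ^ (CARD('n) + 1) * rho_diag a powr \<alpha>"
      using R by (simp only: powr_add powr_realpow power_add powr_one power_one_right less_imp_le)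
    then show ?thesis using R by (simp only: mult.assoc[symmetric] ennreal_mult[symmetric] powr_ge_zero
        zero_le_power less_imp_le)
  qed
  finally show ?thesis .
qed

text \<open>The shear \<open>w \<mapsto> w + (x' \<sqdot> y' + i |y'|\<^sup>2) e\<^sub>n\<close> straightens the domain to a half space; there
  \<open>rho\<close> is bounded below by each coordinate, so a power of it is bounded below by a product.\<close>

lemma forelli_rudin_base:
  assumes \<alpha>: "-1 < \<alpha>" and s: "real CARD('n::{finite,wellorder}) + 1 + \<alpha> < s"
  shows "(\<integral>\<^sup>+z. ennreal (cmod (rho z base_point) powr (-s)) \<partial>(wmeas \<alpha> :: (complex ^ 'n::_) measure)) < \<infinity>"
proof -
  let ?S = "UNIV - {last_ix} :: 'n set"
  let ?N = "real CARD('n)"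
  define F where "F = (\<lambda>z :: complex ^ 'n::_. ennreal (indicator tube z * rho_diag z powr \<alpha>)
      * ennreal (cmod (rho z base_point) powr (-s)))"
  have [measurable]: "F \<in> borel_measurable borel" unfolding F_def by measurable
  define e1 e2 :: "complex ^ 'n::_" where "e1 = axis last_ix 1" and "e2 = axis last_ix \<i>"
  define h1 where "h1 = (\<lambda>w :: complex ^ 'n::_. \<Sum>i\<in>?S. Re (w $ i) * Im (w $ i))"
  define h2 where "h2 = (\<lambda>w :: complex ^ 'n::_. \<Sum>i\<in>?S. (Im (w $ i))\<^sup>2)"
  have [measurable]: "h1 \<in> borel_measurable borel" "h2 \<in> borel_measurable borel"
    unfolding h1_def h2_def by (auto intro!: borel_measurable_continuous_onI continuous_intros)
  have inv: "h1 (w + s *\<^sub>R e1) = h1 w" "h2 (w + s *\<^sub>R e1) = h2 w" "h2 (w + s *\<^sub>R e2) = h2 w" for w s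
    unfolding h1_def h2_def by (auto simp: e1_def e2_def axis_def)
  have e: "e1 \<in> Basis" "e2 \<in> Basis" by (auto simp: e1_def e2_def Basis_complex_def)
  define \<Psi> where "\<Psi> w = w + h1 w *\<^sub>R e1 + h2 w *\<^sub>R e2" for w
  have "(\<integral>\<^sup>+w. F (\<Psi> w) \<partial>lborel) = (\<integral>\<^sup>+w. F (w + h2 w *\<^sub>R e2) \<partial>lborel)"
    using nn_integral_lborel_shear[of e1 h1 "\<lambda>w. F (w + h2 w *\<^sub>R e2)"] by (simp add: e inv \<Psi>_def)
  also have "\<dots> = (\<integral>\<^sup>+w. F w \<partial>lborel)"
    by (rule nn_integral_lborel_shear) (auto simp: e inv)
  finally have eq: "(\<integral>\<^sup>+w. F w \<partial>lborel) = (\<integral>\<^sup>+w. F (\<Psi> w) \<partial>lborel)" by simp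
  have \<Psi>: "\<Psi> w $ last_ix = w $ last_ix + Complex (h1 w) (h2 w)" "j \<noteq> last_ix \<Longrightarrow> \<Psi> w $ j = w $ j" for w j
    by (auto simp: \<Psi>_def e1_def e2_def axis_def complex_eq_iff)
  have rd: "rho_diag (\<Psi> w) = Im (w $ last_ix)" for w
  proof -
    have "(\<Sum>j\<in>?S. (Im (\<Psi> w $ j))\<^sup>2) = h2 w" unfolding h2_def by (intro sum.cong) (auto simp: \<Psi>)
    then show ?thesis by (simp add: rho_diag_eq \<Psi>)
  qed
  have Imr: "Im (rho (\<Psi> w) base_point) = - Re (w $ last_ix) / 2" for w
  proof -
    have "Im (\<Sum>j\<in>?S. (\<Psi> w $ j - cnj (base_point $ j))\<^sup>2) = 2 * h1 w"
      unfolding h1_def sum_distrib_left Im_sum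
          by (intro sum.cong) (auto simp: \<Psi> base_point_nth power2_eq_square)
    then show ?thesis unfolding rho_def by (simp add: \<Psi> base_point_nth field_simps)
  qed
  \<comment> \<open>The critical exponents of the one-dimensional integrals are
    \<open>1 + \<alpha>\<close> and \<open>1\<close> for the last coordinate and \<open>1/2\<close>
    for each real horizontal coordinate; their sum is \<open>n + 1 + \<alpha>\<close>. The excess of
    \<open>s\<close> is spread evenly over the \<open>2 n\<close> real coordinates.\<close>
  define \<epsilon> where "\<epsilon> = (s - (?N + 1 + \<alpha>)) / (2 * ?N)"
  have \<epsilon>: "0 < \<epsilon>" "2 * ?N * \<epsilon> = s - (?N + 1 + \<alpha>)" using s by (auto simp: \<epsilon>_def)
  define s1 s2 s3 where "s1 = 1 + \<alpha> + \<epsilon>" and "s2 = 1 + \<epsilon>" and "s3 = 1/2 + \<epsilon>"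
  have spos: "0 < s1" "0 < s2" "0 < s3" using \<alpha> \<epsilon> by (auto simp: s1_def s2_def s3_def)
  have ssum: "s = s1 + s2 + real (CARD('n) - 1) * (s3 + s3)"
  proof -
    have "real (CARD('n) - 1) = ?N - 1" by (simp add: of_nat_diff)
    then show ?thesis using \<epsilon>(2) by (simp add: s1_def s2_def s3_def algebra_simps)
  qed
  define f where "f = (\<lambda>(b :: complex ^ 'n::_) y. ennreal (if b = e2 then indicator {0<..} y * y powr \<alpha> * (1
      + y) powr (-s1)
     else if b = e1 then (1 + \<bar>y\<bar>) powr (-s2) else (1 + y\<^sup>2) powr (-s3)))"
  have [measurable]: "f b \<in> borel_measurable borel" for b unfolding f_def by measurable
  have bound: "F (\<Psi> w) \<le> ennreal (4 powr s) * (\<Prod>b\<in>Basis. f b (w \<bullet> b))" for w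
  proof (cases "0 < Im (w $ last_ix)")
    case False
    then have "\<Psi> w \<notin> tube" by (simp add: tube_iff rd)
    then show ?thesis by (simp add: F_def)
  next
    case True
    define y where "y = Im (w $ last_ix)"
    \<comment> \<open>The factor 4 clears the denominator in \<open>rho\<close>, so that
      \<open>B\<close> dominates every one-variable base: \<open>1 + y\<close>,
      \<open>1 + |Re (w $ last_ix)|\<close> and \<open>1 + x^2\<close> for each real horizontal
      coordinate \<open>x\<close>.\<close>
    define B where "B = 4 * cmod (rho (\<Psi> w) base_point)"
    have y: "0 < y" using True y_def by simp
    have Re4: "horizontal_norm2 (\<Psi> w) + 2 * y + 2 \<le> B"
      using complex_Re_le_cmod[of "rho (\<Psi> w) base_point"] Re_rho_base[of "\<Psi> w"]
      by (simp add: B_def rd y_def)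
    have B1: "1 + y \<le> B" using Re4 y horizontal_norm2_nonneg[of "\<Psi> w"] by linarith
    have B2: "1 + \<bar>Re (w $ last_ix)\<bar> \<le> B"
      using abs_Im_le_cmod[of "rho (\<Psi> w) base_point"] Re4 y horizontal_norm2_nonneg[of "\<Psi> w"]
          by (simp add: Imr B_def)
    have B3: "1 + (Re (w $ j))\<^sup>2 \<le> B" "1 + (Im (w $ j))\<^sup>2 \<le> B" if "j \<noteq> last_ix" for j
    proof -
      have "(cmod (\<Psi> w $ j))\<^sup>2 \<le> horizontal_norm2 (\<Psi> w)"
        unfolding horizontal_norm2_def using that by (intro member_le_sum) auto
      then have "(Re (w $ j))\<^sup>2 + (Im (w $ j))\<^sup>2 \<le> horizontal_norm2 (\<Psi> w)"
        using that by (simp add: \<Psi> cmod_power2)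
      then show "1 + (Re (w $ j))\<^sup>2 \<le> B" "1 + (Im (w $ j))\<^sup>2 \<le> B"
        using Re4 y zero_le_power2[of "Re (w $ j)"] zero_le_power2[of "Im (w $ j)"] by linarith+
    qed
    have Bpos: "0 < B" using B1 y by linarith
    \<comment> \<open>\<open>q\<close> distributes \<open>B powr (-s)\<close> over the coordinates
      and \<open>p\<close> is its factorwise majorant, in which each copy of \<open>B\<close> is
      replaced by the base of its own variable.\<close>
    define q where "q = (\<lambda>i::'n. if i = last_ix then y powr \<alpha> * B powr (-s1) * B powr (-s2)
        else B powr (-s3) * B powr (-s3))"
    define p where "p = (\<lambda>i::'n. if i = last_ix then y powr \<alpha> * (1 + y) powr (-s1) * (1
        + \<bar>Re (w $ i)\<bar>) powr (-s2)
       else (1 + (Re (w $ i))\<^sup>2) powr (-s3) * (1 + (Im (w $ i))\<^sup>2) powr (-s3))"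
    have "F (\<Psi> w) = ennreal (y powr \<alpha> * cmod (rho (\<Psi> w) base_point) powr (-s))"
      using True by (simp add: F_def tube_iff rd y_def ennreal_mult)
    also have "y powr \<alpha> * cmod (rho (\<Psi> w) base_point) powr (-s) = 4 powr s * (y powr \<alpha> * B powr (-s))"
    proof -
      have B4: "cmod (rho (\<Psi> w) base_point) = B / 4" by (simp add: B_def)
      show ?thesis unfolding B4 using Bpos by (simp add: powr_divide powr_minus_divide)
    qed
    also have "y powr \<alpha> * B powr (-s) = (\<Prod>i\<in>UNIV. q i)"
    proof -
      have "(\<Prod>i\<in>UNIV. q i) = y powr \<alpha> * B powr (-s1) * B powr (-s2) * (B powr (-s3)
          * B powr (-s3)) ^ (CARD('n) - 1)"
        unfolding q_def by (rule prod_last_ix)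
      also have "\<dots> = y powr \<alpha> * B powr (-s)"
        using Bpos by (simp add: ssum powr_add[symmetric] powr_power algebra_simps)
      finally show ?thesis by simp
    qed
    also have "(\<Prod>i\<in>UNIV. q i) \<le> (\<Prod>i\<in>UNIV. p i)"
    proof (rule prod_mono)
      have m: "B powr (-\<sigma>) \<le> u powr (-\<sigma>)" if "u \<le> B" "0 < u" "0 < \<sigma>" for u \<sigma> :: real
        using that by (intro powr_mono2') auto
      fix i :: 'n
      show "0 \<le> q i \<and> q i \<le> p i"
      proof (cases "i = last_ix")
        case True
        then show ?thesis unfolding q_def p_def using B1 B2 y spos
          by (auto intro!: mult_mono m)
      next
        case False
        have "0 < 1 + (Re (w $ i))\<^sup>2" "0 < 1 + (Im (w $ i))\<^sup>2" by (auto intro: add_pos_nonneg)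
        then show ?thesis unfolding q_def p_def using B3[OF False] y spos False
          by (auto intro!: mult_mono m)
      qed
    qed
    also have "ennreal (4 powr s * (\<Prod>i\<in>UNIV. p i)) = ennreal (4 powr s) * (\<Prod>i\<in>UNIV. ennreal (p i))"
      by (subst prod_ennreal) (auto simp: p_def ennreal_mult prod_nonneg)
    also have "(\<Prod>i\<in>UNIV. ennreal (p i)) = (\<Prod>b\<in>Basis. f b (w \<bullet> b))"
      unfolding prod_Basis_vec
    proof (intro prod.cong refl)
      fix i :: 'n
      show "ennreal (p i) = f (axis i 1) (w \<bullet> axis i 1) * f (axis i \<i>) (w \<bullet> axis i \<i>)"
        unfolding inner_axis_ii using y
        by (auto simp: p_def f_def e1_def e2_def axis_eq_axis y_def ennreal_mult[symmetric] mult_ac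
            complex_eq_iff)
    qed
    finally show ?thesis by (simp add: ennreal_leI mult_left_mono)
  qed
  have fin: "(\<integral>\<^sup>+y. f b y \<partial>lborel) < \<infinity>" for b
  proof -
    consider "b = e2" | "b \<noteq> e2" "b = e1" | "b \<noteq> e2" "b \<noteq> e1" by blast
    then show ?thesis
    proof cases
      case 1
      then show ?thesis using nn_integral_powr_tail_finite[of \<alpha> s1] \<alpha> \<epsilon> by (simp add: f_def s1_def)
    next
      case 2
      then show ?thesis using nn_integral_abs_powr_finite[of s2] \<epsilon> by (simp add: f_def s2_def)
    next
      case 3
      then show ?thesis using nn_integral_square_powr_finite[of s3] \<epsilon> by (simp add: f_def s3_def)
    qed
  qed
  have "(\<integral>\<^sup>+z. ennreal (cmod (rho z base_point) powr (-s)) \<partial>(wmeas \<alpha> :: (complex ^ 'n::_) measure))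
      = (\<integral>\<^sup>+w. F w \<partial>lborel)"
    unfolding F_def by (rule nn_integral_wmeas) measurable
  also have "\<dots> = (\<integral>\<^sup>+w. F (\<Psi> w) \<partial>lborel)" by (rule eq)
  also have "\<dots> \<le> (\<integral>\<^sup>+w. ennreal (4 powr s) * (\<Prod>b\<in>Basis. f b (w \<bullet> b)) \<partial>lborel)"
    by (intro nn_integral_mono bound)
  also have "\<dots> = ennreal (4 powr s) * (\<integral>\<^sup>+w. (\<Prod>b\<in>Basis. f b (w \<bullet> b)) \<partial>lborel)"
    by (rule nn_integral_cmult) measurable
  also have "(\<integral>\<^sup>+w. (\<Prod>b\<in>Basis. f b (w \<bullet> b)) \<partial>lborel) = (\<Prod>b\<in>Basis. (\<integral>\<^sup>+y. f b y \<partial>lborel))"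
    by (rule nn_integral_lborel_prod) auto
  also have "ennreal (4 powr s) * \<dots> < \<infinity>"
  proof -
    have "(\<Prod>b\<in>Basis. (\<integral>\<^sup>+y. f b y \<partial>lborel)) \<noteq> top"
      using fin by (auto simp: ennreal_prod_eq_top less_top)
    then show ?thesis by (simp add: ennreal_mult_less_top less_top)
  qed
  finally show ?thesis .
qed

text \<open>By homogeneity an identity holds, not just an estimate: under \<open>aut a\<close> the
  measure contributes \<open>rho_diag a powr (n + 1 + \<alpha>)\<close>, the kernel contributes
  \<open>rho_diag a powr (-s)\<close>, and the constant is the integral at the base point.\<close>

lemma forelli_rudin:
  assumes \<alpha>: "-1 < \<alpha>" and s: "real CARD('n::{finite,wellorder}) + 1 + \<alpha> < s"
  shows "\<exists>C\<ge>0. \<forall>a \<in> (tube :: (complex ^ 'n::{finite,wellorder}) set).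
    (\<integral>\<^sup>+z. ennreal (cmod (rho z a) powr (-s)) \<partial>wmeas \<alpha>) = ennreal (C * rho_diag a powr (real CARD('n) + 1
        + \<alpha> - s))"
proof -
  define I where "I = (\<integral>\<^sup>+z. ennreal (cmod (rho z base_point) powr (-s))
      \<partial>(wmeas \<alpha> :: (complex ^ 'n::_) measure))"
  have I: "I = ennreal (enn2real I)" using forelli_rudin_base[OF assms] by (simp add: I_def)
  show ?thesis
  proof (intro exI[of _ "enn2real I"] conjI ballI)
    fix a :: "complex ^ 'n::_" assume a: "a \<in> tube"
    have R: "0 < rho_diag a" using a by (simp add: tube_iff)
    have ab: "rho (aut a z) a = of_real (rho_diag a) * rho z base_point" for z
      using rho_aut[OF a, of z base_point] aut_base[OF a] by simp
    have "(\<integral>\<^sup>+z. ennreal (cmod (rho z a) powr (-s)) \<partial>wmeas \<alpha>) =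
       ennreal (rho_diag a powr (real CARD('n) + 1 + \<alpha>)) * (\<integral>\<^sup>+z. ennreal (cmod (rho (aut a z) a) powr (-s))
           \<partial>wmeas \<alpha>)"
      by (rule nn_integral_wmeas_aut[OF a]) measurable
    also have "(\<lambda>z. ennreal (cmod (rho (aut a z) a) powr (-s)))
        = (\<lambda>z. ennreal (rho_diag a powr (-s)) * ennreal (cmod (rho z base_point) powr (-s)))"
      using R by (simp add: ab norm_mult powr_mult ennreal_mult)
    also have "(\<integral>\<^sup>+z. ennreal (rho_diag a powr (-s)) * ennreal (cmod (rho z base_point) powr (-s))
        \<partial>(wmeas \<alpha> :: (complex ^ 'n::_) measure)) = ennreal (rho_diag a powr (-s)) * I"
      unfolding I_def by (rule nn_integral_cmult) measurable
    also have "ennreal (rho_diag a powr (real CARD('n) + 1 + \<alpha>)) * (ennreal (rho_diag a powr (-s)) * I) =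
       ennreal (enn2real I * rho_diag a powr (real CARD('n) + 1 + \<alpha> - s))"
      by (subst I) (simp add: ennreal_mult[symmetric] powr_add[symmetric] algebra_simps)
    finally show "(\<integral>\<^sup>+z. ennreal (cmod (rho z a) powr (-s)) \<partial>wmeas \<alpha>)
        = ennreal (enn2real I * rho_diag a powr (real CARD('n) + 1 + \<alpha> - s))" .
  qed simp
qed

section \<open>Separated sequences and lattices\<close>

text \<open>After division by \<open>(x + y) powr p\<close> this is \<open>u \<le> u powr p\<close>
  on the unit interval, added for \<open>u = x / (x + y)\<close> and
  \<open>u = y / (x + y)\<close>.\<close>

lemma powr_add_le:
  fixes x y p :: real
  assumes "0 \<le> x" "0 \<le> y" "0 < p" "p \<le> 1"
  shows "(x + y) powr p \<le> x powr p + y powr p"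
proof (cases "x + y = 0")
  case True
  then show ?thesis by simp
next
  case False
  then have s: "0 < x + y" using assms by simp
  have le: "u \<le> u powr p" if "0 \<le> u" "u \<le> 1" for u :: real
    using powr_mono'[of p 1 u] that assms by simp
  have "1 = x / (x + y) + y / (x + y)" using s by (simp add: add_divide_distrib[symmetric])
  also have "\<dots> \<le> (x / (x + y)) powr p + (y / (x + y)) powr p"
    using s assms by (intro add_mono le) auto
  also have "\<dots> = (x powr p + y powr p) / (x + y) powr p"
    using s assms by (simp add: powr_divide add_divide_distrib)
  finally show ?thesis using s by (simp add: field_simps)
qed

lemma powr_sum_le:
  fixes p :: real
  assumes "finite K" "\<And>k. k \<in> K \<Longrightarrow> 0 \<le> x k" "0 < p" "p \<le> 1"
  shows "(\<Sum>k\<in>K. x k) powr p \<le> (\<Sum>k\<in>K. x k powr p)"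
  using assms(1,2)
proof (induction K)
  case (insert k K)
  have "(\<Sum>j\<in>insert k K. x j) powr p \<le> x k powr p + (\<Sum>j\<in>K. x j) powr p"
    using insert assms by (simp add: powr_add_le sum_nonneg)
  then show ?case using insert by simp
qed simp

text \<open>Convexity: the graph of \<open>t powr p\<close> lies above its tangent at
  \<open>m\<close>. Young's inequality with the exponents \<open>p\<close> and
  \<open>p / (p - 1)\<close> delivers it without derivatives.\<close>

lemma powr_tangent_le:
  fixes p t m :: real
  assumes "1 < p" "0 \<le> t" "0 < m"
  shows "p * t * m powr (p - 1) \<le> t powr p + (p - 1) * m powr p"
proof -
  have "t * m powr (p - 1) \<le> t powr p / p + (m powr (p - 1)) powr (p / (p - 1)) / (p / (p - 1))"
    by (rule Youngs_inequality) (use assms in \<open>auto simp: field_simps\<close>)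
  also have "(m powr (p - 1)) powr (p / (p - 1)) = m powr p"
    using assms by (simp add: powr_powr)
  also have "t powr p / p + m powr p / (p / (p - 1)) = (t powr p + (p - 1) * m powr p) / p"
    using assms by (simp add: field_simps)
  finally have "p * (t * m powr (p - 1)) \<le> p * ((t powr p + (p - 1) * m powr p) / p)"
    using assms by (intro mult_left_mono) auto
  then show ?thesis using assms by (simp add: mult.assoc)
qed

text \<open>Jensen's inequality for weights of arbitrary total mass: the tangent inequality at the
  weighted mean \<open>m = S / W\<close> is summed with the weights.\<close>

lemma powr_weighted_sum_le:
  fixes p :: real
  assumes K: "finite K" and w: "\<And>k. k \<in> K \<Longrightarrow> 0 \<le> w k" and t: "\<And>k. k \<in> K \<Longrightarrow> 0 \<le> t k" and p: "1 < p"
  shows "(\<Sum>k\<in>K. w k * t k) powr p \<le> (\<Sum>k\<in>K. w k) powr (p - 1) * (\<Sum>k\<in>K. w k * t k powr p)"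
proof -
  define S where "S = (\<Sum>k\<in>K. w k * t k)"
  define W where "W = (\<Sum>k\<in>K. w k)"
  have S0: "0 \<le> S" "0 \<le> W" unfolding S_def W_def using w t by (auto intro!: sum_nonneg)
  show ?thesis
  proof (cases "S = 0")
    case True
    then show ?thesis using S0 w t unfolding S_def[symmetric] by (auto intro!: sum_nonneg mult_nonneg_nonneg)
  next
    case False
    then have Spos: "0 < S" using S0 by simp
    have Wpos: "0 < W"
    proof (rule ccontr)
      assume "\<not> 0 < W"
      then have "W = 0" using S0 by simp
      then have "\<forall>k\<in>K. w k = 0" using sum_nonneg_eq_0_iff[OF K, of w] w unfolding W_def by auto
      then have "S = 0" unfolding S_def by simp
      then show False using Spos by simp
    qed
    define m where "m = S / W"
    have m: "0 < m" "S = m * W" using Spos Wpos by (auto simp: m_def)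
    have "p * S * m powr (p - 1) = (\<Sum>k\<in>K. w k * (p * t k * m powr (p - 1)))"
      unfolding S_def by (simp add: sum_distrib_left sum_distrib_right mult_ac)
    also have "\<dots> \<le> (\<Sum>k\<in>K. w k * (t k powr p + (p - 1) * m powr p))"
      using w t p m by (intro sum_mono mult_left_mono powr_tangent_le) auto
    also have "\<dots> = (\<Sum>k\<in>K. w k * t k powr p) + (p - 1) * m powr p * W"
      unfolding W_def by (simp add: distrib_left sum.distrib sum_distrib_right[symmetric] mult_ac)
    finally have *: "p * S * m powr (p - 1) - (p - 1) * m powr p * W \<le> (\<Sum>k\<in>K. w k * t k powr p)" by simp
    have mp: "m powr p = m * m powr (p - 1)" using m by (simp add: powr_mult_base)
    have "p * S * m powr (p - 1) - (p - 1) * m powr p * W = m powr p * W"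
      unfolding m(2) mp by (simp add: algebra_simps)
    then have "m powr p * W \<le> (\<Sum>k\<in>K. w k * t k powr p)" using * by simp
    then have "W powr (p - 1) * (m powr p * W) \<le> W powr (p - 1) * (\<Sum>k\<in>K. w k * t k powr p)"
      by (intro mult_left_mono) auto
    moreover have "W powr (p - 1) * (m powr p * W) = S powr p"
    proof -
      have "W powr p = W * W powr (p - 1)" using Wpos by (simp add: powr_mult_base)
      then show ?thesis unfolding m(2) using m(1) Wpos by (simp add: powr_mult)
    qed
    ultimately show ?thesis unfolding S_def W_def by simp
  qed
qed

section \<open>Volumes of balls, kernel sums over separated points, existence of lattices\<close>

lemma bergman_ball_borel [measurable]: "a \<in> tube \<Longrightarrow> 0 < r \<Longrightarrow> bergman_ball a r \<in> sets borel"
  by (rule borel_open[OF open_bergman_ball])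

text \<open>Invariance reduces the volume to the ball around \<open>base_point\<close>. It is finite
  there because the kernel is bounded below on the ball and has an integrable power, and positive
  because the ball is open and non-empty.\<close>

lemma emeasure_bergman_ball:
  fixes r \<alpha> :: real
  assumes r: "0 < r" and \<alpha>: "-1 < \<alpha>"
  shows "\<exists>c>0. \<forall>a \<in> (tube :: (complex ^ 'n::{finite,wellorder}) set).
    emeasure (wmeas \<alpha>) (bergman_ball a r) = ennreal (c * rho_diag a powr (real CARD('n) + 1 + \<alpha>))"
proof -
  define V where "V = emeasure (wmeas \<alpha>) (bergman_ball (base_point :: complex ^ 'n::_) r)"
  \<comment> \<open>Any exponent beyond the critical value \<open>n + 1 + \<alpha>\<close> serves
    here.\<close>
  define s where "s = real CARD('n) + 1 + \<alpha> + 1"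
  define M where "M = 24 * (cosh r)\<^sup>2"
  have M: "0 < M" by (simp add: M_def)
  have "V = (\<integral>\<^sup>+z. indicator (bergman_ball (base_point :: complex ^ 'n::_) r) z \<partial>wmeas \<alpha>)"
    unfolding V_def using r by simp
  also have "\<dots> \<le> (\<integral>\<^sup>+z. ennreal (M powr s) * ennreal (cmod (rho z base_point) powr (-s))
      \<partial>(wmeas \<alpha> :: (complex ^ 'n::_) measure))"
  proof (rule nn_integral_wmeas_mono)
    fix z :: "complex ^ 'n::_" assume z: "z \<in> tube"
    show "indicator (bergman_ball base_point r) z \<le> ennreal (M powr s)
        * ennreal (cmod (rho z base_point) powr (-s))"
    proof (cases "z \<in> bergman_ball base_point r")
      case True
      have "cmod (rho z base_point) \<le> M"
        using bergman_ball_cmod_rho_le[OF base_point_tube True r base_point_tube] cmod_rho_same[of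
            "base_point :: complex ^ 'n::_"]
        by (simp add: M_def cmod_rho_commute[of z])
      then have "M powr (-s) \<le> cmod (rho z base_point) powr (-s)"
        using cmod_rho_pos[OF z base_point_tube] \<alpha> by (intro powr_mono2') (auto simp: s_def)
      then have "M powr s * M powr (-s) \<le> M powr s * cmod (rho z base_point) powr (-s)"
        by (intro mult_left_mono) auto
      then have "1 \<le> M powr s * cmod (rho z base_point) powr (-s)"
        using M by (simp add: powr_add[symmetric])
      then have "ennreal 1 \<le> ennreal (M powr s * cmod (rho z base_point) powr (-s))" by (rule ennreal_leI)
      then show ?thesis using True by (simp add: ennreal_mult)
    qed simp
  qed
  also have "\<dots> = ennreal (M powr s) * (\<integral>\<^sup>+z. ennreal (cmod (rho z base_point) powr (-s))
      \<partial>(wmeas \<alpha> :: (complex ^ 'n::_) measure))"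
    by (rule nn_integral_cmult) measurable
  also have "\<dots> < \<infinity>"
    using forelli_rudin_base[OF \<alpha>, of s, where 'n = 'n] by (simp add: s_def ennreal_mult_less_top)
  finally have fin: "V < \<infinity>" .
  have pos: "V \<noteq> 0"
  proof
    assume "V = 0"
    then have "(\<integral>\<^sup>+z. ennreal (indicator tube z * rho_diag z powr \<alpha>)
        * indicator (bergman_ball (base_point :: complex ^ 'n::_) r) z \<partial>lborel) = 0"
      unfolding V_def wmeas_def using r by (simp add: emeasure_density)
    then have "AE z in lborel. ennreal (indicator tube z * rho_diag z powr \<alpha>)
        * indicator (bergman_ball (base_point :: complex ^ 'n::_) r) z = 0"
      using r by (subst (asm) nn_integral_0_iff_AE) auto
    then have "AE z in lborel. z \<notin> bergman_ball (base_point :: complex ^ 'n::_) r"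
    proof eventually_elim
      case (elim z)
      then show ?case using bergman_ball_subset_tube[of base_point r]
          by (auto simp: tube_iff indicator_def split: if_splits)
    qed
    then have "emeasure lborel (bergman_ball (base_point :: complex ^ 'n::_) r) = 0"
      using r by (subst (asm) AE_iff_measurable[OF _ refl]) auto
    then have "negligible (bergman_ball (base_point :: complex ^ 'n::_) r)"
      using r by (simp add: negligible_iff_null_sets null_sets_def)
    then show False
      using open_not_negligible[OF open_bergman_ball[OF base_point_tube r]] bergman_ball_self[OF
          base_point_tube r] by blast
  qed
  have V: "V = ennreal (enn2real V)" "0 < enn2real V"
    using fin pos by (auto simp: enn2real_positive_iff pos zero_less_iff_neq_zero)
  show ?thesis
  proof (intro exI[of _ "enn2real V"] conjI ballI V)
    fix a :: "complex ^ 'n::_" assume a: "a \<in> tube"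
    have "emeasure (wmeas \<alpha>) (bergman_ball a r) = (\<integral>\<^sup>+z. indicator (bergman_ball a r) z \<partial>wmeas \<alpha>)"
      using a r by simp
    also have "\<dots> = ennreal (rho_diag a powr (real CARD('n) + 1 + \<alpha>))
        * (\<integral>\<^sup>+z. indicator (bergman_ball a r) (aut a z) \<partial>wmeas \<alpha>)"
      using a r by (intro nn_integral_wmeas_aut) measurable
    also have "(\<lambda>z. indicator (bergman_ball a r) (aut a z) :: ennreal) = indicator (bergman_ball base_point r)"
      using bergman_ball_aut[OF a] by (auto simp: indicator_def fun_eq_iff)
    also have "ennreal (rho_diag a powr (real CARD('n) + 1 + \<alpha>))
        * (\<integral>\<^sup>+z. indicator (bergman_ball base_point r) z \<partial>(wmeas \<alpha> :: (complex ^ 'n::_) measure))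
       = ennreal (rho_diag a powr (real CARD('n) + 1 + \<alpha>)) * V"
      using r by (simp add: V_def)
    also have "\<dots> = ennreal (enn2real V * rho_diag a powr (real CARD('n) + 1 + \<alpha>))"
      by (subst V(1)) (simp add: ennreal_mult[symmetric] mult.commute)
    finally show "emeasure (wmeas \<alpha>) (bergman_ball a r) = ennreal (enn2real V
        * rho_diag a powr (real CARD('n) + 1 + \<alpha>))" .
  qed
qed

text \<open>A discrete Forelli--Rudin estimate: each term is at most a constant times the integral
  of the kernel over \<open>bergman_ball (a k) \<delta>\<close>, and as these balls are disjoint the
  integrals add up to at most the one over the whole domain.\<close>

lemma separated_sum_le:
  fixes a :: "nat \<Rightarrow> complex ^ 'n::{finite,wellorder}"
  assumes a: "\<And>k. a k \<in> tube" and \<delta>: "0 < \<delta>" and disj: "disjoint_family (\<lambda>k. bergman_ball (a k) \<delta>)"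
    and s: "real CARD('n) < s" "s < b"
  shows "\<exists>C\<ge>0. \<forall>z\<in>tube. \<forall>K. finite K \<longrightarrow>
     (\<Sum>k\<in>K. rho_diag (a k) powr s * cmod (rho z (a k)) powr (-b)) \<le> C * rho_diag z powr (s - b)"
proof -
  \<comment> \<open>With this weight the volume of \<open>bergman_ball (a k) \<delta>\<close> is a
    constant times \<open>rho_diag (a k) powr s\<close>.\<close>
  define \<alpha> where "\<alpha> = s - real CARD('n) - 1"
  have \<alpha>: "-1 < \<alpha>" "real CARD('n) + 1 + \<alpha> < b" "s = real CARD('n) + 1 + \<alpha>" using s by (auto simp: \<alpha>_def)
  obtain c where c: "0 < c" "\<And>a :: complex ^ 'n::_. a \<in> tube \<Longrightarrow>
      emeasure (wmeas \<alpha>) (bergman_ball a \<delta>) = ennreal (c * rho_diag a powr (real CARD('n) + 1 + \<alpha>))"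
    using emeasure_bergman_ball[OF \<delta> \<alpha>(1), where 'n = 'n] by blast
  obtain C where C: "0 \<le> C" "\<And>z :: complex ^ 'n::_. z \<in> tube \<Longrightarrow>
      (\<integral>\<^sup>+w. ennreal (cmod (rho w z) powr (-b)) \<partial>wmeas \<alpha>) = ennreal (C * rho_diag z powr (real CARD('n) + 1
          + \<alpha> - b))"
    using forelli_rudin[OF \<alpha>(1,2)] by blast
  define M where "M = 24 * (cosh \<delta>)\<^sup>2"
  have M: "0 < M" by (simp add: M_def)
  have bpos: "0 < b" using s by (meson le_less_trans less_trans of_nat_0_le_iff)
  show ?thesis
  proof (intro exI[of _ "M powr b * C / c"] conjI ballI allI impI)
    fix z :: "complex ^ 'n::_" and K :: "nat set" assume z: "z \<in> tube" and K: "finite K"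
    define f where "f w = ennreal (M powr b) * ennreal (cmod (rho w z) powr (-b))" for w
    have [measurable]: "f \<in> borel_measurable borel" unfolding f_def by measurable
    have tm: "ennreal (c * (rho_diag (a k) powr s * cmod (rho z (a k)) powr (-b)))
        \<le> (\<integral>\<^sup>+w. f w * indicator (bergman_ball (a k) \<delta>) w \<partial>wmeas \<alpha>)" for k
    proof -
      have "ennreal (c * (rho_diag (a k) powr s * cmod (rho z (a k)) powr (-b))) =
          ennreal (cmod (rho z (a k)) powr (-b)) * emeasure (wmeas \<alpha>) (bergman_ball (a k) \<delta>)"
        using c a \<alpha>(3) by (simp add: ennreal_mult[symmetric] mult_ac)
      also have "\<dots> = (\<integral>\<^sup>+w. ennreal (cmod (rho z (a k)) powr (-b)) * indicator (bergman_ball (a k) \<delta>) w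
          \<partial>wmeas \<alpha>)"
        using a \<delta> by (subst nn_integral_cmult_indicator) auto
      also have "\<dots> \<le> (\<integral>\<^sup>+w. f w * indicator (bergman_ball (a k) \<delta>) w \<partial>wmeas \<alpha>)"
      proof (rule nn_integral_wmeas_mono)
        fix w :: "complex ^ 'n::_" assume w: "w \<in> tube"
        show "ennreal (cmod (rho z (a k)) powr (-b)) * indicator (bergman_ball (a k) \<delta>) w
            \<le> f w * indicator (bergman_ball (a k) \<delta>) w"
        proof (cases "w \<in> bergman_ball (a k) \<delta>")
          case True
          have "cmod (rho w z) \<le> M * cmod (rho z (a k))"
            using bergman_ball_cmod_rho_le[OF a True \<delta> z] by (simp add: M_def cmod_rho_commute[of w z])
          then have "(M * cmod (rho z (a k))) powr (-b) \<le> cmod (rho w z) powr (-b)"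
            using cmod_rho_pos[OF w z] bpos by (intro powr_mono2') auto
          then have "M powr b * (M powr (-b) * cmod (rho z (a k)) powr (-b))
              \<le> M powr b * cmod (rho w z) powr (-b)"
            using M by (intro mult_left_mono) (auto simp: powr_mult)
          then have "cmod (rho z (a k)) powr (-b) \<le> M powr b * cmod (rho w z) powr (-b)"
            using M by (simp add: mult.assoc[symmetric] powr_add[symmetric])
          then show ?thesis using True by (simp add: f_def ennreal_mult[symmetric] ennreal_leI)
        qed simp
      qed
      finally show ?thesis .
    qed
    have "ennreal (c * (\<Sum>k\<in>K. rho_diag (a k) powr s * cmod (rho z (a k)) powr (-b))) =
        (\<Sum>k\<in>K. ennreal (c * (rho_diag (a k) powr s * cmod (rho z (a k)) powr (-b))))"
      using c by (subst sum_ennreal) (auto simp: sum_distrib_left)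
    also have "\<dots> \<le> (\<Sum>k\<in>K. \<integral>\<^sup>+w. f w * indicator (bergman_ball (a k) \<delta>) w \<partial>wmeas \<alpha>)"
      by (intro sum_mono tm)
    also have "\<dots> = (\<integral>\<^sup>+w. (\<Sum>k\<in>K. f w * indicator (bergman_ball (a k) \<delta>) w) \<partial>wmeas \<alpha>)"
      using a \<delta> by (intro nn_integral_sum[symmetric]) measurable
    also have "\<dots> \<le> (\<integral>\<^sup>+w. f w \<partial>wmeas \<alpha>)"
    proof (rule nn_integral_mono)
      fix w
      have "(\<Sum>k\<in>K. f w * indicator (bergman_ball (a k) \<delta>) w) = f w * indicator (\<Union>k\<in>K. bergman_ball (a k) \<delta>) w"
        using K disj by (simp add: sum_distrib_left[symmetric] indicator_UN_disjoint
            disjoint_family_on_mono[of K UNIV])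
      also have "\<dots> \<le> f w" by (simp add: indicator_def)
      finally show "(\<Sum>k\<in>K. f w * indicator (bergman_ball (a k) \<delta>) w) \<le> f w" .
    qed
    also have "\<dots> = ennreal (M powr b) * ennreal (C * rho_diag z powr (real CARD('n) + 1 + \<alpha> - b))"
      unfolding f_def by (subst nn_integral_cmult) (auto simp: C(2)[OF z])
    also have "\<dots> = ennreal (M powr b * C * rho_diag z powr (s - b))"
      using C(1) by (simp add: ennreal_mult[symmetric] \<alpha>(3) mult.assoc)
    finally have "c * (\<Sum>k\<in>K. rho_diag (a k) powr s * cmod (rho z (a k)) powr (-b))
        \<le> M powr b * C * rho_diag z powr (s - b)"
      using C(1) by (simp add: ennreal_le_iff)
    then show "(\<Sum>k\<in>K. rho_diag (a k) powr s * cmod (rho z (a k)) powr (-b))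
        \<le> M powr b * C / c * rho_diag z powr (s - b)"
      using c(1) by (simp add: field_simps)
  qed (use C c M in auto)
qed

text \<open>For \<open>p \<ge> 1\<close> the sum is split by Jensen's inequality with weights \<open>rho_diag (a k) powr s\<close> times
  the kernel; \<open>d = b - s\<close> has to be chosen so that both resulting integrals converge, and the
  hypothesis on \<open>b\<close> says that such a \<open>d\<close> exists.\<close>

lemma separated_Lp_bound:
  fixes a :: "nat \<Rightarrow> complex ^ 'n::{finite,wellorder}"
  assumes a: "\<And>k. a k \<in> tube" and \<delta>: "0 < \<delta>" and disj: "disjoint_family (\<lambda>k. bergman_ball (a k) \<delta>)"
    and p: "0 < p" and \<alpha>: "-1 < \<alpha>" and b: "real CARD('n) * max 1 (1 / p) + (1 + \<alpha>) / p < b"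
  shows "\<exists>C\<ge>0. \<forall>K c. finite K \<longrightarrow> (\<forall>k. 0 \<le> c k) \<longrightarrow>
     (\<integral>\<^sup>+z. ennreal ((\<Sum>k\<in>K. c k * rho_diag (a k) powr (b - (real CARD('n) + 1 + \<alpha>) / p)
         * cmod (rho z (a k)) powr (-b)) powr p) \<partial>wmeas \<alpha>)
       \<le> ennreal (C * (\<Sum>k\<in>K. c k powr p))"
proof -
  let ?N = "real CARD('n)"
  have Npos: "1 \<le> ?N" by (simp add: Suc_leI)
  have R: "0 < rho_diag (a k)" for k using a by (simp add: tube_iff)
  show ?thesis
  proof (cases "p \<le> 1")
    case True
    \<comment> \<open>For \<open>p \<le> 1\<close> the power may be moved inside the sum, each
      kernel is integrated separately, and separation of the points plays no part.\<close>
    have "max 1 (1 / p) = 1 / p" using True p by (simp add: max_def)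
    then have "?N * (1 / p) + (1 + \<alpha>) / p < b" using b by simp
    then have "(?N + 1 + \<alpha>) / p < b" by (simp add: add_divide_distrib)
    then have bp: "?N + 1 + \<alpha> < b * p" using p by (simp add: pos_divide_less_eq)
    obtain C where C: "0 \<le> C" "\<And>a :: complex ^ 'n::_. a \<in> tube \<Longrightarrow>
       (\<integral>\<^sup>+z. ennreal (cmod (rho z a) powr (-(b * p))) \<partial>wmeas \<alpha>)
           = ennreal (C * rho_diag a powr (?N + 1 + \<alpha> - b * p))"
      using forelli_rudin[OF \<alpha> bp] by blast
    show ?thesis
    proof (intro exI[of _ C] conjI allI impI C)
      fix K :: "nat set" and c :: "nat \<Rightarrow> real" assume K: "finite K" and c: "\<forall>k. 0 \<le> c k"
      have "(\<integral>\<^sup>+z. ennreal ((\<Sum>k\<in>K. c k * rho_diag (a k) powr (b - (?N + 1 + \<alpha>) / p)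
          * cmod (rho z (a k)) powr (-b)) powr p) \<partial>wmeas \<alpha>)
        \<le> (\<integral>\<^sup>+z. (\<Sum>k\<in>K. ennreal (c k powr p * rho_diag (a k) powr (b * p - (?N + 1 + \<alpha>)))
            * ennreal (cmod (rho z (a k)) powr (-(b * p)))) \<partial>wmeas \<alpha>)"
      proof (rule nn_integral_mono)
        fix z
        have "(\<Sum>k\<in>K. c k * rho_diag (a k) powr (b - (?N + 1 + \<alpha>) / p) * cmod (rho z (a k)) powr (-b)) powr p \<le>
           (\<Sum>k\<in>K. (c k * rho_diag (a k) powr (b - (?N + 1 + \<alpha>) / p) * cmod (rho z (a k)) powr (-b)) powr p)"
          using K c p True by (intro powr_sum_le) auto
        also have "\<dots> = (\<Sum>k\<in>K. c k powr p * rho_diag (a k) powr (b * p - (?N + 1 + \<alpha>))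
            * cmod (rho z (a k)) powr (-(b * p)))"
          using c p by (intro sum.cong refl) (simp add: powr_mult powr_powr left_diff_distrib)
        finally show "ennreal ((\<Sum>k\<in>K. c k * rho_diag (a k) powr (b - (?N + 1 + \<alpha>) / p)
            * cmod (rho z (a k)) powr (-b)) powr p)
          \<le> (\<Sum>k\<in>K. ennreal (c k powr p * rho_diag (a k) powr (b * p - (?N + 1 + \<alpha>)))
              * ennreal (cmod (rho z (a k)) powr (-(b * p))))"
          by (simp add: ennreal_mult[symmetric] ennreal_leI sum_ennreal)
      qed
      also have "\<dots> = (\<Sum>k\<in>K. ennreal (c k powr p * rho_diag (a k) powr (b * p - (?N + 1 + \<alpha>))) * ennreal (C
          * rho_diag (a k) powr (?N + 1 + \<alpha> - b * p)))"
        by (subst nn_integral_sum) (auto simp: nn_integral_cmult C(2)[OF a])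
      also have "\<dots> = (\<Sum>k\<in>K. ennreal (C * c k powr p))"
      proof (intro sum.cong refl)
        fix k
        have "rho_diag (a k) powr (b * p - (?N + 1 + \<alpha>)) * rho_diag (a k) powr (?N + 1 + \<alpha> - b * p) = 1"
          using R[of k] by (simp add: powr_add[symmetric])
        then have "c k powr p * rho_diag (a k) powr (b * p - (?N + 1 + \<alpha>)) * (C * rho_diag (a k) powr (?N
            + 1 + \<alpha> - b * p)) = C * c k powr p"
          by (simp add: mult_ac)
        then show "ennreal (c k powr p * rho_diag (a k) powr (b * p - (?N + 1 + \<alpha>))) * ennreal (C
            * rho_diag (a k) powr (?N + 1 + \<alpha> - b * p)) = ennreal (C * c k powr p)"
          using C(1) by (simp add: ennreal_mult[symmetric])
      qed
      also have "\<dots> = ennreal (C * (\<Sum>k\<in>K. c k powr p))"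
        using C(1) by (subst sum_ennreal) (auto simp: sum_distrib_left)
      finally show "(\<integral>\<^sup>+z. ennreal ((\<Sum>k\<in>K. c k * rho_diag (a k) powr (b - (?N + 1 + \<alpha>) / p)
          * cmod (rho z (a k)) powr (-b)) powr p) \<partial>wmeas \<alpha>)
         \<le> ennreal (C * (\<Sum>k\<in>K. c k powr p))" .
    qed
  next
    case False
    then have p1: "1 < p" by simp
    have "max 1 (1 / p) = 1" using p1 by (simp add: max_def field_simps)
    then have b': "?N + (1 + \<alpha>) / p < b" using b by simp
    have bN: "?N < b" using b' divide_pos_pos[of "1 + \<alpha>" p] \<alpha> p by linarith
    \<comment> \<open>The bounds \<open>0 < d\<close> and \<open>d < b - n\<close> give
      \<open>n < s < b\<close>, as \<open>separated_sum_le\<close> requires. The other two are the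
      conditions of \<open>forelli_rudin\<close> for the kernel exponent \<open>b\<close> and the
      weight \<open>\<alpha> + \<beta>\<close> defined below.\<close>
    have "\<exists>d. max 0 ((?N + 1 + \<alpha> - b) / (p - 1)) < d \<and> d < min (b - ?N) ((1 + \<alpha>) / (p - 1))"
    proof (rule dense)
      have "(1 + \<alpha>) / p < b - ?N" using b' by simp
      then have "1 + \<alpha> < (b - ?N) * p" using p by (simp add: pos_divide_less_eq)
      then have "?N + 1 + \<alpha> - b < (b - ?N) * (p - 1)" by (simp add: algebra_simps)
      moreover have "?N + 1 + \<alpha> - b < 1 + \<alpha>" using bN by simp
      ultimately show "max 0 ((?N + 1 + \<alpha> - b) / (p - 1)) < min (b - ?N) ((1 + \<alpha>) / (p - 1))"
        using p1 bN \<alpha> by (simp add: pos_divide_less_eq divide_strict_right_mono)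
    qed
    then obtain d where d: "0 < d" "(?N + 1 + \<alpha> - b) / (p - 1) < d" "d < b - ?N" "d < (1 + \<alpha>) / (p - 1)" by auto
    define s where "s = b - d"
    have s: "?N < s" "s < b" using d by (auto simp: s_def)
    \<comment> \<open>The power of \<open>rho_diag z\<close> left behind by the factor
      \<open>(\<Sum>k\<in>K. w k) powr (p - 1)\<close> in Jensen's inequality.\<close>
    define \<beta> where "\<beta> = -d * (p - 1)"
    have \<beta>: "-1 < \<alpha> + \<beta>" "?N + 1 + (\<alpha> + \<beta>) < b"
      using d p1 by (auto simp: \<beta>_def pos_divide_less_eq pos_less_divide_eq)
    obtain C1 where C1: "0 \<le> C1" "\<And>z K. z \<in> tube \<Longrightarrow> finite K \<Longrightarrow>
      (\<Sum>k\<in>K. rho_diag (a k) powr s * cmod (rho z (a k)) powr (-b)) \<le> C1 * rho_diag z powr (s - b)"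
      using separated_sum_le[OF a \<delta> disj s] by blast
    obtain C2 where C2: "0 \<le> C2" "\<And>a :: complex ^ 'n::_. a \<in> tube \<Longrightarrow>
       (\<integral>\<^sup>+z. ennreal (cmod (rho z a) powr (-b)) \<partial>wmeas (\<alpha> + \<beta>))
           = ennreal (C2 * rho_diag a powr (?N + 1 + (\<alpha> + \<beta>) - b))"
      using forelli_rudin[OF \<beta>] by blast
    show ?thesis
    proof (intro exI[of _ "C1 powr (p - 1) * C2"] conjI allI impI)
      fix K :: "nat set" and c :: "nat \<Rightarrow> real" assume K: "finite K" and c: "\<forall>k. 0 \<le> c k"
      \<comment> \<open>\<open>e\<close> collects the powers of \<open>rho_diag (a k)\<close>. The
        integral of the kernel against the shifted weight yields exactly the power
        \<open>-e\<close>, so that only \<open>c k powr p\<close> remains.\<close>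
      define e where "e = s + (b - (?N + 1 + \<alpha>) / p - s) * p"
      have "(\<integral>\<^sup>+z. ennreal ((\<Sum>k\<in>K. c k * rho_diag (a k) powr (b - (?N + 1 + \<alpha>) / p)
          * cmod (rho z (a k)) powr (-b)) powr p) \<partial>wmeas \<alpha>)
        \<le> (\<integral>\<^sup>+z. ennreal (rho_diag z powr \<beta>) * (\<Sum>k\<in>K. ennreal (C1 powr (p - 1) * c k powr p
            * rho_diag (a k) powr e) * ennreal (cmod (rho z (a k)) powr (-b))) \<partial>wmeas \<alpha>)"
      proof (rule nn_integral_wmeas_mono)
        fix z :: "complex ^ 'n::_" assume z: "z \<in> tube"
        define w where "w k = rho_diag (a k) powr s * cmod (rho z (a k)) powr (-b)" for k
        define t where "t k = c k * rho_diag (a k) powr (b - (?N + 1 + \<alpha>) / p - s)" for k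
        have wt: "0 \<le> w k" "0 \<le> t k" for k using c by (auto simp: w_def t_def)
        have "(\<Sum>k\<in>K. c k * rho_diag (a k) powr (b - (?N + 1 + \<alpha>) / p) * cmod (rho z (a k)) powr (-b))
            = (\<Sum>k\<in>K. w k * t k)"
        proof (intro sum.cong refl)
          fix k
          have "rho_diag (a k) powr s * rho_diag (a k) powr (b - (?N + 1 + \<alpha>) / p - s)
              = rho_diag (a k) powr (b - (?N + 1 + \<alpha>) / p)"
            by (simp add: powr_add[symmetric])
          then show "c k * rho_diag (a k) powr (b - (?N + 1 + \<alpha>) / p) * cmod (rho z (a k)) powr (-b)
              = w k * t k"
            by (simp add: w_def t_def mult_ac)
        qed
        also have "(\<Sum>k\<in>K. w k * t k) powr p \<le> (\<Sum>k\<in>K. w k) powr (p - 1) * (\<Sum>k\<in>K. w k * t k powr p)"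
          using K wt p1 by (intro powr_weighted_sum_le) auto
        also have "\<dots> \<le> (C1 * rho_diag z powr (s - b)) powr (p - 1) * (\<Sum>k\<in>K. w k * t k powr p)"
          using C1(2)[OF z K] wt p1 by (intro mult_right_mono powr_mono2) (auto simp: w_def intro!: sum_nonneg)
        also have "\<dots> = rho_diag z powr \<beta> * (\<Sum>k\<in>K. C1 powr (p - 1) * c k powr p * rho_diag (a k) powr e
            * cmod (rho z (a k)) powr (-b))"
        proof -
          have 1: "(C1 * rho_diag z powr (s - b)) powr (p - 1) = C1 powr (p - 1) * rho_diag z powr \<beta>"
            using C1(1) by (simp add: powr_mult powr_powr s_def \<beta>_def)
          have 2: "w k * t k powr p = c k powr p * rho_diag (a k) powr e * cmod (rho z (a k)) powr (-b)" for k
          proof -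
            have "rho_diag (a k) powr s * rho_diag (a k) powr ((b - (?N + 1 + \<alpha>) / p - s) * p)
                = rho_diag (a k) powr e"
              by (simp add: powr_add[symmetric] e_def)
            then show ?thesis using c by (simp add: w_def t_def powr_mult powr_powr mult_ac)
          qed
          show ?thesis unfolding 1 2 by (simp add: sum_distrib_left mult_ac)
        qed
        finally show "ennreal ((\<Sum>k\<in>K. c k * rho_diag (a k) powr (b - (?N + 1 + \<alpha>) / p)
            * cmod (rho z (a k)) powr (-b)) powr p)
          \<le> ennreal (rho_diag z powr \<beta>) * (\<Sum>k\<in>K. ennreal (C1 powr (p - 1) * c k powr p
              * rho_diag (a k) powr e) * ennreal (cmod (rho z (a k)) powr (-b)))"
          by (simp add: ennreal_mult[symmetric] ennreal_leI sum_ennreal sum_nonneg)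
      qed
      also have "\<dots> = (\<integral>\<^sup>+z. (\<Sum>k\<in>K. ennreal (C1 powr (p - 1) * c k powr p * rho_diag (a k) powr e)
          * ennreal (cmod (rho z (a k)) powr (-b))) \<partial>wmeas (\<alpha> + \<beta>))"
        by (rule nn_integral_wmeas_shift_weight) measurable
      also have "\<dots> = (\<Sum>k\<in>K. ennreal (C1 powr (p - 1) * c k powr p * rho_diag (a k) powr e) * ennreal (C2
          * rho_diag (a k) powr (?N + 1 + (\<alpha> + \<beta>) - b)))"
        by (subst nn_integral_sum) (auto simp: nn_integral_cmult C2(2)[OF a])
      also have "\<dots> = (\<Sum>k\<in>K. ennreal (C1 powr (p - 1) * C2 * c k powr p))"
      proof (intro sum.cong refl)
        fix k
        define u where "u = (?N + 1 + \<alpha>) / p"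
        have "u * p = ?N + 1 + \<alpha>" using p by (simp add: u_def)
        then have up: "?N + 1 + (\<alpha> + \<beta>) - b = u * p + \<beta> - b" by linarith
        have "e + (u * p + \<beta> - b) = 0"
          unfolding e_def u_def[symmetric] s_def \<beta>_def by (simp add: algebra_simps)
        then have "e + (?N + 1 + (\<alpha> + \<beta>) - b) = 0" unfolding up .
        then have "rho_diag (a k) powr e * rho_diag (a k) powr (?N + 1 + (\<alpha> + \<beta>) - b) = 1"
          using R[of k] by (simp only: powr_add[symmetric]) simp
        then have "C1 powr (p - 1) * c k powr p * rho_diag (a k) powr e * (C2 * rho_diag (a k) powr (?N + 1
            + (\<alpha> + \<beta>) - b)) = C1 powr (p - 1) * C2 * c k powr p"
          by (simp add: mult_ac)
        then show "ennreal (C1 powr (p - 1) * c k powr p * rho_diag (a k) powr e) * ennreal (C2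
            * rho_diag (a k) powr (?N + 1 + (\<alpha> + \<beta>) - b)) = ennreal (C1 powr (p - 1) * C2 * c k powr p)"
          using C2(1) by (simp add: ennreal_mult[symmetric])
      qed
      also have "\<dots> = ennreal (C1 powr (p - 1) * C2 * (\<Sum>k\<in>K. c k powr p))"
        using C2(1) by (subst sum_ennreal) (auto simp: sum_distrib_left)
      finally show "(\<integral>\<^sup>+z. ennreal ((\<Sum>k\<in>K. c k * rho_diag (a k) powr (b - (?N + 1 + \<alpha>) / p)
          * cmod (rho z (a k)) powr (-b)) powr p) \<partial>wmeas \<alpha>)
         \<le> ennreal (C1 powr (p - 1) * C2 * (\<Sum>k\<in>K. c k powr p))" .
    qed (use C2 in auto)
  qed
qed

text \<open>Counting by volume: if \<open>z\<close> lies in \<open>bergman_ball (a k) R\<close>,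
  then the disjoint small ball around \<open>a k\<close> lies in \<open>bergman_ball z R'\<close>
  and occupies at least a fixed fraction of its volume. The radius is arbitrary, since the mean
  value estimates use balls larger than those in the definition of a lattice.\<close>

lemma separated_overlap:
  fixes a :: "'i \<Rightarrow> complex ^ 'n::{finite,wellorder}"
  assumes a: "\<And>k. k \<in> I \<Longrightarrow> a k \<in> tube" and \<delta>: "0 < \<delta>"
    and disj: "disjoint_family_on (\<lambda>k. bergman_ball (a k) \<delta>) I" and R: "0 < R"
  shows "\<exists>M::nat. \<forall>z\<in>tube. finite {k\<in>I. z \<in> bergman_ball (a k) R} \<and> card {k\<in>I. z \<in> bergman_ball (a k) R} \<le> M"
proof -
  define r0 where "r0 = max R \<delta>"
  have r0: "0 < r0" using R by (simp add: r0_def)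
  obtain R' where R': "0 < R'" "12 * (cosh r0)\<^sup>2 \<le> cosh R'" using cosh_unbounded by blast
  obtain c where c: "0 < c" "\<And>a :: complex ^ 'n::_. a \<in> tube \<Longrightarrow>
      emeasure (wmeas 0) (bergman_ball a \<delta>) = ennreal (c * rho_diag a powr (real CARD('n) + 1 + 0))"
    using emeasure_bergman_ball[OF \<delta>, of 0, where 'n = 'n] by auto
  obtain C where C: "0 < C" "\<And>a :: complex ^ 'n::_. a \<in> tube \<Longrightarrow>
      emeasure (wmeas 0) (bergman_ball a R') = ennreal (C * rho_diag a powr (real CARD('n) + 1 + 0))"
    using emeasure_bergman_ball[OF R'(1), of 0, where 'n = 'n] by auto
  define m where "m = real CARD('n) + 1 + 0"
  have m: "0 < m" by (simp add: m_def add_nonneg_pos)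
  define q where "q = 4 * (cosh R)\<^sup>2"
  have q: "0 < q" by (simp add: q_def)
  define M where "M = C / c * q powr m"
  have fin: "real (card K) \<le> M" if K: "finite K" "K \<subseteq> {k\<in>I. z \<in> bergman_ball (a k) R}" and z: "z \<in> tube" for K z
  proof -
    have zpos: "0 < rho_diag z" using z by (simp add: tube_iff)
    have KI: "K \<subseteq> I" using K by auto
    have sub: "bergman_ball (a k) \<delta> \<subseteq> bergman_ball z R'" if "k \<in> K" for k
    proof
      fix w assume "w \<in> bergman_ball (a k) \<delta>"
      then have "w \<in> bergman_ball (a k) r0" using bergman_ball_mono[of \<delta> r0] by (auto simp: r0_def)
      moreover have "a k \<in> bergman_ball z r0"
        using K that a bergman_ball_commute[of "a k" z R] bergman_ball_mono[of R r0 z] by (auto simp: r0_def)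
      ultimately show "w \<in> bergman_ball z R'" using bergman_ball_trans[OF z _ _ r0 R'] by blast
    qed
    have low: "c * (rho_diag z / q) powr m \<le> c * rho_diag (a k) powr m" if "k \<in> K" for k
    proof -
      have "rho_diag z \<le> q * rho_diag (a k)"
        unfolding q_def by (rule bergman_ball_rho_diag_le) (use K that a R in auto)
      then have "rho_diag z / q \<le> rho_diag (a k)" using q by (simp add: field_simps)
      then show ?thesis using c q zpos m by (intro mult_left_mono powr_mono2) auto
    qed
    have "ennreal (real (card K) * (c * (rho_diag z / q) powr m))
        = (\<Sum>k\<in>K. ennreal (c * (rho_diag z / q) powr m))"
      using c by (subst sum_ennreal) auto
    also have "\<dots> \<le> (\<Sum>k\<in>K. emeasure (wmeas 0) (bergman_ball (a k) \<delta>))"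
      using c low K KI a by (intro sum_mono) (auto simp: m_def intro!: ennreal_leI)
    also have "\<dots> = emeasure (wmeas 0) (\<Union>k\<in>K. bergman_ball (a k) \<delta>)"
      using K KI a \<delta> disj by (intro sum_emeasure) (auto intro: disjoint_family_on_mono)
    also have "\<dots> \<le> emeasure (wmeas 0) (bergman_ball z R')"
      using sub z R' by (intro emeasure_mono) auto
    also have "\<dots> = ennreal (C * rho_diag z powr m)" using C z by (simp add: m_def)
    finally have "real (card K) * (c * (rho_diag z / q) powr m) \<le> C * rho_diag z powr m"
      using C by (simp add: ennreal_le_iff)
    then have "(real (card K) * c) * rho_diag z powr m \<le> (C * q powr m) * rho_diag z powr m"
      using q zpos by (simp add: powr_divide field_simps)
    then have "real (card K) * c \<le> C * q powr m"
      using zpos by (simp add: mult_le_cancel_right)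
    then show ?thesis using c by (simp add: M_def field_simps)
  qed
  show ?thesis
  proof (intro exI[of _ "nat \<lceil>M\<rceil>"] ballI)
    fix z :: "complex ^ 'n::_" assume z: "z \<in> tube"
    let ?A = "{k\<in>I. z \<in> bergman_ball (a k) R}"
    have f: "finite ?A"
    proof (rule ccontr)
      assume "infinite ?A"
      then obtain B where B: "finite B" "card B = Suc (nat \<lceil>M\<rceil>)" "B \<subseteq> ?A" using infinite_arbitrarily_large
          by blast
      then have "real (Suc (nat \<lceil>M\<rceil>)) \<le> M" using fin[OF B(1,3) z] by simp
      then show False using real_nat_ceiling_ge[of M] by linarith
    qed
    moreover have "card ?A \<le> nat \<lceil>M\<rceil>" using fin[OF f subset_refl z] real_nat_ceiling_ge[of M] by linarith
    ultimately show "finite ?A \<and> card ?A \<le> nat \<lceil>M\<rceil>" by simp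
  qed
qed

text \<open>Zorn's lemma gives a maximal set of centres with disjoint balls of radius
  \<open>r / 4\<close>. By maximality every such ball meets one of them, and
  \<open>bergman_ball_trans\<close> turns this into a cover by balls of radius \<open>r\<close>.
  This works for large radii only, where \<open>cosh r\<close> beats
  \<open>12 (cosh (r / 4))^2\<close>; one radius is all that is required.\<close>

lemma lattice_exists:
  "\<exists>r>0. \<exists>a :: nat \<Rightarrow> complex ^ 'n::{finite,wellorder}. is_lattice r a"
proof -
  \<comment> \<open>With \<open>u = (cosh x)^2\<close> the double angle formula gives
    \<open>cosh (4 x) = 2 (2 u - 1)^2 - 1\<close>, which is at least \<open>12 u\<close> once
    \<open>4 \<le> u\<close>.\<close>
  obtain x :: real where x: "0 < x" "2 \<le> cosh x" using cosh_unbounded by blast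
  define r where "r = 4 * x"
  have r: "0 < r" "0 < r / 4" using x by (auto simp: r_def)
  have ch: "12 * (cosh (r / 4))\<^sup>2 \<le> cosh r"
  proof -
    define u where "u = (cosh x)\<^sup>2"
    have u: "4 \<le> u" unfolding u_def using power_mono[OF x(2), of 2] by simp
    have dbl: "cosh (2 * y) = 2 * (cosh y)\<^sup>2 - 1" for y :: real
      using cosh_double[of y] cosh_square_eq[of y] by simp
    have "cosh r = 2 * (2 * u - 1)\<^sup>2 - 1"
      using dbl[of "2 * x"] dbl[of x] by (simp add: r_def u_def)
    moreover have "12 * u \<le> 2 * (2 * u - 1)\<^sup>2 - 1"
    proof -
      have "2 * (2 * u - 1)\<^sup>2 - 1 = 8 * (u * u) - 8 * u + 1" by (simp add: power2_eq_square algebra_simps)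
      moreover have "4 * u \<le> u * u" using u by (intro mult_right_mono) auto
      ultimately show ?thesis using u by linarith
    qed
    ultimately show ?thesis by (simp add: r_def u_def)
  qed
  define D where "D a = bergman_ball (a :: complex ^ 'n::_) (r / 4)" for a
  define \<A> where "\<A> = {A :: (complex ^ 'n::_) set. A \<subseteq> tube \<and> pairwise (\<lambda>a b. disjnt (D a) (D b)) A}"
  have "\<exists>M\<in>\<A>. \<forall>X\<in>\<A>. M \<subseteq> X \<longrightarrow> X = M"
  proof (rule subset_Zorn')
    fix \<C> assume C: "subset.chain \<A> \<C>"
    then have "\<C> \<subseteq> \<A>" "chain\<^sub>\<subseteq> \<C>" by (auto simp: subset.chain_def chain_subset_def)
    then show "\<Union>\<C> \<in> \<A>"
      using pairwise_chain_Union[of \<C> "\<lambda>a b. disjnt (D a) (D b)"] by (auto simp: \<A>_def)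
  qed
  then obtain A where A: "A \<subseteq> tube" "pairwise (\<lambda>a b. disjnt (D a) (D b)) A"
    and max: "\<And>X. X \<in> \<A> \<Longrightarrow> A \<subseteq> X \<Longrightarrow> X = A" by (auto simp: \<A>_def)
  have cover: "\<exists>a\<in>A. z \<in> bergman_ball a r" if z: "z \<in> tube" for z
  proof -
    have "\<exists>a\<in>A. \<not> disjnt (D a) (D z)"
    proof (rule ccontr)
      assume n: "\<not> (\<exists>a\<in>A. \<not> disjnt (D a) (D z))"
      then have "insert z A \<in> \<A>" using A z by (auto simp: \<A>_def pairwise_insert disjnt_sym)
      then have "z \<in> A" using max[of "insert z A"] by auto
      then have "disjnt (D z) (D z)" using n by blast
      then show False using bergman_ball_self[OF z r(2)] by (auto simp: D_def disjnt_def)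
    qed
    then obtain a v where a: "a \<in> A" "v \<in> bergman_ball a (r / 4)" "v \<in> bergman_ball z (r / 4)"
      by (auto simp: D_def disjnt_def)
    then have "z \<in> bergman_ball v (r / 4)" using z bergman_ball_commute by blast
    then have "z \<in> bergman_ball a r" using bergman_ball_trans[OF _ a(2) _ r(2) r(1) ch] a A by blast
    then show ?thesis using a by blast
  qed
  have Dne: "a \<in> D a" if "a \<in> A" for a using bergman_ball_self[of a "r / 4"] that A r by (auto simp: D_def)
  have injD: "inj_on D A"
    using A(2) Dne unfolding inj_on_def pairwise_def disjnt_def by blast
  have "countable (D ` A)"
  proof (rule countable_disjoint_open_subsets)
    show "pairwise disjnt (D ` A)" using A(2) by (auto simp: pairwise_def)
    show "open S" if "S \<in> D ` A" for S using that A(1) open_bergman_ball[OF _ r(2)] unfolding D_def by blast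
  qed
  then have cA: "countable A" using injD countable_image_inj_on by blast
  \<comment> \<open>A lattice is an injective sequence, so the set has to be infinite to be
    enumerated: finitely many balls reach only a bounded height, while \<open>rho_diag\<close> is
    unbounded on the domain.\<close>
  have iA: "infinite A"
  proof
    assume f: "finite A"
    have "A \<noteq> {}" using cover[OF base_point_tube] by auto
    define B where "B = Max (rho_diag ` A)"
    have B: "rho_diag a \<le> B" if "a \<in> A" for a using f that by (simp add: B_def)
    define t where "t = 4 * (cosh r)\<^sup>2 * \<bar>B\<bar> + 1"
    have t: "0 < t" by (simp add: t_def add_nonneg_pos)
    define z :: "complex ^ 'n::_" where "z = axis last_ix (\<i> * of_real t)"
    have rz: "rho_diag z = t" by (simp add: z_def rho_diag_eq axis_def)
    then have "z \<in> tube" using t by (simp add: tube_iff)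
    then obtain a where a: "a \<in> A" "z \<in> bergman_ball a r" using cover by blast
    then have "t \<le> 4 * (cosh r)\<^sup>2 * rho_diag a"
      using bergman_ball_rho_diag_le[of a z r] A r rz by auto
    also have "\<dots> \<le> 4 * (cosh r)\<^sup>2 * \<bar>B\<bar>" using B[OF a(1)] by (intro mult_left_mono) auto
    finally show False by (simp add: t_def)
  qed
  define a where "a = from_nat_into A"
  have bij: "bij_betw a UNIV A" unfolding a_def using cA iA by (rule bij_betw_from_nat_into)
  then have rng: "range a = A" and inj: "inj a" by (auto simp: bij_betw_def)
  have disj: "disjoint_family (\<lambda>k. bergman_ball (a k) (r / 4))"
    unfolding disjoint_family_on_def
  proof (intro ballI impI)
    fix j k :: nat assume "j \<noteq> k"
    then have "a j \<noteq> a k" "a j \<in> A" "a k \<in> A" using inj rng by (auto simp: inj_def)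
    then show "bergman_ball (a j) (r / 4) \<inter> bergman_ball (a k) (r / 4) = {}"
      using A(2) by (auto simp: pairwise_def disjnt_def D_def)
  qed
  have at: "a k \<in> tube" for k using rng A by blast
  obtain M :: nat where M: "\<forall>z\<in>tube. finite {k. z \<in> bergman_ball (a k) (2 * r)}
      \<and> card {k. z \<in> bergman_ball (a k) (2 * r)} \<le> M"
    using separated_overlap[of UNIV a "r/4" "2 * r"] at r disj by auto
  have "is_lattice r a"
    unfolding is_lattice_def
  proof (intro conjI)
    show "range a \<subseteq> tube" using at by auto
    show "(\<Union>k. bergman_ball (a k) r) = tube"
      using bergman_ball_subset_tube cover rng by (auto simp: image_iff)
    show "\<exists>N>0. \<forall>z\<in>tube. finite {k. z \<in> bergman_ball (a k) (2 * r)}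
        \<and> card {k. z \<in> bergman_ball (a k) (2 * r)} \<le> N"
      using M by (intro exI[of _ "Suc M"]) (auto intro: le_SucI)
  qed (rule disj)
  then show ?thesis using r by blast
qed

section \<open>Holomorphic functions of several variables\<close>

text \<open>The condition in \<open>holomorphic_tube\<close> at a single point, with the derivative
  named: limits and integrals of derivatives are formed later, and Cauchy estimates are needed on
  balls inside the domain.\<close>

definition complex_derivative :: "(complex ^ 'n::finite \<Rightarrow> complex) \<Rightarrow> (complex ^ 'n \<Rightarrow> complex) \<Rightarrow> complex ^ 'n
    \<Rightarrow> bool" where
  "complex_derivative f f' z \<longleftrightarrow> (f has_derivative f') (at z) \<and> (\<forall>c v. f' (c *s v) = c * f' v)"

definition holo_on :: "(complex ^ 'n::finite \<Rightarrow> complex) \<Rightarrow> (complex ^ 'n) set \<Rightarrow> bool" where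
  "holo_on f S \<longleftrightarrow> (\<forall>z\<in>S. \<exists>f'. complex_derivative f f' z)"

lemma holomorphic_tube_iff: "holomorphic_tube f \<longleftrightarrow> holo_on f tube"
  by (simp add: holomorphic_tube_def holo_on_def complex_derivative_def)

lemma holo_on_subset: "holo_on f S \<Longrightarrow> T \<subseteq> S \<Longrightarrow> holo_on f T"
  by (auto simp: holo_on_def)

lemma holo_on_continuous: "holo_on f S \<Longrightarrow> continuous_on S f"
  by (intro continuous_at_imp_continuous_on)
    (auto simp: holo_on_def complex_derivative_def dest!: has_derivative_continuous)

lemma vector_smult_bounded_linear: "bounded_linear (\<lambda>\<zeta>. \<zeta> *s (v :: complex ^ 'n))"
proof (rule bounded_linear_intro[where K = "norm v"])
  show "(x + y) *s v = x *s v + y *s v" for x y :: complex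
    by (simp add: vec_eq_iff algebra_simps)
  show "(r *\<^sub>R x) *s v = r *\<^sub>R (x *s v)" for r x
    by (simp add: vec_eq_iff)
  show "norm (x *s v) \<le> norm x * norm v" for x
    by (simp add: norm_vector_smult)
qed

text \<open>Restriction to a complex line makes the theory of one complex variable available;
  complex linearity of \<open>f'\<close> is what makes the restriction complex
  differentiable.\<close>

lemma complex_derivative_slice:
  assumes "complex_derivative f f' (z + \<zeta> *s v)"
  shows "((\<lambda>\<zeta>. f (z + \<zeta> *s v)) has_field_derivative f' v) (at \<zeta>)"
proof -
  have "((\<lambda>\<zeta>. z + \<zeta> *s v) has_derivative (\<lambda>h. 0 + h *s v)) (at \<zeta>)"
    by (intro has_derivative_add has_derivative_const bounded_linear.has_derivative[OF
        vector_smult_bounded_linear] has_derivative_ident)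
  moreover have "(f has_derivative f') (at (z + \<zeta> *s v))" using assms by (simp add: complex_derivative_def)
  ultimately have "((\<lambda>\<zeta>. f (z + \<zeta> *s v)) has_derivative (\<lambda>h. f' (0 + h *s v))) (at \<zeta>)"
    by (rule has_derivative_compose)
  moreover have "(\<lambda>h. f' (0 + h *s v)) = (*) (f' v)"
    using assms by (auto simp: complex_derivative_def mult.commute)
  ultimately show ?thesis by (simp add: has_field_derivative_def)
qed

lemma holo_on_slice:
  fixes U :: "complex set"
  assumes "holo_on f S" "open U" "\<And>\<zeta>. \<zeta> \<in> U \<Longrightarrow> z + \<zeta> *s v \<in> S"
  shows "(\<lambda>\<zeta>. f (z + \<zeta> *s v)) holomorphic_on U"
  unfolding holomorphic_on_open[OF assms(2)]
  using assms complex_derivative_slice unfolding holo_on_def by blast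

lemma holo_on_slice_ball:
  assumes "holo_on f (ball z \<delta>)" "v \<noteq> 0"
  shows "(\<lambda>\<zeta>. f (z + \<zeta> *s v)) holomorphic_on ball 0 (\<delta> / norm v)"
proof (rule holo_on_slice[OF assms(1)])
  fix \<zeta> :: complex assume "\<zeta> \<in> ball 0 (\<delta> / norm v)"
  then show "z + \<zeta> *s v \<in> ball z \<delta>" using assms(2) by (simp add: dist_norm norm_vector_smult field_simps)
qed simp

section \<open>Sub-mean value inequalities\<close>

text \<open>Cauchy's integral formula on the unit circle of the complex line through
  \<open>z\<close> in direction \<open>v\<close>; since \<open>norm v < R\<close>, this circle stays
  inside the ball.\<close>

lemma cmod_le_circle_mean:
  assumes f: "holo_on f S" and sub: "ball z R \<subseteq> S" and v: "v \<in> ball 0 R"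
  shows "ennreal (cmod (f z)) \<le> (\<integral>\<^sup>+x. indicator {0..1} x * ennreal (cmod (f (z + exp (2 * of_real pi * \<i>
      * of_real x) *s v))) \<partial>lborel)"
proof -
  define e where "e = (\<lambda>x::real. exp (2 * of_real pi * \<i> * of_real x))"
  define g where "g = (\<lambda>\<zeta>. f (z + \<zeta> *s v))"
  have ne: "norm (e x) = 1" for x by (simp add: e_def norm_exp_eq_Re)
  define U where "U = {\<zeta>::complex. norm \<zeta> * norm v < R}"
  have U: "open U" unfolding U_def by (intro open_Collect_less continuous_intros)
  have cb: "cball 0 1 \<subseteq> U"
  proof
    fix \<zeta> :: complex assume "\<zeta> \<in> cball 0 1"
    then have "norm \<zeta> * norm v \<le> 1 * norm v" by (intro mult_right_mono) auto
    then show "\<zeta> \<in> U" using v by (simp add: U_def)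
  qed
  have hol: "g holomorphic_on U" unfolding g_def
    by (rule holo_on_slice[OF f U]) (use sub in \<open>auto simp: U_def dist_norm norm_vector_smult\<close>)
  have "((\<lambda>u. g u / (u - 0)) has_contour_integral (2 * of_real pi * \<i> * g 0)) (circlepath 0 1)"
    by (rule Cauchy_integral_circlepath_simple) (use hol cb holomorphic_on_subset in auto)
  then have "((\<lambda>x. g (circlepath 0 1 x) / circlepath 0 1 x * vector_derivative (circlepath 0 1) (at x within
      {0..1})) has_integral (2 * of_real pi * \<i> * g 0)) {0..1}"
    by (simp add: has_contour_integral_def)
  then have "((\<lambda>x. (2 * of_real pi * \<i>) * g (e x)) has_integral (2 * of_real pi * \<i> * g 0)) {0..1}"
  proof (rule has_integral_eq[rotated])
    fix x :: real assume "x \<in> {0..1}"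
    then have vd: "vector_derivative (circlepath 0 1) (at x within {0..1}) = 2 * of_real pi * \<i> * e x"
      using vector_derivative_circlepath01[of x 0 1] by (simp add: e_def)
    have cp: "circlepath 0 1 x = e x" by (simp add: circlepath e_def)
    have "e x \<noteq> 0" by (simp add: e_def)
    then show "g (circlepath 0 1 x) / circlepath 0 1 x * vector_derivative (circlepath 0 1) (at x within
        {0..1}) = 2 * of_real pi * \<i> * g (e x)"
      unfolding vd cp by simp
  qed
  moreover define c where "c = 2 * of_real pi * \<i>"
  ultimately have "((\<lambda>x. c * g (e x)) has_integral (c * g 0)) {0..1}" by simp
  then have "((\<lambda>x. inverse c * (c * g (e x))) has_integral inverse c * (c * g 0)) {0..1}"
    by (rule has_integral_mult_right)
  moreover have "c \<noteq> 0" by (simp add: c_def)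
  ultimately have I: "((\<lambda>x. g (e x)) has_integral g 0) {0..1}" by (simp add: mult.assoc[symmetric])
  have cont: "continuous_on {0..1} (\<lambda>x. cmod (g (e x)))"
  proof (intro continuous_intros continuous_on_compose2[OF holomorphic_on_imp_continuous_on[OF hol]])
    show "continuous_on {0..1} e" unfolding e_def by (intro continuous_intros)
    show "e ` {0..1} \<subseteq> U" using cb ne by auto
  qed
  then have int: "(\<lambda>x. cmod (g (e x))) integrable_on {0..1}" by (rule integrable_continuous_interval)
  have "cmod (integral {0..1} (\<lambda>x. g (e x))) \<le> integral {0..1} (\<lambda>x. cmod (g (e x)))"
    by (rule Henstock_Kurzweil_Integration.integral_norm_bound_integral) (use I int in \<open>auto simp:
        integrable_on_def\<close>)
  then have "cmod (g 0) \<le> integral {0..1} (\<lambda>x. cmod (g (e x)))" using I by (simp add: integral_unique)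
  moreover have "(\<integral>\<^sup>+x. ennreal (indicator {0..1} x * cmod (g (e x))) \<partial>lborel)
      = ennreal (integral {0..1} (\<lambda>x. cmod (g (e x))))"
    by (rule nn_integral_has_integral_lebesgue) (use int in \<open>auto simp: has_integral_integral\<close>)
  ultimately have "ennreal (cmod (g 0)) \<le> (\<integral>\<^sup>+x. ennreal (indicator {0..1} x * cmod (g (e x))) \<partial>lborel)"
    by (simp add: ennreal_leI)
  moreover have "ennreal (indicator {0..1} x * cmod (g (e x)))
      = indicator {0..1} x * ennreal (cmod (g (e x)))" for x :: real
    by (simp add: indicator_def)
  ultimately show ?thesis by (simp add: g_def e_def)
qed

text \<open>The circle inequality is integrated over all directions \<open>v\<close> in the ball.
  After exchanging the integrals, each rotation \<open>e x\<close> preserves Lebesgue measure, so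
  the circle average disappears and no polar coordinates are required.\<close>

lemma cmod_le_ball_mean:
  fixes f :: "complex ^ 'n \<Rightarrow> complex"
  assumes f: "holo_on f S" and sub: "ball z R \<subseteq> S" and R: "0 < R"
  shows "ennreal (cmod (f z) * (unit_ball_vol (real DIM(complex ^ 'n)) * R ^ DIM(complex ^ 'n)))
     \<le> (\<integral>\<^sup>+w. ennreal (cmod (f w)) * indicator (ball z R) w \<partial>lborel)"
proof -
  define e where "e = (\<lambda>x::real. exp (2 * of_real pi * \<i> * of_real x))"
  have ne: "norm (e x) = 1" for x by (simp add: e_def norm_exp_eq_Re)
  \<comment> \<open>The extension by zero is Borel measurable and defined everywhere, as the
    rotation and translation invariance of the integral demand.\<close>
  define g where "g = (\<lambda>v. ennreal (cmod (indicator (ball 0 R) v *\<^sub>R f (z + v))))"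
  have [measurable]: "g \<in> borel_measurable borel"
  proof -
    have "continuous_on (ball 0 R) (\<lambda>v. f (z + v))"
      by (intro continuous_on_compose2[OF holo_on_continuous[OF f]] continuous_intros) (use sub in \<open>auto
          simp: dist_norm\<close>)
    then have "(\<lambda>v. indicator (ball 0 R) v *\<^sub>R f (z + v)) \<in> borel_measurable borel"
      by (intro borel_measurable_continuous_on_indicator) auto
    then show ?thesis unfolding g_def by measurable
  qed
  have m: "(\<lambda>p. e (fst p) *s snd p) \<in> borel_measurable (lborel \<Otimes>\<^sub>M (lborel :: (complex ^ 'n) measure))"
  proof -
    have "continuous_on UNIV (\<lambda>p :: real \<times> (complex ^ 'n). e (fst p) *s snd p)"
      unfolding vector_scalar_mult_def e_def by (intro continuous_intros continuous_on_vec_lambda)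
    then have "(\<lambda>p :: real \<times> (complex ^ 'n). e (fst p) *s snd p) \<in> borel_measurable borel"
      by (rule borel_measurable_continuous_onI)
    then show ?thesis by (simp add: lborel_prod)
  qed
  have V: "emeasure lborel (ball (0 :: complex ^ 'n) R) = ennreal (unit_ball_vol (real DIM(complex ^ 'n))
      * R ^ DIM(complex ^ 'n))"
    using R by (intro emeasure_ball) auto
  have "ennreal (cmod (f z) * (unit_ball_vol (real DIM(complex ^ 'n)) * R ^ DIM(complex ^ 'n)))
      = ennreal (cmod (f z)) * emeasure lborel (ball (0 :: complex ^ 'n) R)"
    unfolding V by (rule ennreal_mult') simp
  also have "\<dots> = (\<integral>\<^sup>+v. ennreal (cmod (f z)) * indicator (ball (0 :: complex ^ 'n) R) v \<partial>lborel)"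
    by (simp add: nn_integral_cmult_indicator)
  also have "\<dots> \<le> (\<integral>\<^sup>+v. (\<integral>\<^sup>+x. indicator {0..1} x * g (e x *s v) \<partial>lborel) \<partial>lborel)"
  proof (rule nn_integral_mono)
    fix v :: "complex ^ 'n"
    show "ennreal (cmod (f z)) * indicator (ball 0 R) v \<le> (\<integral>\<^sup>+x. indicator {0..1} x * g (e x *s v) \<partial>lborel)"
    proof (cases "v \<in> ball 0 R")
      case True
      then have "g (e x *s v) = ennreal (cmod (f (z + e x *s v)))" for x
        by (simp add: g_def norm_vector_smult ne)
      then show ?thesis using cmod_le_circle_mean[OF f sub True] True by (simp add: e_def)
    qed simp
  qed
  also have "\<dots> = (\<integral>\<^sup>+x. (\<integral>\<^sup>+v. indicator {0..1} x * g (e x *s v) \<partial>lborel) \<partial>lborel)"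
  proof (rule lborel_pair.Fubini')
    have "(\<lambda>p. indicator {0..1} (fst p) * g (e (fst p) *s snd p)) \<in> borel_measurable (lborel \<Otimes>\<^sub>M (lborel ::
        (complex ^ 'n) measure))"
      using m by measurable
    then show "(\<lambda>(x, v). indicator {0..1} x * g (e x *s v)) \<in> borel_measurable (lborel \<Otimes>\<^sub>M (lborel ::
        (complex ^ 'n) measure))"
      by (simp add: split_def)
  qed
  also have "\<dots> = (\<integral>\<^sup>+x. indicator {0..1} x * (\<integral>\<^sup>+v. g v \<partial>lborel) \<partial>(lborel :: real measure))"
  proof (rule nn_integral_cong)
    fix x :: real
    have [measurable]: "(\<lambda>v. e x *s v) \<in> borel_measurable (borel :: (complex ^ 'n) measure)"
      by (intro borel_measurable_continuous_onI linear_continuous_on)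
        (simp add: linear_conv_bounded_linear[symmetric] linear_vector_smult)
    have "(\<integral>\<^sup>+v. indicator {0..1} x * g (e x *s v) \<partial>lborel) = indicator {0..1} x * (\<integral>\<^sup>+v. g (e x *s v) \<partial>lborel)"
      by (rule nn_integral_cmult) measurable
    then show "(\<integral>\<^sup>+v. indicator {0..1} x * g (e x *s v) \<partial>lborel) = indicator {0..1} x * (\<integral>\<^sup>+v. g v \<partial>lborel)"
      by (simp add: nn_integral_lborel_rotate ne)
  qed
  also have "\<dots> = (\<integral>\<^sup>+v. g v \<partial>lborel)"
    by (simp add: nn_integral_multc)
  also have "\<dots> = (\<integral>\<^sup>+w. g (- z + w) \<partial>lborel)"
    by (rule nn_integral_lborel_shift[symmetric]) measurable
  also have "\<dots> = (\<integral>\<^sup>+w. ennreal (cmod (f w)) * indicator (ball z R) w \<partial>lborel)"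
    by (intro nn_integral_cong) (auto simp: g_def indicator_def dist_norm norm_minus_commute)
  finally show ?thesis .
qed

text \<open>For \<open>p \<le> 1\<close> the mean value inequality is used at the maximum of \<open>|f| (R - |z - z\<^sub>0|)\<^bsup>D/p\<^esup>\<close>;
  around it \<open>|f|\<close> is at most a constant times its value there, so \<open>|f|\<close> may be replaced by
  \<open>|f|\<^sup>p\<close>. For \<open>p > 1\<close> this is applied to a power of \<open>f\<close>.\<close>

lemma cmod_powr_le_ball_mean_aux:
  fixes R p :: real
  assumes R: "0 < R" and p: "0 < p" "p \<le> 1"
  shows "\<exists>C>0. \<forall>(f :: complex ^ 'n \<Rightarrow> complex) S z. holo_on f S \<longrightarrow> cball z R \<subseteq> S \<longrightarrow>
    ennreal (cmod (f z) powr p) \<le> ennreal C * (\<integral>\<^sup>+w. ennreal (cmod (f w) powr p) * indicator (cball z R) w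
        \<partial>lborel)"
proof -
  define D where "D = DIM(complex ^ 'n)"
  define \<omega> where "\<omega> = unit_ball_vol (real D)"
  have \<omega>: "0 < \<omega>" by (simp add: \<omega>_def)
  have D: "0 < D" unfolding D_def by (rule DIM_positive)
  \<comment> \<open>The \<open>p\<close>-th power of a distance raised to \<open>\<kappa>\<close> is
    that distance to the power \<open>D\<close>, which matches the volume of a ball with this
    radius.\<close>
  define \<kappa> where "\<kappa> = real D / p"
  have \<kappa>: "0 < \<kappa>" "\<kappa> * p = real D" using D p by (auto simp: \<kappa>_def)
  define C where "C = 2 ^ D / R ^ D * (2 powr (\<kappa> * (1 - p)) / \<omega>)"
  have C: "0 < C" using R \<omega> by (auto simp: C_def)
  show ?thesis
  proof (intro exI[of _ C] conjI allI impI C)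
    fix f :: "complex ^ 'n \<Rightarrow> complex" and S z0 assume f: "holo_on f S" and sub: "cball z0 R \<subseteq> S"
    define I where "I = (\<integral>\<^sup>+w. ennreal (cmod (f w) powr p) * indicator (cball z0 R) w \<partial>lborel)"
    show "ennreal (cmod (f z0) powr p) \<le> ennreal C * I"
    proof (cases "f z0 = 0 \<or> I = \<infinity>")
      case True
      then show ?thesis using C by (auto simp: ennreal_mult_top)
    next
      case False
      then have nz: "f z0 \<noteq> 0" and I: "I = ennreal (enn2real I)" by (auto simp: less_top[symmetric])
      define u where "u z = cmod (f z) * (R - dist z0 z) powr \<kappa>" for z
      have contu: "continuous_on (cball z0 R) u"
        unfolding u_def using \<kappa> by (intro continuous_intros continuous_on_powr' continuous_on_subset[OF
            holo_on_continuous[OF f] sub]) auto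
      have "\<exists>z\<in>cball z0 R. \<forall>y\<in>cball z0 R. u y \<le> u z"
        using R by (intro continuous_attains_sup contu) auto
      then obtain y where y: "y \<in> cball z0 R" "\<And>w. w \<in> cball z0 R \<Longrightarrow> u w \<le> u y" by blast
      have uy: "cmod (f z0) * R powr \<kappa> \<le> u y" using y(2)[of z0] R by (simp add: u_def)
      moreover have "0 < cmod (f z0) * R powr \<kappa>" using nz R by simp
      ultimately have upos: "0 < u y" by linarith
      \<comment> \<open>Half the distance from \<open>y\<close> to the boundary: in
        \<open>ball y d\<close> the distance factor is still at least
        \<open>d powr \<kappa>\<close>, so maximality of \<open>u\<close> at \<open>y\<close> bounds
        \<open>f\<close> there by \<open>2 powr \<kappa>\<close> times its value at
        \<open>y\<close>.\<close>
      define d where "d = (R - dist z0 y) / 2"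
      have fy: "f y \<noteq> 0" using upos by (auto simp: u_def)
      have "dist z0 y \<noteq> R" using upos by (auto simp: u_def)
      then have d: "0 < d" "R - dist z0 y = 2 * d" using y(1) by (auto simp: d_def)
      define M where "M = 2 powr \<kappa> * cmod (f y)"
      have M: "0 < M" using fy by (simp add: M_def)
      have inb: "w \<in> cball z0 R" "cmod (f w) \<le> M" if w: "w \<in> ball y d" for w
      proof -
        have "dist z0 w \<le> dist z0 y + dist y w" by (rule dist_triangle)
        then have dw: "d \<le> R - dist z0 w" using w d by auto
        then show wR: "w \<in> cball z0 R" using d by auto
        have "cmod (f w) * d powr \<kappa> \<le> u w" unfolding u_def using dw d \<kappa>
            by (intro mult_left_mono powr_mono2) auto
        also have "\<dots> \<le> u y" by (rule y(2)[OF wR])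
        also have "\<dots> = M * d powr \<kappa>" using d by (simp add: u_def M_def powr_mult)
        finally show "cmod (f w) \<le> M" using d by (simp add: mult_le_cancel_right)
      qed
      have "ennreal (cmod (f y) * (\<omega> * d ^ D)) \<le> (\<integral>\<^sup>+w. ennreal (cmod (f w)) * indicator (ball y d) w \<partial>lborel)"
        unfolding \<omega>_def D_def using inb(1) sub d by (intro cmod_le_ball_mean[OF f]) auto
      also have "\<dots> \<le> (\<integral>\<^sup>+w. ennreal (M powr (1 - p)) * (ennreal (cmod (f w) powr p)
          * indicator (cball z0 R) w) \<partial>lborel)"
      proof (rule nn_integral_mono)
        fix w
        show "ennreal (cmod (f w)) * indicator (ball y d) w \<le> ennreal (M powr (1 - p))
            * (ennreal (cmod (f w) powr p) * indicator (cball z0 R) w)"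
        proof (cases "w \<in> ball y d \<and> f w \<noteq> 0")
          case True
          have "cmod (f w) = cmod (f w) powr (1 - p) * cmod (f w) powr p"
            using True by (simp add: powr_add[symmetric])
          also have "\<dots> \<le> M powr (1 - p) * cmod (f w) powr p"
            using inb(2)[of w] True p by (intro mult_right_mono powr_mono2) auto
          finally show ?thesis using True inb(1)[of w] by (simp add: ennreal_mult[symmetric] ennreal_leI)
        qed auto
      qed
      also have "\<dots> = ennreal (M powr (1 - p)) * I"
      proof -
        have "(\<lambda>w. indicator (cball z0 R) w *\<^sub>R f w) \<in> borel_measurable borel"
          by (intro borel_measurable_continuous_on_indicator continuous_on_subset[OF holo_on_continuous[OF
              f] sub]) auto
        then have "(\<lambda>w. ennreal (cmod (indicator (cball z0 R) w *\<^sub>R f w) powr p)) \<in> borel_measurable borel"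
            by measurable
        also have "(\<lambda>w. ennreal (cmod (indicator (cball z0 R) w *\<^sub>R f w) powr p))
            = (\<lambda>w. ennreal (cmod (f w) powr p) * indicator (cball z0 R) w)"
          by (auto simp: indicator_def fun_eq_iff)
        finally show ?thesis unfolding I_def by (intro nn_integral_cmult) simp
      qed
      also have "\<dots> = ennreal (M powr (1 - p) * enn2real I)" by (subst I) (simp add: ennreal_mult)
      finally have "cmod (f y) * (\<omega> * d ^ D) \<le> M powr (1 - p) * enn2real I"
        by (simp add: ennreal_le_iff)
      also have "M powr (1 - p) = 2 powr (\<kappa> * (1 - p)) * cmod (f y) powr (1 - p)"
        by (simp add: M_def powr_mult powr_powr)
      finally have "cmod (f y) * (\<omega> * d ^ D) \<le> 2 powr (\<kappa> * (1 - p)) * cmod (f y) powr (1 - p) * enn2real I" .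
      moreover have "cmod (f y) = cmod (f y) powr (1 - p) * cmod (f y) powr p"
        using fy by (simp add: powr_add[symmetric])
      ultimately have "cmod (f y) powr (1 - p) * (cmod (f y) powr p * (\<omega> * d ^ D))
          \<le> cmod (f y) powr (1 - p) * (2 powr (\<kappa> * (1 - p)) * enn2real I)"
        by (simp only: mult_ac)
      then have 1: "cmod (f y) powr p * (\<omega> * d ^ D) \<le> 2 powr (\<kappa> * (1 - p)) * enn2real I"
        using fy by (simp add: mult_le_cancel_left)
      have pw: "(x powr \<kappa>) powr p = x ^ D" if "0 < x" for x :: real
      proof -
        have "(x powr \<kappa>) powr p = x powr (\<kappa> * p)" by (rule powr_powr)
        also have "\<dots> = x powr (real D)" by (simp only: \<kappa>(2))
        also have "\<dots> = x ^ D" using that by (rule powr_realpow)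
        finally show ?thesis .
      qed
      have "(cmod (f z0) * R powr \<kappa>) powr p \<le> (u y) powr p"
        using uy p by (intro powr_mono2) auto
      then have "cmod (f z0) powr p * R ^ D \<le> cmod (f y) powr p * (2 * d) ^ D"
        using R d by (simp add: u_def powr_mult pw)
      also have "\<dots> = 2 ^ D / \<omega> * (cmod (f y) powr p * (\<omega> * d ^ D))"
        using \<omega> by (simp add: power_mult_distrib)
      also have "\<dots> \<le> 2 ^ D / \<omega> * (2 powr (\<kappa> * (1 - p)) * enn2real I)"
        using 1 \<omega> by (intro mult_left_mono) auto
      finally have "cmod (f z0) powr p \<le> C * enn2real I"
        using R \<omega> by (simp add: C_def field_simps)
      then show ?thesis using C by (subst I) (simp add: ennreal_mult[symmetric] ennreal_leI)
    qed
  qed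
qed

lemma holo_on_power:
  assumes "holo_on f S"
  shows "holo_on (\<lambda>z. f z ^ m) S"
  unfolding holo_on_def
proof
  fix z assume "z \<in> S"
  then obtain f' where f': "(f has_derivative f') (at z)" "\<forall>c v. f' (c *s v) = c * f' v"
    using assms by (auto simp: holo_on_def complex_derivative_def)
  show "\<exists>g'. complex_derivative (\<lambda>z. f z ^ m) g' z"
    unfolding complex_derivative_def
    by (intro exI conjI, rule has_derivative_power[OF f'(1)]) (use f'(2) in auto)
qed

lemma cmod_powr_le_ball_mean:
  fixes R p :: real
  assumes R: "0 < R" and p: "0 < p"
  shows "\<exists>C>0. \<forall>(f :: complex ^ 'n \<Rightarrow> complex) S z. holo_on f S \<longrightarrow> cball z R \<subseteq> S \<longrightarrow>
    ennreal (cmod (f z) powr p) \<le> ennreal C * (\<integral>\<^sup>+w. ennreal (cmod (f w) powr p) * indicator (cball z R) w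
        \<partial>lborel)"
proof -
  define m where "m = nat \<lceil>p\<rceil>"
  have m: "0 < m" "p \<le> real m" using p real_nat_ceiling_ge[of p] by (auto simp: m_def)
  define q where "q = p / real m"
  have q: "0 < q" "q \<le> 1" using m p by (auto simp: q_def)
  have e: "cmod (x ^ m) powr q = cmod x powr p" for x
    using m by (cases "x = 0") (auto simp: norm_power powr_realpow[symmetric] powr_powr q_def)
  obtain C where C: "0 < C" "\<And>(f :: complex ^ 'n \<Rightarrow> complex) S z. holo_on f S \<Longrightarrow> cball z R \<subseteq> S \<Longrightarrow>
    ennreal (cmod (f z) powr q) \<le> ennreal C * (\<integral>\<^sup>+w. ennreal (cmod (f w) powr q) * indicator (cball z R) w
        \<partial>lborel)"
    using cmod_powr_le_ball_mean_aux[OF R q, where 'n = 'n] by blast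
  show ?thesis
  proof (intro exI[of _ C] conjI allI impI C(1))
    fix f :: "complex ^ 'n \<Rightarrow> complex" and S z assume "holo_on f S" "cball z R \<subseteq> S"
    then show "ennreal (cmod (f z) powr p) \<le> ennreal C * (\<integral>\<^sup>+w. ennreal (cmod (f w) powr p)
        * indicator (cball z R) w \<partial>lborel)"
      using C(2)[OF holo_on_power[of f S m]] by (simp add: e)
  qed
qed

section \<open>Cauchy estimates and normal families\<close>

text \<open>Cauchy's inequality on the circle of radius \<open>\<rho> / 2\<close> for the first
  derivative. For the remainder, Taylor's theorem on \<open>ball 0 (\<rho> / 2)\<close> is combined
  with Cauchy's inequality on circles of radius \<open>\<rho> / 4\<close>; hence
  \<open>32 = 2 * 4^2\<close>. The condition \<open>2 < \<rho>\<close> places the point 1 in the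
  smaller disc.\<close>

lemma holomorphic_remainder_bounds:
  fixes g :: "complex \<Rightarrow> complex"
  assumes hol: "g holomorphic_on ball 0 \<rho>" and M: "\<And>\<zeta>. \<zeta> \<in> ball 0 \<rho> \<Longrightarrow> cmod (g \<zeta>) \<le> M" and \<rho>: "2 < \<rho>"
  shows "cmod (deriv g 0) \<le> 2 * M / \<rho>" and "cmod (g 1 - g 0 - deriv g 0) \<le> 32 * M / \<rho>\<^sup>2"
proof -
  have cont: "continuous_on (cball x r) g" if "cball x r \<subseteq> ball 0 \<rho>" for x r
    using holomorphic_on_imp_continuous_on[OF holomorphic_on_subset[OF hol that]] .
  have hol': "g holomorphic_on ball x r" if "cball x r \<subseteq> ball 0 \<rho>" for x r
    using holomorphic_on_subset[OF hol] that ball_subset_cball[of x r] by blast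
  have sub0: "cball 0 (\<rho> / 2) \<subseteq> ball 0 \<rho>" using \<rho> by auto
  have "cmod ((deriv ^^ 1) g 0) \<le> fact 1 * M / (\<rho> / 2) ^ 1"
    by (rule Cauchy_inequality[OF hol'[OF sub0] cont[OF sub0]]) (use \<rho> M in auto)
  then show "cmod (deriv g 0) \<le> 2 * M / \<rho>" by (simp add: mult.commute)
  define S where "S = ball (0::complex) (\<rho> / 2)"
  have sub: "cball x (\<rho> / 4) \<subseteq> ball 0 \<rho>" if "x \<in> S" for x
  proof
    fix y assume "y \<in> cball x (\<rho> / 4)"
    then have "norm (y - x) \<le> \<rho> / 4" "norm x < \<rho> / 2" using that
        by (auto simp: S_def dist_norm norm_minus_commute)
    then show "y \<in> ball 0 \<rho>" using norm_triangle_ineq[of "y - x" x] \<rho> by simp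
  qed
  have "cmod ((deriv ^^ 0) g 1 - (\<Sum>i\<le>1. (deriv ^^ i) g 0 * (1 - 0) ^ i / fact i))
      \<le> (32 * M / \<rho>\<^sup>2) * cmod (1 - 0) ^ Suc 1 / fact 1"
  proof (rule complex_Taylor[where S = S])
    show "convex S" "0 \<in> S" "1 \<in> S" using \<rho> by (auto simp: S_def)
    fix x assume x: "x \<in> S"
    have xb: "x \<in> ball 0 \<rho>" using x \<rho> by (simp add: S_def)
    show "((deriv ^^ i) g has_field_derivative (deriv ^^ Suc i) g x) (at x within S)" for i
    proof -
      have "(deriv ^^ i) g holomorphic_on ball 0 \<rho>" by (intro holomorphic_higher_deriv hol) simp
      then have "((deriv ^^ i) g has_field_derivative deriv ((deriv ^^ i) g) x) (at x)"
        by (rule holomorphic_derivI) (use xb in auto)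
      then show ?thesis by (simp add: has_field_derivative_at_within)
    qed
    have "cmod ((deriv ^^ 2) g x) \<le> fact 2 * M / (\<rho> / 4) ^ 2"
    proof (rule Cauchy_inequality[OF hol'[OF sub[OF x]] cont[OF sub[OF x]]])
      fix y assume "cmod (x - y) = \<rho> / 4"
      then have "y \<in> ball 0 \<rho>" using sub[OF x] by (auto simp: dist_norm)
      then show "cmod (g y) \<le> M" by (rule M)
    qed (use \<rho> in auto)
    also have "fact 2 * M / (\<rho> / 4) ^ 2 = 32 * M / \<rho>\<^sup>2" by (simp add: power_divide fact_numeral)
    finally show "cmod ((deriv ^^ Suc 1) g x) \<le> 32 * M / \<rho>\<^sup>2" by (simp add: numeral_2_eq_2)
  qed
  then show "cmod (g 1 - g 0 - deriv g 0) \<le> 32 * M / \<rho>\<^sup>2" by (simp add: diff_diff_eq)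
qed

text \<open>The one-variable bounds for \<open>f (z + \<zeta> *s v)\<close> on the disc of radius
  \<open>\<delta> / norm v\<close>. The constants depend on \<open>M\<close> and
  \<open>\<delta>\<close> alone; this uniformity carries differentiability over to limits of
  functions and under the integral sign.\<close>

lemma complex_derivative_bounds:
  fixes f :: "complex ^ 'n \<Rightarrow> complex"
  assumes hol: "holo_on f (ball z \<delta>)" and M: "\<And>w. w \<in> ball z \<delta> \<Longrightarrow> cmod (f w) \<le> M"
    and f': "complex_derivative f f' z" and v: "norm v < \<delta> / 2"
  shows "cmod (f' v) \<le> 2 * M * norm v / \<delta>" and "cmod (f (z + v) - f z - f' v) \<le> 32 * M * (norm v)\<^sup>2 / \<delta>\<^sup>2"
proof -
  have \<delta>: "0 < \<delta>" using v norm_ge_zero[of v] by linarith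
  have "cmod (f' v) \<le> 2 * M * norm v / \<delta> \<and> cmod (f (z + v) - f z - f' v) \<le> 32 * M * (norm v)\<^sup>2 / \<delta>\<^sup>2"
  proof (cases "v = 0")
    case True
    have "f' (0 *s 0) = 0 * f' 0" using f' unfolding complex_derivative_def by blast
    then show ?thesis using True by simp
  next
    case False
    define g where "g = (\<lambda>\<zeta>. f (z + \<zeta> *s v))"
    define \<rho> where "\<rho> = \<delta> / norm v"
    have \<rho>: "2 < \<rho>" using False v by (simp add: \<rho>_def field_simps)
    have hg: "g holomorphic_on ball 0 \<rho>" unfolding g_def \<rho>_def by (rule holo_on_slice_ball[OF hol False])
    have Mg: "cmod (g \<zeta>) \<le> M" if "\<zeta> \<in> ball 0 \<rho>" for \<zeta>
      unfolding g_def by (rule M) (use that False in \<open>auto simp: \<rho>_def dist_norm norm_vector_smult field_simps\<close>)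
    have "(g has_field_derivative f' v) (at 0)"
      unfolding g_def by (rule complex_derivative_slice) (use f' in simp)
    then have d: "deriv g 0 = f' v" by (rule DERIV_imp_deriv)
    have g01: "g 0 = f z" "g 1 = f (z + v)" by (auto simp: g_def)
    show ?thesis
      using holomorphic_remainder_bounds[OF hg Mg \<rho>] unfolding d g01 by (simp add: \<rho>_def power_divide)
  qed
  then show "cmod (f' v) \<le> 2 * M * norm v / \<delta>" "cmod (f (z + v) - f z - f' v) \<le> 32 * M * (norm v)\<^sup>2 / \<delta>\<^sup>2"
      by auto
qed

text \<open>Remainder plus linear term, with \<open>18 = 32 / 2 + 2\<close> because
  \<open>norm v / \<delta> < 1 / 2\<close>. It provides the equicontinuity of locally bounded
  families.\<close>

lemma holo_on_lipschitz:
  fixes f :: "complex ^ 'n \<Rightarrow> complex"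
  assumes hol: "holo_on f (ball z \<delta>)" and M: "\<And>w. w \<in> ball z \<delta> \<Longrightarrow> cmod (f w) \<le> M" and v: "norm v < \<delta> / 2"
  shows "cmod (f (z + v) - f z) \<le> 18 * M * norm v / \<delta>"
proof -
  have \<delta>: "0 < \<delta>" using v norm_ge_zero[of v] by linarith
  have z: "z \<in> ball z \<delta>" using \<delta> by simp
  have M0: "0 \<le> M" using M[OF z] norm_ge_zero order_trans by blast
  obtain f' where f': "complex_derivative f f' z" using hol z unfolding holo_on_def by blast
  have "cmod (f (z + v) - f z) \<le> cmod (f (z + v) - f z - f' v) + cmod (f' v)"
    using norm_triangle_ineq[of "f (z + v) - f z - f' v" "f' v"] by simp
  also have "\<dots> \<le> 32 * M * (norm v)\<^sup>2 / \<delta>\<^sup>2 + 2 * M * norm v / \<delta>"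
    using complex_derivative_bounds[OF hol M f' v] by (intro add_mono) auto
  also have "32 * M * (norm v)\<^sup>2 / \<delta>\<^sup>2 = 32 * M * norm v / \<delta> * (norm v / \<delta>)" by (simp add: power2_eq_square)
  also have "\<dots> \<le> 32 * M * norm v / \<delta> * (1 / 2)"
    using v \<delta> M0 by (intro mult_left_mono) (auto simp: field_simps)
  finally show ?thesis by (simp add: add_divide_distrib[symmetric])
qed

text \<open>A quadratic remainder is what Cauchy estimates supply. Additivity and complex
  homogeneity already make \<open>L\<close> real linear, and bounded because the dimension is
  finite.\<close>

lemma complex_derivativeI:
  fixes f :: "complex ^ 'n \<Rightarrow> complex"
  assumes add: "\<And>v w. L (v + w) = L v + L w" and hom: "\<And>c v. L (c *s v) = c * L v"
    and \<delta>: "0 < \<delta>" and K: "\<And>v. norm v < \<delta> \<Longrightarrow> cmod (f (z + v) - f z - L v) \<le> K * (norm v)\<^sup>2"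
  shows "complex_derivative f L z"
proof -
  have "linear L"
  proof (rule linearI)
    show "L (r *\<^sub>R v) = r *\<^sub>R L v" for r v
    proof -
      have "r *\<^sub>R v = complex_of_real r *s v" by (simp add: vec_eq_iff scaleR_conv_of_real[where 'a = complex])
      then show ?thesis by (simp add: hom scaleR_conv_of_real)
    qed
  qed (rule add)
  then have "bounded_linear L" by (simp add: linear_conv_bounded_linear)
  have "(f has_derivative L) (at z)"
    unfolding has_derivative_at_alt
  proof (intro conjI allI impI)
    fix e :: real assume e: "0 < e"
    show "\<exists>d>0. \<forall>y. norm (y - z) < d \<longrightarrow> norm (f y - f z - L (y - z)) \<le> e * norm (y - z)"
    proof (intro exI[of _ "min \<delta> (e / (\<bar>K\<bar> + 1))"] conjI allI impI)
      show "0 < min \<delta> (e / (\<bar>K\<bar> + 1))" using \<delta> e by simp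
      fix y assume y: "norm (y - z) < min \<delta> (e / (\<bar>K\<bar> + 1))"
      have "norm (f y - f z - L (y - z)) \<le> K * (norm (y - z))\<^sup>2" using K[of "y - z"] y by simp
      also have "\<dots> \<le> (\<bar>K\<bar> + 1) * (norm (y - z))\<^sup>2" by (intro mult_right_mono) auto
      also have "\<dots> = ((\<bar>K\<bar> + 1) * norm (y - z)) * norm (y - z)" by (simp add: power2_eq_square)
      also have "\<dots> \<le> e * norm (y - z)"
        using y by (intro mult_right_mono) (auto simp: field_simps)
      finally show "norm (f y - f z - L (y - z)) \<le> e * norm (y - z)" .
    qed
  qed fact
  then show ?thesis using hom by (simp add: complex_derivative_def)
qed

lemma complex_derivative_diff:
  assumes "complex_derivative f f' z" "complex_derivative g g' z"
  shows "complex_derivative (\<lambda>z. f z - g z) (\<lambda>v. f' v - g' v) z"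
  using assms unfolding complex_derivative_def by (auto intro!: has_derivative_diff simp: algebra_simps)

lemma holo_on_diff: "holo_on f S \<Longrightarrow> holo_on g S \<Longrightarrow> holo_on (\<lambda>z. f z - g z) S"
  unfolding holo_on_def using complex_derivative_diff by blast

text \<open>The Cauchy estimate applied to \<open>f m - f n\<close> makes the derivatives in short
  directions a Cauchy sequence, and homogeneity extends this to all directions. The quadratic
  remainder bound is uniform in \<open>j\<close> and passes to the limit.\<close>

lemma holo_uniform_limit:
  fixes f :: "nat \<Rightarrow> complex ^ 'n \<Rightarrow> complex"
  assumes hol: "\<And>j. holo_on (f j) (ball z \<delta>)" and M: "\<And>j w. w \<in> ball z \<delta> \<Longrightarrow> cmod (f j w) \<le> M" and \<delta>: "0 < \<delta>"
    and lim: "\<And>e. 0 < e \<Longrightarrow> \<exists>J. \<forall>j\<ge>J. \<forall>w\<in>ball z \<delta>. cmod (f j w - g w) < e"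
  shows "\<exists>L. complex_derivative g L z"
proof -
  have z: "z \<in> ball z \<delta>" using \<delta> by simp
  have "\<forall>j. \<exists>L. complex_derivative (f j) L z" using hol z by (auto simp: holo_on_def)
  then obtain F where F: "\<And>j. complex_derivative (f j) (F j) z" by metis
  have lin: "F j (v + w) = F j v + F j w" "F j (c *s v) = c * F j v" for j c v w
    using F[of j] has_derivative_linear by (auto simp: complex_derivative_def intro: linear_add)
  have pw: "(\<lambda>j. f j w) \<longlonglongrightarrow> g w" if "w \<in> ball z \<delta>" for w
    unfolding LIMSEQ_iff using lim that by blast
  have small: "convergent (\<lambda>j. F j v)" if v: "norm v < \<delta> / 2" for v
  proof (subst Cauchy_convergent_iff[symmetric], rule CauchyI)
    fix e :: real assume e: "0 < e"
    have "0 < e / 4" using e by simp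
    then obtain J where J: "\<And>j w. j \<ge> J \<Longrightarrow> w \<in> ball z \<delta> \<Longrightarrow> cmod (f j w - g w) < e / 4" using lim by blast
    have "cmod (F m v - F n v) < e" if mn: "m \<ge> J" "n \<ge> J" for m n
    proof -
      have b: "cmod (f m w - f n w) \<le> e / 2" if "w \<in> ball z \<delta>" for w
        using J[OF mn(1) that] J[OF mn(2) that] norm_triangle_ineq4[of "f m w - g w" "f n w - g w"] by simp
      have "cmod (F m v - F n v) \<le> 2 * (e / 2) * norm v / \<delta>"
        by (rule complex_derivative_bounds(1)[OF holo_on_diff[OF hol hol] b complex_derivative_diff[OF F F] v])
      also have "\<dots> < e" using v \<delta> e by (simp add: field_simps)
      finally show ?thesis .
    qed
    then show "\<exists>J. \<forall>m\<ge>J. \<forall>n\<ge>J. cmod (F m v - F n v) < e" by blast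
  qed
  have conv: "convergent (\<lambda>j. F j v)" for v
  proof (cases "v = 0")
    case True then show ?thesis using small[of 0] \<delta> by simp
  next
    case False
    define c where "c = complex_of_real (\<delta> / (4 * norm v))"
    have "norm (c *s v) < \<delta> / 2" using False \<delta> by (simp add: norm_vector_smult c_def norm_divide norm_mult)
    then have "convergent (\<lambda>j. c * F j v)" using small[of "c *s v"] by (simp add: lin)
    moreover have "c \<noteq> 0" using False \<delta> by (simp add: c_def)
    ultimately show ?thesis by (simp add: convergent_mult_const_iff)
  qed
  define L where "L v = lim (\<lambda>j. F j v)" for v
  have L: "(\<lambda>j. F j v) \<longlonglongrightarrow> L v" for v using conv[of v] by (simp add: L_def convergent_LIMSEQ_iff)
  have "complex_derivative g L z"
  proof (rule complex_derivativeI)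
    show "L (v + w) = L v + L w" for v w
    proof (rule LIMSEQ_unique[OF L])
      show "(\<lambda>j. F j (v + w)) \<longlonglongrightarrow> L v + L w" unfolding lin by (intro tendsto_add L)
    qed
    show "L (c *s v) = c * L v" for c v
    proof (rule LIMSEQ_unique[OF L])
      show "(\<lambda>j. F j (c *s v)) \<longlonglongrightarrow> c * L v" unfolding lin by (intro tendsto_mult_left L)
    qed
    show "0 < \<delta> / 2" using \<delta> by simp
    fix v :: "complex ^ 'n" assume v: "norm v < \<delta> / 2"
    have zv: "z + v \<in> ball z \<delta>" using v \<delta> by (simp add: dist_norm)
    have "(\<lambda>j. cmod (f j (z + v) - f j z - F j v)) \<longlonglongrightarrow> cmod (g (z + v) - g z - L v)"
      by (intro tendsto_intros pw zv z L)
    moreover have "cmod (f j (z + v) - f j z - F j v) \<le> 32 * M / \<delta>\<^sup>2 * (norm v)\<^sup>2" for j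
      using complex_derivative_bounds(2)[OF hol M F v] by simp
    ultimately show "cmod (g (z + v) - g z - L v) \<le> 32 * M / \<delta>\<^sup>2 * (norm v)\<^sup>2"
      by (intro LIMSEQ_le_const2) auto
  qed
  then show ?thesis by blast
qed

text \<open>Arzela--Ascoli on each member of a compact exhaustion, followed by a diagonal
  subsequence. Equicontinuity comes from \<open>holo_on_lipschitz\<close> on a ball around each
  point.\<close>

theorem montel_holo_on:
  fixes f :: "nat \<Rightarrow> complex ^ 'n \<Rightarrow> complex"
  assumes S: "open S" and hol: "\<And>j. holo_on (f j) S"
    and bdd: "\<And>K. compact K \<Longrightarrow> K \<subseteq> S \<Longrightarrow> \<exists>M. \<forall>j. \<forall>w\<in>K. cmod (f j w) \<le> M"
  obtains g k where "strict_mono (k :: nat \<Rightarrow> nat)" "holo_on g S"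
    "\<And>K e. compact K \<Longrightarrow> K \<subseteq> S \<Longrightarrow> 0 < e \<Longrightarrow> \<exists>J. \<forall>j\<ge>J. \<forall>w\<in>K. cmod (f (k j) w - g w) < e"
proof -
  obtain C where C: "\<And>n. compact (C n)" "\<And>n. C n \<subseteq> S" "\<And>n. C n \<subseteq> interior (C (Suc n))" "\<Union>(range C) = S"
    "\<And>K. compact K \<Longrightarrow> K \<subseteq> S \<Longrightarrow> \<exists>N. \<forall>n\<ge>N. K \<subseteq> C n"
    by (rule open_Union_compact_subsets[OF S], rule that)
  \<comment> \<open>A uniform Cauchy condition instead of convergence: it does not mention a limit
    that would depend on \<open>i\<close>, and it is inherited by subsequences, as the diagonal
    argument requires. The limit is defined pointwise afterwards.\<close>
  define P where "P i r \<longleftrightarrow> (\<forall>e>0. \<exists>J. \<forall>m\<ge>J. \<forall>n\<ge>J. \<forall>w\<in>C i. cmod (f (r m) w - f (r n) w) < e)" for i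
      and r :: "nat \<Rightarrow> nat"
  obtain k where k: "strict_mono (k :: nat \<Rightarrow> nat)" "\<And>i. P i (id \<circ> k)"
  proof (rule subsequence_diagonalization_lemma[where P = P and r = id])
    fix i and r :: "nat \<Rightarrow> nat"
    obtain M where M: "\<And>j w. w \<in> C i \<Longrightarrow> cmod (f j w) \<le> M" using bdd[OF C(1,2)] by blast
    have "\<exists>d. 0 < d \<and> (\<forall>n y. y \<in> C i \<and> norm (x - y) < d \<longrightarrow> norm (f (r n) x - f (r n) y) < e)" if x: "x \<in> C i"
        and e: "0 < e" for x e
    proof -
      obtain \<delta> where \<delta>: "0 < \<delta>" "cball x \<delta> \<subseteq> S" using S x C(2) open_contains_cball by blast
      obtain M' where M': "\<And>j w. w \<in> cball x \<delta> \<Longrightarrow> cmod (f j w) \<le> M'" using bdd[OF compact_cball \<delta>(2)] by blast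
      have M0: "0 \<le> M'" using M'[of x] \<delta> norm_ge_zero order_trans by (metis centre_in_cball less_imp_le)
      have sub: "ball x \<delta> \<subseteq> S" using \<delta> ball_subset_cball by blast
      \<comment> \<open>Solved from the Lipschitz bound \<open>18 M' d / \<delta> < e\<close>; the
        added 1 avoids division by zero if \<open>M' = 0\<close>.\<close>
      define d where "d = min (\<delta> / 2) (e * \<delta> / (18 * M' + 1))"
      have "0 < d" using \<delta> e M0 by (simp add: d_def)
      moreover have "norm (f (r n) x - f (r n) y) < e" if y: "norm (x - y) < d" for n y
      proof -
        have v: "norm (y - x) < \<delta> / 2" "norm (y - x) < e * \<delta> / (18 * M' + 1)" using y
            by (auto simp: d_def norm_minus_commute)
        have "norm (f (r n) (x + (y - x)) - f (r n) x) \<le> 18 * M' * norm (y - x) / \<delta>"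
          by (rule holo_on_lipschitz[OF holo_on_subset[OF hol sub] _ v(1)]) (use M' ball_subset_cball in blast)
        also have "\<dots> \<le> (18 * M' + 1) * norm (y - x) / \<delta>" using \<delta>
            by (intro divide_right_mono mult_right_mono) auto
        also have "\<dots> < e" using v(2) \<delta> M0 by (simp add: field_simps)
        finally show ?thesis by (simp add: norm_minus_commute)
      qed
      ultimately show ?thesis by blast
    qed
    then obtain g' k' where g': "continuous_on (C i) g'" "strict_mono (k' :: nat \<Rightarrow> nat)"
       "\<And>e. 0 < e \<Longrightarrow> \<exists>N. \<forall>n x. n \<ge> N \<and> x \<in> C i \<longrightarrow> norm (f (r (k' n)) x - g' x) < e"
      using Arzela_Ascoli[OF C(1)[of i], of "\<lambda>n. f (r n)" M] M by metis
    have "P i (r \<circ> k')"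
      unfolding P_def
    proof (intro allI impI)
      fix e :: real assume "0 < e"
      then obtain N where N: "\<And>n x. n \<ge> N \<Longrightarrow> x \<in> C i \<Longrightarrow> norm (f (r (k' n)) x - g' x) < e / 2"
          using g'(3)[of "e/2"] by auto
      have "cmod (f ((r \<circ> k') m) w - f ((r \<circ> k') n) w) < e" if "m \<ge> N" "n \<ge> N" "w \<in> C i" for m n w
        using N[OF that(1,3)] N[OF that(2,3)] norm_triangle_ineq4[of "f (r (k' m)) w - g' w" "f (r (k' n)) w
            - g' w"] by simp
      then show "\<exists>J. \<forall>m\<ge>J. \<forall>n\<ge>J. \<forall>w\<in>C i. cmod (f ((r \<circ> k') m) w - f ((r \<circ> k') n) w) < e" by blast
    qed
    then show "\<exists>k. strict_mono (k :: nat \<Rightarrow> nat) \<and> P i (r \<circ> k)" using g'(2) by blast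
  next
    fix i N and r k1 k2 :: "nat \<Rightarrow> nat"
    assume P1: "P i (r \<circ> k1)" and k2: "\<And>j. N \<le> j \<Longrightarrow> \<exists>j'. j \<le> j' \<and> k2 j = k1 j'"
    show "P i (r \<circ> k2)"
      unfolding P_def
    proof (intro allI impI)
      fix e :: real assume "0 < e"
      then obtain J where J: "\<forall>m\<ge>J. \<forall>n\<ge>J. \<forall>w\<in>C i. cmod (f ((r \<circ> k1) m) w - f ((r \<circ> k1) n) w) < e" using P1
          unfolding P_def by blast
      have "cmod (f ((r \<circ> k2) m) w - f ((r \<circ> k2) n) w) < e" if "m \<ge> max N J" "n \<ge> max N J" "w \<in> C i" for m n w
      proof -
        obtain m' n' where "m \<le> m'" "k2 m = k1 m'" "n \<le> n'" "k2 n = k1 n'"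
            using k2[of m] k2[of n] \<open>m \<ge> max N J\<close> \<open>n \<ge> max N J\<close> by auto
        then show ?thesis using J that by auto
      qed
      then show "\<exists>J. \<forall>m\<ge>J. \<forall>n\<ge>J. \<forall>w\<in>C i. cmod (f ((r \<circ> k2) m) w - f ((r \<circ> k2) n) w) < e" by blast
    qed
  next
    fix k :: "nat \<Rightarrow> nat" assume "strict_mono k" "\<And>i. P i (id \<circ> k)"
    then show thesis by (rule that)
  qed
  define g where "g w = lim (\<lambda>j. f (k j) w)" for w
  have cauchy: "\<exists>J. \<forall>m\<ge>J. \<forall>n\<ge>J. \<forall>w\<in>K. cmod (f (k m) w - f (k n) w) < e"
      if K: "compact K" "K \<subseteq> S" "0 < e" for K e
  proof -
    obtain i where i: "K \<subseteq> C i" using C(5)[OF K(1,2)] by blast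
    then show ?thesis using k(2)[of i] K(3) unfolding P_def by (simp add: subset_iff) blast
  qed
  have pw: "(\<lambda>j. f (k j) w) \<longlonglongrightarrow> g w" if "w \<in> S" for w
  proof -
    have "Cauchy (\<lambda>j. f (k j) w)"
    proof (rule CauchyI)
      fix e :: real assume "0 < e"
      then show "\<exists>M. \<forall>m\<ge>M. \<forall>n\<ge>M. norm (f (k m) w - f (k n) w) < e"
        using cauchy[of "{w}" e] that by simp
    qed
    then show ?thesis by (simp add: g_def convergent_LIMSEQ_iff Cauchy_convergent_iff)
  qed
  have unif: "\<exists>J. \<forall>j\<ge>J. \<forall>w\<in>K. cmod (f (k j) w - g w) < e" if K: "compact K" "K \<subseteq> S" and e: "0 < e" for K e
  proof -
    obtain J where J: "\<And>m n w. m \<ge> J \<Longrightarrow> n \<ge> J \<Longrightarrow> w \<in> K \<Longrightarrow> cmod (f (k m) w - f (k n) w) < e / 2"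
      using cauchy[OF K, of "e/2"] e by auto
    have "cmod (f (k j) w - g w) < e" if j: "j \<ge> J" and w: "w \<in> K" for j w
    proof -
      have "(\<lambda>n. cmod (f (k j) w - f (k n) w)) \<longlonglongrightarrow> cmod (f (k j) w - g w)"
        by (intro tendsto_intros pw) (use w K in auto)
      then have "cmod (f (k j) w - g w) \<le> e / 2"
        by (rule LIMSEQ_le_const2) (use J[OF j _ w] in \<open>auto intro!: exI[of _ J] less_imp_le\<close>)
      then show ?thesis using e by simp
    qed
    then show ?thesis by blast
  qed
  have "holo_on g S"
    unfolding holo_on_def
  proof
    fix z assume z: "z \<in> S"
    then obtain \<delta> where \<delta>: "0 < \<delta>" "cball z \<delta> \<subseteq> S" using S open_contains_cball by blast
    obtain M where M: "\<And>j w. w \<in> cball z \<delta> \<Longrightarrow> cmod (f j w) \<le> M" using bdd[OF compact_cball \<delta>(2)] by blast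
    have sub: "ball z \<delta> \<subseteq> cball z \<delta>" by auto
    show "\<exists>L. complex_derivative g L z"
    proof (rule holo_uniform_limit[of "\<lambda>j. f (k j)" z \<delta> M])
      show "holo_on (f (k j)) (ball z \<delta>)" for j using holo_on_subset[OF hol] \<delta> sub by blast
      show "cmod (f (k j) w) \<le> M" if "w \<in> ball z \<delta>" for j w using M that sub by blast
      show "\<exists>J. \<forall>j\<ge>J. \<forall>w\<in>ball z \<delta>. cmod (f (k j) w - g w) < e" if "0 < e" for e
        using unif[OF compact_cball \<delta>(2) that] sub by blast
    qed (rule \<delta>)
  qed
  then show ?thesis using that k(1) unif by blast
qed

section \<open>Bergman spaces and Toeplitz integrals\<close>

text \<open>The \<open>p\<close>-th power of the quasinorm with values in \<open>ennreal\<close>, so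
  that estimates can be made before finiteness is known and without taking roots.\<close>

definition lp_int :: "real \<Rightarrow> real \<Rightarrow> (complex ^ 'n::{finite,wellorder} \<Rightarrow> complex) \<Rightarrow> ennreal" where
  "lp_int p \<alpha> f = (\<integral>\<^sup>+z. ennreal (cmod (f z) powr p) \<partial>wmeas \<alpha>)"

lemma lp_int_cong: "(\<And>z. z \<in> tube \<Longrightarrow> f z = g z) \<Longrightarrow> lp_int p \<alpha> f = lp_int p \<alpha> g"
  unfolding lp_int_def by (rule nn_integral_wmeas_cong) simp

text \<open>The bridge from the completed measure of the definitions to \<open>wmeas\<close>;
  continuity on the domain makes the integrand measurable for both.\<close>

lemma nn_integral_weighted_measure:
  fixes g :: "complex ^ 'n::{finite,wellorder} \<Rightarrow> real"
  assumes g: "continuous_on tube g"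
  shows "(\<integral>\<^sup>+z. ennreal (g z) \<partial>weighted_measure \<alpha>) = (\<integral>\<^sup>+z. ennreal (g z) \<partial>wmeas \<alpha>)"
proof -
  have m1: "(\<lambda>z. ennreal (rho_diag z powr \<alpha>)) \<in> borel_measurable (lebesgue_on (tube :: (complex ^ 'n::_) set))"
    by (intro measurable_restrict_space1 measurable_completion) measurable
  have m2: "g \<in> borel_measurable (lebesgue_on tube)"
    by (intro continuous_imp_measurable_on_sets_lebesgue g) simp
  have m3: "(\<lambda>z. indicator tube z *\<^sub>R g z) \<in> borel_measurable borel"
    by (intro borel_measurable_continuous_on_indicator g) measurable
  have "(\<integral>\<^sup>+z. ennreal (g z) \<partial>weighted_measure \<alpha>) = (\<integral>\<^sup>+z. ennreal (rho_diag z powr \<alpha>) * ennreal (g z)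
      \<partial>lebesgue_on tube)"
    unfolding weighted_measure_def using m1 m2 by (intro nn_integral_density) auto
  also have "\<dots> = (\<integral>\<^sup>+z. ennreal (rho_diag z powr \<alpha>) * ennreal (g z) * indicator tube z \<partial>lborel)"
    by (subst nn_integral_restrict_space) (auto simp: nn_integral_completion)
  also have "\<dots> = (\<integral>\<^sup>+z. ennreal (indicator tube z * rho_diag z powr \<alpha>) * ennreal (indicator tube z *\<^sub>R g z)
      \<partial>lborel)"
    by (intro nn_integral_cong) (auto simp: indicator_def)
  also have "\<dots> = (\<integral>\<^sup>+z. ennreal (indicator tube z *\<^sub>R g z) \<partial>wmeas \<alpha>)"
    by (intro nn_integral_wmeas[symmetric] measurable_compose[OF m3 measurable_ennreal])
  also have "\<dots> = (\<integral>\<^sup>+z. ennreal (g z) \<partial>wmeas \<alpha>)"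
    by (rule nn_integral_wmeas_cong) simp
  finally show ?thesis .
qed

lemma holomorphic_tube_continuous: "holomorphic_tube f \<Longrightarrow> continuous_on tube f"
  by (simp add: holomorphic_tube_iff holo_on_continuous)

lemma continuous_on_cmod_powr:
  "0 < p \<Longrightarrow> continuous_on S f \<Longrightarrow> continuous_on S (\<lambda>z. cmod (f z) powr p)"
  by (intro continuous_on_powr' continuous_intros) auto

text \<open>Functions on the domain have arbitrary values outside of it and become Borel measurable
  only after multiplication by the indicator of a subset.\<close>

lemma cmod_powr_borel:
  assumes "holomorphic_tube f" "B \<in> sets borel" "B \<subseteq> tube"
  shows "(\<lambda>z. ennreal (cmod (f z) powr p) * indicator B z) \<in> borel_measurable borel"
proof -
  have "(\<lambda>z. indicator B z *\<^sub>R f z) \<in> borel_measurable borel"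
    by (intro borel_measurable_continuous_on_indicator assms(2) continuous_on_subset[OF
        holomorphic_tube_continuous[OF assms(1)] assms(3)])
  then have "(\<lambda>z. ennreal (cmod (indicator B z *\<^sub>R f z) powr p) * indicator B z) \<in> borel_measurable borel"
    using assms(2) by measurable
  also have "(\<lambda>z. ennreal (cmod (indicator B z *\<^sub>R f z) powr p) * indicator B z)
      = (\<lambda>z. ennreal (cmod (f z) powr p) * indicator B z)"
    by (auto simp: indicator_def fun_eq_iff)
  finally show ?thesis .
qed

lemma measurable_weighted_measure:
  assumes "0 < p" "holomorphic_tube f"
  shows "(\<lambda>z. cmod (f z) powr p) \<in> borel_measurable (weighted_measure \<alpha>)"
proof -
  have "(\<lambda>z. cmod (f z) powr p) \<in> borel_measurable (lebesgue_on tube)"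
    using assms by (intro continuous_imp_measurable_on_sets_lebesgue
        continuous_on_cmod_powr holomorphic_tube_continuous) auto
  then show ?thesis by (simp add: weighted_measure_def)
qed

lemma bergman_space_iff:
  assumes "0 < p"
  shows "f \<in> bergman_space p \<alpha> \<longleftrightarrow> holomorphic_tube f \<and> lp_int p \<alpha> f < \<infinity>"
proof (cases "holomorphic_tube f")
  case True
  have "f \<in> borel_measurable (lebesgue_on tube)"
    using True by (intro continuous_imp_measurable_on_sets_lebesgue holomorphic_tube_continuous) auto
  moreover have "integrable (weighted_measure \<alpha>) (\<lambda>z. cmod (f z) powr p) \<longleftrightarrow> lp_int p \<alpha> f < \<infinity>"
    using measurable_weighted_measure[OF assms True]
      nn_integral_weighted_measure[OF continuous_on_cmod_powr[OF assms holomorphic_tube_continuous[OF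
          True]], of \<alpha>]
    by (simp add: integrable_iff_bounded lp_int_def)
  ultimately show ?thesis using True by (simp add: bergman_space_def Lp_space_def)
qed (simp add: bergman_space_def)

lemma Lp_norm_eq:
  assumes "0 < p" "holomorphic_tube f"
  shows "Lp_norm p \<alpha> f = enn2real (lp_int p \<alpha> f) powr (1 / p)"
  unfolding Lp_norm_def using measurable_weighted_measure[OF assms]
    nn_integral_weighted_measure[OF continuous_on_cmod_powr[OF assms(1) holomorphic_tube_continuous[OF
        assms(2)]], of \<alpha>]
  by (subst integral_eq_nn_integral) (auto simp: lp_int_def)

lemma Lp_norm_powr:
  assumes "0 < p" "f \<in> bergman_space p \<alpha>"
  shows "lp_int p \<alpha> f = ennreal (Lp_norm p \<alpha> f powr p)"
  using assms by (simp add: bergman_space_iff Lp_norm_eq powr_powr ennreal_enn2real)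

lemma Lp_norm_nonneg: "0 \<le> Lp_norm p \<alpha> f"
  by (simp add: Lp_norm_def)

lemma Lp_norm_leI:
  assumes p: "0 < p" and f: "holomorphic_tube f" and le: "lp_int p \<alpha> f \<le> ennreal (C powr p)" and C: "0 \<le> C"
  shows "Lp_norm p \<alpha> f \<le> C"
proof -
  have "enn2real (lp_int p \<alpha> f) \<le> C powr p" using le by (intro enn2real_leI) auto
  then have "enn2real (lp_int p \<alpha> f) powr (1 / p) \<le> (C powr p) powr (1 / p)" using p by (intro powr_mono2) auto
  then show ?thesis using p C by (simp add: Lp_norm_eq[OF p f] powr_powr)
qed

text \<open>The complex linear part of the affine map \<open>aut a\<close>, which is its derivative
  at every point.\<close>

definition aut_linear :: "complex ^ 'n::{finite,wellorder} \<Rightarrow> complex ^ 'n::_ \<Rightarrow> complex ^ 'n::_" where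
  "aut_linear a v = (\<chi> j. if j = last_ix
     then of_real (rho_diag a) * v $ j
        + 2 * of_real (sqrt (rho_diag a)) * (\<Sum>i\<in>UNIV - {last_ix}. of_real (Im (a $ i)) * v $ i)
     else of_real (sqrt (rho_diag a)) * v $ j)"

lemma aut_linear_add: "aut_linear a (v + w) = aut_linear a v + aut_linear a w"
  by (simp add: aut_linear_def vec_eq_iff algebra_simps sum.distrib)

lemma aut_linear_smult: "aut_linear a (c *s v) = c *s aut_linear a v"
  by (simp add: aut_linear_def vec_eq_iff algebra_simps sum_distrib_left)

lemma aut_eq_aut_linear: "aut a z = aut_linear a z + aut a 0"
  by (simp add: aut_linear_def aut_def vec_eq_iff)

lemma holomorphic_tube_aut:
  fixes f :: "complex ^ 'n::{finite,wellorder} \<Rightarrow> complex"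
  assumes f: "holomorphic_tube f" and a: "a \<in> tube"
  shows "holomorphic_tube (\<lambda>z. f (aut a z))"
  unfolding holomorphic_tube_def
proof
  fix z :: "complex ^ 'n::_" assume "z \<in> tube"
  then have "aut a z \<in> tube" using a aut_tube by blast
  then obtain f' where f': "(f has_derivative f') (at (aut a z))" "\<forall>c v. f' (c *s v) = c * f' v"
    using f by (auto simp: holomorphic_tube_def)
  have "linear (aut_linear a)"
  proof (rule linearI)
    fix r and v :: "complex ^ 'n::_"
    have "r *\<^sub>R v = complex_of_real r *s v" for v :: "complex ^ 'n::_"
        by (simp add: vec_eq_iff scaleR_conv_of_real[where 'a = complex])
    then show "aut_linear a (r *\<^sub>R v) = r *\<^sub>R aut_linear a v" by (simp add: aut_linear_smult)
  qed (rule aut_linear_add)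
  then have "bounded_linear (aut_linear a)" by (simp add: linear_conv_bounded_linear)
  then have "((\<lambda>z. aut_linear a z + aut a 0) has_derivative (\<lambda>v. aut_linear a v + 0)) (at z)"
    by (rule has_derivative_add[OF bounded_linear.has_derivative[OF _ has_derivative_ident]
        has_derivative_const])
  then have "(aut a has_derivative aut_linear a) (at z)"
  proof -
    have eq: "aut a = (\<lambda>z. aut_linear a z + aut a 0)" by (rule ext) (rule aut_eq_aut_linear)
    show ?thesis by (subst eq) (use \<open>((\<lambda>z. aut_linear a z + aut a 0) has_derivative (\<lambda>v. aut_linear a v
        + 0)) (at z)\<close> in simp)
  qed
  from has_derivative_compose[OF this f'(1)]
  show "\<exists>f'. ((\<lambda>z. f (aut a z)) has_derivative f') (at z) \<and> (\<forall>c v. f' (c *s v) = c * f' v)"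
    using f'(2) by (intro exI[of _ "\<lambda>v. f' (aut_linear a v)"]) (simp add: aut_linear_smult)
qed

section \<open>Pointwise estimates in terms of Bergman balls\<close>

text \<open>At \<open>base_point\<close> this is the Euclidean mean value inequality on a ball
  inside \<open>bergman_ball base_point 1\<close>, where the weight is bounded below. Transport by
  \<open>aut w\<close> produces the power of \<open>rho_diag w\<close>, up to a constant the
  reciprocal volume of the ball when \<open>-1 < \<alpha>\<close>.\<close>

lemma cmod_powr_le_at_center:
  fixes p \<alpha> :: real
  assumes p: "0 < p"
  shows "\<exists>C\<ge>0. \<forall>f. \<forall>w\<in>(tube :: (complex ^ 'n::{finite,wellorder}) set). holomorphic_tube f \<longrightarrow>
    ennreal (cmod (f w) powr p) \<le> ennreal (C * rho_diag w powr (-(real CARD('n) + 1 + \<alpha>))) *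
       (\<integral>\<^sup>+z. ennreal (cmod (f z) powr p) * indicator (bergman_ball w 1) z \<partial>wmeas \<alpha>)"
proof -
  define B where "B = bergman_ball (base_point :: complex ^ 'n::_) 1"
  have B: "open B" "base_point \<in> B" "B \<subseteq> tube"
    unfolding B_def by (auto intro: open_bergman_ball bergman_ball_self bergman_ball_subset_tube[THEN subsetD])
  obtain \<delta> where \<delta>: "0 < \<delta>" "cball base_point \<delta> \<subseteq> B" using B open_contains_cball by blast
  obtain C1 where C1: "0 < C1" "\<And>(f :: complex ^ 'n::_ \<Rightarrow> complex) S z. holo_on f S \<Longrightarrow> cball z \<delta> \<subseteq> S \<Longrightarrow>
    ennreal (cmod (f z) powr p) \<le> ennreal C1 * (\<integral>\<^sup>+w. ennreal (cmod (f w) powr p) * indicator (cball z \<delta>) w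
        \<partial>lborel)"
    using cmod_powr_le_ball_mean[OF \<delta>(1) p, where 'n = 'n] by blast
  define q where "q = 4 * (cosh 1 :: real)\<^sup>2"
  have q: "0 < q" by (simp add: q_def)
  \<comment> \<open>On \<open>B\<close> the values of \<open>rho_diag\<close> lie between
    \<open>1 / q\<close> and \<open>q\<close>, so \<open>q powr \<bar>\<alpha>\<bar>\<close>
    compensates the weight for either sign of \<open>\<alpha>\<close>.\<close>
  define C2 where "C2 = q powr \<bar>\<alpha>\<bar>"
  have C2: "0 < C2" using q by (simp add: C2_def)
  have wt: "1 \<le> C2 * rho_diag z powr \<alpha>" if z: "z \<in> B" for z
  proof -
    have zt: "z \<in> tube" using z B by auto
    have hz: "0 < rho_diag z" using zt by (simp add: tube_iff)
    have up: "rho_diag z \<le> q" and low: "1 / q \<le> rho_diag z"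
      using bergman_ball_rho_diag_le[OF base_point_tube, of z 1] bergman_ball_rho_diag_ge[OF
          base_point_tube, of z 1] z q
      by (auto simp: B_def q_def field_simps)
    show ?thesis
    proof (cases "0 \<le> \<alpha>")
      case True
      have "(1 / q) powr \<alpha> \<le> rho_diag z powr \<alpha>" using low q True by (intro powr_mono2) auto
      then show ?thesis using q True by (simp add: C2_def powr_divide field_simps)
    next
      case False
      have "q powr \<alpha> \<le> rho_diag z powr \<alpha>" using up hz False by (intro powr_mono2') auto
      then have "q powr (-\<alpha>) * q powr \<alpha> \<le> q powr (-\<alpha>) * rho_diag z powr \<alpha>" by (intro mult_left_mono) auto
      then show ?thesis using q False by (simp add: C2_def powr_add[symmetric])
    qed
  qed
  show ?thesis
  proof (intro exI[of _ "C1 * C2"] conjI allI ballI impI)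
    fix f :: "complex ^ 'n::_ \<Rightarrow> complex" and w :: "complex ^ 'n::_" assume w: "w \<in> tube"
        and f: "holomorphic_tube f"
    define g where "g z = f (aut w z)" for z
    have g: "holomorphic_tube g" unfolding g_def by (rule holomorphic_tube_aut[OF f w])
    have R: "0 < rho_diag w" using w by (simp add: tube_iff)
    have gB: "(\<lambda>z. ennreal (cmod (g z) powr p) * indicator B z) \<in> borel_measurable borel"
      by (rule cmod_powr_borel[OF g]) (use B in auto)
    have fB: "(\<lambda>z. ennreal (cmod (f z) powr p) * indicator (bergman_ball w 1) z) \<in> borel_measurable borel"
      by (rule cmod_powr_borel[OF f]) (use w bergman_ball_subset_tube in auto)
    define Y where "Y = (\<integral>\<^sup>+z. ennreal (cmod (g z) powr p) * indicator B z \<partial>wmeas \<alpha>)"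
    define X where "X = (\<integral>\<^sup>+z. ennreal (cmod (f z) powr p) * indicator (bergman_ball w 1) z \<partial>wmeas \<alpha>)"
    define m where "m = real CARD('n) + 1 + \<alpha>"
    have "X = ennreal (rho_diag w powr m) * Y"
    proof -
      have "X = ennreal (rho_diag w powr m) * (\<integral>\<^sup>+z. ennreal (cmod (f (aut w z)) powr p)
          * indicator (bergman_ball w 1) (aut w z) \<partial>wmeas \<alpha>)"
        unfolding X_def m_def using nn_integral_wmeas_aut[OF w fB] by simp
      also have "(\<lambda>z. ennreal (cmod (f (aut w z)) powr p) * indicator (bergman_ball w 1) (aut w z))
          = (\<lambda>z. ennreal (cmod (g z) powr p) * indicator B z)"
        using bergman_ball_aut[OF w] by (auto simp: g_def B_def indicator_def fun_eq_iff)
      finally show ?thesis by (simp add: Y_def)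
    qed
    then have "ennreal (rho_diag w powr (-m)) * X = (ennreal (rho_diag w powr (-m))
        * ennreal (rho_diag w powr m)) * Y"
      by (simp add: mult.assoc)
    also have "ennreal (rho_diag w powr (-m)) * ennreal (rho_diag w powr m) = 1"
      using R by (simp add: ennreal_mult[symmetric] powr_add[symmetric])
    finally have Y: "Y = ennreal (rho_diag w powr (-m)) * X" by simp
    have "ennreal (cmod (f w) powr p) = ennreal (cmod (g base_point) powr p)"
      by (simp add: g_def aut_base[OF w])
    also have "\<dots> \<le> ennreal C1 * (\<integral>\<^sup>+z. ennreal (cmod (g z) powr p) * indicator (cball base_point \<delta>) z \<partial>lborel)"
      using C1(2)[of g tube base_point] g \<delta> B by (auto simp: holomorphic_tube_iff)
    also have "\<dots> \<le> ennreal C1 * (\<integral>\<^sup>+z. ennreal C2 * (ennreal (indicator tube z * rho_diag z powr \<alpha>)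
        * (ennreal (cmod (g z) powr p) * indicator B z)) \<partial>lborel)"
    proof (intro mult_left_mono nn_integral_mono)
      fix z
      show "ennreal (cmod (g z) powr p) * indicator (cball base_point \<delta>) z
          \<le> ennreal C2 * (ennreal (indicator tube z * rho_diag z powr \<alpha>) * (ennreal (cmod (g z) powr p)
          * indicator B z))"
      proof (cases "z \<in> cball base_point \<delta>")
        case True
        then have z: "z \<in> B" "z \<in> tube" using \<delta> B by auto
        have "1 * cmod (g z) powr p \<le> (C2 * rho_diag z powr \<alpha>) * cmod (g z) powr p"
          using wt[OF z(1)] by (intro mult_right_mono) auto
        then show ?thesis using True z C2 by (simp add: ennreal_mult[symmetric] ennreal_leI mult.assoc)
      qed simp
    qed simp
    also have "\<dots> = ennreal C1 * (ennreal C2 * Y)"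
      unfolding Y_def using gB by (subst nn_integral_cmult) (auto simp: nn_integral_wmeas)
    also have "\<dots> = ennreal (C1 * C2 * rho_diag w powr (-m)) * X"
      unfolding Y using C1 C2 by (simp add: ennreal_mult mult.assoc)
    finally show "ennreal (cmod (f w) powr p) \<le> ennreal (C1 * C2 * rho_diag w powr (-(real CARD('n) + 1 + \<alpha>))) *
       (\<integral>\<^sup>+z. ennreal (cmod (f z) powr p) * indicator (bergman_ball w 1) z \<partial>wmeas \<alpha>)"
      by (simp add: X_def m_def)
  qed (use C1 C2 in simp)
qed

text \<open>The unit ball around \<open>w\<close> lies in one fixed larger ball around
  \<open>a\<close>, and \<open>rho_diag\<close> is comparable at both centres, so the same integral
  serves all \<open>w\<close> in the ball.\<close>

lemma cmod_powr_le_on_ball: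
  fixes p \<alpha> r :: real
  assumes p: "0 < p" and \<alpha>: "-1 < \<alpha>" and r: "0 < r"
  shows "\<exists>R>0. \<exists>C\<ge>0. \<forall>f. \<forall>a\<in>(tube :: (complex ^ 'n::{finite,wellorder}) set). \<forall>w\<in>bergman_ball a r.
      holomorphic_tube f \<longrightarrow>
    ennreal (cmod (f w) powr p) \<le> ennreal (C * rho_diag a powr (-(real CARD('n) + 1 + \<alpha>))) *
       (\<integral>\<^sup>+z. ennreal (cmod (f z) powr p) * indicator (bergman_ball a R) z \<partial>wmeas \<alpha>)"
proof -
  define m where "m = real CARD('n) + 1 + \<alpha>"
  have m: "0 < m" using \<alpha> by (simp add: m_def add_nonneg_pos add.assoc)
  obtain C where C: "0 \<le> C" "\<And>f w. w \<in> (tube :: (complex ^ 'n::_) set) \<Longrightarrow> holomorphic_tube f \<Longrightarrow>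
    ennreal (cmod (f w) powr p) \<le> ennreal (C * rho_diag w powr (-m)) *
       (\<integral>\<^sup>+z. ennreal (cmod (f z) powr p) * indicator (bergman_ball w 1) z \<partial>wmeas \<alpha>)"
    using cmod_powr_le_at_center[OF p, of \<alpha>, where 'n = 'n] unfolding m_def by blast
  define r0 where "r0 = max r 1"
  have r0: "0 < r0" by (simp add: r0_def)
  obtain R where R: "0 < R" "12 * (cosh r0)\<^sup>2 \<le> cosh R" using cosh_unbounded by blast
  define q where "q = 4 * (cosh r)\<^sup>2"
  have q: "0 < q" by (simp add: q_def)
  show ?thesis
  proof (rule exI[of _ R], rule conjI[OF R(1)], rule exI[of _ "C * q powr m"], intro conjI allI ballI impI)
    fix f :: "complex ^ 'n::_ \<Rightarrow> complex" and a w :: "complex ^ 'n::_"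
    assume a: "a \<in> tube" and w: "w \<in> bergman_ball a r" and f: "holomorphic_tube f"
    have wt: "w \<in> tube" using w bergman_ball_subset_tube by blast
    have pos: "0 < rho_diag a" "0 < rho_diag w" using a wt by (auto simp: tube_iff)
    have "rho_diag a \<le> q * rho_diag w" unfolding q_def by (rule bergman_ball_rho_diag_ge[OF a w r])
    then have "rho_diag w powr (-m) \<le> (rho_diag a / q) powr (-m)"
      using pos q m by (intro powr_mono2') (auto simp: field_simps)
    also have "\<dots> = q powr m * rho_diag a powr (-m)"
      using pos q by (simp add: powr_divide powr_minus_divide)
    finally have le: "C * rho_diag w powr (-m) \<le> C * q powr m * rho_diag a powr (-m)"
      using C(1) by (simp add: mult_left_mono mult.assoc)
    have sub: "bergman_ball w 1 \<subseteq> bergman_ball a R"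
    proof
      fix v assume "v \<in> bergman_ball w 1"
      then have "v \<in> bergman_ball w r0" "w \<in> bergman_ball a r0"
        using bergman_ball_mono[of 1 r0 w] bergman_ball_mono[of r r0 a] w by (auto simp: r0_def)
      then show "v \<in> bergman_ball a R" using bergman_ball_trans[OF a _ _ r0 R] by blast
    qed
    have "ennreal (cmod (f w) powr p) \<le> ennreal (C * rho_diag w powr (-m)) *
       (\<integral>\<^sup>+z. ennreal (cmod (f z) powr p) * indicator (bergman_ball w 1) z \<partial>wmeas \<alpha>)"
      by (rule C(2)[OF wt f])
    also have "\<dots> \<le> ennreal (C * q powr m * rho_diag a powr (-m)) *
       (\<integral>\<^sup>+z. ennreal (cmod (f z) powr p) * indicator (bergman_ball a R) z \<partial>wmeas \<alpha>)"
      using sub by (intro mult_mono[OF ennreal_leI[OF le] nn_integral_mono]) (auto simp: indicator_def)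
    finally show "ennreal (cmod (f w) powr p) \<le> ennreal (C * q powr m * rho_diag a powr (-(real CARD('n) + 1
        + \<alpha>))) *
       (\<integral>\<^sup>+z. ennreal (cmod (f z) powr p) * indicator (bergman_ball a R) z \<partial>wmeas \<alpha>)"
      by (simp add: m_def)
  qed (use C in simp)
qed

section \<open>Holomorphy of the kernel and of Toeplitz integrals\<close>

definition rho_deriv :: "complex ^ 'n::{finite,wellorder} \<Rightarrow> complex ^ 'n::_ \<Rightarrow> complex ^ 'n::_ \<Rightarrow> complex" where
  "rho_deriv z w v = (1/4) * (2 * (\<Sum>j\<in>UNIV - {last_ix}. (z $ j - cnj (w $ j)) * v $ j) - 2 * \<i> * v $ last_ix)"

lemma rho_deriv_add: "rho_deriv z w (v + u) = rho_deriv z w v + rho_deriv z w u"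
proof -
  have "(\<Sum>j\<in>UNIV - {last_ix}. (z $ j - cnj (w $ j)) * (v + u) $ j) =
    (\<Sum>j\<in>UNIV - {last_ix}. (z $ j - cnj (w $ j)) * v $ j) + (\<Sum>j\<in>UNIV - {last_ix}. (z $ j - cnj (w $ j)) * u $ j)"
    by (simp add: distrib_left sum.distrib)
  then show ?thesis unfolding rho_deriv_def by (simp only: vector_add_component distrib_left) (simp add:
      field_simps)
qed

lemma rho_deriv_smult: "rho_deriv z w (c *s v) = c * rho_deriv z w v"
proof -
  have "(\<Sum>j\<in>UNIV - {last_ix}. (z $ j - cnj (w $ j)) * (c *s v) $ j)
      = c * (\<Sum>j\<in>UNIV - {last_ix}. (z $ j - cnj (w $ j)) * v $ j)"
    unfolding sum_distrib_left by (intro sum.cong) auto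
  then show ?thesis unfolding rho_deriv_def by (simp only: vector_smult_component) (simp add:
      right_diff_distrib)
qed

text \<open>As a function of \<open>z\<close>, \<open>rho z w\<close> is a quadratic polynomial, so
  its remainder is exactly a quarter of the sum of the horizontal \<open>(v $ j)^2\<close>.\<close>

lemma rho_complex_derivative:
  fixes z w :: "complex ^ 'n::{finite,wellorder}"
  shows "complex_derivative (\<lambda>z. rho z w) (rho_deriv z w) z"
proof (rule complex_derivativeI[where \<delta> = 1 and K = "1/4"])
  let ?S = "UNIV - {last_ix} :: 'n set"
  fix v :: "complex ^ 'n::_"
  have "(\<Sum>j\<in>?S. ((z + v) $ j - cnj (w $ j))\<^sup>2) = (\<Sum>j\<in>?S. (z $ j - cnj (w $ j))\<^sup>2) + 2
      * (\<Sum>j\<in>?S. (z $ j - cnj (w $ j)) * v $ j) + (\<Sum>j\<in>?S. (v $ j)\<^sup>2)"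
    unfolding sum_distrib_left sum.distrib[symmetric]
        by (intro sum.cong) (auto simp: power2_eq_square algebra_simps)
  then have "rho (z + v) w - rho z w - rho_deriv z w v = (1/4) * (\<Sum>j\<in>?S. (v $ j)\<^sup>2)"
    unfolding rho_def rho_deriv_def by (simp add: right_diff_distrib distrib_left add_divide_distrib
        diff_divide_distrib del: sum_distrib_left)
  then have "cmod (rho (z + v) w - rho z w - rho_deriv z w v) = cmod ((1/4) * (\<Sum>j\<in>?S. (v $ j)\<^sup>2))"
      by (rule arg_cong)
  also have "\<dots> = (1/4) * cmod (\<Sum>j\<in>?S. (v $ j)\<^sup>2)" by (simp add: norm_mult norm_divide)
  also have "\<dots> \<le> (1/4) * (\<Sum>j\<in>?S. (cmod (v $ j))\<^sup>2)"
    using norm_sum[of "\<lambda>j. (v $ j)\<^sup>2" ?S] by (simp add: norm_power)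
  also have "\<dots> \<le> (1/4) * (\<Sum>j\<in>UNIV. (cmod (v $ j))\<^sup>2)"
    by (intro mult_left_mono sum_mono2) auto
  also have "(\<Sum>j\<in>UNIV. (cmod (v $ j))\<^sup>2) = (norm v)\<^sup>2"
    by (simp add: norm_vec_def L2_set_def sum_nonneg)
  finally show "cmod (rho (z + v) w - rho z w - rho_deriv z w v) \<le> 1 / 4 * (norm v)\<^sup>2" .
qed (auto simp: rho_deriv_add rho_deriv_smult)

lemma rho_powr_complex_derivative:
  fixes z w :: "complex ^ 'n::{finite,wellorder}"
  assumes "z \<in> tube" "w \<in> tube"
  shows "complex_derivative (\<lambda>z. rho z w powr c) (\<lambda>v. c * rho z w powr (c - 1) * rho_deriv z w v) z"
proof -
  have "rho z w \<notin> \<real>\<^sub>\<le>\<^sub>0" using Re_rho_pos[OF assms] by (auto simp: complex_nonpos_Reals_iff)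
  then have h: "((\<lambda>u. u powr c) has_derivative (*) (c * rho z w powr (c - 1))) (at (rho z w))"
    using has_field_derivative_powr by (simp add: has_field_derivative_def)
  have "((\<lambda>z. rho z w) has_derivative rho_deriv z w) (at z)"
    using rho_complex_derivative[of w z] unfolding complex_derivative_def by blast
  from has_derivative_compose[OF this h] show ?thesis
    by (simp add: complex_derivative_def rho_deriv_smult)
qed

lemma holo_on_rho_powr: "w \<in> tube \<Longrightarrow> holo_on (\<lambda>z. rho z w powr c) tube"
  unfolding holo_on_def using rho_powr_complex_derivative by blast

lemma norm_rho_powr: "cmod (rho z w powr of_real c) = cmod (rho z w) powr c"
  by (simp add: norm_powr_real_powr')

lemma continuous_on_rho_powr: "z \<in> tube \<Longrightarrow> continuous_on tube (\<lambda>w. rho z w powr c)"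
  using Re_rho_pos[of z] rho_nonzero[of z] by (intro continuous_on_powr_complex continuous_intros) (force
      intro: less_imp_le)+

text \<open>The derivative is homogeneous, so the restriction to short vectors in
  \<open>complex_derivative_bounds\<close> is removed by scaling.\<close>

lemma complex_derivative_bound:
  fixes f :: "complex ^ 'n \<Rightarrow> complex"
  assumes hol: "holo_on f (ball z \<delta>)" and M: "\<And>w. w \<in> ball z \<delta> \<Longrightarrow> cmod (f w) \<le> M"
    and f': "complex_derivative f f' z" and \<delta>: "0 < \<delta>"
  shows "cmod (f' v) \<le> 2 * M * norm v / \<delta>"
proof (cases "v = 0")
  case True
  have "f' (0 *s 0) = 0 * f' 0" using f' unfolding complex_derivative_def by blast
  then show ?thesis using True by simp
next
  case False
  define s where "s = \<delta> / (4 * norm v)"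
  have s: "0 < s" using False \<delta> by (simp add: s_def)
  have "norm (of_real s *s v) < \<delta> / 2" using False \<delta>
      by (simp add: norm_vector_smult s_def norm_divide norm_mult)
  from complex_derivative_bounds(1)[OF hol M f' this]
  have "cmod (of_real s * f' v) \<le> 2 * M * (s * norm v) / \<delta>"
    using f' s by (simp add: complex_derivative_def norm_vector_smult)
  then have "s * cmod (f' v) \<le> s * (2 * M * norm v / \<delta>)" using s by (simp add: norm_mult mult_ac)
  then show ?thesis by (rule mult_left_le_imp_le[OF _ s])
qed

lemma measurable_tube_measure:
  assumes "sets \<mu> = sets (restrict_space borel tube)" "continuous_on tube f"
  shows "f \<in> borel_measurable \<mu>"
  by (subst measurable_cong_sets[OF assms(1) refl]) (rule borel_measurable_continuous_on_restrict[OF assms(2)])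

lemma space_tube_measure:
  assumes "sets \<mu> = sets (restrict_space borel tube)"
  shows "space \<mu> = tube"
  using sets_eq_imp_space_eq[OF assms] by (simp add: space_restrict_space)

lemma toeplitz_integrand_eq:
  "toeplitz_integrand \<xi> f z w = f w * rho z (w :: complex ^ 'n::{finite,wellorder}) powr (- of_real (real
      CARD('n) + 1 + \<xi>))"
  unfolding toeplitz_integrand_def powr_minus_divide by simp

lemma cmod_toeplitz_integrand:
  "cmod (toeplitz_integrand \<xi> f z w) = cmod (f w) * cmod (rho z (w :: complex ^ 'n::{finite,wellorder}))
      powr (-(real CARD('n) + 1 + \<xi>))"
  unfolding toeplitz_integrand_eq norm_mult of_real_minus[symmetric] norm_rho_powr ..

lemma toeplitz_integrand_measurable:
  assumes "sets \<mu> = sets (restrict_space borel tube)" "continuous_on tube f" "z \<in> tube"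
  shows "toeplitz_integrand \<xi> f z \<in> borel_measurable \<mu>"
proof (rule measurable_tube_measure[OF assms(1)])
  have "toeplitz_integrand \<xi> f z = (\<lambda>w. f w * rho z w powr (- of_real (real CARD('a) + 1 + \<xi>)))"
    by (rule ext) (rule toeplitz_integrand_eq)
  then show "continuous_on tube (toeplitz_integrand \<xi> f z)"
    using assms by (auto intro!: continuous_intros continuous_on_rho_powr simp del: of_real_add
        of_real_of_nat_eq)
qed

lemma cmod_rho_powr_ball_le:
  assumes a: "a \<in> tube" "w \<in> bergman_ball a r" "0 < r" "z \<in> tube" and b: "0 \<le> b"
  shows "cmod (rho z w) powr (-b) \<le> (24 * (cosh r)\<^sup>2) powr b * cmod (rho z a) powr (-b)"
proof -
  define M where "M = 24 * (cosh r)\<^sup>2"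
  have M: "0 < M" by (simp add: M_def)
  have "cmod (rho z a) \<le> M * cmod (rho z w)" unfolding M_def by (rule bergman_ball_cmod_rho_ge[OF a])
  then have "(M * cmod (rho z w)) powr (-b) \<le> cmod (rho z a) powr (-b)"
    using cmod_rho_pos[OF a(4,1)] b by (intro powr_mono2') auto
  then have "M powr b * (M powr (-b) * cmod (rho z w) powr (-b)) \<le> M powr b * cmod (rho z a) powr (-b)"
    using M by (intro mult_left_mono) (auto simp: powr_mult)
  then show ?thesis
    using M unfolding M_def[symmetric] by (simp add: mult.assoc[symmetric] powr_add[symmetric])
qed

text \<open>Near \<open>z0\<close> the kernel is at most a constant times its value at
  \<open>z0\<close>, uniformly in \<open>w\<close>. Cauchy estimates in \<open>z\<close> then bound
  its derivative and its quadratic remainder by multiples of the same quantity, and this is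
  integrable because the integral converges absolutely at \<open>z0\<close>. Integrating the
  remainder bound gives differentiability with the integrated derivative.\<close>

lemma toeplitz_holomorphic:
  fixes f :: "complex ^ 'n::{finite,wellorder} \<Rightarrow> complex"
  assumes \<mu>: "sets \<mu> = sets (restrict_space borel tube)" and f: "continuous_on tube f" and \<xi>: "-1 < \<xi>"
    and int: "\<And>z. z \<in> tube \<Longrightarrow> integrable \<mu> (toeplitz_integrand \<xi> f z)"
  shows "holomorphic_tube (toeplitz \<mu> \<xi> f)"
  unfolding holomorphic_tube_iff holo_on_def
proof
  fix z0 :: "complex ^ 'n::_" assume z0: "z0 \<in> tube"
  define b where "b = real CARD('n) + 1 + \<xi>"
  have b: "0 < b" using \<xi> by (simp add: b_def add_nonneg_pos add.assoc)
  define k where "k = (\<lambda>z w :: complex ^ 'n::_. rho z w powr (- of_real b))"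
  have kf: "toeplitz_integrand \<xi> f z w = f w * k z w" for z w by (simp add: toeplitz_integrand_eq k_def b_def)
  have nk: "cmod (k z w) = cmod (rho z w) powr (-b)" for z w
    unfolding k_def of_real_minus[symmetric] norm_rho_powr ..
  define c where "c = - complex_of_real b"
  define D where "D w v = c * rho z0 w powr (c - 1) * rho_deriv z0 w v" for w v
  have D: "complex_derivative (\<lambda>z. k z w) (D w) z0" if "w \<in> tube" for w
    unfolding k_def D_def c_def by (rule rho_powr_complex_derivative[OF z0 that])
  have Dadd: "D w (v + u) = D w v + D w u" and Dsm: "D w (s *s v) = s * D w v" for w v u s
    unfolding D_def by (simp_all add: rho_deriv_add rho_deriv_smult algebra_simps)
  obtain \<delta> where \<delta>: "0 < \<delta>" "ball z0 \<delta> \<subseteq> bergman_ball z0 1"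
    using open_bergman_ball[OF z0, of 1] bergman_ball_self[OF z0, of 1] open_contains_ball
        by (metis zero_less_one)
  have sub: "ball z0 \<delta> \<subseteq> tube" using \<delta> bergman_ball_subset_tube by blast
  define M0 where "M0 = (24 * (cosh 1)\<^sup>2) powr b"
  have kb: "cmod (k z w) \<le> M0 * cmod (k z0 w)" if "z \<in> ball z0 \<delta>" "w \<in> tube" for z w
    unfolding nk M0_def using cmod_rho_powr_ball_le[OF z0 _ _ that(2), of z 1 b] that \<delta> b
    by (auto simp: cmod_rho_commute[of w])
  have hk: "holo_on (\<lambda>z. k z w) (ball z0 \<delta>)" if "w \<in> tube" for w
    unfolding k_def using holo_on_subset[OF holo_on_rho_powr[OF that] sub] .
  have Db: "cmod (D w v) \<le> 2 * (M0 * cmod (k z0 w)) * norm v / \<delta>" if "w \<in> tube" for w v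
    by (rule complex_derivative_bound[OF hk[OF that] kb[OF _ that] D[OF that] \<delta>(1)])
  have Kb: "cmod (k (z0 + v) w - k z0 w - D w v) \<le> 32 * (M0 * cmod (k z0 w)) * (norm v)\<^sup>2 / \<delta>\<^sup>2"
      if "w \<in> tube" "norm v < \<delta> / 2" for w v
    by (rule complex_derivative_bounds(2)[OF hk[OF that(1)] kb[OF _ that(1)] D[OF that(1)] that(2)])
  have int': "integrable \<mu> (\<lambda>w. f w * k z w)" if "z \<in> tube" for z
  proof -
    have "toeplitz_integrand \<xi> f z = (\<lambda>w. f w * k z w)" by (rule ext) (rule kf)
    then show ?thesis using int[OF that] by simp
  qed
  have sp: "space \<mu> = tube" by (rule space_tube_measure[OF \<mu>])
  have intD: "integrable \<mu> (\<lambda>w. f w * D w v)" for v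
  proof (rule Bochner_Integration.integrable_bound)
    show "integrable \<mu> (\<lambda>w. of_real (2 * M0 * norm v / \<delta>) * (f w * k z0 w))"
      by (intro integrable_mult_right int' z0)
    show "(\<lambda>w. f w * D w v) \<in> borel_measurable \<mu>"
      unfolding D_def rho_deriv_def by (rule measurable_tube_measure[OF \<mu>]) (intro continuous_intros f
          continuous_on_rho_powr z0)
    show "AE w in \<mu>. norm (f w * D w v) \<le> norm (of_real (2 * M0 * norm v / \<delta>) * (f w * k z0 w))"
    proof (rule AE_I2)
      fix w assume "w \<in> space \<mu>"
      then have w: "w \<in> tube" using sp by simp
      have "norm (f w * D w v) \<le> cmod (f w) * (2 * (M0 * cmod (k z0 w)) * norm v / \<delta>)"
        unfolding norm_mult by (intro mult_left_mono Db w) simp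
      also have "\<dots> = (2 * M0 * norm v / \<delta>) * (cmod (f w) * cmod (k z0 w))" by simp
      also have "\<dots> = norm (of_real (2 * M0 * norm v / \<delta>) * (f w * k z0 w))"
        using \<delta> unfolding norm_mult norm_of_real by (simp add: M0_def)
      finally show "norm (f w * D w v) \<le> norm (of_real (2 * M0 * norm v / \<delta>) * (f w * k z0 w))" .
    qed
  qed
  define L where "L v = (\<integral>w. f w * D w v \<partial>\<mu>)" for v
  define A where "A = (\<integral>w. cmod (f w * k z0 w) \<partial>\<mu>)"
  have T: "toeplitz \<mu> \<xi> f z = (\<integral>w. f w * k z w \<partial>\<mu>)" for z by (simp add: toeplitz_def kf)
  have "complex_derivative (toeplitz \<mu> \<xi> f) L z0"
  proof (rule complex_derivativeI[where \<delta> = "\<delta> / 2" and K = "32 * M0 / \<delta>\<^sup>2 * A"])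
    show "L (v + u) = L v + L u" for v u
      unfolding L_def Dadd distrib_left by (rule Bochner_Integration.integral_add[OF intD intD])
    show "L (s *s v) = s * L v" for s v
    proof -
      have "L (s *s v) = (\<integral>w. s * (f w * D w v) \<partial>\<mu>)" unfolding L_def Dsm by (simp add: mult_ac)
      then show ?thesis by (simp add: L_def)
    qed
    show "0 < \<delta> / 2" using \<delta> by simp
    fix v :: "complex ^ 'n::_" assume v: "norm v < \<delta> / 2"
    have zv: "z0 + v \<in> tube" using sub v \<delta> by (auto simp: dist_norm subset_iff)
    have i3: "integrable \<mu> (\<lambda>w. f w * k (z0 + v) w - f w * k z0 w - f w * D w v)"
      by (intro Bochner_Integration.integrable_diff int' intD z0 zv)
    have "toeplitz \<mu> \<xi> f (z0 + v) - toeplitz \<mu> \<xi> f z0 - L v = (\<integral>w. f w * k (z0 + v) w - f w * k z0 w - f w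
        * D w v \<partial>\<mu>)"
      unfolding T L_def using int'[OF zv] int'[OF z0] intD by (simp add: Bochner_Integration.integral_diff)
    also have "cmod \<dots> \<le> (\<integral>w. 32 * M0 / \<delta>\<^sup>2 * (norm v)\<^sup>2 * cmod (f w * k z0 w) \<partial>\<mu>)"
    proof (rule Bochner_Integration.integral_norm_bound_integral[OF i3])
      show "integrable \<mu> (\<lambda>w. 32 * M0 / \<delta>\<^sup>2 * (norm v)\<^sup>2 * cmod (f w * k z0 w))"
        by (intro integrable_mult_right integrable_norm int' z0)
      fix w assume "w \<in> space \<mu>"
      then have w: "w \<in> tube" using sp by simp
      have "norm (f w * k (z0 + v) w - f w * k z0 w - f w * D w v)
          = cmod (f w) * cmod (k (z0 + v) w - k z0 w - D w v)"
        by (simp add: norm_mult[symmetric] right_diff_distrib)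
      also have "\<dots> \<le> cmod (f w) * (32 * (M0 * cmod (k z0 w)) * (norm v)\<^sup>2 / \<delta>\<^sup>2)"
        by (intro mult_left_mono Kb w v) simp
      also have "\<dots> = 32 * M0 / \<delta>\<^sup>2 * (norm v)\<^sup>2 * cmod (f w * k z0 w)" by (simp add: norm_mult)
      finally show "norm (f w * k (z0 + v) w - f w * k z0 w - f w * D w v)
          \<le> 32 * M0 / \<delta>\<^sup>2 * (norm v)\<^sup>2 * cmod (f w * k z0 w)" .
    qed
    also have "\<dots> = 32 * M0 / \<delta>\<^sup>2 * A * (norm v)\<^sup>2" by (simp add: A_def)
    finally show "cmod (toeplitz \<mu> \<xi> f (z0 + v) - toeplitz \<mu> \<xi> f z0 - L v) \<le> 32 * M0 / \<delta>\<^sup>2 * A * (norm v)\<^sup>2" .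
  qed
  then show "\<exists>L. complex_derivative (toeplitz \<mu> \<xi> f) L z0" by blast
qed

text \<open>On the ball \<open>rho z base_point\<close> is bounded, so the integrand in the
  definition of \<open>M_plus\<close> is bounded below there. Finiteness matters because
  \<open>measure\<close> assigns 0 to sets of infinite measure.\<close>

lemma M_plus_ball_finite:
  assumes \<mu>: "\<mu> \<in> M_plus" and a: "a \<in> tube" and r: "0 < r"
  shows "emeasure \<mu> (bergman_ball a r) < \<infinity>"
proof -
  have sets: "sets \<mu> = sets (restrict_space borel tube)" using \<mu> by (simp add: M_plus_def)
  obtain t where t: "0 < t" "(\<integral>\<^sup>+z. ennreal (cmod (rho z base_point) powr (- t)) \<partial>\<mu>) < \<infinity>"
    using \<mu> by (auto simp: M_plus_def)
  have m: "bergman_ball a r \<in> sets \<mu>"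
    unfolding sets using a r bergman_ball_subset_tube by (auto simp: sets_restrict_space_iff)
  define M where "M = 24 * (cosh r)\<^sup>2 * cmod (rho base_point a)"
  have M: "0 < M" using cmod_rho_pos[OF base_point_tube a] by (simp add: M_def)
  have cont: "continuous_on tube (\<lambda>z. cmod (rho z base_point) powr (-t))"
    using rho_nonzero[OF _ base_point_tube] by (intro continuous_intros) auto
  have "emeasure \<mu> (bergman_ball a r) = (\<integral>\<^sup>+z. indicator (bergman_ball a r) z \<partial>\<mu>)" using m by simp
  also have "\<dots> \<le> (\<integral>\<^sup>+z. ennreal (M powr t) * ennreal (cmod (rho z base_point) powr (-t)) \<partial>\<mu>)"
  proof (rule nn_integral_mono)
    fix z assume "z \<in> space \<mu>"
    then have z: "z \<in> tube" by (simp add: space_tube_measure[OF sets])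
    show "indicator (bergman_ball a r) z \<le> ennreal (M powr t) * ennreal (cmod (rho z base_point) powr (-t))"
    proof (cases "z \<in> bergman_ball a r")
      case True
      have "cmod (rho z base_point) \<le> M"
        using bergman_ball_cmod_rho_le[OF a True r base_point_tube] by (simp add: M_def cmod_rho_commute[of z])
      then have "M powr (-t) \<le> cmod (rho z base_point) powr (-t)"
        using cmod_rho_pos[OF z base_point_tube] t by (intro powr_mono2') auto
      then have "M powr t * M powr (-t) \<le> M powr t * cmod (rho z base_point) powr (-t)"
        by (intro mult_left_mono) auto
      then have "1 \<le> M powr t * cmod (rho z base_point) powr (-t)"
        using M by (simp add: powr_add[symmetric])
      then have "ennreal 1 \<le> ennreal (M powr t * cmod (rho z base_point) powr (-t))" by (rule ennreal_leI)
      then show ?thesis using True by (simp add: ennreal_mult)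
    qed simp
  qed
  also have "\<dots> = ennreal (M powr t) * (\<integral>\<^sup>+z. ennreal (cmod (rho z base_point) powr (-t)) \<partial>\<mu>)"
    by (intro nn_integral_cmult measurable_compose[OF measurable_tube_measure[OF sets cont] measurable_ennreal])
  also have "\<dots> < \<infinity>" using t by (simp add: ennreal_mult_less_top)
  finally show ?thesis .
qed

section \<open>Boundedness implies summability\<close>

lemma emeasure_wmeas_open_pos:
  assumes B: "open B" "B \<subseteq> tube" "z \<in> B"
  shows "emeasure (wmeas \<alpha>) B \<noteq> 0"
proof
  assume "emeasure (wmeas \<alpha>) B = 0"
  then have "(\<integral>\<^sup>+z. ennreal (indicator tube z * rho_diag z powr \<alpha>) * indicator B z \<partial>lborel) = 0"
    unfolding wmeas_def using B by (simp add: emeasure_density)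
  then have "AE z in lborel. ennreal (indicator tube z * rho_diag z powr \<alpha>) * indicator B z = 0"
    using B by (subst (asm) nn_integral_0_iff_AE) auto
  then have "AE z in lborel. z \<notin> B"
  proof eventually_elim
    case (elim z)
    then show ?case using B by (auto simp: tube_iff indicator_def split: if_splits)
  qed
  then have "emeasure lborel B = 0"
    using B by (subst (asm) AE_iff_measurable[OF _ refl]) auto
  then have "negligible B"
    using B by (simp add: negligible_iff_null_sets null_sets_def)
  then show False using open_not_negligible[OF B(1)] B(3) by blast
qed

text \<open>Averaging over all subsets takes the place of random signs: \<open>A\<close> and \<open>insert j A\<close> differ by \<open>x j\<close>.\<close>

lemma sum_Pow_cmod_powr_ge:
  fixes x :: "'i \<Rightarrow> complex"
  assumes K: "finite K" and j: "j \<in> K" and p: "0 < p"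
  shows "2 ^ card K * (cmod (x j) / 2) powr p \<le> 2 * (\<Sum>A\<in>Pow K. cmod (\<Sum>k\<in>A. x k) powr p)"
proof -
  define K' where "K' = K - {j}"
  have K': "finite K'" "j \<notin> K'" "K = insert j K'" using K j by (auto simp: K'_def)
  have inj: "inj_on (insert j) (Pow K')" using K'(2) unfolding inj_on_def
      by (metis Pow_iff insert_ident subsetD)
  have "(\<Sum>A\<in>Pow K. cmod (\<Sum>k\<in>A. x k) powr p) =
     (\<Sum>A\<in>Pow K'. cmod (\<Sum>k\<in>A. x k) powr p) + (\<Sum>A\<in>insert j ` Pow K'. cmod (\<Sum>k\<in>A. x k) powr p)"
    unfolding K'(3) Pow_insert using K' by (intro sum.union_disjoint) auto
  also have "(\<Sum>A\<in>insert j ` Pow K'. cmod (\<Sum>k\<in>A. x k) powr p) = (\<Sum>A\<in>Pow K'. cmod (\<Sum>k\<in>insert j A. x k) powr p)"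
    using sum.reindex[OF inj] by simp
  also have "(\<Sum>A\<in>Pow K'. cmod (\<Sum>k\<in>A. x k) powr p) + \<dots> = (\<Sum>A\<in>Pow K'. cmod (\<Sum>k\<in>A. x k) powr p
      + cmod (\<Sum>k\<in>insert j A. x k) powr p)"
    by (simp add: sum.distrib)
  also have "\<dots> \<ge> (\<Sum>A\<in>Pow K'. (cmod (x j) / 2) powr p)"
  proof (rule sum_mono)
    fix A assume A: "A \<in> Pow K'"
    define S where "S = (\<Sum>k\<in>A. x k)"
    have "finite A" "j \<notin> A" using A K' finite_subset by auto
    then have ins: "(\<Sum>k\<in>insert j A. x k) = x j + S" by (simp add: S_def)
    have "cmod (x j) \<le> cmod (x j + S) + cmod S" using norm_triangle_ineq4[of "x j + S" S] by simp
    then consider "cmod (x j) / 2 \<le> cmod S" | "cmod (x j) / 2 \<le> cmod (x j + S)" by linarith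
    then have "(cmod (x j) / 2) powr p \<le> cmod S powr p + cmod (x j + S) powr p"
    proof cases
      case 1
      then have "(cmod (x j) / 2) powr p \<le> cmod S powr p" using p by (intro powr_mono2) auto
      then show ?thesis using powr_ge_zero[of "cmod (x j + S)" p] by linarith
    next
      case 2
      then have "(cmod (x j) / 2) powr p \<le> cmod (x j + S) powr p" using p by (intro powr_mono2) auto
      then show ?thesis using powr_ge_zero[of "cmod S" p] by linarith
    qed
    then show "(cmod (x j) / 2) powr p \<le> cmod (\<Sum>k\<in>A. x k) powr p + cmod (\<Sum>k\<in>insert j A. x k) powr p"
      unfolding ins by (simp add: S_def)
  qed
  moreover have "(\<Sum>A\<in>Pow K'. (cmod (x j) / 2) powr p) = 2 ^ card K' * (cmod (x j) / 2) powr p"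
  proof -
    have "real (card (Pow K')) = 2 ^ card K'" using K' by (simp add: card_Pow)
    then show ?thesis by (simp only: sum_constant)
  qed
  moreover have "2 ^ card K = 2 * (2::real) ^ card K'" using K' by simp
  ultimately show ?thesis by (simp del: sum_constant)
qed

text \<open>Two arguments strictly between \<open>-pi / 2\<close> and \<open>pi / 2\<close> have a
  sum within the range of the principal logarithm.\<close>

lemma complex_powr_mult_right_half_plane:
  fixes x u c :: complex
  assumes "0 < Re x" "0 < Re u"
  shows "(x * u) powr c = x powr c * u powr c"
proof -
  have nz: "x \<noteq> 0" "u \<noteq> 0" using assms by auto
  have "\<bar>Im (Ln x)\<bar> < pi / 2" "\<bar>Im (Ln u)\<bar> < pi / 2" by (rule Re_Ln_pos_lt_imp, rule assms)+
  then have "Ln (x * u) = Ln x + Ln u" using nz by (subst Ln_times) (auto simp: abs_less_iff)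
  then show ?thesis using nz by (simp add: powr_def distrib_left exp_add)
qed

text \<open>For \<open>v = base_point\<close>, where \<open>aut a v = a\<close>, the two factors are
  conjugate to each other and the product equals \<open>cmod (rho w a) powr (-(2 * b))\<close>.
  Changing \<open>v\<close> multiplies it by a power of a number \<open>u\<close>, which by
  \<open>rho_near_base\<close>, after transport to the base point, is close to 1 uniformly in
  \<open>a\<close> and \<open>w\<close>. Since all \<open>w\<close> in the domain are covered,
  integration against any positive measure keeps the lower bound.\<close>

lemma Re_rho_kernel_product_ge:
  fixes b r :: real
  assumes b: "0 < b" and r: "0 < r"
  shows "\<exists>B. open B \<and> (base_point :: complex ^ 'n::{finite,wellorder}) \<in> B \<and> B \<subseteq> bergman_ball base_point r \<and>
    (\<forall>v\<in>B. \<forall>a\<in>tube. \<forall>w\<in>tube. (1/2) * cmod (rho w a) powr (-(2 * b))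
        \<le> Re (rho w a powr (- of_real b) * rho (aut a v) w powr (- of_real b)))"
proof -
  define c where "c = - complex_of_real b"
  have "((\<lambda>u. u powr c) has_field_derivative c * 1 powr (c - 1)) (at 1)"
    by (rule has_field_derivative_powr) (simp add: complex_nonpos_Reals_iff)
  then have "isCont (\<lambda>u. u powr c) 1" by (rule DERIV_isCont)
  then obtain \<epsilon>0 where \<epsilon>0: "0 < \<epsilon>0" "\<And>u. cmod (u - 1) < \<epsilon>0 \<Longrightarrow> cmod (u powr c - 1) < 1/2"
    unfolding continuous_at_eps_delta dist_norm by (auto dest: spec[of _ "1/2"])
  \<comment> \<open>\<open>\<epsilon> < 1\<close> keeps \<open>u\<close> in the right half plane,
    where powers are multiplicative; \<open>\<epsilon> < \<epsilon>0\<close> keeps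
    \<open>u powr c\<close> within 1/2 of 1.\<close>
  define \<epsilon> where "\<epsilon> = min (1/2) (\<epsilon>0 / 2)"
  have \<epsilon>: "0 < \<epsilon>" "\<epsilon> < 1" "\<epsilon> < \<epsilon>0" using \<epsilon>0 by (auto simp: \<epsilon>_def)
  obtain \<delta> where \<delta>: "0 < \<delta>" "\<And>v z :: complex ^ 'n::_. v \<in> ball base_point \<delta> \<Longrightarrow> z \<in> tube
      \<Longrightarrow> cmod (rho z v / rho z base_point - 1) \<le> \<epsilon>"
    using rho_near_base[OF \<epsilon>(1), where 'n = 'n] by blast
  define B where "B = ball base_point \<delta> \<inter> bergman_ball (base_point :: complex ^ 'n::_) r"
  show ?thesis
  proof (intro exI[of _ B] conjI ballI)
    show "open B" unfolding B_def by (intro open_Int open_ball open_bergman_ball base_point_tube r)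
    show "base_point \<in> B" unfolding B_def using \<delta> bergman_ball_self[OF base_point_tube r] by simp
    show "B \<subseteq> bergman_ball base_point r" by (simp add: B_def)
    fix v a w :: "complex ^ 'n::_" assume v: "v \<in> B" and a: "a \<in> tube" and w: "w \<in> tube"
    have vt: "v \<in> tube" using v bergman_ball_subset_tube by (auto simp: B_def)
    obtain w' where w': "aut a w' = w" using aut_surj[OF a] by metis
    have w't: "w' \<in> tube" using w w' aut_tube[OF a] by metis
    define R where "R = rho_diag a"
    have R: "0 < R" using a by (simp add: R_def tube_iff)
    define u where "u = cnj (rho w' v / rho w' base_point)"
    have "cmod (rho w' v / rho w' base_point - 1) \<le> \<epsilon>" using \<delta>(2)[of v w'] v w't by (simp add: B_def)
    also have "cmod (rho w' v / rho w' base_point - 1) = cmod (u - 1)"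
      unfolding u_def by (metis complex_cnj_diff complex_cnj_one complex_mod_cnj)
    finally have u: "cmod (u - 1) \<le> \<epsilon>" .
    have Reu: "0 < Re u" using u \<epsilon> abs_Re_le_cmod[of "u - 1"] by simp
    have "cmod (u powr c - 1) < 1/2" using u \<epsilon> by (intro \<epsilon>0(2)) auto
    then have Re: "1/2 \<le> Re (u powr c)" using abs_Re_le_cmod[of "u powr c - 1"] by simp
    define x where "x = rho a w"
    have Rex: "0 < Re x" unfolding x_def by (rule Re_rho_pos[OF a w])
    have x: "x = of_real R * rho base_point w'"
      unfolding x_def using rho_aut[OF a, of base_point w'] aut_base[OF a] w' by (simp add: R_def)
    have "rho (aut a v) w = of_real R * rho v w'" using rho_aut[OF a, of v w'] w' by (simp add: R_def)
    also have "rho v w' = rho base_point w' * u"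
      unfolding u_def using rho_nonzero[OF w't base_point_tube]
          by (simp add: rho_commute[of v w'] rho_commute[of base_point w'])
    finally have xu: "rho (aut a v) w = x * u" by (simp add: x)
    have "rho w a powr c * rho (aut a v) w powr c = cnj (x powr c) * (x powr c * u powr c)"
    proof -
      have "cnj (x powr c) = cnj x powr cnj c" by (rule cnj_powr) (use Rex in auto)
      also have "\<dots> = rho w a powr c" by (simp add: x_def c_def rho_commute[of w a])
      finally show ?thesis unfolding xu complex_powr_mult_right_half_plane[OF Rex Reu] by simp
    qed
    also have "\<dots> = of_real ((cmod (x powr c))\<^sup>2) * u powr c"
      by (simp only: complex_norm_square mult_ac)
    also have "(cmod (x powr c))\<^sup>2 = cmod x powr (-(2 * b))"
    proof -
      have "cmod (x powr c) = cmod x powr (-b)" unfolding c_def of_real_minus[symmetric]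
          by (simp add: norm_powr_real_powr')
      then show ?thesis by (simp add: power2_eq_square powr_add[symmetric])
    qed
    finally have "Re (rho w a powr c * rho (aut a v) w powr c) = cmod x powr (-(2 * b)) * Re (u powr c)" by simp
    also have "\<dots> \<ge> cmod x powr (-(2 * b)) * (1/2)" using Re by (intro mult_left_mono) auto
    finally show "(1/2) * cmod (rho w a) powr (-(2 * b)) \<le> Re (rho w a powr (- of_real b)
        * rho (aut a v) w powr (- of_real b))"
      by (simp add: c_def x_def cmod_rho_commute[of w a] mult.commute)
  qed
qed

lemma toeplitz_sum:
  assumes "finite A" "\<And>k. k \<in> A \<Longrightarrow> integrable \<mu> (toeplitz_integrand \<xi> (f k) z)"
  shows "toeplitz \<mu> \<xi> (\<lambda>w. \<Sum>k\<in>A. of_real (c k) * f k w) z = (\<Sum>k\<in>A. of_real (c k) * toeplitz \<mu> \<xi> (f k) z)"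
proof -
  have "toeplitz \<mu> \<xi> (\<lambda>w. \<Sum>k\<in>A. of_real (c k) * f k w) z = (\<integral>w. (\<Sum>k\<in>A. of_real (c k)
      * toeplitz_integrand \<xi> (f k) z w) \<partial>\<mu>)"
    by (simp add: toeplitz_def toeplitz_integrand_def sum_divide_distrib)
  also have "\<dots> = (\<Sum>k\<in>A. of_real (c k) * toeplitz \<mu> \<xi> (f k) z)"
    using assms by (simp add: toeplitz_def Bochner_Integration.integral_sum)
  finally show ?thesis .
qed

lemma complex_derivative_cmult:
  "complex_derivative f f' z \<Longrightarrow> complex_derivative (\<lambda>z. c * f z) (\<lambda>v. c * f' v) z"
  unfolding complex_derivative_def by (auto intro!: has_derivative_mult_right)

lemma holo_on_cmult: "holo_on f S \<Longrightarrow> holo_on (\<lambda>z. c * f z) S"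
  unfolding holo_on_def using complex_derivative_cmult by blast

lemma holo_on_sum:
  assumes "finite A" "\<And>k. k \<in> A \<Longrightarrow> holo_on (f k) S"
  shows "holo_on (\<lambda>z. \<Sum>k\<in>A. f k z) S"
  using assms
proof (induction A)
  case empty
  have "complex_derivative (\<lambda>z. 0) (\<lambda>v. 0) z" for z :: "complex ^ 'b" by (simp add: complex_derivative_def)
  then show ?case by (auto simp: holo_on_def)
next
  case (insert k A)
  then have "holo_on (\<lambda>z. f k z - (-1) * (\<Sum>k\<in>A. f k z)) S" by (intro holo_on_diff holo_on_cmult) auto
  then show ?case using insert by simp
qed

text \<open>The exponent arises as \<open>e = 2 b - e1 - (n + 1 + \<alpha>2) / p2\<close>: on the
  ball around \<open>a k\<close> the two kernels together have size
  \<open>rho_diag (a k) powr (-2 b)\<close>, the normalisation of the test function supplies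
  \<open>e1\<close>, and the volume of the ball supplies the last term after the
  \<open>p2\<close>-th root.\<close>

lemma toeplitz_bounded_imp_summable:
  fixes a :: "nat \<Rightarrow> complex ^ 'n::{finite,wellorder}" and \<mu> :: "(complex ^ 'n::_) measure" and \<xi> :: real
  defines "b \<equiv> real CARD('n) + 1 + \<xi>"
  assumes p: "0 < p2" "p2 < p1" and \<alpha>: "-1 < \<alpha>1" "-1 < \<alpha>2" and \<xi>: "-1 < \<xi>" and \<mu>: "\<mu> \<in> M_plus"
    and b: "real CARD('n) * max 1 (1 / p1) + (1 + \<alpha>1) / p1 < b"
    and bdd: "toeplitz_bounded \<mu> \<xi> p1 \<alpha>1 p2 \<alpha>2"
    and r: "0 < r" and lat: "is_lattice r a"
    and e: "e = b - (real CARD('n) + 1 + \<alpha>2) / p2 + (real CARD('n) + 1 + \<alpha>1) / p1"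
    and s: "s = 1 / (1 / p2 - 1 / p1)"
  shows "summable (\<lambda>k. (measure \<mu> (bergman_ball (a k) r) / rho_diag (a k) powr e) powr s)"
proof -
  let ?N = "real CARD('n)"
  have at: "a k \<in> tube" for k using lat by (auto simp: is_lattice_def)
  have r4: "0 < r / 4" using r by simp
  have disj: "disjoint_family (\<lambda>k. bergman_ball (a k) (r / 4))" using lat by (simp add: is_lattice_def)
  have R: "0 < rho_diag (a k)" for k using at by (simp add: tube_iff)
  have p1: "0 < p1" using p by simp
  have bpos: "0 < b" using \<xi> by (simp add: b_def add_nonneg_pos add.assoc)
  have sets: "sets \<mu> = sets (restrict_space borel tube)" using \<mu> by (simp add: M_plus_def)
  have sp: "space \<mu> = tube" by (rule space_tube_measure[OF sets])
  \<comment> \<open>The normalisation under which \<open>separated_Lp_bound\<close> bounds the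
    functions \<open>f k\<close> in the source space independently of \<open>k\<close>.\<close>
  define e1 where "e1 = b - (?N + 1 + \<alpha>1) / p1"
  define f where "f k w = of_real (rho_diag (a k) powr e1) * rho w (a k) powr (- of_real b)" for k w
  have nf: "cmod (f k w) = rho_diag (a k) powr e1 * cmod (rho w (a k)) powr (-b)" for k w
    unfolding f_def of_real_minus[symmetric] norm_mult norm_rho_powr by simp
  have hf: "holo_on (f k) tube" for k
    unfolding f_def by (intro holo_on_cmult holo_on_rho_powr at)
  define F where "F c A w = (\<Sum>k\<in>A. of_real (c k) * f k w)" for c :: "nat \<Rightarrow> real" and A w
  have hF: "holomorphic_tube (F c A)" if "finite A" for c A
    unfolding F_def holomorphic_tube_iff by (intro holo_on_sum holo_on_cmult hf that)
  obtain C1 where C1: "0 \<le> C1" "\<And>K c. finite K \<Longrightarrow> (\<And>k. 0 \<le> c k) \<Longrightarrow>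
     (\<integral>\<^sup>+z. ennreal ((\<Sum>k\<in>K. c k * rho_diag (a k) powr (b - (?N + 1 + \<alpha>1) / p1)
         * cmod (rho z (a k)) powr (-b)) powr p1) \<partial>wmeas \<alpha>1)
       \<le> ennreal (C1 * (\<Sum>k\<in>K. c k powr p1))"
    using separated_Lp_bound[OF at r4 disj p1 \<alpha>(1) b] by blast
  have lF: "lp_int p1 \<alpha>1 (F c A) \<le> ennreal (C1 * (\<Sum>k\<in>A. c k powr p1))" if A: "finite A"
      and c: "\<And>k. 0 \<le> c k" for c A
  proof -
    have "lp_int p1 \<alpha>1 (F c A) \<le> (\<integral>\<^sup>+z. ennreal ((\<Sum>k\<in>A. c k * rho_diag (a k) powr (b - (?N + 1 + \<alpha>1) / p1)
        * cmod (rho z (a k)) powr (-b)) powr p1) \<partial>wmeas \<alpha>1)"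
      unfolding lp_int_def
    proof (rule nn_integral_mono, rule ennreal_leI, rule powr_mono2)
      fix z
      have "cmod (F c A z) \<le> (\<Sum>k\<in>A. cmod (of_real (c k) * f k z))" unfolding F_def by (rule norm_sum)
      also have "\<dots> = (\<Sum>k\<in>A. c k * rho_diag (a k) powr (b - (?N + 1 + \<alpha>1) / p1) * cmod (rho z (a k)) powr (-b))"
        unfolding norm_mult nf e1_def using c by (intro sum.cong) auto
      finally show "cmod (F c A z) \<le> (\<Sum>k\<in>A. c k * rho_diag (a k) powr (b - (?N + 1 + \<alpha>1) / p1)
          * cmod (rho z (a k)) powr (-b))" .
    qed (use p1 in auto)
    also have "\<dots> \<le> ennreal (C1 * (\<Sum>k\<in>A. c k powr p1))" by (rule C1(2)[OF A c])
    finally show ?thesis .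
  qed
  have FA: "F c A \<in> bergman_space p1 \<alpha>1" if "finite A" "\<And>k. 0 \<le> c k" for c A
    using hF[OF that(1)] le_less_trans[OF lF[OF that(1) that(2)] ennreal_less_top]
        by (simp add: bergman_space_iff[OF p1])
  have fA: "f k \<in> bergman_space p1 \<alpha>1" for k
  proof -
    have "F (\<lambda>_. 1) {k} = f k" by (simp add: F_def fun_eq_iff)
    then show ?thesis using FA[of "{k}" "\<lambda>_. 1"] by simp
  qed
  have int: "integrable \<mu> (toeplitz_integrand \<xi> (f k) z)" if "z \<in> tube" for k z
    using bdd fA that by (auto simp: toeplitz_bounded_def)
  obtain C0 where C0: "\<And>g. g \<in> bergman_space p1 \<alpha>1 \<Longrightarrow> Lp_norm p2 \<alpha>2 (toeplitz \<mu> \<xi> g) \<le> C0 * Lp_norm p1 \<alpha>1 g"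
    using bdd by (auto simp: toeplitz_bounded_def)
  \<comment> \<open>The constant in \<open>toeplitz_bounded\<close> may be negative; a non-negative
    one is needed in the monotonicity steps.\<close>
  define C where "C = \<bar>C0\<bar>"
  have C: "0 \<le> C" "\<And>g. g \<in> bergman_space p1 \<alpha>1 \<Longrightarrow> Lp_norm p2 \<alpha>2 (toeplitz \<mu> \<xi> g) \<le> C * Lp_norm p1 \<alpha>1 g"
    unfolding C_def using order_trans[OF C0 mult_right_mono[OF abs_ge_self Lp_norm_nonneg]] by simp_all
  define \<theta> where "\<theta> = p2 / p1"
  have \<theta>: "0 < \<theta>" "\<theta> < 1" using p p1 by (auto simp: \<theta>_def)
  have TF: "lp_int p2 \<alpha>2 (toeplitz \<mu> \<xi> (F c A)) \<le> ennreal (C powr p2 * C1 powr \<theta> * (\<Sum>k\<in>K. c k powr p1) powr \<theta>)"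
    if K: "finite K" "A \<subseteq> K" and c: "\<And>k. 0 \<le> c k" for c A K
  proof -
    have fin: "finite A" using K finite_subset by blast
    have mem: "toeplitz \<mu> \<xi> (F c A) \<in> bergman_space p2 \<alpha>2" using bdd FA[OF fin c]
        by (auto simp: toeplitz_bounded_def)
    have n1: "Lp_norm p1 \<alpha>1 (F c A) \<le> (C1 * (\<Sum>k\<in>K. c k powr p1)) powr (1 / p1)"
    proof (rule Lp_norm_leI[OF p1 hF[OF fin]])
      have "C1 * (\<Sum>k\<in>A. c k powr p1) \<le> C1 * (\<Sum>k\<in>K. c k powr p1)"
        using K C1(1) by (intro mult_left_mono sum_mono2) auto
      moreover have "0 \<le> C1 * (\<Sum>k\<in>K. c k powr p1)" using C1 by (intro mult_nonneg_nonneg sum_nonneg) auto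
      then have "((C1 * (\<Sum>k\<in>K. c k powr p1)) powr (1 / p1)) powr p1 = C1 * (\<Sum>k\<in>K. c k powr p1)"
        using p1 by (simp add: powr_powr)
      ultimately show "lp_int p1 \<alpha>1 (F c A) \<le> ennreal (((C1 * (\<Sum>k\<in>K. c k powr p1)) powr (1 / p1)) powr p1)"
        using order_trans[OF lF[OF fin c] ennreal_leI] by simp
    qed simp
    have "lp_int p2 \<alpha>2 (toeplitz \<mu> \<xi> (F c A)) = ennreal (Lp_norm p2 \<alpha>2 (toeplitz \<mu> \<xi> (F c A)) powr p2)"
      by (rule Lp_norm_powr[OF p(1) mem])
    also have "\<dots> \<le> ennreal ((C * (C1 * (\<Sum>k\<in>K. c k powr p1)) powr (1 / p1)) powr p2)"
      using order_trans[OF C(2)[OF FA[OF fin c]] mult_left_mono[OF n1 C(1)]] p Lp_norm_nonneg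
      by (intro ennreal_leI powr_mono2) auto
    also have "(C * (C1 * (\<Sum>k\<in>K. c k powr p1)) powr (1 / p1)) powr p2
        = C powr p2 * C1 powr \<theta> * (\<Sum>k\<in>K. c k powr p1) powr \<theta>"
      using C(1) C1(1) by (simp add: powr_mult powr_powr sum_nonneg \<theta>_def)
    finally show ?thesis .
  qed
  obtain B where B: "open B" "(base_point :: complex ^ 'n::_) \<in> B" "B \<subseteq> bergman_ball base_point (r / 4)"
    "\<And>v a w. v \<in> B \<Longrightarrow> a \<in> tube \<Longrightarrow> w \<in> tube \<Longrightarrow> (1/2) * cmod (rho w a) powr (-(2 * b))
        \<le> Re (rho w a powr (- of_real b) * rho (aut a v) w powr (- of_real b))"
    using Re_rho_kernel_product_ge[OF bpos r4, where 'n = 'n] by blast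
  have Bt: "B \<subseteq> tube" using B(3) bergman_ball_subset_tube by blast
  define v1 where "v1 = enn2real (emeasure (wmeas \<alpha>2) B)"
  have v1: "emeasure (wmeas \<alpha>2) B = ennreal v1" "0 < v1"
  proof -
    obtain c where "emeasure (wmeas \<alpha>2) (bergman_ball (base_point :: complex ^ 'n::_) (r / 4)) = ennreal c"
      using emeasure_bergman_ball[OF r4 \<alpha>(2), where 'n = 'n] base_point_tube by blast
    moreover have "emeasure (wmeas \<alpha>2) B \<le> emeasure (wmeas \<alpha>2) (bergman_ball (base_point :: complex ^ 'n::_)
        (r / 4))"
      using B r4 by (intro emeasure_mono) auto
    ultimately have fin: "emeasure (wmeas \<alpha>2) B < \<infinity>" by (simp add: le_less_trans)
    moreover have "emeasure (wmeas \<alpha>2) B \<noteq> 0" by (rule emeasure_wmeas_open_pos[OF B(1) Bt B(2)])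
    ultimately show "emeasure (wmeas \<alpha>2) B = ennreal v1" "0 < v1"
      unfolding v1_def by (auto simp: enn2real_positive_iff zero_less_iff_neq_zero)
  qed
  define M where "M = 24 * (cosh r)\<^sup>2"
  have M: "0 < M" by (simp add: M_def)
  define c0 where "c0 = (1/2) * M powr (-(2 * b))"
  have c0: "0 < c0" using M by (simp add: c0_def)
  define m where "m k = measure \<mu> (bergman_ball (a k) r)" for k
  have m0: "0 \<le> m k" for k by (simp add: m_def)
  \<comment> \<open>The lower bound for the diagonal term: half of the kernel product, estimated by
    \<open>M * rho_diag (a k)\<close> to the power \<open>-2 b\<close>, and integrated over the ball
    of radius \<open>r\<close> only.\<close>
  define t where "t k = c0 * rho_diag (a k) powr (e1 - 2 * b) * m k" for k
  have low: "t k \<le> cmod (toeplitz \<mu> \<xi> (f k) (aut (a k) v))" if v: "v \<in> B" for k v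
  proof -
    define z where "z = aut (a k) v"
    have z: "z \<in> tube" using v Bt aut_tube[OF at] by (auto simp: z_def)
    define Q where "Q = c0 * rho_diag (a k) powr (e1 - 2 * b)"
    have Dm: "bergman_ball (a k) r \<in> sets \<mu>"
      unfolding sets using at r bergman_ball_subset_tube by (auto simp: sets_restrict_space_iff)
    have Dfin: "emeasure \<mu> (bergman_ball (a k) r) < \<infinity>" by (rule M_plus_ball_finite[OF \<mu> at r])
    have "t k = (\<integral>w. Q * indicator (bergman_ball (a k) r) w \<partial>\<mu>)"
      using Dm by (simp add: t_def Q_def m_def)
    \<comment> \<open>Restricting to the ball is legitimate because the real part is non-negative
      outside of it as well.\<close>
    also have "\<dots> \<le> (\<integral>w. Re (toeplitz_integrand \<xi> (f k) z w) \<partial>\<mu>)"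
    proof (rule integral_mono)
      show "integrable \<mu> (\<lambda>w. Q * indicator (bergman_ball (a k) r) w)"
        using Dm Dfin by (intro integrable_mult_right integrable_real_indicator) auto
      show "integrable \<mu> (\<lambda>w. Re (toeplitz_integrand \<xi> (f k) z w))" using int[OF z] by (rule integrable_Re)
      fix w assume "w \<in> space \<mu>"
      then have w: "w \<in> tube" using sp by simp
      have "toeplitz_integrand \<xi> (f k) z w = of_real (rho_diag (a k) powr e1)
          * (rho w (a k) powr (- of_real b) * rho z w powr (- of_real b))"
        unfolding toeplitz_integrand_eq f_def b_def by (simp only: mult.assoc)
      then have "Re (toeplitz_integrand \<xi> (f k) z w) = rho_diag (a k) powr e1
          * Re (rho w (a k) powr (- of_real b) * rho z w powr (- of_real b))"
      proof -
        have "Re (of_real x * y) = x * Re y" for x y by simp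
        then show "toeplitz_integrand \<xi> (f k) z w = of_real (rho_diag (a k) powr e1)
            * (rho w (a k) powr (- of_real b) * rho z w powr (- of_real b)) \<Longrightarrow> ?thesis"
          by metis
      qed
      moreover have "rho_diag (a k) powr e1 * ((1/2) * cmod (rho w (a k)) powr (-(2 * b)))
          \<le> rho_diag (a k) powr e1 * Re (rho w (a k) powr (- of_real b) * rho z w powr (- of_real b))"
        unfolding z_def by (intro mult_left_mono B(4)[OF v at w]) simp
      ultimately have ge: "rho_diag (a k) powr e1 * ((1/2) * cmod (rho w (a k)) powr (-(2 * b)))
          \<le> Re (toeplitz_integrand \<xi> (f k) z w)" by simp
      show "Q * indicator (bergman_ball (a k) r) w \<le> Re (toeplitz_integrand \<xi> (f k) z w)"
      proof (cases "w \<in> bergman_ball (a k) r")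
        case True
        have "cmod (rho w (a k)) \<le> M * rho_diag (a k)"
          using bergman_ball_cmod_rho_le[OF at True r at[of k]] cmod_rho_same[OF at[of k]]
              by (simp add: M_def cmod_rho_commute[of w])
        then have "(M * rho_diag (a k)) powr (-(2 * b)) \<le> cmod (rho w (a k)) powr (-(2 * b))"
          using bpos cmod_rho_pos[OF w at] by (intro powr_mono2') auto
        then have "rho_diag (a k) powr e1 * ((1/2) * (M * rho_diag (a k)) powr (-(2 * b)))
            \<le> rho_diag (a k) powr e1 * ((1/2) * cmod (rho w (a k)) powr (-(2 * b)))"
          by (intro mult_left_mono) auto
        also have "rho_diag (a k) powr e1 * ((1/2) * (M * rho_diag (a k)) powr (-(2 * b))) = Q"
        proof -
          have "rho_diag (a k) powr (e1 - 2 * b) = rho_diag (a k) powr e1 * rho_diag (a k) powr (-(2 * b))"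
            by (simp add: powr_add[symmetric])
          then show ?thesis using M R[of k] by (simp add: Q_def c0_def powr_mult mult_ac)
        qed
        finally show ?thesis using ge True by simp
      next
        case False
        have "0 \<le> rho_diag (a k) powr e1 * ((1/2) * cmod (rho w (a k)) powr (-(2 * b)))" by simp
        from order_trans[OF this ge] show ?thesis using False by simp
      qed
    qed
    also have "\<dots> = Re (toeplitz \<mu> \<xi> (f k) z)" using int[OF z] by (simp add: toeplitz_def)
    also have "\<dots> \<le> cmod (toeplitz \<mu> \<xi> (f k) z)" by (rule complex_Re_le_cmod)
    finally show ?thesis by (simp add: z_def)
  qed
  define d where "d k = m k / rho_diag (a k) powr e" for k
  have d0: "0 \<le> d k" for k by (simp add: d_def m0)
  define C' where "C' = 2 * (C powr p2 * C1 powr \<theta>) / (v1 * (c0 / 2) powr p2)"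
  have C'0: "0 \<le> C'" using C1 v1 by (simp add: C'_def)
  have key: "(\<Sum>j\<in>K. (c j * d j) powr p2) \<le> C' * (\<Sum>k\<in>K. c k powr p1) powr \<theta>" if K: "finite K"
      and c: "\<And>k. 0 \<le> c k" for K c
  proof -
    define G where "G A z = ennreal (cmod (toeplitz \<mu> \<xi> (F c A) z) powr p2)" for A z
    define X where "X = (\<Sum>k\<in>K. c k powr p1)"
    have hT: "holomorphic_tube (toeplitz \<mu> \<xi> (F c A))" if "A \<subseteq> K" for A
      using bdd FA[OF finite_subset[OF that K] c] by (auto simp: toeplitz_bounded_def bergman_space_def)
    have GB: "(\<lambda>z. G A z * indicator (bergman_ball (a j) (r / 4)) z) \<in> borel_measurable borel"
        if "A \<subseteq> K" for A j
      unfolding G_def by (rule cmod_powr_borel[OF hT[OF that]]) (use at r4 bergman_ball_subset_tube in auto)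
    \<comment> \<open>The balls of radius \<open>r / 4\<close> are disjoint, so for each
      \<open>A\<close> their contributions add up to at most the full integral, which boundedness
      controls independently of \<open>A\<close>.\<close>
    have up: "(\<Sum>j\<in>K. \<integral>\<^sup>+z. G A z * indicator (bergman_ball (a j) (r / 4)) z \<partial>wmeas \<alpha>2)
        \<le> ennreal (C powr p2 * C1 powr \<theta> * X powr \<theta>)" if A: "A \<subseteq> K" for A
    proof -
      have "(\<Sum>j\<in>K. \<integral>\<^sup>+z. G A z * indicator (bergman_ball (a j) (r / 4)) z \<partial>wmeas \<alpha>2)
          = (\<integral>\<^sup>+z. (\<Sum>j\<in>K. G A z * indicator (bergman_ball (a j) (r / 4)) z) \<partial>wmeas \<alpha>2)"
        using GB[OF A] by (intro nn_integral_sum[symmetric]) auto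
      also have "\<dots> \<le> lp_int p2 \<alpha>2 (toeplitz \<mu> \<xi> (F c A))"
        unfolding lp_int_def
      proof (rule nn_integral_mono)
        fix z
        have "(\<Sum>j\<in>K. G A z * indicator (bergman_ball (a j) (r / 4)) z)
            = G A z * indicator (\<Union>j\<in>K. bergman_ball (a j) (r / 4)) z"
          using K disj by (simp add: sum_distrib_left[symmetric] indicator_UN_disjoint
              disjoint_family_on_mono[of K UNIV])
        also have "\<dots> \<le> G A z" by (simp add: indicator_def)
        finally show "(\<Sum>j\<in>K. G A z * indicator (bergman_ball (a j) (r / 4)) z)
            \<le> ennreal (cmod (toeplitz \<mu> \<xi> (F c A) z) powr p2)"
          by (simp add: G_def)
      qed
      also have "\<dots> \<le> ennreal (C powr p2 * C1 powr \<theta> * X powr \<theta>)" unfolding X_def by (rule TF[OF K A c])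
      finally show ?thesis .
    qed
    \<comment> \<open>Moved to the base point, the ball around \<open>a j\<close> contains
      \<open>B\<close>, on which the \<open>j\<close>-th term is at least \<open>c j * t j\<close>.
      Averaging over \<open>A\<close> prevents cancellation with the other terms.\<close>
    have lower: "ennreal (2 ^ card K * (v1 * (c0 / 2) powr p2 * (c j * d j) powr p2))
        \<le> 2 * (\<Sum>A\<in>Pow K. \<integral>\<^sup>+z. G A z * indicator (bergman_ball (a j) (r / 4)) z \<partial>wmeas \<alpha>2)" if j: "j \<in> K" for j
    proof -
      define W where "W = rho_diag (a j) powr (?N + 1 + \<alpha>2)"
      have tr: "(\<integral>\<^sup>+z. G A z * indicator (bergman_ball (a j) (r / 4)) z \<partial>wmeas \<alpha>2)
          = ennreal W * (\<integral>\<^sup>+v. G A (aut (a j) v) * indicator (bergman_ball base_point (r / 4)) v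
          \<partial>wmeas \<alpha>2)" if "A \<subseteq> K" for A
      proof -
        have "(\<lambda>v. indicator (bergman_ball (a j) (r / 4)) (aut (a j) v) :: ennreal)
            = indicator (bergman_ball base_point (r / 4))"
          using bergman_ball_aut[OF at] by (auto simp: indicator_def fun_eq_iff)
        then show ?thesis unfolding W_def using nn_integral_wmeas_aut[OF at[of j] GB[OF that, of j], of \<alpha>2]
            by (simp add: fun_eq_iff)
      qed
      have GaB: "(\<lambda>v. G A (aut (a j) v) * indicator (bergman_ball base_point (r / 4)) v) \<in> borel_measurable
          borel" if "A \<subseteq> K" for A
        unfolding G_def using cmod_powr_borel[OF holomorphic_tube_aut[OF hT[OF that] at[of j]], of
            "bergman_ball base_point (r / 4)" p2] r4 bergman_ball_subset_tube by auto
      have "ennreal (2 ^ card K * ((c j * t j) / 2) powr p2) * emeasure (wmeas \<alpha>2) B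
          = (\<integral>\<^sup>+v. ennreal (2 ^ card K * ((c j * t j) / 2) powr p2) * indicator B v \<partial>wmeas \<alpha>2)"
        using B by (subst nn_integral_cmult_indicator) auto
      also have "\<dots> \<le> (\<integral>\<^sup>+v. 2 * (\<Sum>A\<in>Pow K. G A (aut (a j) v)
          * indicator (bergman_ball base_point (r / 4)) v) \<partial>wmeas \<alpha>2)"
      proof (rule nn_integral_mono)
        fix v
        show "ennreal (2 ^ card K * ((c j * t j) / 2) powr p2) * indicator B v
            \<le> 2 * (\<Sum>A\<in>Pow K. G A (aut (a j) v) * indicator (bergman_ball base_point (r / 4)) v)"
        proof (cases "v \<in> B")
          case True
          define z where "z = aut (a j) v"
          have z: "z \<in> tube" using True Bt aut_tube[OF at] by (auto simp: z_def)
          define x where "x k = of_real (c k) * toeplitz \<mu> \<xi> (f k) z" for k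
          have TFx: "toeplitz \<mu> \<xi> (F c A) z = (\<Sum>k\<in>A. x k)" if "A \<in> Pow K" for A
            unfolding F_def x_def by (rule toeplitz_sum) (use that K finite_subset int[OF z] in auto)
          have "c j * t j \<le> cmod (x j)"
            unfolding x_def norm_mult using low[OF True, of j] c[of j] by (simp add: z_def mult_left_mono)
          then have "2 ^ card K * ((c j * t j) / 2) powr p2 \<le> 2 ^ card K * (cmod (x j) / 2) powr p2"
            using c[of j] c0 m0 p by (intro mult_left_mono powr_mono2) (auto simp: t_def)
          also have "\<dots> \<le> 2 * (\<Sum>A\<in>Pow K. cmod (\<Sum>k\<in>A. x k) powr p2)" by (rule sum_Pow_cmod_powr_ge[OF K j p(1)])
          also have "\<dots> = 2 * (\<Sum>A\<in>Pow K. cmod (toeplitz \<mu> \<xi> (F c A) z) powr p2)" using TFx by simp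
          finally have "ennreal (2 ^ card K * ((c j * t j) / 2) powr p2)
              \<le> ennreal (2 * (\<Sum>A\<in>Pow K. cmod (toeplitz \<mu> \<xi> (F c A) z) powr p2))"
            by (rule ennreal_leI)
          also have "\<dots> = 2 * (\<Sum>A\<in>Pow K. G A z)"
            unfolding G_def by (subst sum_ennreal) (auto simp: ennreal_mult sum_nonneg)
          finally show ?thesis using True B(3) by (auto simp: z_def)
        qed simp
      qed
      also have "\<dots> = 2 * (\<Sum>A\<in>Pow K. \<integral>\<^sup>+v. G A (aut (a j) v) * indicator (bergman_ball base_point (r / 4)) v
          \<partial>wmeas \<alpha>2)"
      proof -
        have "(\<lambda>v. \<Sum>A\<in>Pow K. G A (aut (a j) v) * indicator (bergman_ball base_point (r / 4)) v) \<in>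
            borel_measurable (wmeas \<alpha>2)"
          using GaB by (intro borel_measurable_sum) auto
        moreover have "(\<integral>\<^sup>+v. (\<Sum>A\<in>Pow K. G A (aut (a j) v) * indicator (bergman_ball base_point (r / 4)) v)
            \<partial>wmeas \<alpha>2)
           = (\<Sum>A\<in>Pow K. \<integral>\<^sup>+v. G A (aut (a j) v) * indicator (bergman_ball base_point (r / 4)) v \<partial>wmeas \<alpha>2)"
          by (rule nn_integral_sum) (use GaB in auto)
        ultimately show ?thesis by (simp add: nn_integral_cmult)
      qed
      finally have "ennreal W * (ennreal (2 ^ card K * ((c j * t j) / 2) powr p2) * ennreal v1)
          \<le> ennreal W * (2 * (\<Sum>A\<in>Pow K. \<integral>\<^sup>+v. G A (aut (a j) v)
          * indicator (bergman_ball base_point (r / 4)) v \<partial>wmeas \<alpha>2))"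
        unfolding v1(1) by (intro mult_left_mono) auto
      also have "\<dots> = 2 * (\<Sum>A\<in>Pow K. \<integral>\<^sup>+z. G A z * indicator (bergman_ball (a j) (r / 4)) z \<partial>wmeas \<alpha>2)"
        using tr by (simp add: sum_distrib_left mult.left_commute)
      also have "ennreal W * (ennreal (2 ^ card K * ((c j * t j) / 2) powr p2) * ennreal v1)
          = ennreal (2 ^ card K * (v1 * (c0 / 2) powr p2 * (c j * d j) powr p2))"
      proof -
        have "W * ((c j * t j) / 2) powr p2 = (c0 / 2) powr p2 * (c j * d j) powr p2"
        proof -
          have W: "W = (rho_diag (a j) powr ((?N + 1 + \<alpha>2) / p2)) powr p2" using p
              by (simp add: W_def powr_powr)
          have ex: "(?N + 1 + \<alpha>2) / p2 + (e1 - 2 * b) = - e" by (simp add: e e1_def)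
          have "rho_diag (a j) powr ((?N + 1 + \<alpha>2) / p2) * ((c j * t j) / 2)
              = (c0 / 2) * (c j * (m j * (rho_diag (a j) powr ((?N + 1 + \<alpha>2) / p2)
              * rho_diag (a j) powr (e1 - 2 * b))))"
            by (simp add: t_def)
          also have "rho_diag (a j) powr ((?N + 1 + \<alpha>2) / p2) * rho_diag (a j) powr (e1 - 2 * b)
              = 1 / rho_diag (a j) powr e"
            unfolding powr_add[symmetric] ex by (simp add: powr_minus_divide)
          finally have "rho_diag (a j) powr ((?N + 1 + \<alpha>2) / p2) * ((c j * t j) / 2)
              = (c0 / 2) * (c j * d j)" by (simp add: d_def)
          then have "(rho_diag (a j) powr ((?N + 1 + \<alpha>2) / p2) * ((c j * t j) / 2)) powr p2
              = ((c0 / 2) * (c j * d j)) powr p2" by (rule arg_cong)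
          moreover have "0 \<le> c j * t j / 2" "0 \<le> c j * d j" using c[of j] c0 m0 d0[of j] by (auto simp: t_def)
          ultimately show ?thesis unfolding W using c0
              by (simp only: powr_mult powr_ge_zero less_imp_le divide_nonneg_nonneg zero_le_numeral)
        qed
        then have "W * (2 ^ card K * ((c j * t j) / 2) powr p2 * v1)
            = 2 ^ card K * (v1 * (c0 / 2) powr p2 * (c j * d j) powr p2)"
          by (simp add: mult_ac)
        moreover have "0 \<le> W" by (simp add: W_def)
        ultimately show ?thesis using v1(2) by (simp add: ennreal_mult[symmetric])
      qed
      finally show ?thesis .
    qed
    have "ennreal (2 ^ card K * (v1 * (c0 / 2) powr p2 * (\<Sum>j\<in>K. (c j * d j) powr p2)))
        = (\<Sum>j\<in>K. ennreal (2 ^ card K * (v1 * (c0 / 2) powr p2 * (c j * d j) powr p2)))"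
      using v1 by (subst sum_ennreal) (auto simp: sum_distrib_left)
    also have "\<dots> \<le> (\<Sum>j\<in>K. 2 * (\<Sum>A\<in>Pow K. \<integral>\<^sup>+z. G A z * indicator (bergman_ball (a j) (r / 4)) z \<partial>wmeas \<alpha>2))"
      by (intro sum_mono lower)
    also have "\<dots> = 2 * (\<Sum>A\<in>Pow K. \<Sum>j\<in>K. \<integral>\<^sup>+z. G A z * indicator (bergman_ball (a j) (r / 4)) z \<partial>wmeas \<alpha>2)"
      by (subst sum.swap) (simp add: sum_distrib_left)
    also have "\<dots> \<le> 2 * (\<Sum>A\<in>Pow K. ennreal (C powr p2 * C1 powr \<theta> * X powr \<theta>))"
      using up by (intro mult_left_mono sum_mono) auto
    also have "\<dots> = ennreal (2 * (2 ^ card K * (C powr p2 * C1 powr \<theta> * X powr \<theta>)))"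
      using K by (simp add: card_Pow ennreal_mult ennreal_power[symmetric])
    finally have "2 ^ card K * (v1 * (c0 / 2) powr p2 * (\<Sum>j\<in>K. (c j * d j) powr p2))
        \<le> 2 ^ card K * (2 * (C powr p2 * C1 powr \<theta> * X powr \<theta>))"
      by (simp add: ennreal_le_iff)
    then have "v1 * (c0 / 2) powr p2 * (\<Sum>j\<in>K. (c j * d j) powr p2) \<le> 2 * (C powr p2 * C1 powr \<theta> * X powr \<theta>)"
      by (rule mult_left_le_imp_le) simp
    moreover have "0 < v1 * (c0 / 2) powr p2" using v1 c0 by simp
    ultimately show ?thesis by (simp add: C'_def X_def field_simps)
  qed
  have s_pos: "0 < s" "s / p1 + 1 = s / p2"
  proof -
    have "0 < 1 / p2 - 1 / p1" using p by (simp add: field_simps)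
    then have "0 < s" "s * (1 / p2 - 1 / p1) = 1" using p by (simp_all add: s)
    then show "0 < s" "s / p1 + 1 = s / p2" by (simp_all add: right_diff_distrib)
  qed
  have bound: "(\<Sum>k<n. d k powr s) \<le> C' powr (1 / (1 - \<theta>))" for n
  proof -
    define X where "X = (\<Sum>k<n. d k powr s)"
    have X0: "0 \<le> X" by (simp add: X_def sum_nonneg)
    \<comment> \<open>With \<open>c = d powr (s / p1)\<close> both sums become \<open>X\<close>,
      since \<open>s / p1 + 1 = s / p2\<close>. As \<open>\<theta> < 1\<close>, the inequality
      \<open>X \<le> C' * X powr \<theta>\<close> then bounds \<open>X\<close> independently of
      \<open>n\<close>.\<close>
    have "(\<Sum>j<n. (d j powr (s / p1) * d j) powr p2) \<le> C' * (\<Sum>k<n. (d k powr (s / p1)) powr p1) powr \<theta>"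
      by (rule key) auto
    moreover have "(d j powr (s / p1) * d j) powr p2 = d j powr s" for j
    proof (cases "d j = 0")
      case False
      then have dj: "0 < d j" using d0[of j] by simp
      then have "d j powr (s / p1) * d j = d j powr (s / p1 + 1)" by (simp add: powr_add)
      then show ?thesis using p by (simp add: s_pos powr_powr)
    qed simp
    moreover have "(d k powr (s / p1)) powr p1 = d k powr s" for k using p1 by (simp add: powr_powr)
    ultimately have XX: "X \<le> C' * X powr \<theta>" by (simp add: X_def)
    show ?thesis
    proof (cases "X = 0")
      case False
      then have Xp: "0 < X" using X0 by simp
      have "X = X powr (1 - \<theta>) * X powr \<theta>" using Xp by (simp add: powr_add[symmetric])
      then have "X powr (1 - \<theta>) * X powr \<theta> \<le> C' * X powr \<theta>" using XX by simp
      then have "X powr (1 - \<theta>) \<le> C'" using Xp by (simp add: mult_le_cancel_right)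
      then have "(X powr (1 - \<theta>)) powr (1 / (1 - \<theta>)) \<le> C' powr (1 / (1 - \<theta>))" using \<theta> by (intro powr_mono2) auto
      then show ?thesis using \<theta> Xp by (simp add: powr_powr X_def)
    qed (simp add: X_def[symmetric])
  qed
  have "summable (\<lambda>k. d k powr s)" by (rule summableI_nonneg_bounded[OF _ bound]) simp
  then show ?thesis by (simp add: d_def m_def)
qed

section \<open>Compactness in Bergman spaces\<close>

lemma lp_int_indicator:
  "lp_int p \<alpha> f = (\<integral>\<^sup>+z. ennreal (cmod (f z) powr p) * indicator tube z \<partial>wmeas \<alpha>)"
  unfolding lp_int_def by (rule nn_integral_wmeas_cong) simp

lemma nn_integral_lp_combination:
  fixes f g :: "complex ^ 'n::{finite,wellorder} \<Rightarrow> complex"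
  assumes f: "holomorphic_tube f" and g: "holomorphic_tube g" and c: "0 \<le> c1" "0 \<le> c2"
  shows "(\<integral>\<^sup>+z. ennreal (c1 * cmod (f z) powr p + c2 * cmod (g z) powr p) \<partial>wmeas \<alpha>)
      = ennreal c1 * lp_int p \<alpha> f + ennreal c2 * lp_int p \<alpha> g"
proof -
  define X where "X f z = ennreal (cmod (f z) powr p) * indicator tube z" for f :: "complex ^ 'n::_ \<Rightarrow>
      complex" and z
  have X: "X f \<in> borel_measurable borel" if "holomorphic_tube f" for f
    unfolding X_def by (rule cmod_powr_borel[OF that]) auto
  have "(\<integral>\<^sup>+z. ennreal (c1 * cmod (f z) powr p + c2 * cmod (g z) powr p) \<partial>wmeas \<alpha>)
      = (\<integral>\<^sup>+z. ennreal c1 * X f z + ennreal c2 * X g z \<partial>wmeas \<alpha>)"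
    by (rule nn_integral_wmeas_cong) (use c in \<open>simp add: X_def ennreal_mult\<close>)
  also have "\<dots> = (\<integral>\<^sup>+z. ennreal c1 * X f z \<partial>wmeas \<alpha>) + (\<integral>\<^sup>+z. ennreal c2 * X g z \<partial>wmeas \<alpha>)"
    by (rule nn_integral_add) (use X[OF f] X[OF g] in auto)
  also have "\<dots> = ennreal c1 * lp_int p \<alpha> f + ennreal c2 * lp_int p \<alpha> g"
    unfolding lp_int_indicator using X[OF f] X[OF g]
    by (subst (1 2) nn_integral_cmult) (auto simp: X_def[abs_def])
  finally show ?thesis .
qed

lemma cmod_diff_powr_le:
  assumes "0 < p"
  shows "cmod (u - v) powr p \<le> 2 powr p * cmod u powr p + 2 powr p * cmod v powr p"
proof -
  have "cmod (u - v) \<le> 2 * cmod u \<or> cmod (u - v) \<le> 2 * cmod v"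
    using norm_triangle_ineq4[of u v] by linarith
  then have "cmod (u - v) powr p \<le> (2 * cmod u) powr p \<or> cmod (u - v) powr p \<le> (2 * cmod v) powr p"
    using assms powr_mono2[of p "cmod (u - v)" "2 * cmod u"] powr_mono2[of p "cmod (u - v)" "2 * cmod v"]
        by auto
  then show ?thesis by (auto simp: powr_mult intro: add_increasing add_increasing2)
qed

lemma lp_int_diff_le:
  assumes p: "0 < p" and f: "holomorphic_tube f" and g: "holomorphic_tube g"
  shows "lp_int p \<alpha> (\<lambda>z. f z - g z) \<le> ennreal (2 powr p) * lp_int p \<alpha> f + ennreal (2 powr p) * lp_int p \<alpha> g"
proof -
  have "lp_int p \<alpha> (\<lambda>z. f z - g z) \<le> (\<integral>\<^sup>+z. ennreal (2 powr p * cmod (f z) powr p + 2 powr p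
      * cmod (g z) powr p) \<partial>wmeas \<alpha>)"
    unfolding lp_int_def by (intro nn_integral_mono ennreal_leI cmod_diff_powr_le p)
  also have "\<dots> = ennreal (2 powr p) * lp_int p \<alpha> f + ennreal (2 powr p) * lp_int p \<alpha> g"
    by (rule nn_integral_lp_combination[OF f g]) auto
  finally show ?thesis .
qed

lemma holomorphic_tube_diff: "holomorphic_tube f \<Longrightarrow> holomorphic_tube g \<Longrightarrow> holomorphic_tube (\<lambda>z. f z - g z)"
  by (simp add: holomorphic_tube_iff holo_on_diff)

lemma bergman_space_diff:
  assumes p: "0 < p" and f: "f \<in> bergman_space p \<alpha>" and g: "g \<in> bergman_space p \<alpha>"
  shows "(\<lambda>z. f z - g z) \<in> bergman_space p \<alpha>"
proof -
  have h: "holomorphic_tube f" "holomorphic_tube g" "lp_int p \<alpha> f < \<infinity>" "lp_int p \<alpha> g < \<infinity>"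
    using f g by (auto simp: bergman_space_iff[OF p])
  have "lp_int p \<alpha> (\<lambda>z. f z - g z) \<le> ennreal (2 powr p) * lp_int p \<alpha> f + ennreal (2 powr p) * lp_int p \<alpha> g"
    by (rule lp_int_diff_le[OF p h(1,2)])
  also have "\<dots> < \<infinity>" using h by (simp add: ennreal_mult_less_top)
  finally show ?thesis using h by (simp add: bergman_space_iff[OF p] holomorphic_tube_diff)
qed

lemma Lp_norm_cong:
  fixes f g :: "complex ^ 'n::{finite,wellorder} \<Rightarrow> complex"
  assumes "\<And>z. z \<in> tube \<Longrightarrow> g z = f z"
  shows "Lp_norm p \<alpha> g = Lp_norm p \<alpha> f"
proof -
  have "space (weighted_measure \<alpha> :: (complex ^ 'n::_) measure) = tube"
      by (simp add: weighted_measure_def space_restrict_space)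
  then have "(\<integral>z. cmod (g z) powr p \<partial>weighted_measure \<alpha>) = (\<integral>z. cmod (f z) powr p \<partial>weighted_measure \<alpha>)"
    using assms by (intro Bochner_Integration.integral_cong) auto
  then show ?thesis by (simp add: Lp_norm_def)
qed

lemma convex_powr_two:
  fixes t x y p :: real
  assumes "0 \<le> t" "t \<le> 1" "0 \<le> x" "0 \<le> y" "1 < p"
  shows "(t * x + (1 - t) * y) powr p \<le> t * x powr p + (1 - t) * y powr p"
  using powr_weighted_sum_le[of "{True, False}" "\<lambda>b. if b then t else 1 - t" "\<lambda>b. if b then x else y" p] assms
  by simp

text \<open>With \<open>t = A / (A + B)\<close>, the sum \<open>|u| + |v|\<close> is
  \<open>A + B\<close> times a convex combination of \<open>|u| / A\<close> and
  \<open>|v| / B\<close>; convexity of the power and integration give the bound.\<close>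

lemma minkowski_holomorphic:
  assumes p: "1 < p" and f: "f \<in> bergman_space p \<alpha>" and g: "g \<in> bergman_space p \<alpha>"
  shows "Lp_norm p \<alpha> (\<lambda>z. f z - g z) \<le> Lp_norm p \<alpha> f + Lp_norm p \<alpha> g"
proof (rule field_le_epsilon)
  have p0: "0 < p" using p by simp
  have h: "holomorphic_tube f" "holomorphic_tube g" using f g by (auto simp: bergman_space_iff[OF p0])
  fix e :: real assume e: "0 < e"
  \<comment> \<open>The summand \<open>e / 2\<close> keeps both numbers positive when a norm
    vanishes.\<close>
  define A B where "A = Lp_norm p \<alpha> f + e / 2" and "B = Lp_norm p \<alpha> g + e / 2"
  have AB: "0 < A" "0 < B" "Lp_norm p \<alpha> f \<le> A" "Lp_norm p \<alpha> g \<le> B"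
    unfolding A_def B_def using e Lp_norm_nonneg[of p \<alpha> f] Lp_norm_nonneg[of p \<alpha> g] by auto
  define t where "t = A / (A + B)"
  have t: "0 \<le> t" "t \<le> 1" "1 - t = B / (A + B)" using AB by (auto simp: t_def field_simps)
  define c1 c2 where "c1 = (A + B) powr p * t / A powr p" and "c2 = (A + B) powr p * (1 - t) / B powr p"
  have c: "0 \<le> c1" "0 \<le> c2" using AB(1,2) t(1,2) by (auto simp: c1_def c2_def)
  have pt: "cmod (u - v) powr p \<le> c1 * cmod u powr p + c2 * cmod v powr p" for u v
  proof -
    have "cmod (u - v) \<le> cmod u + cmod v" by (rule norm_triangle_ineq4)
    also have "\<dots> = (A + B) * (t * (cmod u / A) + (1 - t) * (cmod v / B))"
    proof -
      have "(A + B) * (t * (cmod u / A)) = cmod u" "(A + B) * ((1 - t) * (cmod v / B)) = cmod v"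
        unfolding t(3) using AB(1,2) by (auto simp: t_def)
      then show ?thesis by (simp only: distrib_left)
    qed
    finally have "cmod (u - v) powr p \<le> ((A + B) * (t * (cmod u / A) + (1 - t) * (cmod v / B))) powr p"
      using p by (intro powr_mono2) auto
    also have "\<dots> = (A + B) powr p * (t * (cmod u / A) + (1 - t) * (cmod v / B)) powr p"
      using AB t by (subst powr_mult) auto
    also have "\<dots> \<le> (A + B) powr p * (t * (cmod u / A) powr p + (1 - t) * (cmod v / B) powr p)"
      using AB t p by (intro mult_left_mono convex_powr_two) auto
    also have "\<dots> = c1 * cmod u powr p + c2 * cmod v powr p"
      using AB by (simp add: c1_def c2_def powr_divide distrib_left)
    finally show ?thesis .
  qed
  have "lp_int p \<alpha> (\<lambda>z. f z - g z) \<le> (\<integral>\<^sup>+z. ennreal (c1 * cmod (f z) powr p + c2 * cmod (g z) powr p) \<partial>wmeas \<alpha>)"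
    unfolding lp_int_def by (intro nn_integral_mono ennreal_leI pt)
  also have "\<dots> = ennreal c1 * lp_int p \<alpha> f + ennreal c2 * lp_int p \<alpha> g"
    by (rule nn_integral_lp_combination[OF h c])
  also have "\<dots> \<le> ennreal c1 * ennreal (A powr p) + ennreal c2 * ennreal (B powr p)"
    unfolding Lp_norm_powr[OF p0 f] Lp_norm_powr[OF p0 g]
    using AB p Lp_norm_nonneg[of p \<alpha>] by (intro add_mono mult_left_mono ennreal_leI powr_mono2) auto
  also have "\<dots> = ennreal (c1 * A powr p + c2 * B powr p)"
    using c by (simp add: ennreal_mult)
  also have "c1 * A powr p + c2 * B powr p = (A + B) powr p"
    using AB by (simp add: c1_def c2_def distrib_left[symmetric])
  finally have "Lp_norm p \<alpha> (\<lambda>z. f z - g z) \<le> A + B"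
    using AB by (intro Lp_norm_leI[OF p0 holomorphic_tube_diff[OF h]]) auto
  then show "Lp_norm p \<alpha> (\<lambda>z. f z - g z) \<le> Lp_norm p \<alpha> f + Lp_norm p \<alpha> g + e" by (simp add: A_def B_def)
qed

text \<open>Minkowski's inequality above 1 and subadditivity of the power up to 1, in one form. It
  is the triangle inequality of the metric used in the compactness argument.\<close>

lemma Lp_norm_powr_min_triangle:
  assumes p: "0 < p" and f: "f \<in> bergman_space p \<alpha>" and g: "g \<in> bergman_space p \<alpha>"
  shows "Lp_norm p \<alpha> (\<lambda>z. f z - g z) powr min 1 p \<le> Lp_norm p \<alpha> f powr min 1 p + Lp_norm p \<alpha> g powr min 1 p"
proof (cases "1 < p")
  case True
  then show ?thesis using minkowski_holomorphic[OF True f g] by (simp add: min_def Lp_norm_nonneg)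
next
  case False
  have h: "holomorphic_tube f" "holomorphic_tube g" using f g by (auto simp: bergman_space_iff[OF p])
  have "ennreal (Lp_norm p \<alpha> (\<lambda>z. f z - g z) powr p) = lp_int p \<alpha> (\<lambda>z. f z - g z)"
    using Lp_norm_powr[OF p bergman_space_diff[OF p f g]] by simp
  also have "\<dots> \<le> (\<integral>\<^sup>+z. ennreal (1 * cmod (f z) powr p + 1 * cmod (g z) powr p) \<partial>wmeas \<alpha>)"
    unfolding lp_int_def
  proof (intro nn_integral_mono ennreal_leI)
    fix z
    have "cmod (f z - g z) powr p \<le> (cmod (f z) + cmod (g z)) powr p"
      using p by (intro powr_mono2 norm_triangle_ineq4) auto
    also have "\<dots> \<le> cmod (f z) powr p + cmod (g z) powr p"
      using p False by (intro powr_add_le) auto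
    finally show "cmod (f z - g z) powr p \<le> 1 * cmod (f z) powr p + 1 * cmod (g z) powr p" by simp
  qed
  also have "\<dots> = ennreal 1 * lp_int p \<alpha> f + ennreal 1 * lp_int p \<alpha> g"
    by (rule nn_integral_lp_combination[OF h]) auto
  also have "\<dots> = ennreal (Lp_norm p \<alpha> f powr p + Lp_norm p \<alpha> g powr p)"
    by (simp add: Lp_norm_powr[OF p f] Lp_norm_powr[OF p g])
  finally have "Lp_norm p \<alpha> (\<lambda>z. f z - g z) powr p \<le> Lp_norm p \<alpha> f powr p + Lp_norm p \<alpha> g powr p"
    by (subst (asm) ennreal_le_iff) auto
  then show ?thesis using False by (simp add: min_def)
qed

text \<open>The mean value estimate controls individual points, so the conclusion is not weakened by
  a null set.\<close>

lemma Lp_norm_eq_0_imp: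
  assumes p: "0 < p" and f: "f \<in> bergman_space p \<alpha>" and 0: "Lp_norm p \<alpha> f = 0" and w: "w \<in> tube"
  shows "f w = 0"
proof -
  have h: "holomorphic_tube f" using f by (auto simp: bergman_space_iff[OF p])
  obtain C where "ennreal (cmod (f w) powr p) \<le> ennreal C *
       (\<integral>\<^sup>+z. ennreal (cmod (f z) powr p) * indicator (bergman_ball w 1) z \<partial>wmeas \<alpha>)"
    using cmod_powr_le_at_center[OF p, of \<alpha>] w h by blast
  also have "\<dots> \<le> ennreal C * lp_int p \<alpha> f"
    unfolding lp_int_def by (intro mult_left_mono nn_integral_mono) (auto simp: indicator_def)
  also have "\<dots> = 0" using Lp_norm_powr[OF p f] 0 p by simp
  finally show ?thesis using p by (simp add: ennreal_eq_0_iff)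
qed

lemma topspace_bergman_topology [simp]: "topspace (bergman_topology p \<alpha>) = bergman_space p \<alpha>"
proof
  show "topspace (bergman_topology p \<alpha>) \<subseteq> bergman_space p \<alpha>"
    using openin_topspace[of "bergman_topology p \<alpha>"] unfolding openin_bergman_topology by blast
  have "openin (bergman_topology p \<alpha>) (bergman_space p \<alpha>)"
    unfolding openin_bergman_topology by (auto intro: exI[of _ 1])
  then show "bergman_space p \<alpha> \<subseteq> topspace (bergman_topology p \<alpha>)" by (rule openin_subset)
qed

text \<open>\<open>bergman_topology\<close> is only pseudometric. Functions vanishing off the tube form a genuine metric
  space, and every open set of \<open>bergman_topology\<close> is saturated under restriction to the tube.\<close>

lemma bergman_compact_closure:
  fixes T :: "(complex ^ 'n::{finite,wellorder} \<Rightarrow> complex) set"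
  assumes p: "0 < p" and T: "T \<subseteq> bergman_space p \<alpha>"
    and seq: "\<And>\<sigma> :: nat \<Rightarrow> complex ^ 'n::_ \<Rightarrow> complex. range \<sigma> \<subseteq> T
        \<Longrightarrow> \<exists>l\<in>bergman_space p \<alpha>. \<exists>r. strict_mono (r :: nat \<Rightarrow> nat) \<and>
        (\<lambda>j. Lp_norm p \<alpha> (\<lambda>z. \<sigma> (r j) z - l z)) \<longlonglongrightarrow> 0"
  shows "compactin (bergman_topology p \<alpha>) (bergman_topology p \<alpha> closure_of T)"
proof -
  let ?B = "bergman_space p \<alpha> :: (complex ^ 'n::_ \<Rightarrow> complex) set"
  let ?\<tau> = "bergman_topology p \<alpha> :: (complex ^ 'n::_ \<Rightarrow> complex) topology"
  \<comment> \<open>Extension by zero picks one representative from each class of functions that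
    agree on the domain.\<close>
  define q where "q = (\<lambda>(f :: complex ^ 'n::_ \<Rightarrow> complex) z. if z \<in> tube then f z else 0)"
  define M where "M = {f \<in> ?B. \<forall>z. z \<notin> tube \<longrightarrow> f z = 0}"
  define m where "m = min 1 p"
  have m: "0 < m" using p by (simp add: m_def)
  define d where "d = (\<lambda>f g :: complex ^ 'n::_ \<Rightarrow> complex. Lp_norm p \<alpha> (\<lambda>z. f z - g z) powr m)"
  have hol: "holomorphic_tube f" if "f \<in> ?B" for f using that by (simp add: bergman_space_iff[OF p])
  have qB: "q f \<in> M" if "f \<in> ?B" for f
  proof -
    note holf = hol[OF that]
    have "lp_int p \<alpha> (q f) = lp_int p \<alpha> f" by (rule lp_int_cong) (simp add: q_def)
    moreover have "holomorphic_tube (q f)"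
      unfolding holomorphic_tube_def
    proof
      fix z :: "complex ^ 'n::_" assume z: "z \<in> tube"
      then obtain f' where f': "(f has_derivative f') (at z)" "\<forall>c v. f' (c *s v) = c * f' v"
        using holf unfolding holomorphic_tube_def by blast
      have "(q f has_derivative f') (at z)"
        by (rule has_derivative_transform_within_open[OF f'(1) open_tube z]) (simp add: q_def)
      then show "\<exists>f'. (q f has_derivative f') (at z) \<and> (\<forall>c v. f' (c *s v) = c * f' v)" using f'(2) by blast
    qed
    ultimately show ?thesis using that by (simp add: M_def bergman_space_iff[OF p] q_def)
  qed
  have MB: "f \<in> ?B" if "f \<in> M" for f using that by (simp add: M_def)
  have nq: "Lp_norm p \<alpha> (\<lambda>z. q f z - q g z) = Lp_norm p \<alpha> (\<lambda>z. f z - g z)" if "f \<in> ?B" "g \<in> ?B" for f g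
    by (rule Lp_norm_cong) (simp add: q_def)
  have nqr: "Lp_norm p \<alpha> (\<lambda>z. q f z - f z) = 0" if "f \<in> ?B" for f
  proof -
    have "Lp_norm p \<alpha> (\<lambda>z. q f z - f z) = Lp_norm p \<alpha> (\<lambda>z. f z - f z)"
      by (rule Lp_norm_cong) (simp add: q_def)
    then show ?thesis using p by (simp add: Lp_norm_def)
  qed
  have ncomm: "Lp_norm p \<alpha> (\<lambda>z. f z - g z) = Lp_norm p \<alpha> (\<lambda>z. g z - f z)" for f g :: "complex ^ 'n::_ \<Rightarrow> complex"
    by (simp add: Lp_norm_def norm_minus_commute)
  interpret Metric_space M d
  proof
    show "0 \<le> d f g" for f g by (simp add: d_def)
    show "d f g = d g f" for f g unfolding d_def by (subst ncomm) simp
    show "d f g = 0 \<longleftrightarrow> f = g" if fg: "f \<in> M" "g \<in> M" for f g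
    proof
      assume "d f g = 0"
      then have 0: "Lp_norm p \<alpha> (\<lambda>z. f z - g z) = 0" by (simp add: d_def)
      have "f z = g z" for z
      proof (cases "z \<in> tube")
        case True
        then show ?thesis using Lp_norm_eq_0_imp[OF p bergman_space_diff[OF p MB[OF fg(1)] MB[OF fg(2)]] 0
            True] by simp
      next
        case False
        then show ?thesis using fg by (simp add: M_def)
      qed
      then show "f = g" by blast
    next
      assume "f = g"
      then show "d f g = 0" using p by (simp add: d_def Lp_norm_def)
    qed
    show "d f h \<le> d f g + d g h" if fgh: "f \<in> M" "g \<in> M" "h \<in> M" for f g h
    proof -
      have "Lp_norm p \<alpha> (\<lambda>z. (f z - g z) - (h z - g z)) powr m
          \<le> Lp_norm p \<alpha> (\<lambda>z. f z - g z) powr m + Lp_norm p \<alpha> (\<lambda>z. h z - g z) powr m"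
        unfolding m_def using fgh MB by (intro Lp_norm_powr_min_triangle bergman_space_diff p) auto
      then show ?thesis unfolding d_def ncomm[of h g] by simp
    qed
  qed
  have small: "d f g < \<epsilon> powr m \<Longrightarrow> Lp_norm p \<alpha> (\<lambda>z. f z - g z) < \<epsilon>" if "0 < \<epsilon>" for f g \<epsilon>
    unfolding d_def using m that Lp_norm_nonneg by (metis not_le powr_mono2 less_imp_le)
  have small': "Lp_norm p \<alpha> (\<lambda>z. f z - g z) < \<epsilon> \<Longrightarrow> d f g < \<epsilon> powr m" if "0 < \<epsilon>" for f g \<epsilon>
    unfolding d_def using m that Lp_norm_nonneg by (intro powr_less_mono2) auto
  have sat: "q f \<in> U \<longleftrightarrow> f \<in> U" if U: "openin ?\<tau> U" and f: "f \<in> ?B" for U f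
  proof
    assume "f \<in> U"
    then obtain \<epsilon> where "\<epsilon> > 0" "\<forall>g\<in>?B. Lp_norm p \<alpha> (\<lambda>z. g z - f z) < \<epsilon> \<longrightarrow> g \<in> U" using U
        unfolding openin_bergman_topology by blast
    then show "q f \<in> U" using nqr[OF f] MB[OF qB[OF f]] by simp
  next
    assume "q f \<in> U"
    then obtain \<epsilon> where "\<epsilon> > 0" "\<forall>g\<in>?B. Lp_norm p \<alpha> (\<lambda>z. g z - q f z) < \<epsilon> \<longrightarrow> g \<in> U" using U
        unfolding openin_bergman_topology by blast
    then show "f \<in> U" using nqr[OF f] ncomm[of f "q f"] f by simp
  qed
  have openM: "openin mtopology (U \<inter> M)" if U: "openin ?\<tau> U" for U
    unfolding openin_mtopology
  proof (intro conjI allI impI)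
    fix f assume f: "f \<in> U \<inter> M"
    then obtain \<epsilon> where \<epsilon>: "\<epsilon> > 0" "\<forall>g\<in>?B. Lp_norm p \<alpha> (\<lambda>z. g z - f z) < \<epsilon> \<longrightarrow> g \<in> U" using U
        unfolding openin_bergman_topology by blast
    have "mball f (\<epsilon> powr m) \<subseteq> U \<inter> M"
    proof
      fix g assume "g \<in> mball f (\<epsilon> powr m)"
      then have g: "g \<in> M" "d f g < \<epsilon> powr m" by auto
      then have "Lp_norm p \<alpha> (\<lambda>z. g z - f z) < \<epsilon>" using small[OF \<epsilon>(1)] ncomm[of g f] by simp
      then show "g \<in> U \<inter> M" using \<epsilon>(2) g MB by blast
    qed
    then show "\<exists>r>0. mball f r \<subseteq> U \<inter> M" using \<epsilon>(1) by (intro exI[of _ "\<epsilon> powr m"]) auto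
  qed simp
  have openB: "openin ?\<tau> {f \<in> ?B. q f \<in> V}" if V: "openin mtopology V" for V
    unfolding openin_bergman_topology
  proof (intro conjI ballI)
    fix f assume "f \<in> {f \<in> ?B. q f \<in> V}"
    then have f: "f \<in> ?B" "q f \<in> V" by auto
    then obtain r where r: "r > 0" "mball (q f) r \<subseteq> V" using V unfolding openin_mtopology by blast
    show "\<exists>\<epsilon>>0. \<forall>g\<in>?B. Lp_norm p \<alpha> (\<lambda>z. g z - f z) < \<epsilon> \<longrightarrow> g \<in> {f \<in> ?B. q f \<in> V}"
    proof (intro exI[of _ "r powr (1 / m)"] conjI ballI impI)
      show "0 < r powr (1 / m)" using r by simp
      fix g assume g: "g \<in> ?B" "Lp_norm p \<alpha> (\<lambda>z. g z - f z) < r powr (1 / m)"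
      then have "Lp_norm p \<alpha> (\<lambda>z. q f z - q g z) < r powr (1 / m)" using nq[OF f(1) g(1)] ncomm[of f g] by simp
      then have "d (q f) (q g) < (r powr (1 / m)) powr m" using r by (intro small') auto
      then have "d (q f) (q g) < r" using r m by (simp add: powr_powr)
      then have "q g \<in> mball (q f) r" using qB f(1) g(1) by simp
      then show "g \<in> {f \<in> ?B. q f \<in> V}" using g r by blast
    qed
  qed simp
  have cm: "compactin mtopology (mtopology closure_of (q ` T))"
  proof -
    have qTM: "q ` T \<subseteq> M" using qB T by blast
    have "\<forall>\<sigma>::nat \<Rightarrow> _. range \<sigma> \<subseteq> q ` T \<longrightarrow> (\<exists>l r. l \<in> M \<and> strict_mono r
        \<and> limitin mtopology (\<sigma> \<circ> r) l sequentially)"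
    proof (intro allI impI)
      fix \<sigma> :: "nat \<Rightarrow> complex ^ 'n::_ \<Rightarrow> complex" assume "range \<sigma> \<subseteq> q ` T"
      then have "\<forall>n. \<exists>t\<in>T. \<sigma> n = q t" by blast
      then obtain t where t: "\<And>n. t n \<in> T" "\<And>n. \<sigma> n = q (t n)" by metis
      then obtain l r where l: "l \<in> ?B" "strict_mono (r :: nat \<Rightarrow> nat)" "(\<lambda>j. Lp_norm p \<alpha> (\<lambda>z. t (r j) z - l
          z)) \<longlonglongrightarrow> 0"
        using seq[of t] by blast
      have tB: "t n \<in> ?B" for n using t T by blast
      have "(\<lambda>j. Lp_norm p \<alpha> (\<lambda>z. t (r j) z - l z) powr m) \<longlonglongrightarrow> 0 powr m"
        using m l(3) by (intro tendsto_powr2 tendsto_const) (auto simp: Lp_norm_nonneg)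
      then have lim: "(\<lambda>j. d (\<sigma> (r j)) (q l)) \<longlonglongrightarrow> 0"
        unfolding d_def t(2) using nq[OF tB l(1)] by simp
      have "limitin mtopology (\<sigma> \<circ> r) (q l) sequentially"
        unfolding limitin_metric
      proof (intro conjI allI impI)
        show "q l \<in> M" by (rule qB[OF l(1)])
        fix \<epsilon> :: real assume "0 < \<epsilon>"
        with lim have "\<forall>\<^sub>F j in sequentially. d (\<sigma> (r j)) (q l) < \<epsilon>" by (rule order_tendstoD(2))
        then show "\<forall>\<^sub>F j in sequentially. (\<sigma> \<circ> r) j \<in> M \<and> d ((\<sigma> \<circ> r) j) (q l) < \<epsilon>"
          by eventually_elim (use qB tB t(2) in auto)
      qed
      then show "\<exists>l r. l \<in> M \<and> strict_mono r \<and> limitin mtopology (\<sigma> \<circ> r) l sequentially"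
          using l(2) qB[OF l(1)] by blast
    qed
    then have "\<forall>T'. T' \<subseteq> q ` T \<and> infinite T' \<longrightarrow> M \<inter> mtopology derived_set_of T' \<noteq> {}"
      by (rule Bolzano_Weierstrass_property[THEN iffD1, rotated 2]) (use qTM in auto)
    then show ?thesis unfolding compact_closure_of_eq_Bolzano_Weierstrass by blast
  qed
  \<comment> \<open>The two closures correspond under \<open>q\<close>: the metric closure is
    contained in the other one, and by \<open>clB\<close> below \<open>q\<close> maps that one back
    into it.\<close>
  have clM: "mtopology closure_of (q ` T) \<subseteq> ?\<tau> closure_of T"
  proof
    fix f assume f: "f \<in> mtopology closure_of (q ` T)"
    then have fM: "f \<in> M" using closure_of_subset_topspace[of mtopology "q ` T"] by auto
    show "f \<in> ?\<tau> closure_of T"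
      unfolding in_closure_of
    proof (intro conjI allI impI)
      show "f \<in> topspace ?\<tau>" using MB[OF fM] by simp
      fix U assume "f \<in> U \<and> openin ?\<tau> U"
      then obtain y where "y \<in> q ` T" "y \<in> U \<inter> M" using f openM[of U] fM unfolding in_closure_of by blast
      then obtain t where "t \<in> T" "q t \<in> U" by blast
      then show "\<exists>y. y \<in> T \<and> y \<in> U" using sat[of U t] T \<open>f \<in> U \<and> openin ?\<tau> U\<close> by blast
    qed
  qed
  have clB: "q f \<in> mtopology closure_of (q ` T)" if f: "f \<in> ?\<tau> closure_of T" for f
    unfolding in_closure_of
  proof (intro conjI allI impI)
    have fB: "f \<in> ?B" using f closure_of_subset_topspace[of ?\<tau> T] by auto
    then show "q f \<in> topspace mtopology" using qB by simp
    fix V assume V: "q f \<in> V \<and> openin mtopology V"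
    then obtain t where "t \<in> T" "q t \<in> V"
    proof -
      have "openin ?\<tau> {f \<in> ?B. q f \<in> V}" using V by (intro openB) simp
      moreover have "f \<in> {f \<in> ?B. q f \<in> V}" using V fB by simp
      ultimately have "\<exists>y. y \<in> T \<and> y \<in> {f \<in> ?B. q f \<in> V}" using f by (simp only: in_closure_of)
      then show ?thesis using that by blast
    qed
    then show "\<exists>y. y \<in> q ` T \<and> y \<in> V" by blast
  qed
  show ?thesis
    unfolding compactin_def
  proof (intro conjI allI impI)
    show "?\<tau> closure_of T \<subseteq> topspace ?\<tau>" by (rule closure_of_subset_topspace)
    fix \<U> assume \<U>: "(\<forall>U\<in>\<U>. openin ?\<tau> U) \<and> ?\<tau> closure_of T \<subseteq> \<Union>\<U>"
    \<comment> \<open>An open cover is intersected with \<open>M\<close>, reduced to a finite one by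
      metric compactness, and pulled back along \<open>q\<close> by saturation.\<close>
    have cov: "mtopology closure_of (q ` T) \<subseteq> \<Union>((\<lambda>U. U \<inter> M) ` \<U>)"
    proof
      fix f assume f: "f \<in> mtopology closure_of (q ` T)"
      then have "f \<in> M" using closure_of_subset_topspace[of mtopology "q ` T"] by auto
      moreover have "f \<in> \<Union>\<U>" using f clM \<U> by blast
      ultimately show "f \<in> \<Union>((\<lambda>U. U \<inter> M) ` \<U>)" by blast
    qed
    have ops: "openin mtopology V" if "V \<in> (\<lambda>U. U \<inter> M) ` \<U>" for V using that openM \<U> by blast
    have "\<exists>\<F>. finite \<F> \<and> \<F> \<subseteq> (\<lambda>U. U \<inter> M) ` \<U> \<and> mtopology closure_of (q ` T) \<subseteq> \<Union>\<F>"
      by (rule compactinD[OF cm ops cov])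
    then obtain \<F> where \<F>: "finite \<F>" "\<F> \<subseteq> (\<lambda>U. U \<inter> M) ` \<U>" "mtopology closure_of (q ` T) \<subseteq> \<Union>\<F>"
      by (elim exE conjE)
    then obtain \<G> where \<G>: "\<G> \<subseteq> \<U>" "finite \<G>" "\<F> = (\<lambda>U. U \<inter> M) ` \<G>" using finite_subset_image by metis
    have "?\<tau> closure_of T \<subseteq> \<Union>\<G>"
    proof
      fix f assume f: "f \<in> ?\<tau> closure_of T"
      then have fB: "f \<in> ?B" using closure_of_subset_topspace[of ?\<tau> T] by auto
      obtain U where "U \<in> \<G>" "q f \<in> U" using clB[OF f] \<F>(3) \<G>(3) by blast
      then show "f \<in> \<Union>\<G>" using sat[of U f] fB \<U> \<G> by blast
    qed
    then show "\<exists>\<F>. finite \<F> \<and> \<F> \<subseteq> \<U> \<and> ?\<tau> closure_of T \<subseteq> \<Union>\<F>" using \<G> by blast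
  qed
qed

section \<open>Summability implies compactness\<close>

text \<open>The integral bound passes to the series by Fatou's lemma. Convergence is needed at every
  point, as the operator has to be defined everywhere: partial sums at \<open>z1\<close> are
  comparable with those on the whole ball around \<open>z1\<close>, hence bounded by their integrals
  over it.\<close>

lemma separated_Lp_bound_series:
  fixes a :: "nat \<Rightarrow> complex ^ 'n::{finite,wellorder}" and p \<alpha> b \<delta> :: real
  defines "e \<equiv> b - (real CARD('n) + 1 + \<alpha>) / p"
  assumes a: "\<And>k. a k \<in> tube" and \<delta>: "0 < \<delta>" and disj: "disjoint_family (\<lambda>k. bergman_ball (a k) \<delta>)"
    and p: "0 < p" and \<alpha>: "-1 < \<alpha>" and b: "real CARD('n) * max 1 (1 / p) + (1 + \<alpha>) / p < b"
  shows "\<exists>C\<ge>0. \<forall>c. (\<forall>k. 0 \<le> c k) \<longrightarrow> summable (\<lambda>k. c k powr p) \<longrightarrow>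
     (\<forall>z\<in>tube. summable (\<lambda>k. c k * rho_diag (a k) powr e * cmod (rho z (a k)) powr (-b))) \<and>
     (\<integral>\<^sup>+z. ennreal ((\<Sum>k. c k * rho_diag (a k) powr e * cmod (rho z (a k)) powr (-b)) powr p) \<partial>wmeas \<alpha>)
       \<le> ennreal (C * (\<Sum>k. c k powr p))"
proof -
  obtain C where C: "0 \<le> C" "\<And>K c. finite K \<Longrightarrow> (\<forall>k. 0 \<le> c k) \<Longrightarrow>
     (\<integral>\<^sup>+z. ennreal ((\<Sum>k\<in>K. c k * rho_diag (a k) powr e * cmod (rho z (a k)) powr (-b)) powr p) \<partial>wmeas \<alpha>)
       \<le> ennreal (C * (\<Sum>k\<in>K. c k powr p))"
    using separated_Lp_bound[OF a \<delta> disj p \<alpha> b] unfolding e_def by blast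
  have "0 \<le> real CARD('n) * max 1 (1 / p) + (1 + \<alpha>) / p" using p \<alpha>
      by (intro add_nonneg_nonneg mult_nonneg_nonneg) auto
  then have b0: "0 \<le> b" using b by simp
  show ?thesis
  proof (intro exI[of _ C] conjI allI impI C(1))
    fix c :: "nat \<Rightarrow> real" assume c: "\<forall>k. 0 \<le> c k" and sc: "summable (\<lambda>k. c k powr p)"
    define t where "t k z = c k * rho_diag (a k) powr e * cmod (rho z (a k)) powr (-b)" for k
        and z :: "complex ^ 'n::_"
    define g where "g n z = (\<Sum>k<n. t k z)" for n z
    define S where "S = (\<Sum>k. c k powr p)"
    have t0: "0 \<le> t k z" for k z using c by (simp add: t_def)
    have g0: "0 \<le> g n z" for n z unfolding g_def by (intro sum_nonneg t0)
    have S0: "0 \<le> S" unfolding S_def by (intro suminf_nonneg sc) auto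
    have gint: "(\<integral>\<^sup>+z. ennreal (g n z powr p) \<partial>wmeas \<alpha>) \<le> ennreal (C * S)" for n
    proof -
      have "(\<integral>\<^sup>+z. ennreal (g n z powr p) \<partial>wmeas \<alpha>) \<le> ennreal (C * (\<Sum>k<n. c k powr p))"
        unfolding g_def t_def by (rule C(2)) (use c in auto)
      also have "\<dots> \<le> ennreal (C * S)"
        unfolding S_def by (intro ennreal_leI mult_left_mono C(1) sum_le_suminf sc) auto
      finally show ?thesis .
    qed
    show sum: "\<forall>z\<in>tube. summable (\<lambda>k. c k * rho_diag (a k) powr e * cmod (rho z (a k)) powr (-b))"
    proof
      fix z1 :: "complex ^ 'n::_" assume z1: "z1 \<in> tube"
      let ?B = "bergman_ball z1 1"
      define D where "D = (24 * (cosh (1::real))\<^sup>2) powr b"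
      have D0: "0 \<le> D" by (simp add: D_def)
      have tle: "t k z1 \<le> D * t k w" if w: "w \<in> ?B" for k w
      proof -
        have wt: "w \<in> tube" using w bergman_ball_subset_tube by blast
        have "z1 \<in> bergman_ball w 1" using w z1 wt bergman_ball_commute by blast
        then have "cmod (rho (a k) z1) powr (-b) \<le> D * cmod (rho (a k) w) powr (-b)"
          unfolding D_def using cmod_rho_powr_ball_le[OF wt _ _ a b0, of z1 1 k] by simp
        then have "cmod (rho z1 (a k)) powr (-b) \<le> D * cmod (rho w (a k)) powr (-b)"
          by (simp add: cmod_rho_commute[of z1] cmod_rho_commute[of w])
        then have "c k * rho_diag (a k) powr e * cmod (rho z1 (a k)) powr (-b)
            \<le> c k * rho_diag (a k) powr e * (D * cmod (rho w (a k)) powr (-b))"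
          using c by (intro mult_left_mono) auto
        then show ?thesis by (simp add: t_def mult_ac)
      qed
      have gle: "g n z1 powr p \<le> D powr p * g n w powr p" if "w \<in> ?B" for n w
      proof -
        have "g n z1 \<le> D * g n w" unfolding g_def sum_distrib_left by (intro sum_mono tle that)
        then have "g n z1 powr p \<le> (D * g n w) powr p" using p g0 by (intro powr_mono2) auto
        then show ?thesis using D0 g0 by (simp add: powr_mult)
      qed
      obtain c1 where c1: "c1 > 0" "\<And>a. a \<in> (tube :: (complex ^ 'n::_) set) \<Longrightarrow>
          emeasure (wmeas \<alpha>) (bergman_ball a 1) = ennreal (c1 * rho_diag a powr (real CARD('n) + 1 + \<alpha>))"
        using emeasure_bergman_ball[OF zero_less_one \<alpha>] by blast
      define V where "V = c1 * rho_diag z1 powr (real CARD('n) + 1 + \<alpha>)"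
      have V: "0 < V" using c1 z1 by (simp add: V_def tube_iff)
      have Bs: "?B \<in> sets (wmeas \<alpha>)" using bergman_ball_borel[OF z1, of 1] by (simp add: sets_wmeas)
      have bound: "g n z1 powr p * V \<le> D powr p * (C * S)" for n
      proof -
        have "ennreal (g n z1 powr p * V) = ennreal (g n z1 powr p) * emeasure (wmeas \<alpha>) ?B"
          using V by (simp add: c1(2)[OF z1] V_def ennreal_mult)
        also have "\<dots> = (\<integral>\<^sup>+w. ennreal (g n z1 powr p) * indicator ?B w \<partial>wmeas \<alpha>)"
          using Bs by (simp add: nn_integral_cmult_indicator)
        also have "\<dots> \<le> (\<integral>\<^sup>+w. ennreal (D powr p) * ennreal (g n w powr p) \<partial>wmeas \<alpha>)"
          using gle by (intro nn_integral_mono) (auto simp: indicator_def ennreal_mult[symmetric] intro!: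
              ennreal_leI)
        also have "\<dots> = ennreal (D powr p) * (\<integral>\<^sup>+w. ennreal (g n w powr p) \<partial>wmeas \<alpha>)"
          by (rule nn_integral_cmult) (simp add: g_def t_def)
        also have "\<dots> \<le> ennreal (D powr p) * ennreal (C * S)" by (intro mult_left_mono gint) auto
        also have "\<dots> = ennreal (D powr p * (C * S))" using C(1) S0 by (simp add: ennreal_mult)
        finally show ?thesis using C(1) S0 by (subst (asm) ennreal_le_iff) auto
      qed
      have "g n z1 \<le> (D powr p * (C * S) / V) powr (1 / p)" for n
      proof -
        have "g n z1 powr p \<le> D powr p * (C * S) / V" using bound[of n] V by (simp add: pos_le_divide_eq)
        then have "(g n z1 powr p) powr (1 / p) \<le> (D powr p * (C * S) / V) powr (1 / p)"
          using p by (intro powr_mono2) auto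
        then show ?thesis using p g0 by (simp add: powr_powr)
      qed
      then have "sum (\<lambda>k. t k z1) {..n} \<le> (D powr p * (C * S) / V) powr (1 / p)" for n
        unfolding g_def lessThan_Suc_atMost[symmetric] .
      then have "summable (\<lambda>k. t k z1)" by (rule bounded_imp_summable[OF t0])
      then show "summable (\<lambda>k. c k * rho_diag (a k) powr e * cmod (rho z1 (a k)) powr (-b))"
          by (simp add: t_def)
    qed
    have "(\<integral>\<^sup>+z. ennreal ((\<Sum>k. t k z) powr p) \<partial>wmeas \<alpha>) \<le> (\<integral>\<^sup>+z. liminf (\<lambda>n. ennreal (g n z powr p)) \<partial>wmeas \<alpha>)"
    proof (rule nn_integral_wmeas_mono)
      fix z :: "complex ^ 'n::_" assume z: "z \<in> tube"
      have "(\<lambda>n. g n z) \<longlonglongrightarrow> (\<Sum>k. t k z)"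
        unfolding g_def by (rule summable_LIMSEQ) (use sum z in \<open>simp add: t_def\<close>)
      then have "(\<lambda>n. g n z powr p) \<longlonglongrightarrow> (\<Sum>k. t k z) powr p"
        using p g0 by (intro tendsto_powr2 tendsto_const) auto
      then have "(\<lambda>n. ennreal (g n z powr p)) \<longlonglongrightarrow> ennreal ((\<Sum>k. t k z) powr p)" by (rule tendsto_ennrealI)
      from lim_imp_Liminf[OF sequentially_bot this]
      show "ennreal ((\<Sum>k. t k z) powr p) \<le> liminf (\<lambda>n. ennreal (g n z powr p))" by simp
    qed
    also have "\<dots> \<le> liminf (\<lambda>n. \<integral>\<^sup>+z. ennreal (g n z powr p) \<partial>wmeas \<alpha>)"
      by (rule nn_integral_liminf) (simp add: g_def t_def)
    also have "\<dots> \<le> liminf (\<lambda>n::nat. ennreal (C * S))" by (intro Liminf_mono always_eventually allI gint)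
    also have "\<dots> = ennreal (C * S)" by (simp add: Liminf_const)
    finally show "(\<integral>\<^sup>+z. ennreal ((\<Sum>k. c k * rho_diag (a k) powr e * cmod (rho z (a k)) powr (-b)) powr p)
        \<partial>wmeas \<alpha>)
       \<le> ennreal (C * (\<Sum>k. c k powr p))" by (simp add: t_def S_def)
  qed
qed

text \<open>On each ball of the cover \<open>f\<close> is replaced by its bound \<open>u k\<close>
  and the kernel, up to a constant, by its value at the centre; what remains is a kernel sum. The
  sequence \<open>u\<close> is left free, since a uniform bound on finitely many balls and local
  integrals on the others will be combined.\<close>

lemma toeplitz_lp_int_le:
  fixes a :: "nat \<Rightarrow> complex ^ 'n::{finite,wellorder}" and \<mu> :: "(complex ^ 'n::_) measure" and p \<alpha> \<xi> r :: real
  defines "b \<equiv> real CARD('n) + 1 + \<xi>"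
  defines "e \<equiv> b - (real CARD('n) + 1 + \<alpha>) / p"
  assumes p: "0 < p" and \<alpha>: "-1 < \<alpha>" and \<xi>: "-1 < \<xi>" and \<mu>: "\<mu> \<in> M_plus"
    and b: "real CARD('n) * max 1 (1 / p) + (1 + \<alpha>) / p < b"
    and r: "0 < r" and lat: "is_lattice r a"
  shows "\<exists>C\<ge>0. \<forall>f u. holomorphic_tube f \<longrightarrow> (\<forall>k. 0 \<le> u k) \<longrightarrow> (\<forall>k. \<forall>w\<in>bergman_ball (a k) r. cmod (f w) \<le> u k) \<longrightarrow>
     summable (\<lambda>k. (u k * (measure \<mu> (bergman_ball (a k) r) / rho_diag (a k) powr e)) powr p) \<longrightarrow>
     (\<forall>z\<in>tube. integrable \<mu> (toeplitz_integrand \<xi> f z)) \<and>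
     lp_int p \<alpha> (toeplitz \<mu> \<xi> f) \<le> ennreal (C * (\<Sum>k. (u k * (measure \<mu> (bergman_ball (a k) r) / rho_diag (a
         k) powr e)) powr p))"
proof -
  have a: "a k \<in> tube" for k using lat by (auto simp: is_lattice_def)
  have cover: "(\<Union>k. bergman_ball (a k) r) = tube" using lat by (auto simp: is_lattice_def)
  have disj: "disjoint_family (\<lambda>k. bergman_ball (a k) (r / 4))" using lat by (auto simp: is_lattice_def)
  have r4: "0 < r / 4" using r by simp
  have ha: "0 < rho_diag (a k)" for k using a[of k] by (simp add: tube_iff)
  have sets\<mu>: "sets \<mu> = sets (restrict_space borel tube)" using \<mu> by (auto simp: M_plus_def)
  have sp: "space \<mu> = tube" by (rule space_tube_measure[OF sets\<mu>])
  have b0: "0 \<le> b" using \<xi> by (simp add: b_def)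
  obtain C where C: "0 \<le> C" and Cs: "\<And>c. (\<forall>k. 0 \<le> c k) \<Longrightarrow> summable (\<lambda>k. c k powr p) \<Longrightarrow>
     (\<forall>z\<in>tube. summable (\<lambda>k. c k * rho_diag (a k) powr e * cmod (rho z (a k)) powr (-b))) \<and>
     (\<integral>\<^sup>+z. ennreal ((\<Sum>k. c k * rho_diag (a k) powr e * cmod (rho z (a k)) powr (-b)) powr p) \<partial>wmeas \<alpha>)
       \<le> ennreal (C * (\<Sum>k. c k powr p))"
    using separated_Lp_bound_series[OF a r4 disj p \<alpha> b] unfolding e_def by blast
  define D where "D = (24 * (cosh r)\<^sup>2) powr b"
  have D0: "0 \<le> D" by (simp add: D_def)
  define B where "B k = bergman_ball (a k) r" for k
  define m where "m k = measure \<mu> (B k)" for k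
  have Bsub: "B k \<subseteq> tube" for k by (simp add: B_def bergman_ball_subset_tube)
  have Bs: "B k \<in> sets \<mu>" for k
    using bergman_ball_borel[OF a r, of k] Bsub[of k]
        by (simp add: sets\<mu> sets_restrict_space_iff tube_borel B_def)
  have em: "emeasure \<mu> (B k) = ennreal (m k)" for k
    unfolding m_def B_def using M_plus_ball_finite[OF \<mu> a r, of k] by (intro emeasure_eq_ennreal_measure) auto
  show ?thesis
  proof (rule exI[of _ "D powr p * C"], intro conjI allI impI)
    show "0 \<le> D powr p * C" using C by simp
    fix f :: "complex ^ 'n::_ \<Rightarrow> complex" and u :: "nat \<Rightarrow> real"
    assume f: "holomorphic_tube f" and u: "\<forall>k. 0 \<le> u k" and fu: "\<forall>k. \<forall>w\<in>bergman_ball (a k) r. cmod (f w) \<le> u k"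
      and sm: "summable (\<lambda>k. (u k * (measure \<mu> (bergman_ball (a k) r) / rho_diag (a k) powr e)) powr p)"
    \<comment> \<open>The coefficient in the normalisation of the kernel sum; the power of
      \<open>rho_diag (a k)\<close> cancels in \<open>tc\<close> and leaves
      \<open>u k * m k\<close>.\<close>
    define c where "c k = u k * (m k / rho_diag (a k) powr e)" for k
    have c0: "0 \<le> c k" for k using u by (simp add: c_def m_def)
    have sc: "summable (\<lambda>k. c k powr p)" using sm by (simp add: c_def m_def B_def)
    define t where "t k z = u k * m k * cmod (rho z (a k)) powr (-b)" for k z
    have tc: "c k * rho_diag (a k) powr e * cmod (rho z (a k)) powr (-b) = t k z" for k z
      using ha[of k] by (simp add: c_def t_def)
    have t0: "0 \<le> t k z" for k z using u by (simp add: t_def m_def)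
    have ts: "summable (\<lambda>k. t k z)" if "z \<in> tube" for z using Cs[of c] c0 sc that by (simp add: tc)
    have tint: "(\<integral>\<^sup>+z. ennreal ((\<Sum>k. t k z) powr p) \<partial>wmeas \<alpha>) \<le> ennreal (C * (\<Sum>k. c k powr p))"
      using Cs[of c] c0 sc by (simp add: tc)
    have meas: "toeplitz_integrand \<xi> f z \<in> borel_measurable \<mu>" if "z \<in> tube" for z
      by (rule toeplitz_integrand_measurable[OF sets\<mu> holomorphic_tube_continuous[OF f] that])
    have key: "(\<integral>\<^sup>+w. ennreal (cmod (toeplitz_integrand \<xi> f z w)) \<partial>\<mu>) \<le> ennreal (D * (\<Sum>k. t k z))"
        if z: "z \<in> tube" for z
    proof -
      have "(\<integral>\<^sup>+w. ennreal (cmod (toeplitz_integrand \<xi> f z w)) \<partial>\<mu>)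
          \<le> (\<integral>\<^sup>+w. (\<Sum>k. ennreal (u k * (D * cmod (rho z (a k)) powr (-b))) * indicator (B k) w) \<partial>\<mu>)"
      proof (rule nn_integral_mono)
        fix w assume "w \<in> space \<mu>"
        then obtain k where k: "w \<in> B k" using cover sp by (auto simp: B_def)
        then have "cmod (f w) * cmod (rho z w) powr (-b) \<le> u k * (D * cmod (rho z (a k)) powr (-b))"
          using fu u cmod_rho_powr_ball_le[OF a _ r z b0, of w k] by (intro mult_mono) (auto simp: B_def D_def)
        then have "ennreal (cmod (toeplitz_integrand \<xi> f z w))
            \<le> ennreal (u k * (D * cmod (rho z (a k)) powr (-b))) * indicator (B k) w"
          using k by (auto simp: cmod_toeplitz_integrand b_def intro!: ennreal_leI)
        also have "\<dots> = (\<Sum>j\<in>{k}. ennreal (u j * (D * cmod (rho z (a j)) powr (-b))) * indicator (B j) w)"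
            by (subst sum.insert) auto
        also have "\<dots> \<le> (\<Sum>k. ennreal (u k * (D * cmod (rho z (a k)) powr (-b))) * indicator (B k) w)"
          by (rule sum_le_suminf) auto
        finally show "ennreal (cmod (toeplitz_integrand \<xi> f z w))
            \<le> (\<Sum>k. ennreal (u k * (D * cmod (rho z (a k)) powr (-b))) * indicator (B k) w)" .
      qed
      also have "\<dots> = (\<Sum>k. \<integral>\<^sup>+w. ennreal (u k * (D * cmod (rho z (a k)) powr (-b))) * indicator (B k) w \<partial>\<mu>)"
        using Bs by (intro nn_integral_suminf) auto
      also have "\<dots> = (\<Sum>k. ennreal (D * t k z))"
      proof (rule suminf_cong)
        fix k
        have "(\<integral>\<^sup>+w. ennreal (u k * (D * cmod (rho z (a k)) powr (-b))) * indicator (B k) w \<partial>\<mu>)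
            = ennreal (u k * (D * cmod (rho z (a k)) powr (-b))) * ennreal (m k)"
          using Bs by (simp add: nn_integral_cmult_indicator em)
        also have "\<dots> = ennreal (D * t k z)" using u D0
            by (simp add: ennreal_mult[symmetric] t_def m_def mult_ac)
        finally show "(\<integral>\<^sup>+w. ennreal (u k * (D * cmod (rho z (a k)) powr (-b))) * indicator (B k) w \<partial>\<mu>)
            = ennreal (D * t k z)" .
      qed
      also have "\<dots> = ennreal (\<Sum>k. D * t k z)"
        using t0 D0 by (intro suminf_ennreal_eq summable_sums summable_mult ts z) auto
      also have "\<dots> = ennreal (D * (\<Sum>k. t k z))" by (simp add: suminf_mult ts z)
      finally show ?thesis .
    qed
    show int: "\<forall>z\<in>tube. integrable \<mu> (toeplitz_integrand \<xi> f z)"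
    proof
      fix z :: "complex ^ 'n::_" assume z: "z \<in> tube"
      show "integrable \<mu> (toeplitz_integrand \<xi> f z)"
        by (rule integrableI_bounded[OF meas[OF z]]) (use le_less_trans[OF key[OF z] ennreal_less_top] in simp)
    qed
    have Tle: "cmod (toeplitz \<mu> \<xi> f z) \<le> D * (\<Sum>k. t k z)" if z: "z \<in> tube" for z
    proof -
      have "ennreal (cmod (toeplitz \<mu> \<xi> f z)) \<le> (\<integral>\<^sup>+w. ennreal (cmod (toeplitz_integrand \<xi> f z w)) \<partial>\<mu>)"
        unfolding toeplitz_def by (rule integral_norm_bound_ennreal) (use int z in blast)
      also note key[OF z]
      finally show ?thesis using D0 suminf_nonneg[OF ts[OF z] t0] by (subst (asm) ennreal_le_iff) auto
    qed
    have "lp_int p \<alpha> (toeplitz \<mu> \<xi> f) \<le> (\<integral>\<^sup>+z. ennreal (D powr p) * (ennreal ((\<Sum>k. t k z) powr p)) \<partial>wmeas \<alpha>)"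
      unfolding lp_int_def
    proof (rule nn_integral_wmeas_mono)
      fix z :: "complex ^ 'n::_" assume z: "z \<in> tube"
      have "cmod (toeplitz \<mu> \<xi> f z) powr p \<le> (D * (\<Sum>k. t k z)) powr p"
        using p Tle[OF z] by (intro powr_mono2) auto
      also have "\<dots> = D powr p * (\<Sum>k. t k z) powr p"
        using D0 suminf_nonneg[OF ts[OF z] t0] by (simp add: powr_mult)
      finally show "ennreal (cmod (toeplitz \<mu> \<xi> f z) powr p)
          \<le> ennreal (D powr p) * ennreal ((\<Sum>k. t k z) powr p)"
        by (simp add: ennreal_mult[symmetric] ennreal_leI)
    qed
    also have "\<dots> = ennreal (D powr p) * (\<integral>\<^sup>+z. ennreal ((\<Sum>k. t k z) powr p) \<partial>wmeas \<alpha>)"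
      by (rule nn_integral_cmult) (simp add: t_def)
    also have "\<dots> \<le> ennreal (D powr p) * ennreal (C * (\<Sum>k. c k powr p))" by (intro mult_left_mono tint) auto
    also have "\<dots> = ennreal (D powr p * C * (\<Sum>k. c k powr p))"
      using C suminf_nonneg[OF sc] by (simp add: ennreal_mult[symmetric] mult.assoc)
    finally show "lp_int p \<alpha> (toeplitz \<mu> \<xi> f) \<le> ennreal (D powr p * C * (\<Sum>k. (u k
        * (measure \<mu> (bergman_ball (a k) r) / rho_diag (a k) powr e)) powr p))"
      by (simp add: c_def m_def B_def)
  qed
qed

text \<open>\<open>x k\<close> is a constant times the integral of the \<open>p\<close>-th power
  over \<open>bergman_ball (a k) R\<close>, and the bounded overlap of these larger balls bounds the
  sum.\<close>

lemma bergman_ball_majorant: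
  fixes a :: "nat \<Rightarrow> complex ^ 'n::{finite,wellorder}" and p \<alpha> r :: real
  assumes p: "0 < p" and \<alpha>: "-1 < \<alpha>" and r: "0 < r" and a: "\<And>k. a k \<in> tube"
    and \<delta>: "0 < \<delta>" and disj: "disjoint_family (\<lambda>k. bergman_ball (a k) \<delta>)"
  shows "\<exists>A\<ge>0. \<forall>f. holomorphic_tube f \<longrightarrow> lp_int p \<alpha> f \<le> 1 \<longrightarrow> (\<exists>x. (\<forall>k. 0 \<le> x k) \<and> summable x \<and> suminf x \<le> A \<and>
     (\<forall>k. \<forall>w\<in>bergman_ball (a k) r. cmod (f w) \<le> x k powr (1 / p) * rho_diag (a k) powr (- ((real CARD('n)
         + 1 + \<alpha>) / p))))"
proof -
  obtain R C where R: "0 < R" and C: "0 \<le> C" "\<And>f a w. a \<in> (tube :: (complex ^ 'n::_) set)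
      \<Longrightarrow> w \<in> bergman_ball a r \<Longrightarrow> holomorphic_tube f \<Longrightarrow>
    ennreal (cmod (f w) powr p) \<le> ennreal (C * rho_diag a powr (-(real CARD('n) + 1 + \<alpha>))) *
       (\<integral>\<^sup>+z. ennreal (cmod (f z) powr p) * indicator (bergman_ball a R) z \<partial>wmeas \<alpha>)"
    using cmod_powr_le_on_ball[OF p \<alpha> r] by blast
  have "disjoint_family_on (\<lambda>k. bergman_ball (a k) \<delta>) UNIV" using disj .
  from separated_overlap[OF a \<delta> this R] obtain M :: nat where
    M: "\<And>z. z \<in> tube \<Longrightarrow> finite {k. z \<in> bergman_ball (a k) R} \<and> card {k. z \<in> bergman_ball (a k) R} \<le> M"
    by auto
  show ?thesis
  proof (rule exI[of _ "C * real M"], intro conjI allI impI)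
    show "0 \<le> C * real M" using C by simp
    fix f :: "complex ^ 'n::_ \<Rightarrow> complex" assume f: "holomorphic_tube f" and f1: "lp_int p \<alpha> f \<le> 1"
    define X where "X k z = ennreal (cmod (f z) powr p) * indicator (bergman_ball (a k) R) z" for k z
    define J where "J k = (\<integral>\<^sup>+z. X k z \<partial>wmeas \<alpha>)" for k
    have "J k \<le> lp_int p \<alpha> f" for k
      unfolding J_def X_def lp_int_def by (intro nn_integral_mono) (auto simp: indicator_def)
    then have J: "J k = ennreal (enn2real (J k))" for k
      using f1 order_trans by (metis ennreal_enn2real ennreal_one_less_top le_less_trans less_top)
    have Jsum: "(\<Sum>k\<in>I. enn2real (J k)) \<le> real M" if "finite I" for I
    proof -
      have "ennreal (\<Sum>k\<in>I. enn2real (J k)) = (\<Sum>k\<in>I. J k)"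
        by (subst sum_ennreal[symmetric]) (simp_all add: J[symmetric])
      also have "\<dots> = (\<integral>\<^sup>+z. (\<Sum>k\<in>I. X k z) \<partial>wmeas \<alpha>)"
        unfolding J_def
      proof (rule nn_integral_sum[symmetric])
        fix k
        have "X k \<in> borel_measurable borel" unfolding X_def[abs_def]
          by (rule cmod_powr_borel[OF f bergman_ball_borel[OF a R] bergman_ball_subset_tube])
        then show "X k \<in> borel_measurable (wmeas \<alpha>)" by simp
      qed
      also have "\<dots> \<le> (\<integral>\<^sup>+z. of_nat M * (ennreal (cmod (f z) powr p) * indicator tube z) \<partial>wmeas \<alpha>)"
      proof (rule nn_integral_wmeas_mono)
        fix z :: "complex ^ 'n::_" assume z: "z \<in> tube"
        have "(\<Sum>k\<in>I. X k z) = ennreal (cmod (f z) powr p) * of_nat (card {k\<in>I. z \<in> bergman_ball (a k) R})"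
          using \<open>finite I\<close> by (simp add: X_def sum_distrib_left[symmetric] indicator_def sum.If_cases Int_def)
        also have "card {k\<in>I. z \<in> bergman_ball (a k) R} \<le> card {k. z \<in> bergman_ball (a k) R}"
          using M[OF z] by (intro card_mono) auto
        then have "ennreal (cmod (f z) powr p) * of_nat (card {k\<in>I. z \<in> bergman_ball (a k) R})
            \<le> ennreal (cmod (f z) powr p) * of_nat M"
          using M[OF z] by (intro mult_left_mono) auto
        finally show "(\<Sum>k\<in>I. X k z) \<le> of_nat M * (ennreal (cmod (f z) powr p) * indicator tube z)"
          using z by (simp add: mult.commute)
      qed
      also have "\<dots> = of_nat M * lp_int p \<alpha> f"
        unfolding lp_int_indicator using cmod_powr_borel[OF f tube_borel order_refl]
            by (intro nn_integral_cmult) simp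
      also have "\<dots> \<le> of_nat M * 1" by (intro mult_left_mono f1) simp
      finally have "ennreal (\<Sum>k\<in>I. enn2real (J k)) \<le> ennreal (real M)"
          by (simp add: ennreal_of_nat_eq_real_of_nat)
      then show ?thesis by (subst (asm) ennreal_le_iff) auto
    qed
    define x where "x k = C * enn2real (J k)" for k
    have x0: "0 \<le> x k" for k using C by (simp add: x_def)
    have xs: "(\<Sum>k\<in>I. x k) \<le> C * real M" if "finite I" for I
      unfolding x_def sum_distrib_left[symmetric] by (intro mult_left_mono Jsum that C)
    have smx: "summable x" by (rule bounded_imp_summable[OF x0 xs]) simp
    have "cmod (f w) \<le> x k powr (1 / p) * rho_diag (a k) powr (- ((real CARD('n) + 1 + \<alpha>) / p))"
        if w: "w \<in> bergman_ball (a k) r" for k w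
    proof -
      have "ennreal (cmod (f w) powr p) \<le> ennreal (C * rho_diag (a k) powr (-(real CARD('n) + 1 + \<alpha>))) * J k"
        using C(2)[OF a w f] by (simp add: J_def X_def)
      also have "\<dots> = ennreal (x k * rho_diag (a k) powr (-(real CARD('n) + 1 + \<alpha>)))"
        by (subst J) (use C(1) in \<open>simp add: ennreal_mult[symmetric] x_def mult_ac\<close>)
      finally have "cmod (f w) powr p \<le> x k * rho_diag (a k) powr (-(real CARD('n) + 1 + \<alpha>))"
        using x0[of k] by (subst (asm) ennreal_le_iff) auto
      then have "(cmod (f w) powr p) powr (1 / p) \<le> (x k * rho_diag (a k) powr (-(real CARD('n) + 1
          + \<alpha>))) powr (1 / p)"
        using p by (intro powr_mono2) auto
      then show ?thesis using p x0[of k] by (simp add: powr_powr powr_mult diff_divide_distrib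
          add_divide_distrib)
    qed
    then show "\<exists>x. (\<forall>k. 0 \<le> x k) \<and> summable x \<and> suminf x \<le> C * real M \<and>
     (\<forall>k. \<forall>w\<in>bergman_ball (a k) r. cmod (f w) \<le> x k powr (1 / p) * rho_diag (a k) powr (- ((real CARD('n)
         + 1 + \<alpha>) / p)))"
      using x0 smx suminf_le_const[OF smx xs[OF finite_lessThan]] by blast
  qed
qed

text \<open>Young's inequality with weights \<open>\<theta> = p2 / p1\<close> and
  \<open>1 - \<theta>\<close> for the numbers \<open>\<eta> * x\<close> and
  \<open>\<eta> powr (- (s / p1)) * d powr s\<close>. The power of \<open>\<eta>\<close> is chosen
  so that it cancels on the left, where \<open>s * (1 - \<theta>) = p2\<close>.\<close>

lemma young_powr:
  fixes p1 p2 x d \<eta> s :: real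
  assumes p: "0 < p2" "p2 < p1" and x: "0 \<le> x" and d: "0 \<le> d" and \<eta>: "0 < \<eta>"
    and s: "s = 1 / (1 / p2 - 1 / p1)"
  shows "(x powr (1 / p1) * d) powr p2 \<le> \<eta> * x + \<eta> powr (- (s / p1)) * d powr s"
proof (cases "x = 0 \<or> d = 0")
  case True
  then show ?thesis using x \<eta> by auto
next
  case False
  define \<theta> where "\<theta> = p2 / p1"
  have th: "0 < \<theta>" "\<theta> < 1" using p by (auto simp: \<theta>_def)
  have s1: "s * (1 - \<theta>) = p2" and s2: "s / p1 * (1 - \<theta>) = \<theta>"
    using p by (simp_all add: s \<theta>_def field_simps)
  have "(\<eta> * x) powr \<theta> * (\<eta> powr (- (s / p1)) * d powr s) powr (1 - \<theta>)
      \<le> \<theta> * (\<eta> * x) + (1 - \<theta>) * (\<eta> powr (- (s / p1)) * d powr s)"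
    using th x \<eta> False d by (intro Youngs_inequality_0) auto
  also have "\<dots> \<le> 1 * (\<eta> * x) + 1 * (\<eta> powr (- (s / p1)) * d powr s)"
    using th x \<eta> by (intro add_mono mult_right_mono) auto
  also have "(\<eta> * x) powr \<theta> * (\<eta> powr (- (s / p1)) * d powr s) powr (1 - \<theta>) = x powr \<theta> * d powr p2"
  proof -
    have "(\<eta> powr (- (s / p1)) * d powr s) powr (1 - \<theta>) = \<eta> powr (- \<theta>) * d powr p2"
      using \<eta> s2 by (simp add: powr_mult powr_powr s1)
    then show ?thesis using \<eta> x by (simp add: powr_mult powr_minus field_simps)
  qed
  also have "x powr \<theta> * d powr p2 = (x powr (1 / p1) * d) powr p2"
    using d by (simp add: powr_mult powr_powr \<theta>_def)
  finally show ?thesis by simp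
qed

text \<open>One estimate for boundedness and compactness: the first \<open>K\<close> balls use the
  bound \<open>\<tau>\<close>, the others Young's inequality. \<open>A\<close> and \<open>Q\<close>
  are fixed before \<open>\<eta>\<close>, \<open>K\<close>, \<open>\<tau>\<close> and
  \<open>f\<close>. With \<open>K = 0\<close> there is no condition on balls and boundedness
  results; for compactness \<open>\<eta>\<close>, \<open>K\<close> and \<open>\<tau>\<close> are
  chosen in this order.\<close>

lemma toeplitz_small_on_balls:
  fixes a :: "nat \<Rightarrow> complex ^ 'n::{finite,wellorder}" and \<mu> :: "(complex ^ 'n::_) measure"
      and p1 p2 \<alpha>1 \<alpha>2 \<xi> r e s :: real
  defines "b \<equiv> real CARD('n) + 1 + \<xi>"
  assumes p: "0 < p2" "p2 < p1" and \<alpha>: "-1 < \<alpha>1" "-1 < \<alpha>2" and \<xi>: "-1 < \<xi>" and \<mu>: "\<mu> \<in> M_plus"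
    and b: "real CARD('n) * max 1 (1 / p2) + (1 + \<alpha>2) / p2 < b"
    and r: "0 < r" and lat: "is_lattice r a"
    and e: "e = b - (real CARD('n) + 1 + \<alpha>2) / p2 + (real CARD('n) + 1 + \<alpha>1) / p1"
    and s: "s = 1 / (1 / p2 - 1 / p1)"
    and sm: "summable (\<lambda>k. (measure \<mu> (bergman_ball (a k) r) / rho_diag (a k) powr e) powr s)"
  shows "\<exists>A\<ge>0. \<exists>Q. \<forall>\<eta>>0. \<forall>K \<tau> f. 0 \<le> \<tau> \<longrightarrow> holomorphic_tube f \<longrightarrow> lp_int p1 \<alpha>1 f \<le> 1 \<longrightarrow>
      (\<forall>k<K. \<forall>w\<in>bergman_ball (a k) r. cmod (f w) \<le> \<tau>) \<longrightarrow>
      (\<forall>z\<in>tube. integrable \<mu> (toeplitz_integrand \<xi> f z)) \<and>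
      lp_int p2 \<alpha>2 (toeplitz \<mu> \<xi> f) \<le> ennreal (A * (\<tau> powr p2 * Q K + \<eta> +
         \<eta> powr (- (s / p1)) * (\<Sum>k. (measure \<mu> (bergman_ball (a (k + K)) r) / rho_diag (a (k
             + K)) powr e) powr s)))"
proof -
  have a: "a k \<in> tube" for k using lat by (auto simp: is_lattice_def)
  have disj: "disjoint_family (\<lambda>k. bergman_ball (a k) (r / 4))" using lat by (auto simp: is_lattice_def)
  have r4: "0 < r / 4" and p1: "0 < p1" using r p by auto
  have h: "0 < rho_diag (a k)" for k using a[of k] by (simp add: tube_iff)
  define m where "m k = measure \<mu> (bergman_ball (a k) r)" for k
  define e2 where "e2 = b - (real CARD('n) + 1 + \<alpha>2) / p2"
  define d where "d k = m k / rho_diag (a k) powr e" for k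
  define Q where "Q K = (\<Sum>k<K. (m k / rho_diag (a k) powr e2) powr p2)" for K
  have m0: "0 \<le> m k" and d0: "0 \<le> d k" for k by (auto simp: m_def d_def)
  have sd: "summable (\<lambda>k. d k powr s)" using sm by (simp add: d_def m_def)
  obtain C where C: "0 \<le> C" and Cs: "\<And>f u. holomorphic_tube f \<Longrightarrow> (\<forall>k. 0 \<le> u k)
      \<Longrightarrow> (\<forall>k. \<forall>w\<in>bergman_ball (a k) r. cmod (f w) \<le> u k) \<Longrightarrow>
     summable (\<lambda>k. (u k * (m k / rho_diag (a k) powr e2)) powr p2) \<Longrightarrow>
     (\<forall>z\<in>tube. integrable \<mu> (toeplitz_integrand \<xi> f z)) \<and>
     lp_int p2 \<alpha>2 (toeplitz \<mu> \<xi> f) \<le> ennreal (C * (\<Sum>k. (u k * (m k / rho_diag (a k) powr e2)) powr p2))"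
    using toeplitz_lp_int_le[OF p(1) \<alpha>(2) \<xi> \<mu> b[unfolded b_def] r lat] unfolding e2_def b_def m_def by blast
  obtain A where A: "0 \<le> A" and As: "\<And>f. holomorphic_tube f \<Longrightarrow> lp_int p1 \<alpha>1 f \<le> 1
      \<Longrightarrow> \<exists>x. (\<forall>k. 0 \<le> x k) \<and> summable x \<and> suminf x \<le> A \<and>
     (\<forall>k. \<forall>w\<in>bergman_ball (a k) r. cmod (f w) \<le> x k powr (1 / p1) * rho_diag (a k) powr (- ((real CARD('n)
         + 1 + \<alpha>1) / p1)))"
    using bergman_ball_majorant[OF p1 \<alpha>(1) r a r4 disj] by blast
  show ?thesis
  proof (rule exI[of _ "C * (1 + A)"], intro conjI exI[of _ Q] allI impI)
    show "0 \<le> C * (1 + A)" using C A by simp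
    fix \<eta> \<tau> :: real and K f
    assume \<eta>: "0 < \<eta>" and \<tau>: "0 \<le> \<tau>" and f: "holomorphic_tube f" "lp_int p1 \<alpha>1 f \<le> 1"
      and fK: "\<forall>k<K. \<forall>w\<in>bergman_ball (a k) r. cmod (f w) \<le> \<tau>"
    obtain x where x: "\<And>k. 0 \<le> x k" "summable x" "suminf x \<le> A"
       "\<And>k w. w \<in> bergman_ball (a k) r \<Longrightarrow> cmod (f w) \<le> x k powr (1 / p1)
           * rho_diag (a k) powr (- ((real CARD('n) + 1 + \<alpha>1) / p1))"
      using As[OF f] by blast
    define u where "u k = (if k < K then \<tau> else x k powr (1 / p1) * rho_diag (a k) powr (- ((real CARD('n)
        + 1 + \<alpha>1) / p1)))" for k
    define c where "c k = u k * (m k / rho_diag (a k) powr e2)" for k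
    define q where "q k = (if k \<in> {..<K} then \<tau> powr p2 * (m k / rho_diag (a k) powr e2) powr p2 else 0)" for k
    define y where "y k = (if k < K then 0 else d k powr s)" for k
    define \<kappa> where "\<kappa> = \<eta> powr (- (s / p1))"
    have u0: "0 \<le> u k" for k using \<tau> x(1) by (simp add: u_def)
    have fu: "\<forall>k. \<forall>w\<in>bergman_ball (a k) r. cmod (f w) \<le> u k" using fK x(4) by (auto simp: u_def)
    have cle: "c k powr p2 \<le> q k + \<eta> * x k + \<kappa> * y k" for k
    proof (cases "k < K")
      case True
      have "c k powr p2 = q k" using True \<tau> m0[of k]
          by (simp add: c_def u_def q_def powr_mult del: times_divide_eq_right)
      then show ?thesis using True x(1)[of k] \<eta> by (simp add: y_def)
    next
      case False
      \<comment> \<open>The local majorant of \<open>f\<close> brings the power by which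
        \<open>e\<close> exceeds the normalising exponent \<open>e2\<close>.\<close>
      have "rho_diag (a k) powr e = rho_diag (a k) powr e2 * rho_diag (a k) powr ((real CARD('n) + 1
          + \<alpha>1) / p1)"
        by (simp add: e e2_def powr_add)
      then have "c k = x k powr (1 / p1) * d k"
        using False h[of k] by (simp add: c_def u_def d_def powr_minus divide_simps)
      then show ?thesis using young_powr[OF p x(1) d0 \<eta> s, of k k] False by (simp add: q_def y_def \<kappa>_def)
    qed
    have sq: "q sums (\<tau> powr p2 * Q K)"
      using sums_If_finite_set[of "{..<K}" "\<lambda>k. \<tau> powr p2 * (m k / rho_diag (a k) powr e2) powr p2"]
      unfolding q_def[abs_def] Q_def by (simp add: sum_distrib_left)
    have sy: "summable y"
      by (rule summable_comparison_test'[OF sd, of 0]) (auto simp: y_def)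
    have ysum: "suminf y = (\<Sum>k. d (k + K) powr s)"
      using suminf_split_initial_segment[OF sy, of K] by (simp add: y_def)
    have tot: "(\<lambda>k. q k + \<eta> * x k + \<kappa> * y k) sums (\<tau> powr p2 * Q K + \<eta> * suminf x + \<kappa> * suminf y)"
      by (intro sums_add sums_mult sq summable_sums x sy)
    have sc: "summable (\<lambda>k. c k powr p2)"
      by (rule summable_comparison_test'[OF sums_summable[OF tot], of 0]) (use cle in auto)
    have tail0: "0 \<le> (\<Sum>k. d (k + K) powr s)"
      unfolding ysum[symmetric] by (intro suminf_nonneg sy) (simp add: y_def)
    have Q0: "0 \<le> Q K" unfolding Q_def by (intro sum_nonneg) auto
    have "(\<Sum>k. c k powr p2) \<le> \<tau> powr p2 * Q K + \<eta> * suminf x + \<kappa> * suminf y"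
      by (rule sums_le[OF cle summable_sums[OF sc] tot])
    also have "\<dots> \<le> (1 + A) * (\<tau> powr p2 * Q K) + (1 + A) * \<eta> + (1 + A) * (\<kappa> * suminf y)"
    proof (intro add_mono)
      show "\<tau> powr p2 * Q K \<le> (1 + A) * (\<tau> powr p2 * Q K)"
        using mult_right_mono[of 1 "1 + A" "\<tau> powr p2 * Q K"] A Q0 by simp
      show "\<eta> * suminf x \<le> (1 + A) * \<eta>"
        using mult_right_mono[of "suminf x" "1 + A" \<eta>] x(3) \<eta> by (simp add: mult.commute)
      show "\<kappa> * suminf y \<le> (1 + A) * (\<kappa> * suminf y)"
        using mult_right_mono[of 1 "1 + A" "\<kappa> * suminf y"] A tail0 by (simp add: ysum \<kappa>_def)
    qed
    also have "\<dots> = (1 + A) * (\<tau> powr p2 * Q K + \<eta> + \<kappa> * (\<Sum>k. d (k + K) powr s))"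
      by (simp add: ysum distrib_left)
    finally have le: "C * (\<Sum>k. c k powr p2) \<le> C * (1 + A) * (\<tau> powr p2 * Q K + \<eta> + \<kappa> * (\<Sum>k. d (k + K) powr s))"
      unfolding mult.assoc[of C] by (intro mult_left_mono C)
    have "(\<forall>z\<in>tube. integrable \<mu> (toeplitz_integrand \<xi> f z))
        \<and> lp_int p2 \<alpha>2 (toeplitz \<mu> \<xi> f) \<le> ennreal (C * (\<Sum>k. c k powr p2))"
      unfolding c_def by (rule Cs[OF f(1) _ fu]) (use u0 sc in \<open>auto simp: c_def\<close>)
    then show "\<forall>z\<in>tube. integrable \<mu> (toeplitz_integrand \<xi> f z)"
      and "lp_int p2 \<alpha>2 (toeplitz \<mu> \<xi> f) \<le> ennreal (C * (1 + A) * (\<tau> powr p2 * Q K + \<eta> +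
         \<eta> powr (- (s / p1)) * (\<Sum>k. (measure \<mu> (bergman_ball (a (k + K)) r) / rho_diag (a (k
             + K)) powr e) powr s)))"
      using order_trans[OF _ ennreal_leI[OF le]] by (auto simp: \<kappa>_def d_def m_def)
  qed
qed

lemma lp_int_cmult:
  assumes "holomorphic_tube f"
  shows "lp_int p \<alpha> (\<lambda>z. c * f z) = ennreal (cmod c powr p) * lp_int p \<alpha> f"
proof -
  have "lp_int p \<alpha> (\<lambda>z. c * f z) = (\<integral>\<^sup>+z. ennreal (cmod c powr p) * (ennreal (cmod (f z) powr p)
      * indicator tube z) \<partial>wmeas \<alpha>)"
    unfolding lp_int_def by (rule nn_integral_wmeas_cong) (simp add: norm_mult powr_mult ennreal_mult)
  also have "\<dots> = ennreal (cmod c powr p) * lp_int p \<alpha> f"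
    unfolding lp_int_indicator using cmod_powr_borel[OF assms tube_borel order_refl]
        by (intro nn_integral_cmult) simp
  finally show ?thesis .
qed

lemma holomorphic_tube_cmult: "holomorphic_tube f \<Longrightarrow> holomorphic_tube (\<lambda>z. c * f z)"
  by (simp add: holomorphic_tube_iff holo_on_cmult)

lemma toeplitz_integrand_cmult: "toeplitz_integrand \<xi> (\<lambda>w. c * f w) z = (\<lambda>w. c * toeplitz_integrand \<xi> f z w)"
  by (simp add: toeplitz_integrand_def fun_eq_iff)

lemma toeplitz_cmult: "toeplitz \<mu> \<xi> (\<lambda>w. c * f w) = (\<lambda>z. c * toeplitz \<mu> \<xi> f z)"
  by (simp add: toeplitz_def toeplitz_integrand_cmult fun_eq_iff)

lemma toeplitz_diff:
  assumes "integrable \<mu> (toeplitz_integrand \<xi> f z)" "integrable \<mu> (toeplitz_integrand \<xi> g z)"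
  shows "toeplitz \<mu> \<xi> (\<lambda>w. f w - g w) z = toeplitz \<mu> \<xi> f z - toeplitz \<mu> \<xi> g z"
proof -
  have "toeplitz_integrand \<xi> (\<lambda>w. f w - g w) z = (\<lambda>w. toeplitz_integrand \<xi> f z w - toeplitz_integrand \<xi> g z w)"
    by (simp add: toeplitz_integrand_def fun_eq_iff diff_divide_distrib)
  then show ?thesis using assms by (simp add: toeplitz_def)
qed

text \<open>Functions with integral at most 1 are covered by \<open>toeplitz_small_on_balls\<close>;
  the rest is homogeneity. A function is divided by a number \<open>t\<close> larger than its norm,
  as the norm itself may vanish, and \<open>t\<close> then tends to the norm.\<close>

lemma summable_imp_toeplitz_bounded:
  fixes a :: "nat \<Rightarrow> complex ^ 'n::{finite,wellorder}" and \<mu> :: "(complex ^ 'n::_) measure"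
      and p1 p2 \<alpha>1 \<alpha>2 \<xi> r e s :: real
  assumes p: "0 < p2" "p2 < p1" and \<alpha>: "-1 < \<alpha>1" "-1 < \<alpha>2" and \<xi>: "-1 < \<xi>" and \<mu>: "\<mu> \<in> M_plus"
    and b: "real CARD('n) * max 1 (1 / p2) + (1 + \<alpha>2) / p2 < real CARD('n) + 1 + \<xi>"
    and r: "0 < r" and lat: "is_lattice r a"
    and e: "e = real CARD('n) + 1 + \<xi> - (real CARD('n) + 1 + \<alpha>2) / p2 + (real CARD('n) + 1 + \<alpha>1) / p1"
    and s: "s = 1 / (1 / p2 - 1 / p1)"
    and sm: "summable (\<lambda>k. (measure \<mu> (bergman_ball (a k) r) / rho_diag (a k) powr e) powr s)"
  shows "toeplitz_bounded \<mu> \<xi> p1 \<alpha>1 p2 \<alpha>2"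
proof -
  have p1: "0 < p1" using p by simp
  have sets\<mu>: "sets \<mu> = sets (restrict_space borel tube)" using \<mu> by (auto simp: M_plus_def)
  define B where "B = (\<Sum>k. (measure \<mu> (bergman_ball (a k) r) / rho_diag (a k) powr e) powr s)"
  obtain A Q where "0 \<le> A" and *: "\<And>\<eta> K \<tau> f. 0 < \<eta> \<Longrightarrow> 0 \<le> \<tau> \<Longrightarrow> holomorphic_tube f \<Longrightarrow> lp_int p1 \<alpha>1 f \<le> 1 \<Longrightarrow>
      (\<forall>k<K. \<forall>w\<in>bergman_ball (a k) r. cmod (f w) \<le> \<tau>) \<Longrightarrow>
      (\<forall>z\<in>tube. integrable \<mu> (toeplitz_integrand \<xi> f z)) \<and>
      lp_int p2 \<alpha>2 (toeplitz \<mu> \<xi> f) \<le> ennreal (A * (\<tau> powr p2 * Q K + \<eta> +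
         \<eta> powr (- (s / p1)) * (\<Sum>k. (measure \<mu> (bergman_ball (a (k + K)) r) / rho_diag (a (k
             + K)) powr e) powr s)))"
    using toeplitz_small_on_balls[OF p \<alpha> \<xi> \<mu> b r lat e s sm] by blast
  \<comment> \<open>The summand 1 makes \<open>D\<close> positive, so that
    \<open>\<epsilon> / D\<close> can be used below.\<close>
  define D where "D = (A * (1 + B)) powr (1 / p2) + 1"
  have D: "0 < D" unfolding D_def by (intro add_nonneg_pos) auto
  have unit: "(\<forall>z\<in>tube. integrable \<mu> (toeplitz_integrand \<xi> g z))
      \<and> lp_int p2 \<alpha>2 (toeplitz \<mu> \<xi> g) \<le> ennreal (D powr p2)"
    if "holomorphic_tube g" "lp_int p1 \<alpha>1 g \<le> 1" for g
  proof -
    have B0: "0 \<le> B" unfolding B_def by (intro suminf_nonneg sm) auto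
    have "A * (1 + B) = ((A * (1 + B)) powr (1 / p2)) powr p2"
      using p \<open>0 \<le> A\<close> B0 by (simp add: powr_powr)
    also have "\<dots> \<le> D powr p2" unfolding D_def using p by (intro powr_mono2) auto
    finally have "ennreal (A * (1 + B)) \<le> ennreal (D powr p2)" by (rule ennreal_leI)
    moreover have "(\<forall>z\<in>tube. integrable \<mu> (toeplitz_integrand \<xi> g z))
        \<and> lp_int p2 \<alpha>2 (toeplitz \<mu> \<xi> g) \<le> ennreal (A * (1 + B))"
      using *[of 1 0 g 0] that p by (simp add: B_def)
    ultimately show ?thesis using order_trans by blast
  qed
  have scaled: "(\<forall>z\<in>tube. integrable \<mu> (toeplitz_integrand \<xi> f z)) \<and> toeplitz \<mu> \<xi> f \<in> bergman_space p2 \<alpha>2 \<and>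
      Lp_norm p2 \<alpha>2 (toeplitz \<mu> \<xi> f) \<le> t * D"
    if f: "f \<in> bergman_space p1 \<alpha>1" and t: "Lp_norm p1 \<alpha>1 f < t" for f t
  proof -
    have t0: "0 < t" using t Lp_norm_nonneg[of p1 \<alpha>1 f] by linarith
    define g where "g = (\<lambda>z. complex_of_real (1 / t) * f z)"
    have f_eq: "f = (\<lambda>z. complex_of_real t * g z)" using t0 by (auto simp: g_def)
    have hf: "holomorphic_tube f" using f by (simp add: bergman_space_iff[OF p1])
    have hg: "holomorphic_tube g" unfolding g_def by (rule holomorphic_tube_cmult[OF hf])
    have "lp_int p1 \<alpha>1 g = ennreal ((1 / t) powr p1) * ennreal (Lp_norm p1 \<alpha>1 f powr p1)"
      unfolding g_def lp_int_cmult[OF hf] Lp_norm_powr[OF p1 f] using t0 by (simp add: norm_divide)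
    also have "\<dots> = ennreal ((1 / t * Lp_norm p1 \<alpha>1 f) powr p1)"
      using t0 Lp_norm_nonneg[of p1 \<alpha>1 f] by (subst powr_mult) (auto simp: ennreal_mult)
    also have "\<dots> \<le> ennreal (1 powr p1)"
      using t0 t p1 Lp_norm_nonneg[of p1 \<alpha>1 f] by (intro ennreal_leI powr_mono2) (auto simp: divide_simps)
    finally have "lp_int p1 \<alpha>1 g \<le> 1" by simp
    note u = unit[OF hg this]
    have hTg: "holomorphic_tube (toeplitz \<mu> \<xi> g)"
      using u by (intro toeplitz_holomorphic sets\<mu> holomorphic_tube_continuous hg \<xi>) auto
    have int: "integrable \<mu> (toeplitz_integrand \<xi> f z)" if "z \<in> tube" for z
      unfolding f_eq toeplitz_integrand_cmult using u that by simp
    have hTf: "holomorphic_tube (toeplitz \<mu> \<xi> f)"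
      unfolding f_eq toeplitz_cmult by (rule holomorphic_tube_cmult[OF hTg])
    have "lp_int p2 \<alpha>2 (toeplitz \<mu> \<xi> f) = ennreal (t powr p2) * lp_int p2 \<alpha>2 (toeplitz \<mu> \<xi> g)"
      unfolding f_eq toeplitz_cmult lp_int_cmult[OF hTg] using t0 by simp
    also have "\<dots> \<le> ennreal (t powr p2) * ennreal (D powr p2)" using u by (intro mult_left_mono) auto
    also have "\<dots> = ennreal ((t * D) powr p2)" using t0 D by (simp add: powr_mult ennreal_mult)
    finally have le: "lp_int p2 \<alpha>2 (toeplitz \<mu> \<xi> f) \<le> ennreal ((t * D) powr p2)" .
    then have "lp_int p2 \<alpha>2 (toeplitz \<mu> \<xi> f) < \<infinity>" using le_less_trans[OF le ennreal_less_top] by simp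
    then show ?thesis
      using int hTf Lp_norm_leI[OF p(1) hTf le] t0 D by (simp add: bergman_space_iff[OF p(1)])
  qed
  have "Lp_norm p2 \<alpha>2 (toeplitz \<mu> \<xi> f) \<le> D * Lp_norm p1 \<alpha>1 f" if f: "f \<in> bergman_space p1 \<alpha>1" for f
  proof (rule field_le_epsilon)
    fix \<epsilon> :: real assume \<epsilon>: "0 < \<epsilon>"
    then have "Lp_norm p1 \<alpha>1 f < Lp_norm p1 \<alpha>1 f + \<epsilon> / D" using D by simp
    from scaled[OF f this] show "Lp_norm p2 \<alpha>2 (toeplitz \<mu> \<xi> f) \<le> D * Lp_norm p1 \<alpha>1 f + \<epsilon>"
      using D by (simp add: distrib_left distrib_right mult.commute)
  qed
  moreover have "(\<forall>z\<in>tube. integrable \<mu> (toeplitz_integrand \<xi> f z)) \<and> toeplitz \<mu> \<xi> f \<in> bergman_space p2 \<alpha>2"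
    if "f \<in> bergman_space p1 \<alpha>1" for f
    using scaled[OF that, of "Lp_norm p1 \<alpha>1 f + 1"] by simp
  ultimately show ?thesis unfolding toeplitz_bounded_def by blast
qed

text \<open>Locally uniform convergence thus becomes uniform on each ball. Around
  \<open>base_point\<close> the compact set bounds \<open>rho_diag\<close> from below, which keeps
  it away from the boundary, and the kernel from above, which makes it bounded; \<open>aut a\<close>
  moves it to the other balls.\<close>

lemma bergman_ball_subset_compact:
  fixes a :: "complex ^ 'n::{finite,wellorder}"
  assumes a: "a \<in> tube" and r: "0 < r"
  shows "\<exists>K. compact K \<and> bergman_ball a r \<subseteq> K \<and> K \<subseteq> tube"
proof -
  define c where "c = 4 * (cosh r)\<^sup>2"
  have c: "0 < c" by (simp add: c_def cosh_real_pos)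
  define C where "C = 24 * (cosh r)\<^sup>2"
  define K where "K = {w :: complex ^ 'n::_. 1 / c \<le> rho_diag w} \<inter> {w. cmod (rho w base_point) \<le> C}"
  have "0 < 1 / c" using c by simp
  then have K_tube: "K \<subseteq> tube" unfolding K_def tube_iff subset_eq using less_le_trans by blast
  have ball: "bergman_ball base_point r \<subseteq> K"
  proof
    fix w :: "complex ^ 'n::_" assume w: "w \<in> bergman_ball base_point r"
    have "1 \<le> c * rho_diag w"
      using bergman_ball_rho_diag_ge[OF base_point_tube w r] by (simp add: rho_diag_base c_def)
    moreover have "cmod (rho base_point w) \<le> C"
      using bergman_ball_cmod_rho_le[OF base_point_tube w r base_point_tube]
          by (simp add: C_def cmod_rho_same base_point_tube rho_diag_base)
    ultimately show "w \<in> K" using c cmod_rho_commute[of w base_point] by (simp add: K_def field_simps)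
  qed
  have "closed K" unfolding K_def
    by (intro closed_Int closed_Collect_le continuous_on_const continuous_rho_diag continuous_on_norm
        continuous_rho1 continuous_on_id)
  moreover have "bounded K"
    unfolding bounded_iff
  proof (intro exI ballI)
    fix w :: "complex ^ 'n::_" assume w: "w \<in> K"
    let ?S = "UNIV - {last_ix} :: 'n set"
    have wC: "cmod (rho w base_point) \<le> C" using w by (simp add: K_def)
    have C0: "0 \<le> C" by (simp add: C_def)
    have "horizontal_norm2 w / 4 \<le> Re (rho w base_point)"
      using w K_tube by (auto simp: Re_rho_base tube_iff)
    then have hor: "horizontal_norm2 w \<le> 4 * C" using complex_Re_le_cmod[of "rho w base_point"] wC by linarith
    \<comment> \<open>Once the horizontal part is controlled by the real part of \<open>rho\<close>,
      the last coordinate is recovered from the value of \<open>rho\<close> itself.\<close>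
    have "2 * \<i> * (w $ last_ix + \<i>) = (\<Sum>j\<in>?S. (w $ j)\<^sup>2) - 4 * rho w base_point"
      by (simp add: rho_def base_point_nth diff_divide_distrib)
    then have "2 * cmod (w $ last_ix + \<i>) = cmod ((\<Sum>j\<in>?S. (w $ j)\<^sup>2) - 4 * rho w base_point)"
      by (metis norm_mult norm_ii norm_numeral mult.right_neutral)
    also have "\<dots> \<le> cmod (\<Sum>j\<in>?S. (w $ j)\<^sup>2) + 4 * cmod (rho w base_point)"
      using norm_triangle_ineq4[of "\<Sum>j\<in>?S. (w $ j)\<^sup>2" "4 * rho w base_point"] by (simp add: norm_mult)
    also have "cmod (\<Sum>j\<in>?S. (w $ j)\<^sup>2) \<le> horizontal_norm2 w"
      unfolding horizontal_norm2_def by (rule order_trans[OF norm_sum]) (simp add: norm_power)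
    finally have "cmod (w $ last_ix + \<i>) \<le> 4 * C" using hor wC by linarith
    then have last: "cmod (w $ last_ix) \<le> 4 * C + 1"
      using norm_triangle_ineq4[of "w $ last_ix + \<i>" \<i>] by simp
    have "(norm w)\<^sup>2 = (\<Sum>j\<in>UNIV. (cmod (w $ j))\<^sup>2)"
      by (simp add: norm_vec_def L2_set_def sum_nonneg)
    also have "\<dots> = (cmod (w $ last_ix))\<^sup>2 + horizontal_norm2 w"
      unfolding horizontal_norm2_def by (rule sum.remove) auto
    also have "\<dots> \<le> (4 * C + 1)\<^sup>2 + 4 * C"
      using hor last by (intro add_mono power_mono) auto
    finally show "norm w \<le> sqrt ((4 * C + 1)\<^sup>2 + 4 * C)" by (simp add: real_le_rsqrt)
  qed
  ultimately have "compact K" by (simp add: compact_eq_bounded_closed)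
  show ?thesis
  proof (intro exI conjI)
    show "compact (aut a ` K)" by (rule compact_continuous_image[OF continuous_aut \<open>compact K\<close>])
    show "aut a ` K \<subseteq> tube" using K_tube aut_tube[OF a] by blast
    show "bergman_ball a r \<subseteq> aut a ` K"
    proof
      fix w assume "w \<in> bergman_ball a r"
      moreover obtain z where "aut a z = w" using aut_surj[OF a] .
      ultimately show "w \<in> aut a ` K" using bergman_ball_aut[OF a, of z r] ball by blast
    qed
  qed
qed

lemma lp_int_Fatou:
  fixes f :: "nat \<Rightarrow> complex ^ 'n::{finite,wellorder} \<Rightarrow> complex"
  assumes f: "\<And>j. holomorphic_tube (f j)" and B: "\<And>j. lp_int p \<alpha> (f j) \<le> B" and p: "0 < p"
    and lim: "\<And>z. z \<in> tube \<Longrightarrow> (\<lambda>j. f j z) \<longlonglongrightarrow> g z"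
  shows "lp_int p \<alpha> g \<le> B"
proof -
  have "lp_int p \<alpha> g \<le> (\<integral>\<^sup>+z. liminf (\<lambda>j. ennreal (cmod (f j z) powr p) * indicator tube z) \<partial>wmeas \<alpha>)"
    unfolding lp_int_def
  proof (rule nn_integral_wmeas_mono)
    fix z :: "complex ^ 'n::_" assume z: "z \<in> tube"
    have "(\<lambda>j. cmod (f j z) powr p) \<longlonglongrightarrow> cmod (g z) powr p"
      using p by (intro tendsto_powr2 tendsto_norm lim z tendsto_const) auto
    then have "(\<lambda>j. ennreal (cmod (f j z) powr p)) \<longlonglongrightarrow> ennreal (cmod (g z) powr p)" by (rule tendsto_ennrealI)
    from lim_imp_Liminf[OF sequentially_bot this]
    show "ennreal (cmod (g z) powr p) \<le> liminf (\<lambda>j. ennreal (cmod (f j z) powr p) * indicator tube z)"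
      using z by simp
  qed
  also have "\<dots> \<le> liminf (\<lambda>j. \<integral>\<^sup>+z. ennreal (cmod (f j z) powr p) * indicator tube z \<partial>wmeas \<alpha>)"
    using cmod_powr_borel[OF f tube_borel order_refl] by (intro nn_integral_liminf) simp
  also have "\<dots> \<le> liminf (\<lambda>j::nat. B)"
    using B by (intro Liminf_mono always_eventually allI) (simp add: lp_int_indicator)
  also have "\<dots> = B" by (simp add: Liminf_const)
  finally show ?thesis .
qed

text \<open>The mean value estimate, with the power of \<open>rho_diag\<close> bounded on
  \<open>K\<close> by continuity. It supplies the hypothesis of Montel's theorem.\<close>

lemma lp_int_bounded_imp_locally_bounded:
  fixes K :: "(complex ^ 'n::{finite,wellorder}) set"
  assumes p: "0 < p" and K: "compact K" "K \<subseteq> tube"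
  shows "\<exists>M. \<forall>f. holomorphic_tube f \<longrightarrow> lp_int p \<alpha> f \<le> ennreal B \<longrightarrow> (\<forall>w\<in>K. cmod (f w) \<le> M)"
proof -
  obtain C where C: "0 \<le> C" "\<And>f w. w \<in> (tube :: (complex ^ 'n::_) set) \<Longrightarrow> holomorphic_tube f \<Longrightarrow>
    ennreal (cmod (f w) powr p) \<le> ennreal (C * rho_diag w powr (-(real CARD('n) + 1 + \<alpha>))) *
       (\<integral>\<^sup>+z. ennreal (cmod (f z) powr p) * indicator (bergman_ball w 1) z \<partial>wmeas \<alpha>)"
    using cmod_powr_le_at_center[OF p, of \<alpha>] by blast
  have "continuous_on K (\<lambda>w. rho_diag w powr (-(real CARD('n) + 1 + \<alpha>)))"
    using K(2) by (intro continuous_on_powr continuous_rho_diag continuous_on_id continuous_on_const) (auto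
        simp: tube_iff)
  from compact_continuous_image[OF this K(1)] obtain H where
    H: "\<And>w. w \<in> K \<Longrightarrow> rho_diag w powr (-(real CARD('n) + 1 + \<alpha>)) \<le> H"
    unfolding compact_eq_bounded_closed bounded_iff by (metis abs_le_D1 image_eqI real_norm_def)
  show ?thesis
  proof (rule exI[of _ "(C * H * max B 0) powr (1 / p)"], intro allI impI ballI)
    fix f :: "complex ^ 'n::_ \<Rightarrow> complex" and w
    assume f: "holomorphic_tube f" "lp_int p \<alpha> f \<le> ennreal B" and w: "w \<in> K"
    have H0: "0 \<le> H" using H[OF w] by (rule order_trans[rotated]) simp
    have "ennreal (cmod (f w) powr p) \<le> ennreal (C * rho_diag w powr (-(real CARD('n) + 1 + \<alpha>))) *
       (\<integral>\<^sup>+z. ennreal (cmod (f z) powr p) * indicator (bergman_ball w 1) z \<partial>wmeas \<alpha>)"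
      using C(2) w K f(1) by blast
    also have "\<dots> \<le> ennreal (C * H) * ennreal (max B 0)"
    proof (intro mult_mono ennreal_leI mult_left_mono H[OF w] C(1))
      have "(\<integral>\<^sup>+z. ennreal (cmod (f z) powr p) * indicator (bergman_ball w 1) z \<partial>wmeas \<alpha>) \<le> lp_int p \<alpha> f"
        unfolding lp_int_def by (intro nn_integral_mono) (auto simp: indicator_def)
      also have "\<dots> \<le> ennreal (max B 0)" using f(2) by (rule order_trans) (simp add: ennreal_leI)
      finally show "(\<integral>\<^sup>+z. ennreal (cmod (f z) powr p) * indicator (bergman_ball w 1) z \<partial>wmeas \<alpha>)
          \<le> ennreal (max B 0)" .
    qed auto
    also have "\<dots> = ennreal (C * H * max B 0)" using C(1) H0 by (simp add: ennreal_mult)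
    finally have "cmod (f w) powr p \<le> C * H * max B 0"
      using C(1) H0 by (subst (asm) ennreal_le_iff) auto
    then have "(cmod (f w) powr p) powr (1 / p) \<le> (C * H * max B 0) powr (1 / p)"
      using p by (intro powr_mono2) auto
    then show "cmod (f w) \<le> (C * H * max B 0) powr (1 / p)" using p by (simp add: powr_powr)
  qed
qed

text \<open>By Fatou's lemma the locally uniform limit \<open>g\<close> lies in the source space
  again, so its image is the candidate limit. The differences, rescaled to integral at most 1, are
  small on any finite number of balls and meet the conditions of
  \<open>toeplitz_small_on_balls\<close>.\<close>

lemma summable_imp_toeplitz_compact:
  fixes a :: "nat \<Rightarrow> complex ^ 'n::{finite,wellorder}" and \<mu> :: "(complex ^ 'n::_) measure"
      and p1 p2 \<alpha>1 \<alpha>2 \<xi> r e s :: real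
  assumes p: "0 < p2" "p2 < p1" and \<alpha>: "-1 < \<alpha>1" "-1 < \<alpha>2" and \<xi>: "-1 < \<xi>" and \<mu>: "\<mu> \<in> M_plus"
    and b: "real CARD('n) * max 1 (1 / p2) + (1 + \<alpha>2) / p2 < real CARD('n) + 1 + \<xi>"
    and r: "0 < r" and lat: "is_lattice r a"
    and e: "e = real CARD('n) + 1 + \<xi> - (real CARD('n) + 1 + \<alpha>2) / p2 + (real CARD('n) + 1 + \<alpha>1) / p1"
    and s: "s = 1 / (1 / p2 - 1 / p1)"
    and sm: "summable (\<lambda>k. (measure \<mu> (bergman_ball (a k) r) / rho_diag (a k) powr e) powr s)"
  shows "toeplitz_compact \<mu> \<xi> p1 \<alpha>1 p2 \<alpha>2"
  unfolding toeplitz_compact_def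
proof (intro conjI allI impI)
  show bdd: "toeplitz_bounded \<mu> \<xi> p1 \<alpha>1 p2 \<alpha>2" by (rule summable_imp_toeplitz_bounded[OF assms])
  have p1: "0 < p1" using p by simp
  have a: "a k \<in> tube" for k using lat by (auto simp: is_lattice_def)
  define d where "d k = (measure \<mu> (bergman_ball (a k) r) / rho_diag (a k) powr e) powr s" for k
  obtain A Q where A: "0 \<le> A" and small: "\<And>\<eta> K \<tau> f. 0 < \<eta> \<Longrightarrow> 0 \<le> \<tau> \<Longrightarrow> holomorphic_tube f \<Longrightarrow> lp_int p1 \<alpha>1 f \<le> 1 \<Longrightarrow>
      (\<forall>k<K. \<forall>w\<in>bergman_ball (a k) r. cmod (f w) \<le> \<tau>) \<Longrightarrow>
      (\<forall>z\<in>tube. integrable \<mu> (toeplitz_integrand \<xi> f z)) \<and>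
      lp_int p2 \<alpha>2 (toeplitz \<mu> \<xi> f) \<le> ennreal (A * (\<tau> powr p2 * Q K + \<eta> + \<eta> powr (- (s / p1)) * (\<Sum>k. d (k
          + K))))"
    using toeplitz_small_on_balls[OF p \<alpha> \<xi> \<mu> b r lat e s sm] unfolding d_def by blast
  fix S :: "(complex ^ 'n::_ \<Rightarrow> complex) set"
  assume S: "S \<subseteq> bergman_space p1 \<alpha>1" and "\<exists>M. \<forall>f\<in>S. Lp_norm p1 \<alpha>1 f \<le> M"
  then obtain M where M: "\<And>f. f \<in> S \<Longrightarrow> Lp_norm p1 \<alpha>1 f \<le> M" by blast
  define M0 where "M0 = \<bar>M\<bar> + 1"
  have M0: "0 < M0" by (simp add: M0_def)
  have TS: "toeplitz \<mu> \<xi> ` S \<subseteq> bergman_space p2 \<alpha>2" using bdd S by (auto simp: toeplitz_bounded_def)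
  have int: "integrable \<mu> (toeplitz_integrand \<xi> f z)" if "f \<in> bergman_space p1 \<alpha>1" "z \<in> tube" for f z
    using bdd that by (auto simp: toeplitz_bounded_def)
  show "compactin (bergman_topology p2 \<alpha>2) (bergman_topology p2 \<alpha>2 closure_of (toeplitz \<mu> \<xi> ` S))"
  proof (rule bergman_compact_closure[OF p(1) TS])
    fix \<sigma> :: "nat \<Rightarrow> complex ^ 'n::_ \<Rightarrow> complex" assume \<sigma>: "range \<sigma> \<subseteq> toeplitz \<mu> \<xi> ` S"
    then have "\<forall>j. \<exists>f\<in>S. \<sigma> j = toeplitz \<mu> \<xi> f" by blast
    then obtain F where F: "\<And>j. F j \<in> S" "\<And>j. \<sigma> j = toeplitz \<mu> \<xi> (F j)" by metis
    have FB: "F j \<in> bergman_space p1 \<alpha>1" for j using F S by blast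
    have hF: "holomorphic_tube (F j)" for j using FB[of j] by (simp add: bergman_space_iff[OF p1])
    have Fint: "lp_int p1 \<alpha>1 (F j) \<le> ennreal (M0 powr p1)" for j
      unfolding Lp_norm_powr[OF p1 FB] using M[OF F(1)[of j]] p1 Lp_norm_nonneg[of p1 \<alpha>1 "F j"]
      by (intro ennreal_leI powr_mono2) (auto simp: M0_def)
    have hol: "holo_on (F j) tube" for j using hF[of j] by (simp add: holomorphic_tube_iff)
    have locb: "\<exists>M. \<forall>j. \<forall>w\<in>K. cmod (F j w) \<le> M" if "compact K" "K \<subseteq> tube" for K
      using lp_int_bounded_imp_locally_bounded[OF p1 that, of \<alpha>1 "M0 powr p1"] hF Fint by blast
    obtain g k where k: "strict_mono (k :: nat \<Rightarrow> nat)" and g: "holo_on g tube"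
      and unif: "\<And>K e. compact K \<Longrightarrow> K \<subseteq> tube \<Longrightarrow> 0 < e \<Longrightarrow> \<exists>J. \<forall>j\<ge>J. \<forall>w\<in>K. cmod (F (k j) w - g w) < e"
    proof (rule montel_holo_on[OF open_tube hol locb])
      fix g and k :: "nat \<Rightarrow> nat"
      assume "strict_mono k" "holo_on g tube"
        "\<And>K e. compact K \<Longrightarrow> K \<subseteq> tube \<Longrightarrow> 0 < e \<Longrightarrow> \<exists>J. \<forall>j\<ge>J. \<forall>w\<in>K. cmod (F (k j) w - g w) < e"
      then show thesis by (rule that)
    qed
    have hg: "holomorphic_tube g" using g by (simp add: holomorphic_tube_iff)
    have gint: "lp_int p1 \<alpha>1 g \<le> ennreal (M0 powr p1)"
    proof (rule lp_int_Fatou[where f = "\<lambda>j. F (k j)"])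
      fix z :: "complex ^ 'n::_" assume "z \<in> tube"
      then show "(\<lambda>j. F (k j) z) \<longlonglongrightarrow> g z"
        using unif[of "{z}"] by (auto simp: LIMSEQ_iff)
    qed (use hF Fint p1 in auto)
    have gB: "g \<in> bergman_space p1 \<alpha>1"
      using hg le_less_trans[OF gint ennreal_less_top] by (simp add: bergman_space_iff[OF p1])
    \<comment> \<open>\<open>t powr p1\<close> is the bound of \<open>lp_int_diff_le\<close> for a
      difference of two functions with integrals at most \<open>M0 powr p1\<close>.\<close>
    define t where "t = (2 * (2 powr p1 * M0 powr p1)) powr (1 / p1)"
    have t: "0 < t" using M0 by (simp add: t_def)
    have tp: "t powr p1 = 2 * (2 powr p1 * M0 powr p1)" using p1 by (simp add: t_def powr_powr)
    define G where "G j = (\<lambda>z. complex_of_real (1 / t) * (F (k j) z - g z))" for j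
    have hD: "holomorphic_tube (\<lambda>z. F (k j) z - g z)" for j by (rule holomorphic_tube_diff[OF hF hg])
    have hG: "holomorphic_tube (G j)" for j unfolding G_def by (rule holomorphic_tube_cmult[OF hD])
    have G1: "lp_int p1 \<alpha>1 (G j) \<le> 1" for j
    proof -
      have "lp_int p1 \<alpha>1 (\<lambda>z. F (k j) z - g z) \<le> ennreal (2 powr p1) * lp_int p1 \<alpha>1 (F (k j))
          + ennreal (2 powr p1) * lp_int p1 \<alpha>1 g"
        by (rule lp_int_diff_le[OF p1 hF hg])
      also have "\<dots> \<le> ennreal (2 powr p1) * ennreal (M0 powr p1) + ennreal (2 powr p1) * ennreal (M0 powr p1)"
        by (intro add_mono mult_left_mono Fint gint) auto
      also have "\<dots> = ennreal (t powr p1)"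
        unfolding tp by (subst mult_2, subst ennreal_plus) (auto simp only: ennreal_mult powr_ge_zero
            intro!: mult_nonneg_nonneg)
      finally have "lp_int p1 \<alpha>1 (G j) \<le> ennreal ((1 / t) powr p1) * ennreal (t powr p1)"
        unfolding G_def lp_int_cmult[OF hD] using t by (intro mult_mono) (auto simp: norm_divide)
      also have "\<dots> = 1" using t by (simp add: ennreal_mult[symmetric] powr_divide)
      finally show ?thesis .
    qed
    have ev: "\<forall>\<^sub>F j in sequentially. lp_int p2 \<alpha>2 (toeplitz \<mu> \<xi> (G j)) \<le> ennreal \<epsilon>" if \<epsilon>: "0 < \<epsilon>" for \<epsilon>
    proof -
      \<comment> \<open>Head, middle term and tail will each be at most \<open>\<eta>\<close>; the
        added 1 covers \<open>A = 0\<close>.\<close>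
      define \<eta> where "\<eta> = \<epsilon> / (3 * (A + 1))"
      have \<eta>: "0 < \<eta>" using \<epsilon> A by (simp add: \<eta>_def)
      have "0 < \<eta> / \<eta> powr (- (s / p1))" using \<eta> by simp
      from suminf_exist_split[OF this sm[folded d_def]] obtain K
          where "norm (\<Sum>i. d (i + K)) < \<eta> / \<eta> powr (- (s / p1))" by blast
      then have "(\<Sum>i. d (i + K)) \<le> \<eta> / \<eta> powr (- (s / p1))" by simp
      from mult_left_mono[OF this powr_ge_zero[of \<eta> "- (s / p1)"]]
      have tail: "\<eta> powr (- (s / p1)) * (\<Sum>i. d (i + K)) \<le> \<eta>" using \<eta> by simp
      \<comment> \<open>Chosen after \<open>K\<close>, so that the head
        \<open>\<tau> powr p2 * Q K\<close> is at most \<open>\<eta>\<close>.\<close>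
      define \<tau> where "\<tau> = (\<eta> / (1 + \<bar>Q K\<bar>)) powr (1 / p2)"
      have \<tau>: "0 < \<tau>" using \<eta> by (simp add: \<tau>_def add_pos_nonneg)
      have "\<tau> powr p2 = \<eta> / (1 + \<bar>Q K\<bar>)" using p \<eta> by (simp add: \<tau>_def powr_powr)
      then have "\<tau> powr p2 * Q K \<le> \<eta> / (1 + \<bar>Q K\<bar>) * (1 + \<bar>Q K\<bar>)"
        using \<eta> by (simp only:) (intro mult_left_mono, auto)
      then have head: "\<tau> powr p2 * Q K \<le> \<eta>" using \<eta> by (simp add: add_pos_nonneg)
      have "A * (\<tau> powr p2 * Q K + \<eta> + \<eta> powr (- (s / p1)) * (\<Sum>k. d (k + K))) \<le> A * (3 * \<eta>)"
        using head tail A by (intro mult_left_mono) auto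
      also have "\<dots> \<le> (A + 1) * (3 * \<eta>)" using \<eta> by (intro mult_right_mono) auto
      also have "\<dots> = \<epsilon>" using A by (simp add: \<eta>_def field_simps)
      finally have le: "A * (\<tau> powr p2 * Q K + \<eta> + \<eta> powr (- (s / p1)) * (\<Sum>k. d (k + K))) \<le> \<epsilon>" .
      have "\<forall>\<^sub>F j in sequentially. \<forall>i\<in>{..<K}. \<forall>w\<in>bergman_ball (a i) r. cmod (G j w) \<le> \<tau>"
      proof (rule eventually_ball_finite[OF finite_lessThan], rule ballI)
        fix i
        obtain B where B: "compact B" "bergman_ball (a i) r \<subseteq> B" "B \<subseteq> tube"
          using bergman_ball_subset_compact[OF a r] by blast
        obtain J where J: "\<And>j w. J \<le> j \<Longrightarrow> w \<in> B \<Longrightarrow> cmod (F (k j) w - g w) < t * \<tau>"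
          using unif[OF B(1,3), of "t * \<tau>"] t \<tau> by auto
        show "\<forall>\<^sub>F j in sequentially. \<forall>w\<in>bergman_ball (a i) r. cmod (G j w) \<le> \<tau>"
        proof (intro eventually_sequentiallyI[of J] ballI)
          fix j w assume "J \<le> j" "w \<in> bergman_ball (a i) r"
          then have "cmod (F (k j) w - g w) \<le> t * \<tau>" using J[of j w] B(2) by auto
          then show "cmod (G j w) \<le> \<tau>" using t by (simp add: G_def norm_mult norm_divide field_simps)
        qed
      qed
      then show ?thesis
      proof eventually_elim
        case (elim j)
        then have "lp_int p2 \<alpha>2 (toeplitz \<mu> \<xi> (G j)) \<le> ennreal (A * (\<tau> powr p2 * Q K + \<eta>
            + \<eta> powr (- (s / p1)) * (\<Sum>k. d (k + K))))"
          using small[OF \<eta> _ hG G1, of \<tau> K j] \<tau> by auto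
        then show ?case using ennreal_leI[OF le] order_trans by blast
      qed
    qed
    have lp_eq: "lp_int p2 \<alpha>2 (\<lambda>z. toeplitz \<mu> \<xi> (F (k j)) z - toeplitz \<mu> \<xi> g z)
        = ennreal (t powr p2) * lp_int p2 \<alpha>2 (toeplitz \<mu> \<xi> (G j))"
      and hTd: "holomorphic_tube (\<lambda>z. toeplitz \<mu> \<xi> (F (k j)) z - toeplitz \<mu> \<xi> g z)" for j
    proof -
      have "toeplitz \<mu> \<xi> f \<in> bergman_space p2 \<alpha>2" if "f \<in> bergman_space p1 \<alpha>1" for f
        using bdd that by (auto simp: toeplitz_bounded_def)
      then have hT: "holomorphic_tube (toeplitz \<mu> \<xi> f)" if "f \<in> bergman_space p1 \<alpha>1" for f
        using that by (simp add: bergman_space_iff[OF p(1)])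
      show "holomorphic_tube (\<lambda>z. toeplitz \<mu> \<xi> (F (k j)) z - toeplitz \<mu> \<xi> g z)"
        by (rule holomorphic_tube_diff[OF hT[OF FB] hT[OF gB]])
      have "toeplitz \<mu> \<xi> (F (k j)) z - toeplitz \<mu> \<xi> g z = complex_of_real t * toeplitz \<mu> \<xi> (G j) z"
          if "z \<in> tube" for z
        using toeplitz_diff[OF int[OF FB that] int[OF gB that], of "k j"] t unfolding G_def toeplitz_cmult
            by simp
      then have "lp_int p2 \<alpha>2 (\<lambda>z. toeplitz \<mu> \<xi> (F (k j)) z - toeplitz \<mu> \<xi> g z)
          = lp_int p2 \<alpha>2 (\<lambda>z. complex_of_real t * toeplitz \<mu> \<xi> (G j) z)"
        by (rule lp_int_cong)
      moreover have "G j \<in> bergman_space p1 \<alpha>1"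
        using hG le_less_trans[OF G1[of j], of \<infinity>] by (simp add: bergman_space_iff[OF p1])
      ultimately show "lp_int p2 \<alpha>2 (\<lambda>z. toeplitz \<mu> \<xi> (F (k j)) z - toeplitz \<mu> \<xi> g z)
          = ennreal (t powr p2) * lp_int p2 \<alpha>2 (toeplitz \<mu> \<xi> (G j))"
        using t by (simp add: lp_int_cmult[OF hT])
    qed
    have "(\<lambda>j. Lp_norm p2 \<alpha>2 (\<lambda>z. \<sigma> (k j) z - toeplitz \<mu> \<xi> g z)) \<longlonglongrightarrow> 0"
    proof (rule tendstoI)
      fix \<epsilon> :: real assume \<epsilon>: "0 < \<epsilon>"
      have "0 < (\<epsilon> / 2 / t) powr p2" using \<epsilon> t by simp
      from ev[OF this] show "\<forall>\<^sub>F j in sequentially. dist (Lp_norm p2 \<alpha>2 (\<lambda>z. \<sigma> (k j) z - toeplitz \<mu> \<xi> g z))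
          0 < \<epsilon>"
      proof eventually_elim
        case (elim j)
        have "lp_int p2 \<alpha>2 (\<lambda>z. toeplitz \<mu> \<xi> (F (k j)) z - toeplitz \<mu> \<xi> g z)
            \<le> ennreal (t powr p2) * ennreal ((\<epsilon> / 2 / t) powr p2)"
          unfolding lp_eq by (intro mult_left_mono elim) auto
        also have "\<dots> = ennreal ((t * (\<epsilon> / 2 / t)) powr p2)"
          using t \<epsilon> by (subst powr_mult) (auto simp: ennreal_mult)
        also have "t * (\<epsilon> / 2 / t) = \<epsilon> / 2" using t by simp
        finally have "Lp_norm p2 \<alpha>2 (\<lambda>z. toeplitz \<mu> \<xi> (F (k j)) z - toeplitz \<mu> \<xi> g z) \<le> \<epsilon> / 2"
          using \<epsilon> by (intro Lp_norm_leI[OF p(1) hTd]) auto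
        then show ?case using \<epsilon> Lp_norm_nonneg[of p2 \<alpha>2 "\<lambda>z. toeplitz \<mu> \<xi> (F (k j)) z - toeplitz \<mu> \<xi> g z"]
            by (simp add: F(2))
      qed
    qed
    moreover have "toeplitz \<mu> \<xi> g \<in> bergman_space p2 \<alpha>2" using bdd gB by (auto simp: toeplitz_bounded_def)
    ultimately show "\<exists>l\<in>bergman_space p2 \<alpha>2. \<exists>r. strict_mono (r :: nat \<Rightarrow> nat)
        \<and> (\<lambda>j. Lp_norm p2 \<alpha>2 (\<lambda>z. \<sigma> (r j) z - l z)) \<longlonglongrightarrow> 0"
      using k by blast
  qed
qed

theorem theorem5p3:
  fixes p\<^sub>1 p\<^sub>2 \<alpha>\<^sub>1 \<alpha>\<^sub>2 \<xi> lam n :: real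
    and \<mu> :: "(complex ^ 'n::{finite,wellorder}) measure"
  assumes "n = real CARD('n)"
    and "0 < p\<^sub>2" and "p\<^sub>2 < p\<^sub>1"
    and "-1 < \<alpha>\<^sub>1" and "-1 < \<alpha>\<^sub>2" and "-1 < \<xi>"
    and "\<mu> \<in> M_plus"
    and "n + 1 + \<xi> > n * max 1 (1 / p\<^sub>1) + (1 + \<alpha>\<^sub>1) / p\<^sub>1"
    and "n + 1 + \<xi> > n * max 1 (1 / p\<^sub>2) + (1 + \<alpha>\<^sub>2) / p\<^sub>2"
    and "lam = 1 + 1 / p\<^sub>1 - 1 / p\<^sub>2"
  shows "(toeplitz_bounded \<mu> \<xi> p\<^sub>1 \<alpha>\<^sub>1 p\<^sub>2 \<alpha>\<^sub>2 \<longleftrightarrow>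
           (\<forall>r>0. \<forall>a. is_lattice r a \<longrightarrow>
              (\<lambda>k. complex_of_real (measure \<mu> (bergman_ball (a k) r) /
                     rho_diag (a k) powr ((n + 1) * lam + \<xi> + \<alpha>\<^sub>1 / p\<^sub>1 - \<alpha>\<^sub>2 / p\<^sub>2)))
                \<in> lseq (1 / (1 - lam))))
       \<and> (toeplitz_bounded \<mu> \<xi> p\<^sub>1 \<alpha>\<^sub>1 p\<^sub>2 \<alpha>\<^sub>2 \<longleftrightarrow> toeplitz_compact \<mu> \<xi> p\<^sub>1 \<alpha>\<^sub>1 p\<^sub>2 \<alpha>\<^sub>2)"
proof -
  note pa = assms(2-7)
  let ?e = "(n + 1) * lam + \<xi> + \<alpha>\<^sub>1 / p\<^sub>1 - \<alpha>\<^sub>2 / p\<^sub>2" and ?s = "1 / (1 - lam)"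
  \<comment> \<open>The powers of \<open>n + 1\<close> are regrouped by \<open>p\<^sub>1\<close> and
    \<open>p\<^sub>2\<close>. No division by \<open>lam\<close> occurs, so \<open>lam = 0\<close> is
    no exception.\<close>
  have e: "?e = real CARD('n) + 1 + \<xi> - (real CARD('n) + 1 + \<alpha>\<^sub>2) / p\<^sub>2 + (real CARD('n) + 1 + \<alpha>\<^sub>1) / p\<^sub>1"
    unfolding assms(1,10) by (simp add: algebra_simps add_divide_distrib)
  have s: "?s = 1 / (1 / p\<^sub>2 - 1 / p\<^sub>1)" unfolding assms(10) by simp
  note b1 = assms(8)[unfolded assms(1)] and b2 = assms(9)[unfolded assms(1)]
  have lseq: "(\<lambda>k. complex_of_real (measure \<mu> (bergman_ball (a k) r) / rho_diag (a k) powr ?e)) \<in> lseq ?s \<longleftrightarrow>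
      summable (\<lambda>k. (measure \<mu> (bergman_ball (a k) r) / rho_diag (a k) powr ?e) powr ?s)"
    for a :: "nat \<Rightarrow> complex ^ 'n::_" and r
    unfolding lseq_def mem_Collect_eq norm_of_real by simp
  let ?C = "\<forall>r>0. \<forall>a :: nat \<Rightarrow> complex ^ 'n::_. is_lattice r a \<longrightarrow>
      summable (\<lambda>k. (measure \<mu> (bergman_ball (a k) r) / rho_diag (a k) powr ?e) powr ?s)"
  have "?C" if "toeplitz_bounded \<mu> \<xi> p\<^sub>1 \<alpha>\<^sub>1 p\<^sub>2 \<alpha>\<^sub>2"
    using toeplitz_bounded_imp_summable[OF pa b1 that _ _ e s] by blast
  \<comment> \<open>Summability for a single lattice suffices, and its existence is what gives the
    universally quantified condition content.\<close>
  moreover have "toeplitz_compact \<mu> \<xi> p\<^sub>1 \<alpha>\<^sub>1 p\<^sub>2 \<alpha>\<^sub>2" if ?C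
  proof -
    obtain r and a :: "nat \<Rightarrow> complex ^ 'n::_" where "0 < r" "is_lattice r a" using lattice_exists by blast
    with that show ?thesis by (intro summable_imp_toeplitz_compact[OF pa b2 _ _ e s]) auto
  qed
  moreover have "toeplitz_bounded \<mu> \<xi> p\<^sub>1 \<alpha>\<^sub>1 p\<^sub>2 \<alpha>\<^sub>2" if "toeplitz_compact \<mu> \<xi> p\<^sub>1 \<alpha>\<^sub>1 p\<^sub>2 \<alpha>\<^sub>2"
    using that by (simp add: toeplitz_compact_def)
  ultimately show ?thesis unfolding lseq by blast
qed

end
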